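(* Let $\mathcal{A}$ be an abelian category with enough projectives satisfying Grothendieck's AB 5 axiom, let $\mathcal{D}$ be its derived category, and let $k\ge 1$. Let $X$ be a complex such that the projective dimensions (in $\mathcal{A}$) of $B_nX$ and $H_nX$ are less than $k$ for each $n$. Then the projective dimension of $X$ with respect to the ideal of ghosts in $\mathcal{D}$ is less than $k$. In particular, $X$ has length at most $k$ with respect to the ghost projective class, and a $k$-fold composite $$X\to Y^1\to\cdots\to Y^k$$ of maps in $\mathcal{D}$, each zero in homology, is zero in $\mathcal{D}$.
   Context: AB 5: set-indexed colimits exist in $\mathcal{A}$ and filtered colimits are exact. Complexes are unbounded $\mathbb{Z}$-graded chain complexes of objects of $\mathcal{A}$ with differential $d$ of degree $-1$; $B_nX=\mathrm{im}(d:X_{n+1}\to X_n)$, $Z_nX=\ker(d:X_n\to X_{n-1})$, $H_nX=Z_nX/B_nX$. The derived category $\mathcal{D}$ is obtained from the category of chain complexes by inverting the quasi-isomorphisms; it is triangulated. A ghost is a map in $\mathcal{D}$ inducing zero in homology; $\mathcal{I}$ denotes the ideal of ghosts, and $\mathcal{P}$ denotes the class of objects isomorphic in $\mathcal{D}$ to a complex of projectives with zero differential; $(\mathcal{P},\mathcal{I})$ is the ghost projective class. Projective dimension of $X$ with respect to $(\mathcal{P},\mathcal{I})$ is the length $m$ of the shortest projective resolution of $X$, i.e. sequence $0\leftarrow X\leftarrow P_0\leftarrow P_1\leftarrow\cdots\leftarrow P_m\leftarrow 0$ with every $P_s$ in $\mathcal{P}$, where the maps $P_{s+1}\to P_s$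 are graded maps of degree $-1$ (i.e. maps $P_{s+1}\to\Sigma P_s$) for $s\ge0$ (this degree shift is immaterial, as $\mathcal{P}$ is closed under suspension and desuspension), such that the sequence becomes exact after applying the graded functor $\mathcal{D}(P,-)_*$ for each $P$ in $\mathcal{P}$. Length: let $\mathcal{P}_0$ be the zero objects, $\mathcal{P}_1=\mathcal{P}$, and inductively let $\mathcal{P}_n$ be the class of retracts of objects $V$ sitting in an exact triangle $U\to V\to P\to\Sigma U$ with $U$ in $\mathcal{P}_{n-1}$ and $P$ in $\mathcal{P}$; $X$ has length at most $k$ if $X$ is in $\mathcal{P}_k$. *)

theory Defs
  imports "HOL-Algebra.Group" "HOL-Library.Extended_Nat" "HOL-Library.Equipollence"
    "HOL-Library.Countable_Set"
begin

section \<open>Categories\<close>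

record ('o, 'm) category =
  Ob :: "'o set"
  Ar :: "'m set"
  Dom :: "'m \<Rightarrow> 'o"
  Cod :: "'m \<Rightarrow> 'o"
  Ident :: "'o \<Rightarrow> 'm"
  Comp :: "'m \<Rightarrow> 'm \<Rightarrow> 'm"  (infixr "\<cdot>\<index>" 70)

definition Hom :: "('o, 'm, 'z) category_scheme \<Rightarrow> 'o \<Rightarrow> 'o \<Rightarrow> 'm set" where
  "Hom C X Y = {f \<in> Ar C. Dom C f = X \<and> Cod C f = Y}"

locale category =
  fixes C :: "('o, 'm, 'z) category_scheme" (structure)
  assumes Dom_Ob: "f \<in> Ar C \<Longrightarrow> Dom C f \<in> Ob C"
    and Cod_Ob: "f \<in> Ar C \<Longrightarrow> Cod C f \<in> Ob C"
    and Ident_Hom: "X \<in> Ob C \<Longrightarrow> Ident C X \<in> Hom C X X"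
    and Comp_Hom: "\<lbrakk>f \<in> Hom C X Y; g \<in> Hom C Y Z\<rbrakk> \<Longrightarrow> g \<cdot> f \<in> Hom C X Z"
    and Ident_left: "f \<in> Hom C X Y \<Longrightarrow> Ident C Y \<cdot> f = f"
    and Ident_right: "f \<in> Hom C X Y \<Longrightarrow> f \<cdot> Ident C X = f"
    and Comp_assoc: "\<lbrakk>f \<in> Hom C X Y; g \<in> Hom C Y Z; h \<in> Hom C Z W\<rbrakk>
      \<Longrightarrow> h \<cdot> (g \<cdot> f) = (h \<cdot> g) \<cdot> f"

definition mono_arrow :: "('o, 'm, 'z) category_scheme \<Rightarrow> 'm \<Rightarrow> bool" where
  "mono_arrow C f \<longleftrightarrow> f \<in> Ar C \<and>
    (\<forall>W. \<forall>g \<in> Hom C W (Dom C f). \<forall>h \<in> Hom C W (Dom C f).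
      f \<cdot>\<^bsub>C\<^esub> g = f \<cdot>\<^bsub>C\<^esub> h \<longrightarrow> g = h)"

definition epi_arrow :: "('o, 'm, 'z) category_scheme \<Rightarrow> 'm \<Rightarrow> bool" where
  "epi_arrow C f \<longleftrightarrow> f \<in> Ar C \<and>
    (\<forall>W. \<forall>g \<in> Hom C (Cod C f) W. \<forall>h \<in> Hom C (Cod C f) W.
      g \<cdot>\<^bsub>C\<^esub> f = h \<cdot>\<^bsub>C\<^esub> f \<longrightarrow> g = h)"

definition inverse_arrows :: "('o, 'm, 'z) category_scheme \<Rightarrow> 'm \<Rightarrow> 'm \<Rightarrow> bool" where
  "inverse_arrows C f g \<longleftrightarrow> f \<in> Ar C \<and> g \<in> Hom C (Cod C f) (Dom C f) \<and>
    g \<cdot>\<^bsub>C\<^esub> f = Ident C (Dom C f) \<and> f \<cdot>\<^bsub>C\<^esub> g = Ident C (Cod C f)"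

definition iso_arrow :: "('o, 'm, 'z) category_scheme \<Rightarrow> 'm \<Rightarrow> bool" where
  "iso_arrow C f \<longleftrightarrow> (\<exists>g. inverse_arrows C f g)"

definition inv_arrow :: "('o, 'm, 'z) category_scheme \<Rightarrow> 'm \<Rightarrow> 'm" where
  "inv_arrow C f = (THE g. inverse_arrows C f g)"

definition isomorphic :: "('o, 'm, 'z) category_scheme \<Rightarrow> 'o \<Rightarrow> 'o \<Rightarrow> bool" where
  "isomorphic C X Y \<longleftrightarrow> (\<exists>f \<in> Hom C X Y. iso_arrow C f)"

definition retract_of :: "('o, 'm, 'z) category_scheme \<Rightarrow> 'o \<Rightarrow> 'o \<Rightarrow> bool" where
  "retract_of C X V \<longleftrightarrow> X \<in> Ob C \<and> V \<in> Ob C \<and>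
    (\<exists>i \<in> Hom C X V. \<exists>r \<in> Hom C V X. r \<cdot>\<^bsub>C\<^esub> i = Ident C X)"

definition zero_object :: "('o, 'm, 'z) category_scheme \<Rightarrow> 'o \<Rightarrow> bool" where
  "zero_object C Z \<longleftrightarrow> Z \<in> Ob C \<and>
    (\<forall>X \<in> Ob C. (\<exists>!f. f \<in> Hom C Z X) \<and> (\<exists>!f. f \<in> Hom C X Z))"

definition zero_arrow :: "('o, 'm, 'z) category_scheme \<Rightarrow> 'm \<Rightarrow> bool" where
  "zero_arrow C f \<longleftrightarrow>
    (\<exists>Z. zero_object C Z \<and>
      (\<exists>g \<in> Hom C (Dom C f) Z. \<exists>h \<in> Hom C Z (Cod C f). f = h \<cdot>\<^bsub>C\<^esub> g))"

text \<open>The composite of \<open>X = Y 0 \<rightarrow> Y 1 \<rightarrow> \<dots> \<rightarrow> Y k\<close>, where \<open>f i : Y i \<rightarrow> Y (i + 1)\<close>.\<close>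

primrec composite :: "('o, 'm, 'z) category_scheme \<Rightarrow> 'o \<Rightarrow> (nat \<Rightarrow> 'm) \<Rightarrow> nat \<Rightarrow> 'm" where
  "composite C X f 0 = Ident C X"
| "composite C X f (Suc n) = f n \<cdot>\<^bsub>C\<^esub> composite C X f n"

text \<open>The unique factorisations of \<open>g\<close> through a monomorphism \<open>m\<close>, respectively through an
  epimorphism \<open>e\<close>.\<close>

definition lift_along :: "('o, 'm, 'z) category_scheme \<Rightarrow> 'm \<Rightarrow> 'm \<Rightarrow> 'm" where
  "lift_along C m g = (THE h. h \<in> Hom C (Dom C g) (Dom C m) \<and> m \<cdot>\<^bsub>C\<^esub> h = g)"

definition descend_along :: "('o, 'm, 'z) category_scheme \<Rightarrow> 'm \<Rightarrow> 'm \<Rightarrow> 'm" where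
  "descend_along C e g = (THE h. h \<in> Hom C (Cod C e) (Cod C g) \<and> h \<cdot>\<^bsub>C\<^esub> e = g)"

subsection \<open>Functors and colimits\<close>

text \<open>A functor is a pair of an object map and an arrow map.\<close>

definition is_functor ::
  "('j, 'a, 'y) category_scheme \<Rightarrow> ('o, 'm, 'z) category_scheme
    \<Rightarrow> ('j \<Rightarrow> 'o) \<times> ('a \<Rightarrow> 'm) \<Rightarrow> bool" where
  "is_functor J C F \<longleftrightarrow>
    (\<forall>x \<in> Ob J. fst F x \<in> Ob C) \<and>
    (\<forall>a \<in> Ar J. snd F a \<in> Hom C (fst F (Dom J a)) (fst F (Cod J a))) \<and>
    (\<forall>x \<in> Ob J. snd F (Ident J x) = Ident C (fst F x)) \<and>
    (\<forall>a \<in> Ar J. \<forall>b \<in> Ar J. Cod J a = Dom J b \<longrightarrow>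
      snd F (b \<cdot>\<^bsub>J\<^esub> a) = snd F b \<cdot>\<^bsub>C\<^esub> snd F a)"

definition natural_transformation ::
  "('j, 'a, 'y) category_scheme \<Rightarrow> ('o, 'm, 'z) category_scheme
    \<Rightarrow> ('j \<Rightarrow> 'o) \<times> ('a \<Rightarrow> 'm) \<Rightarrow> ('j \<Rightarrow> 'o) \<times> ('a \<Rightarrow> 'm) \<Rightarrow> ('j \<Rightarrow> 'm) \<Rightarrow> bool" where
  "natural_transformation J C F G \<alpha> \<longleftrightarrow>
    (\<forall>x \<in> Ob J. \<alpha> x \<in> Hom C (fst F x) (fst G x)) \<and>
    (\<forall>a \<in> Ar J. \<alpha> (Cod J a) \<cdot>\<^bsub>C\<^esub> snd F a = snd G a \<cdot>\<^bsub>C\<^esub> \<alpha> (Dom J a))"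

definition cocone ::
  "('j, 'a, 'y) category_scheme \<Rightarrow> ('o, 'm, 'z) category_scheme
    \<Rightarrow> ('j \<Rightarrow> 'o) \<times> ('a \<Rightarrow> 'm) \<Rightarrow> 'o \<Rightarrow> ('j \<Rightarrow> 'm) \<Rightarrow> bool" where
  "cocone J C F L l \<longleftrightarrow> L \<in> Ob C \<and>
    (\<forall>x \<in> Ob J. l x \<in> Hom C (fst F x) L) \<and>
    (\<forall>a \<in> Ar J. l (Cod J a) \<cdot>\<^bsub>C\<^esub> snd F a = l (Dom J a))"

definition colimit ::
  "('j, 'a, 'y) category_scheme \<Rightarrow> ('o, 'm, 'z) category_scheme
    \<Rightarrow> ('j \<Rightarrow> 'o) \<times> ('a \<Rightarrow> 'm) \<Rightarrow> 'o \<Rightarrow> ('j \<Rightarrow> 'm) \<Rightarrow> bool" where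
  "colimit J C F L l \<longleftrightarrow> cocone J C F L l \<and>
    (\<forall>M m. cocone J C F M m \<longrightarrow>
      (\<exists>!u. u \<in> Hom C L M \<and> (\<forall>x \<in> Ob J. u \<cdot>\<^bsub>C\<^esub> l x = m x)))"

definition filtered :: "('j, 'a, 'y) category_scheme \<Rightarrow> bool" where
  "filtered J \<longleftrightarrow> Ob J \<noteq> {} \<and>
    (\<forall>x \<in> Ob J. \<forall>y \<in> Ob J. \<exists>z. Hom J x z \<noteq> {} \<and> Hom J y z \<noteq> {}) \<and>
    (\<forall>x y. \<forall>a \<in> Hom J x y. \<forall>b \<in> Hom J x y.
      \<exists>z. \<exists>c \<in> Hom J y z. c \<cdot>\<^bsub>J\<^esub> a = c \<cdot>\<^bsub>J\<^esub> b)"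

section \<open>Abelian categories\<close>

record ('o, 'm) ab_category = "('o, 'm) category" +
  Add :: "'m \<Rightarrow> 'm \<Rightarrow> 'm"
  Zer :: "'o \<Rightarrow> 'o \<Rightarrow> 'm"

definition hom_group :: "('o, 'm, 'z) ab_category_scheme \<Rightarrow> 'o \<Rightarrow> 'o \<Rightarrow> 'm monoid" where
  "hom_group A X Y = \<lparr>carrier = Hom A X Y, monoid.mult = Add A, one = Zer A X Y\<rparr>"

definition neg :: "('o, 'm, 'z) ab_category_scheme \<Rightarrow> 'm \<Rightarrow> 'm" where
  "neg A f = inv\<^bsub>hom_group A (Dom A f) (Cod A f)\<^esub> f"

definition is_kernel :: "('o, 'm, 'z) ab_category_scheme \<Rightarrow> 'm \<Rightarrow> 'm \<Rightarrow> bool" where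
  "is_kernel A f k \<longleftrightarrow> f \<in> Ar A \<and> k \<in> Ar A \<and> Cod A k = Dom A f \<and>
    f \<cdot>\<^bsub>A\<^esub> k = Zer A (Dom A k) (Cod A f) \<and>
    (\<forall>W. \<forall>h \<in> Hom A W (Dom A f). f \<cdot>\<^bsub>A\<^esub> h = Zer A W (Cod A f) \<longrightarrow>
      (\<exists>!u. u \<in> Hom A W (Dom A k) \<and> k \<cdot>\<^bsub>A\<^esub> u = h))"

definition is_cokernel :: "('o, 'm, 'z) ab_category_scheme \<Rightarrow> 'm \<Rightarrow> 'm \<Rightarrow> bool" where
  "is_cokernel A f c \<longleftrightarrow> f \<in> Ar A \<and> c \<in> Ar A \<and> Dom A c = Cod A f \<and>
    c \<cdot>\<^bsub>A\<^esub> f = Zer A (Dom A f) (Cod A c) \<and>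
    (\<forall>W. \<forall>h \<in> Hom A (Cod A f) W. h \<cdot>\<^bsub>A\<^esub> f = Zer A (Dom A f) W \<longrightarrow>
      (\<exists>!u. u \<in> Hom A (Cod A c) W \<and> u \<cdot>\<^bsub>A\<^esub> c = h))"

text \<open>\<open>S\<close> is the biproduct of \<open>X\<close> and \<open>Y\<close>, with inclusions \<open>i\<close>, \<open>j\<close> and projections
  \<open>p\<close>, \<open>q\<close>.\<close>

definition biproduct ::
  "('o, 'm, 'z) ab_category_scheme \<Rightarrow> 'o \<Rightarrow> 'o \<Rightarrow> 'o \<Rightarrow> 'm \<Rightarrow> 'm \<Rightarrow> 'm \<Rightarrow> 'm \<Rightarrow> bool" where
  "biproduct A X Y S i j p q \<longleftrightarrow>
    i \<in> Hom A X S \<and> j \<in> Hom A Y S \<and> p \<in> Hom A S X \<and> q \<in> Hom A S Y \<and>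
    p \<cdot>\<^bsub>A\<^esub> i = Ident A X \<and> q \<cdot>\<^bsub>A\<^esub> j = Ident A Y \<and>
    q \<cdot>\<^bsub>A\<^esub> i = Zer A X Y \<and> p \<cdot>\<^bsub>A\<^esub> j = Zer A Y X \<and>
    Add A (i \<cdot>\<^bsub>A\<^esub> p) (j \<cdot>\<^bsub>A\<^esub> q) = Ident A S"

locale abelian_category = category A
  for A :: "('o, 'm, 'z) ab_category_scheme" (structure) +
  assumes hom_comm_group: "\<lbrakk>X \<in> Ob A; Y \<in> Ob A\<rbrakk> \<Longrightarrow> comm_group (hom_group A X Y)"
    and Comp_Add_left: "\<lbrakk>f \<in> Hom A X Y; g \<in> Hom A Y Z; h \<in> Hom A Y Z\<rbrakk>
      \<Longrightarrow> Add A g h \<cdot> f = Add A (g \<cdot> f) (h \<cdot> f)"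
    and Comp_Add_right: "\<lbrakk>f \<in> Hom A X Y; g \<in> Hom A X Y; h \<in> Hom A Y Z\<rbrakk>
      \<Longrightarrow> h \<cdot> Add A f g = Add A (h \<cdot> f) (h \<cdot> g)"
    and ex_zero_object: "\<exists>Z. zero_object A Z"
    and ex_biproduct: "\<lbrakk>X \<in> Ob A; Y \<in> Ob A\<rbrakk> \<Longrightarrow> \<exists>S i j p q. biproduct A X Y S i j p q"
    and ex_kernel: "f \<in> Ar A \<Longrightarrow> \<exists>k. is_kernel A f k"
    and ex_cokernel: "f \<in> Ar A \<Longrightarrow> \<exists>c. is_cokernel A f c"
    and mono_is_kernel: "mono_arrow A m \<Longrightarrow> \<exists>f. is_kernel A f m"
    and epi_is_cokernel: "epi_arrow A e \<Longrightarrow> \<exists>f. is_cokernel A f e"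

text \<open>Chosen kernels, cokernels and images, as arrows.\<close>

definition ker_arrow :: "('o, 'm, 'z) ab_category_scheme \<Rightarrow> 'm \<Rightarrow> 'm" where
  "ker_arrow A f = (SOME k. is_kernel A f k)"

definition coker_arrow :: "('o, 'm, 'z) ab_category_scheme \<Rightarrow> 'm \<Rightarrow> 'm" where
  "coker_arrow A f = (SOME c. is_cokernel A f c)"

definition im_arrow :: "('o, 'm, 'z) ab_category_scheme \<Rightarrow> 'm \<Rightarrow> 'm" where
  "im_arrow A f = ker_arrow A (coker_arrow A f)"

definition exact_pair :: "('o, 'm, 'z) ab_category_scheme \<Rightarrow> 'm \<Rightarrow> 'm \<Rightarrow> bool" where
  "exact_pair A f g \<longleftrightarrow> f \<in> Ar A \<and> g \<in> Ar A \<and> Cod A f = Dom A g \<and>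
    is_kernel A g (im_arrow A f)"

definition short_exact :: "('o, 'm, 'z) ab_category_scheme \<Rightarrow> 'm \<Rightarrow> 'm \<Rightarrow> bool" where
  "short_exact A f g \<longleftrightarrow> mono_arrow A f \<and> exact_pair A f g \<and> epi_arrow A g"

definition projective :: "('o, 'm, 'z) ab_category_scheme \<Rightarrow> 'o \<Rightarrow> bool" where
  "projective A P \<longleftrightarrow> P \<in> Ob A \<and>
    (\<forall>e. epi_arrow A e \<longrightarrow>
      (\<forall>f \<in> Hom A P (Cod A e). \<exists>g \<in> Hom A P (Dom A e). e \<cdot>\<^bsub>A\<^esub> g = f))"

definition enough_projectives :: "('o, 'm, 'z) ab_category_scheme \<Rightarrow> bool" where
  "enough_projectives A \<longleftrightarrow>
    (\<forall>X \<in> Ob A. \<exists>P e. projective A P \<and> e \<in> Hom A P X \<and> epi_arrow A e)"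

text \<open>A resolution \<open>0 \<leftarrow> M \<leftarrow> P 0 \<leftarrow> \<dots> \<leftarrow> P m \<leftarrow> 0\<close> is written as an infinite sequence with
  \<open>P s\<close> zero for \<open>s > m\<close>; \<open>r 0\<close> is the augmentation and \<open>r (Suc s) : P (Suc s) \<rightarrow> P s\<close>.\<close>

definition projective_resolution ::
  "('o, 'm, 'z) ab_category_scheme \<Rightarrow> 'o \<Rightarrow> nat \<Rightarrow> (nat \<Rightarrow> 'o) \<Rightarrow> (nat \<Rightarrow> 'm) \<Rightarrow> bool" where
  "projective_resolution A M m P r \<longleftrightarrow>
    (\<forall>s \<le> m. projective A (P s)) \<and> (\<forall>s > m. zero_object A (P s)) \<and>
    r 0 \<in> Hom A (P 0) M \<and> (\<forall>s. r (Suc s) \<in> Hom A (P (Suc s)) (P s)) \<and>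
    epi_arrow A (r 0) \<and> (\<forall>s. exact_pair A (r (Suc s)) (r s))"

text \<open>The infimum is \<open>\<infinity>\<close> if there is no finite resolution.\<close>

definition projdim :: "('o, 'm, 'z) ab_category_scheme \<Rightarrow> 'o \<Rightarrow> enat" where
  "projdim A M = (INF m \<in> {m. \<exists>P r. projective_resolution A M m P r}. enat m)"

subsection \<open>The axiom AB 5\<close>

text \<open>The smallness notion in \<open>set-indexed\<close> is given by the type \<open>'i\<close>: a set is small if its
  cardinality is strictly less than that of \<open>'i\<close>. (If \<open>'i\<close> has the cardinality of a Grothendieck
  universe, these are up to bijection the sets belonging to that universe.) The type \<open>'i\<close>
  is independent of the types of objects and arrows of \<open>A\<close>; an abelian category with coproducts
  indexed by arbitrary sets of its own arrows would be trivial.\<close>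

definition AB5 :: "'i itself \<Rightarrow> ('o, 'm, 'z) ab_category_scheme \<Rightarrow> bool" where
  "AB5 _ A \<longleftrightarrow>
    (\<forall>(J :: ('i, 'i) category) F.
      category J \<and> Ar J \<prec> (UNIV :: 'i set) \<and> is_functor J A F \<longrightarrow>
      (\<exists>L l. colimit J A F L l)) \<and>
    (\<forall>(J :: ('i, 'i) category) F F' F'' \<alpha> \<beta> L l L' l' L'' l'' a b.
      category J \<and> Ar J \<prec> (UNIV :: 'i set) \<and> filtered J \<and>
      is_functor J A F \<and> is_functor J A F' \<and> is_functor J A F'' \<and>
      natural_transformation J A F F' \<alpha> \<and> natural_transformation J A F' F'' \<beta> \<and>
      (\<forall>x \<in> Ob J. short_exact A (\<alpha> x) (\<beta> x)) \<and>
      colimit J A F L l \<and> colimit J A F' L' l' \<and> colimit J A F'' L'' l'' \<and>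
      a \<in> Hom A L L' \<and> (\<forall>x \<in> Ob J. a \<cdot>\<^bsub>A\<^esub> l x = l' x \<cdot>\<^bsub>A\<^esub> \<alpha> x) \<and>
      b \<in> Hom A L' L'' \<and> (\<forall>x \<in> Ob J. b \<cdot>\<^bsub>A\<^esub> l' x = l'' x \<cdot>\<^bsub>A\<^esub> \<beta> x) \<longrightarrow>
      short_exact A a b)"

section \<open>Chain complexes\<close>

text \<open>A complex is a pair \<open>(X, d)\<close> with \<open>d n : X n \<rightarrow> X (n - 1)\<close>; a chain map carries its source
  and target.\<close>

type_synonym ('o, 'm) cplx = "(int \<Rightarrow> 'o) \<times> (int \<Rightarrow> 'm)"
type_synonym ('o, 'm) chmap = "('o, 'm) cplx \<times> (int \<Rightarrow> 'm) \<times> ('o, 'm) cplx"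

definition chain_complex :: "('o, 'm, 'z) ab_category_scheme \<Rightarrow> ('o, 'm) cplx \<Rightarrow> bool" where
  "chain_complex A X \<longleftrightarrow>
    (\<forall>n. fst X n \<in> Ob A \<and> snd X n \<in> Hom A (fst X n) (fst X (n - 1)) \<and>
      snd X (n - 1) \<cdot>\<^bsub>A\<^esub> snd X n = Zer A (fst X n) (fst X (n - 2)))"

definition chain_map :: "('o, 'm, 'z) ab_category_scheme \<Rightarrow> ('o, 'm) chmap \<Rightarrow> bool" where
  "chain_map A \<phi> \<longleftrightarrow> (case \<phi> of (X, f, Y) \<Rightarrow>
    chain_complex A X \<and> chain_complex A Y \<and>
    (\<forall>n. f n \<in> Hom A (fst X n) (fst Y n) \<and>
      snd Y n \<cdot>\<^bsub>A\<^esub> f n = f (n - 1) \<cdot>\<^bsub>A\<^esub> snd X n))"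

definition Ch :: "('o, 'm, 'z) ab_category_scheme \<Rightarrow> (('o, 'm) cplx, ('o, 'm) chmap) category" where
  "Ch A = \<lparr>Ob = {X. chain_complex A X}, Ar = {\<phi>. chain_map A \<phi>},
    Dom = (\<lambda>(X, f, Y). X), Cod = (\<lambda>(X, f, Y). Y),
    Ident = (\<lambda>X. (X, (\<lambda>n. Ident A (fst X n)), X)),
    Comp = (\<lambda>(Y', g, Z) (X, f, Y). (X, (\<lambda>n. g n \<cdot>\<^bsub>A\<^esub> f n), Z))\<rparr>"

text \<open>The inclusions \<open>Z\<^sub>n X \<rightarrow> X\<^sub>n\<close> and \<open>B\<^sub>n X \<rightarrow> X\<^sub>n\<close>, and the projection \<open>Z\<^sub>n X \<rightarrow> H\<^sub>n X\<close>.\<close>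

definition cycles_incl :: "('o, 'm, 'z) ab_category_scheme \<Rightarrow> int \<Rightarrow> ('o, 'm) cplx \<Rightarrow> 'm" where
  "cycles_incl A n X = ker_arrow A (snd X n)"

definition boundaries_incl :: "('o, 'm, 'z) ab_category_scheme \<Rightarrow> int \<Rightarrow> ('o, 'm) cplx \<Rightarrow> 'm" where
  "boundaries_incl A n X = im_arrow A (snd X (n + 1))"

definition homology_proj :: "('o, 'm, 'z) ab_category_scheme \<Rightarrow> int \<Rightarrow> ('o, 'm) cplx \<Rightarrow> 'm" where
  "homology_proj A n X =
    coker_arrow A (lift_along A (cycles_incl A n X) (boundaries_incl A n X))"

definition boundaries :: "('o, 'm, 'z) ab_category_scheme \<Rightarrow> int \<Rightarrow> ('o, 'm) cplx \<Rightarrow> 'o" where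
  "boundaries A n X = Dom A (boundaries_incl A n X)"

definition homology :: "('o, 'm, 'z) ab_category_scheme \<Rightarrow> int \<Rightarrow> ('o, 'm) cplx \<Rightarrow> 'o" where
  "homology A n X = Cod A (homology_proj A n X)"

definition homology_map :: "('o, 'm, 'z) ab_category_scheme \<Rightarrow> int \<Rightarrow> ('o, 'm) chmap \<Rightarrow> 'm" where
  "homology_map A n \<phi> = (case \<phi> of (X, f, Y) \<Rightarrow>
    descend_along A (homology_proj A n X)
      (homology_proj A n Y \<cdot>\<^bsub>A\<^esub>
        lift_along A (cycles_incl A n Y) (f n \<cdot>\<^bsub>A\<^esub> cycles_incl A n X)))"

definition quasi_isos :: "('o, 'm, 'z) ab_category_scheme \<Rightarrow> ('o, 'm) chmap set" where
  "quasi_isos A = {\<phi>. chain_map A \<phi> \<and> (\<forall>n. iso_arrow A (homology_map A n \<phi>))}"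

text \<open>The \<open>n\<close>-fold suspension: \<open>(\<Sigma>\<^sup>n X)\<^sub>m = X\<^bsub>m-n\<^esub>\<close> with differential \<open>(-1)\<^sup>n d\<close>.\<close>

definition shift_cplx ::
  "('o, 'm, 'z) ab_category_scheme \<Rightarrow> int \<Rightarrow> ('o, 'm) cplx \<Rightarrow> ('o, 'm) cplx" where
  "shift_cplx A n X =
    ((\<lambda>m. fst X (m - n)),
     (\<lambda>m. if even n then snd X (m - n) else neg A (snd X (m - n))))"

definition shift_chmap ::
  "('o, 'm, 'z) ab_category_scheme \<Rightarrow> int \<Rightarrow> ('o, 'm) chmap \<Rightarrow> ('o, 'm) chmap" where
  "shift_chmap A n \<phi> = (case \<phi> of (X, f, Y) \<Rightarrow>
    (shift_cplx A n X, (\<lambda>m. f (m - n)), shift_cplx A n Y))"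

text \<open>\<open>X \<rightarrow> Y \<rightarrow> C \<rightarrow> \<Sigma>X\<close> is the sequence of a mapping cone of \<open>\<phi> : X \<rightarrow> Y\<close>: in degree \<open>n\<close>,
  \<open>C\<close> is a biproduct of \<open>X (n - 1)\<close> and \<open>Y n\<close>, with differential
  \<open>(x, y) \<mapsto> (- d x, \<phi> x + d y)\<close>. The first summand of the formula below is this \<open>- d\<close>, written as
  the differential of \<open>\<Sigma>X\<close>.\<close>

definition cone_sequence ::
  "('o, 'm, 'z) ab_category_scheme \<Rightarrow> ('o, 'm) chmap \<Rightarrow> ('o, 'm) chmap \<Rightarrow> ('o, 'm) chmap \<Rightarrow> bool" where
  "cone_sequence A \<phi> \<iota> \<pi> \<longleftrightarrow> (\<exists>X f Y C i j p q.
    \<phi> = (X, f, Y) \<and> \<iota> = (Y, j, C) \<and> \<pi> = (C, p, shift_cplx A 1 X) \<and>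
    chain_map A \<phi> \<and> chain_map A \<iota> \<and> chain_map A \<pi> \<and>
    (\<forall>n. biproduct A (fst X (n - 1)) (fst Y n) (fst C n) (i n) (j n) (p n) (q n) \<and>
      snd C n =
        Add A (i (n - 1) \<cdot>\<^bsub>A\<^esub> snd (shift_cplx A 1 X) n \<cdot>\<^bsub>A\<^esub> p n)
          (Add A (j (n - 1) \<cdot>\<^bsub>A\<^esub> f (n - 1) \<cdot>\<^bsub>A\<^esub> p n)
            (j (n - 1) \<cdot>\<^bsub>A\<^esub> snd Y n \<cdot>\<^bsub>A\<^esub> q n))))"

section \<open>Localization of a category\<close>

text \<open>The localization of \<open>C\<close> at a set \<open>W\<close> of arrows, as constructed by Gabriel and Zisman: arrows
  are zigzags of arrows of \<open>C\<close> and formal inverses of arrows of \<open>W\<close>, modulo the congruence that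
  makes \<open>C\<close> map functorially and makes the formal inverses inverse. Zigzags are lists in
  diagrammatic order: the head is applied first.\<close>

datatype 'm letter = Fwd 'm | Bwd 'm

primrec letter_src :: "('o, 'm, 'z) category_scheme \<Rightarrow> 'm letter \<Rightarrow> 'o" where
  "letter_src C (Fwd f) = Dom C f"
| "letter_src C (Bwd w) = Cod C w"

primrec letter_tgt :: "('o, 'm, 'z) category_scheme \<Rightarrow> 'm letter \<Rightarrow> 'o" where
  "letter_tgt C (Fwd f) = Cod C f"
| "letter_tgt C (Bwd w) = Dom C w"

primrec letter_ok :: "('o, 'm, 'z) category_scheme \<Rightarrow> 'm set \<Rightarrow> 'm letter \<Rightarrow> bool" where
  "letter_ok C W (Fwd f) \<longleftrightarrow> f \<in> Ar C"
| "letter_ok C W (Bwd w) \<longleftrightarrow> w \<in> W"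

primrec zigzag ::
  "('o, 'm, 'z) category_scheme \<Rightarrow> 'm set \<Rightarrow> 'o \<Rightarrow> 'm letter list \<Rightarrow> 'o \<Rightarrow> bool" where
  "zigzag C W X [] Y \<longleftrightarrow> X \<in> Ob C \<and> X = Y"
| "zigzag C W X (l # p) Y \<longleftrightarrow>
    letter_ok C W l \<and> letter_src C l = X \<and> zigzag C W (letter_tgt C l) p Y"

inductive zigzag_rel ::
  "('o, 'm, 'z) category_scheme \<Rightarrow> 'm set \<Rightarrow> 'm letter list \<Rightarrow> 'm letter list \<Rightarrow> bool"
  for C :: "('o, 'm, 'z) category_scheme" and W :: "'m set" where
  ident: "X \<in> Ob C \<Longrightarrow> zigzag_rel C W [Fwd (Ident C X)] []"
| comp: "\<lbrakk>f \<in> Ar C; g \<in> Ar C; Cod C f = Dom C g\<rbrakk>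
    \<Longrightarrow> zigzag_rel C W [Fwd f, Fwd g] [Fwd (g \<cdot>\<^bsub>C\<^esub> f)]"
| inv_right: "w \<in> W \<Longrightarrow> zigzag_rel C W [Fwd w, Bwd w] []"
| inv_left: "w \<in> W \<Longrightarrow> zigzag_rel C W [Bwd w, Fwd w] []"

inductive loc_equiv ::
  "('o, 'm, 'z) category_scheme \<Rightarrow> 'm set \<Rightarrow> 'o \<Rightarrow> 'o \<Rightarrow> 'm letter list \<Rightarrow> 'm letter list \<Rightarrow> bool"
  for C :: "('o, 'm, 'z) category_scheme" and W :: "'m set" and X Y :: 'o where
  step: "\<lbrakk>zigzag_rel C W a b; zigzag C W X (p @ a @ q) Y; zigzag C W X (p @ b @ q) Y\<rbrakk>
    \<Longrightarrow> loc_equiv C W X Y (p @ a @ q) (p @ b @ q)"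
| refl: "zigzag C W X p Y \<Longrightarrow> loc_equiv C W X Y p p"
| sym: "loc_equiv C W X Y p q \<Longrightarrow> loc_equiv C W X Y q p"
| trans: "\<lbrakk>loc_equiv C W X Y p q; loc_equiv C W X Y q r\<rbrakk> \<Longrightarrow> loc_equiv C W X Y p r"

type_synonym ('o, 'm) loc_arrow = "'o \<times> 'm letter list set \<times> 'o"

definition loc_class ::
  "('o, 'm, 'z) category_scheme \<Rightarrow> 'm set \<Rightarrow> 'o \<Rightarrow> 'm letter list \<Rightarrow> 'o \<Rightarrow> ('o, 'm) loc_arrow" where
  "loc_class C W X p Y = (X, {q. loc_equiv C W X Y p q}, Y)"

definition localization ::
  "('o, 'm, 'z) category_scheme \<Rightarrow> 'm set \<Rightarrow> ('o, ('o, 'm) loc_arrow) category" where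
  "localization C W = \<lparr>Ob = Ob C,
    Ar = {loc_class C W X p Y | X p Y. zigzag C W X p Y},
    Dom = (\<lambda>(X, c, Y). X), Cod = (\<lambda>(X, c, Y). Y),
    Ident = (\<lambda>X. loc_class C W X [] X),
    Comp = (\<lambda>(Y', b, Z) (X, a, Y).
      (X, {r. \<exists>p \<in> a. \<exists>q \<in> b. loc_equiv C W X Z (p @ q) r}, Z))\<rparr>"

definition loc_functor ::
  "('o, 'm, 'z) category_scheme \<Rightarrow> 'm set \<Rightarrow> 'm \<Rightarrow> ('o, 'm) loc_arrow" where
  "loc_functor C W f = loc_class C W (Dom C f) [Fwd f] (Cod C f)"

section \<open>The derived category\<close>

text \<open>A category with integer powers of a suspension, on objects and on arrows, and a class of
  distinguished triangles \<open>U \<rightarrow> V \<rightarrow> W \<rightarrow> \<Sigma>U\<close>.\<close>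

record ('o, 'm) tri_category = "('o, 'm) category" +
  Susp :: "int \<Rightarrow> 'o \<Rightarrow> 'o"
  SuspAr :: "int \<Rightarrow> 'm \<Rightarrow> 'm"
  Tri :: "('m \<times> 'm \<times> 'm) set"

type_synonym ('o, 'm) darrow = "(('o, 'm) cplx, ('o, 'm) chmap) loc_arrow"

definition loc_derived ::
  "('o, 'm, 'z) ab_category_scheme \<Rightarrow> (('o, 'm) cplx, ('o, 'm) darrow) category" where
  "loc_derived A = localization (Ch A) (quasi_isos A)"

definition shift_darrow ::
  "('o, 'm, 'z) ab_category_scheme \<Rightarrow> int \<Rightarrow> ('o, 'm) darrow \<Rightarrow> ('o, 'm) darrow" where
  "shift_darrow A n \<alpha> = (case \<alpha> of (X, c, Y) \<Rightarrow>
    (shift_cplx A n X,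
     {q. \<exists>p \<in> c. loc_equiv (Ch A) (quasi_isos A) (shift_cplx A n X) (shift_cplx A n Y)
        (map (map_letter (shift_chmap A n)) p) q},
     shift_cplx A n Y))"

text \<open>The distinguished triangles are those isomorphic to the image of a mapping cone sequence.\<close>

definition derived_triangles ::
  "('o, 'm, 'z) ab_category_scheme
    \<Rightarrow> (('o, 'm) darrow \<times> ('o, 'm) darrow \<times> ('o, 'm) darrow) set" where
  "derived_triangles A = (let D = loc_derived A; Q = loc_functor (Ch A) (quasi_isos A) in
    {(u, v, w) | u v w. \<exists>U V W \<phi> \<iota> \<pi> a b c.
      u \<in> Hom D U V \<and> v \<in> Hom D V W \<and> w \<in> Hom D W (shift_cplx A 1 U) \<and>
      cone_sequence A \<phi> \<iota> \<pi> \<and>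
      a \<in> Hom D U (Dom (Ch A) \<phi>) \<and> iso_arrow D a \<and>
      b \<in> Hom D V (Cod (Ch A) \<phi>) \<and> iso_arrow D b \<and>
      c \<in> Hom D W (Cod (Ch A) \<iota>) \<and> iso_arrow D c \<and>
      b \<cdot>\<^bsub>D\<^esub> u = Q \<phi> \<cdot>\<^bsub>D\<^esub> a \<and>
      c \<cdot>\<^bsub>D\<^esub> v = Q \<iota> \<cdot>\<^bsub>D\<^esub> b \<and>
      shift_darrow A 1 a \<cdot>\<^bsub>D\<^esub> w = Q \<pi> \<cdot>\<^bsub>D\<^esub> c})"

definition derived ::
  "('o, 'm, 'z) ab_category_scheme \<Rightarrow> (('o, 'm) cplx, ('o, 'm) darrow) tri_category" where
  "derived A = category.extend (loc_derived A)
    (tri_category.fields (shift_cplx A) (shift_darrow A) (derived_triangles A))"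

text \<open>The map induced in homology by an arrow of the derived category is computed on any
  representing zigzag, with formal inverses going to inverses.\<close>

primrec letter_homology ::
  "('o, 'm, 'z) ab_category_scheme \<Rightarrow> int \<Rightarrow> ('o, 'm) chmap letter \<Rightarrow> 'm" where
  "letter_homology A n (Fwd \<phi>) = homology_map A n \<phi>"
| "letter_homology A n (Bwd \<phi>) = inv_arrow A (homology_map A n \<phi>)"

primrec zigzag_homology ::
  "('o, 'm, 'z) ab_category_scheme \<Rightarrow> int \<Rightarrow> ('o, 'm) cplx \<Rightarrow> ('o, 'm) chmap letter list \<Rightarrow> 'm" where
  "zigzag_homology A n X [] = Ident A (homology A n X)"
| "zigzag_homology A n X (l # p) =
    zigzag_homology A n (letter_tgt (Ch A) l) p \<cdot>\<^bsub>A\<^esub> letter_homology A n l"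

definition derived_homology ::
  "('o, 'm, 'z) ab_category_scheme \<Rightarrow> int \<Rightarrow> ('o, 'm) darrow \<Rightarrow> 'm" where
  "derived_homology A n \<alpha> = (case \<alpha> of (X, c, Y) \<Rightarrow>
    (THE h. \<exists>p \<in> c. h = zigzag_homology A n X p))"

definition ghosts :: "('o, 'm, 'z) ab_category_scheme \<Rightarrow> ('o, 'm) darrow set" where
  "ghosts A = {\<alpha> \<in> Ar (derived A). \<forall>n. derived_homology A n \<alpha> =
    Zer A (homology A n (Dom (derived A) \<alpha>)) (homology A n (Cod (derived A) \<alpha>))}"

definition ghost_projectives :: "('o, 'm, 'z) ab_category_scheme \<Rightarrow> ('o, 'm) cplx set" where
  "ghost_projectives A = {X \<in> Ob (derived A). \<exists>P.
    chain_complex A P \<and> (\<forall>n. projective A (fst P n)) \<and>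
    (\<forall>n. snd P n = Zer A (fst P n) (fst P (n - 1))) \<and>
    isomorphic (derived A) X P}"

section \<open>Projective dimension and length with respect to a projective class\<close>

text \<open>Exactness of \<open>T(Q, U) \<rightarrow> T(Q, V) \<rightarrow> T(Q, W)\<close> at the middle term, for \<open>f : U \<rightarrow> V\<close> and
  \<open>g : V \<rightarrow> W\<close>.\<close>

definition hom_exact :: "('o, 'm, 'z) category_scheme \<Rightarrow> 'o \<Rightarrow> 'm \<Rightarrow> 'm \<Rightarrow> bool" where
  "hom_exact T Q f g \<longleftrightarrow>
    (\<forall>h \<in> Hom T Q (Dom T g).
      zero_arrow T (g \<cdot>\<^bsub>T\<^esub> h) \<longleftrightarrow> (\<exists>h' \<in> Hom T Q (Dom T f). f \<cdot>\<^bsub>T\<^esub> h' = h))"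

text \<open>A resolution of length \<open>m\<close> with \<open>r 0 : P 0 \<rightarrow> X\<close> and degree \<open>-1\<close> maps
  \<open>r (Suc s) : P (Suc s) \<rightarrow> \<Sigma> (P s)\<close>; as for \<open>projective_resolution\<close>, \<open>P s\<close> is zero for \<open>s > m\<close>.
  The degree \<open>n\<close> part of \<open>T(Q, -)\<^sub>*\<close> is \<open>T(\<Sigma>\<^sup>n Q, -)\<close>, so exactness at \<open>P s\<close> (where \<open>n\<close> ranges
  over all integers) can be tested on
  \<open>P (Suc s) \<rightarrow> \<Sigma> (P s) \<rightarrow> \<Sigma>\<^sup>2 (P (s - 1))\<close> for \<open>s \<ge> 1\<close> and on \<open>P 1 \<rightarrow> \<Sigma> (P 0) \<rightarrow> \<Sigma>X\<close> for \<open>s = 0\<close>.\<close>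

definition rel_resolution ::
  "('o, 'm, 'z) tri_category_scheme \<Rightarrow> 'o set \<Rightarrow> 'o \<Rightarrow> nat \<Rightarrow> (nat \<Rightarrow> 'o) \<Rightarrow> (nat \<Rightarrow> 'm) \<Rightarrow> bool" where
  "rel_resolution T \<P> X m P r \<longleftrightarrow>
    (\<forall>s \<le> m. P s \<in> \<P>) \<and> (\<forall>s > m. zero_object T (P s)) \<and>
    r 0 \<in> Hom T (P 0) X \<and> (\<forall>s. r (Suc s) \<in> Hom T (P (Suc s)) (Susp T 1 (P s))) \<and>
    (\<forall>Q \<in> \<P>. \<forall>n.
      (\<forall>h \<in> Hom T (Susp T n Q) X. \<exists>h' \<in> Hom T (Susp T n Q) (P 0). r 0 \<cdot>\<^bsub>T\<^esub> h' = h) \<and>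
      (\<forall>s. hom_exact T (Susp T n Q) (r (Suc s)) (SuspAr T 1 (r s))))"

definition rel_projdim :: "('o, 'm, 'z) tri_category_scheme \<Rightarrow> 'o set \<Rightarrow> 'o \<Rightarrow> enat" where
  "rel_projdim T \<P> X = (INF m \<in> {m. \<exists>P r. rel_resolution T \<P> X m P r}. enat m)"

text \<open>\<open>X\<close> has length at most \<open>k\<close> if \<open>X \<in> length_class T \<P> k\<close>.\<close>

fun length_class :: "('o, 'm, 'z) tri_category_scheme \<Rightarrow> 'o set \<Rightarrow> nat \<Rightarrow> 'o set" where
  "length_class T \<P> 0 = {X. zero_object T X}"
| "length_class T \<P> (Suc 0) = \<P>"
| "length_class T \<P> (Suc (Suc n)) =
    {X. \<exists>U V P u v w. U \<in> length_class T \<P> (Suc n) \<and> P \<in> \<P> \<and>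
      u \<in> Hom T U V \<and> v \<in> Hom T V P \<and> w \<in> Hom T P (Susp T 1 U) \<and>
      (u, v, w) \<in> Tri T \<and> retract_of T X V}"

end

theory Submission
  imports Defs
begin

text \<open>A map from a complex of projectives with zero differential to \<open>X\<close> is, in the derived category, the same as a family of maps
  to the objects \<open>H\<^sub>n X\<close>; it can be represented by a chain map, since such complexes lift through
  quasi-isomorphisms up to homotopy. Hence projective resolutions of length less than \<open>k\<close> of the
  objects \<open>H\<^sub>n X\<close>, regarded as complexes with zero differential, form a resolution of \<open>X\<close> relative to
  the ghosts. For the length, kill the successive syzygies by cones: starting from a lift
  \<open>S\<^sub>0 \<rightarrow> X\<close> of the augmentation, attach \<open>S\<^sub>1, S\<^sub>2, \<dots>\<close> until the map to \<open>X\<close> is a quasi-isomorphism.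
  For composites of ghosts, pass instead from \<open>X\<close> to the cone of \<open>S\<^sub>0 \<rightarrow> X\<close>: the homology of this cone is
  the next syzygy, and a ghost out of \<open>X\<close> factors through it.\<close>

section \<open>Arrows of an abelian category\<close>

text \<open>Arrows of the derived category are classes of arbitrarily long zigzags and come without
  a normal form. Statements about all of them are therefore proved by induction on the letters, and
  have to be formulated so as to survive both kinds of letters. This is why a chain map out of a
  complex of projectives with zero differential, together with its cone, is carried along the
  zigzag. Backward letters are harmless for such a source because its degrees can be lifted
  separately: there is no differential with which the choices must be compatible.

  Once homology has been described by cycles and boundaries, chases are carried out on arrows out of
  projective objects. With enough projectives these detect isomorphisms, so the chases look like
  those with elements of modules.

  The bound \<open>k\<close> enters through the graded homology as a whole. The resolutions in the
  various degrees are shifted against each other so that all maps get degree \<open>-1\<close>, and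
  every term of index at least \<open>k\<close> vanishes. Each cone uses up one term.\<close>

lemma Hom_iff: "f \<in> Hom C X Y \<longleftrightarrow> f \<in> Ar C \<and> Dom C f = X \<and> Cod C f = Y"
  by (auto simp: Hom_def)

section \<open>General categories: a typed calculus of composition, inverses and isomorphism\<close>

context category
begin

lemma Hom_Ob: "f \<in> Hom C X Y \<Longrightarrow> X \<in> Ob C" "f \<in> Hom C X Y \<Longrightarrow> Y \<in> Ob C"
  using Dom_Ob Cod_Ob by (auto simp: Hom_iff)

lemma Comp_simps:
  assumes "f \<in> Ar C" "g \<in> Ar C" "Dom C g = Cod C f"
  shows "g \<cdot> f \<in> Ar C" "Dom C (g \<cdot> f) = Dom C f" "Cod C (g \<cdot> f) = Cod C g"
  using Comp_Hom[of f "Dom C f" "Cod C f" g "Cod C g"] assms by (auto simp: Hom_iff)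

lemma Ident_simps:
  assumes "X \<in> Ob C"
  shows "Ident C X \<in> Ar C" "Dom C (Ident C X) = X" "Cod C (Ident C X) = X"
  using Ident_Hom[OF assms] by (auto simp: Hom_iff)

lemma Comp_Ident_simps:
  "f \<in> Ar C \<Longrightarrow> Cod C f = Y \<Longrightarrow> Ident C Y \<cdot> f = f"
  "f \<in> Ar C \<Longrightarrow> Dom C f = Y \<Longrightarrow> f \<cdot> Ident C Y = f"
  using Ident_left Ident_right by (auto simp: Hom_iff)

lemma Comp_assoc_simp:
  "f \<in> Ar C \<Longrightarrow> g \<in> Ar C \<Longrightarrow> h \<in> Ar C \<Longrightarrow> Dom C g = Cod C f \<Longrightarrow> Dom C h = Cod C g
    \<Longrightarrow> (h \<cdot> g) \<cdot> f = h \<cdot> (g \<cdot> f)"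
  using Comp_assoc[of f "Dom C f" "Cod C f" g "Cod C g" h "Cod C h"] by (auto simp: Hom_iff)

text \<open>Typing is kept as membership in \<open>Ar\<close> with equations for \<open>Dom\<close>
  and \<open>Cod\<close>, because the simplifier can discharge such side conditions, while
  \<open>Hom\<close> would force it to guess objects. Composites are normalised by associating to
  the right; steps that need the other bracketing invoke associativity explicitly.\<close>

lemmas cat_simps = Dom_Ob Cod_Ob Comp_simps Ident_simps Comp_Ident_simps Comp_assoc_simp

lemma inverse_arrows_unique:
  assumes "inverse_arrows C f g" "inverse_arrows C f h"
  shows "g = h"
proof -
  note a = assms[unfolded inverse_arrows_def Hom_iff]
  have "(g \<cdot> f) \<cdot> h = g \<cdot> (f \<cdot> h)" by (rule Comp_assoc_simp) (use a in auto)
  thus ?thesis using a by (simp add: cat_simps)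
qed

lemma inv_arrow_eq: "inverse_arrows C f g \<Longrightarrow> inv_arrow C f = g"
  unfolding inv_arrow_def using inverse_arrows_unique by blast

lemma inv_arrow_inverse: "iso_arrow C f \<Longrightarrow> inverse_arrows C f (inv_arrow C f)"
  unfolding iso_arrow_def using inv_arrow_eq by metis

lemma inverse_arrowsI:
  assumes "f \<in> Hom C X Y" "g \<in> Hom C Y X" "g \<cdot> f = Ident C X" "f \<cdot> g = Ident C Y"
  shows "inverse_arrows C f g"
  using assms by (auto simp: inverse_arrows_def Hom_iff)

lemma inverse_arrows_sym: "inverse_arrows C f g \<Longrightarrow> inverse_arrows C g f"
  by (auto simp: inverse_arrows_def Hom_iff)

lemma inverse_arrows_comp:
  assumes "inverse_arrows C f f'" "inverse_arrows C g g'" "Cod C f = Dom C g"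
  shows "inverse_arrows C (g \<cdot> f) (f' \<cdot> g')"
proof (rule inverse_arrowsI[of _ "Dom C f" "Cod C g"])
  note a = assms[unfolded inverse_arrows_def Hom_iff]
  show "g \<cdot> f \<in> Hom C (Dom C f) (Cod C g)" "f' \<cdot> g' \<in> Hom C (Cod C g) (Dom C f)"
    using a by (auto simp: Hom_iff cat_simps)
  have "(f' \<cdot> g') \<cdot> (g \<cdot> f) = f' \<cdot> (g' \<cdot> (g \<cdot> f))"
    using a by (intro Comp_assoc_simp) (auto simp: cat_simps)
  also have "g' \<cdot> (g \<cdot> f) = (g' \<cdot> g) \<cdot> f"
    using a by (intro Comp_assoc_simp[symmetric]) (auto simp: cat_simps)
  finally show "(f' \<cdot> g') \<cdot> g \<cdot> f = Ident C (Dom C f)" using a by (simp add: cat_simps)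
  have "(g \<cdot> f) \<cdot> (f' \<cdot> g') = g \<cdot> (f \<cdot> (f' \<cdot> g'))"
    using a by (intro Comp_assoc_simp) (auto simp: cat_simps)
  also have "f \<cdot> (f' \<cdot> g') = (f \<cdot> f') \<cdot> g'"
    using a by (intro Comp_assoc_simp[symmetric]) (auto simp: cat_simps)
  finally show "(g \<cdot> f) \<cdot> f' \<cdot> g' = Ident C (Cod C g)" using a by (simp add: cat_simps)
qed

lemma isomorphic_trans:
  assumes "isomorphic C X Y" "isomorphic C Y Z"
  shows "isomorphic C X Z"
proof -
  obtain f f' where f: "f \<in> Hom C X Y" "inverse_arrows C f f'"
    using assms(1) by (auto simp: isomorphic_def iso_arrow_def)
  obtain g g' where g: "g \<in> Hom C Y Z" "inverse_arrows C g g'"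
    using assms(2) by (auto simp: isomorphic_def iso_arrow_def)
  have "inverse_arrows C (g \<cdot> f) (f' \<cdot> g')"
    by (rule inverse_arrows_comp) (use f g in \<open>auto simp: Hom_iff\<close>)
  thus ?thesis using Comp_Hom[OF f(1) g(1)] by (auto simp: isomorphic_def iso_arrow_def)
qed

lemma isomorphicE:
  assumes "isomorphic C X Y"
  obtains f g where "f \<in> Hom C X Y" "g \<in> Hom C Y X" "g \<cdot> f = Ident C X" "f \<cdot> g = Ident C Y"
  using assms by (auto simp: isomorphic_def iso_arrow_def inverse_arrows_def Hom_iff)

lemma isomorphicI:
  assumes "f \<in> Hom C X Y" "g \<in> Hom C Y X" "g \<cdot> f = Ident C X" "f \<cdot> g = Ident C Y"
  shows "isomorphic C X Y"
  using assms inverse_arrowsI unfolding isomorphic_def iso_arrow_def by blast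

lemma composite_Hom:
  assumes "X \<in> Ob C" "Y 0 = X" "\<And>i. i < n \<Longrightarrow> f i \<in> Hom C (Y i) (Y (Suc i))"
  shows "composite C X f n \<in> Hom C X (Y n)"
  using assms(3)
proof (induction n)
  case 0
  thus ?case using assms Ident_Hom by simp
next
  case (Suc n)
  thus ?case using Comp_Hom[of "composite C X f n" X "Y n" "f n" "Y (Suc n)"] by simp
qed

text \<open>\<open>composite\<close> grows at the target end, but the induction over ghosts peels
  off the arrow at the source; this is the bridge between the two.\<close>

lemma composite_Suc_shift:
  assumes "X \<in> Ob C" "Y 0 = X" "\<And>i. i < Suc n \<Longrightarrow> f i \<in> Hom C (Y i) (Y (Suc i))"
  shows "composite C X f (Suc n) = composite C (Y (Suc 0)) (\<lambda>i. f (Suc i)) n \<cdot> f 0"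
  using assms(3)
proof (induction n)
  case 0
  thus ?case using assms Ident_left[of "f 0"] Ident_right[of "f 0"] by fastforce
next
  case (Suc n)
  have f: "f i \<in> Hom C (Y i) (Y (Suc i))" if "i < Suc (Suc n)" for i using Suc.prems that by blast
  have f0: "f 0 \<in> Hom C X (Y (Suc 0))" using f[of 0] assms(2) by simp
  have "composite C (Y (Suc 0)) (\<lambda>i. f (Suc i)) n \<in> Hom C (Y (Suc 0)) (Y (Suc n))"
    by (rule composite_Hom[where Y = "\<lambda>i. Y (Suc i)"]) (use f f0 Hom_Ob in auto)
  from Comp_assoc[OF f0 this f[of "Suc n"]] Suc.IH f show ?case by simp
qed

end

section \<open>Additive calculus of arrows, kernels and images\<close>

context abelian_category
begin

abbreviation add (infixl "\<oplus>" 65) where "f \<oplus> g \<equiv> Add A f g"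
abbreviation minus_arrow ("\<ominus> _" [81] 80) where "\<ominus> f \<equiv> neg A f"

lemma hom_group_simps:
  "carrier (hom_group A X Y) = Hom A X Y"
  "f \<otimes>\<^bsub>hom_group A X Y\<^esub> g = f \<oplus> g"
  "\<one>\<^bsub>hom_group A X Y\<^esub> = Zer A X Y"
  by (simp_all add: hom_group_def)

lemma Zer_simps:
  assumes "X \<in> Ob A" "Y \<in> Ob A"
  shows "Zer A X Y \<in> Ar A" "Dom A (Zer A X Y) = X" "Cod A (Zer A X Y) = Y"
proof -
  interpret comm_group "hom_group A X Y" by (rule hom_comm_group[OF assms])
  show "Zer A X Y \<in> Ar A" "Dom A (Zer A X Y) = X" "Cod A (Zer A X Y) = Y"
    using one_closed by (auto simp: hom_group_simps Hom_iff)
qed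

lemma Zer_Hom: "X \<in> Ob A \<Longrightarrow> Y \<in> Ob A \<Longrightarrow> Zer A X Y \<in> Hom A X Y"
  by (simp add: Zer_simps Hom_iff)

lemma Add_simps:
  assumes "f \<in> Ar A" "g \<in> Ar A" "Dom A g = Dom A f" "Cod A g = Cod A f"
  shows "f \<oplus> g \<in> Ar A" "Dom A (f \<oplus> g) = Dom A f" "Cod A (f \<oplus> g) = Cod A f"
proof -
  interpret comm_group "hom_group A (Dom A f) (Cod A f)"
    by (rule hom_comm_group) (use assms Dom_Ob Cod_Ob in auto)
  show "f \<oplus> g \<in> Ar A" "Dom A (f \<oplus> g) = Dom A f" "Cod A (f \<oplus> g) = Cod A f"
    using m_closed[of f g] assms by (auto simp: hom_group_simps Hom_iff)
qed

lemma Add_Hom: "f \<in> Hom A X Y \<Longrightarrow> g \<in> Hom A X Y \<Longrightarrow> f \<oplus> g \<in> Hom A X Y"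
  by (auto simp: Hom_iff Add_simps)

lemma neg_simps:
  assumes "f \<in> Ar A"
  shows "\<ominus> f \<in> Ar A" "Dom A (\<ominus> f) = Dom A f" "Cod A (\<ominus> f) = Cod A f"
proof -
  interpret comm_group "hom_group A (Dom A f) (Cod A f)"
    by (rule hom_comm_group) (use assms Dom_Ob Cod_Ob in auto)
  show "\<ominus> f \<in> Ar A" "Dom A (\<ominus> f) = Dom A f" "Cod A (\<ominus> f) = Cod A f"
    using inv_closed[of f] assms by (auto simp: hom_group_simps Hom_iff neg_def)
qed

lemma neg_Hom: "f \<in> Hom A X Y \<Longrightarrow> \<ominus> f \<in> Hom A X Y"
  by (auto simp: Hom_iff neg_simps)

lemma Add_assoc:
  "f \<in> Ar A \<Longrightarrow> g \<in> Ar A \<Longrightarrow> h \<in> Ar A \<Longrightarrow> Dom A g = Dom A f \<Longrightarrow> Cod A g = Cod A f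
    \<Longrightarrow> Dom A h = Dom A f \<Longrightarrow> Cod A h = Cod A f \<Longrightarrow> (f \<oplus> g) \<oplus> h = f \<oplus> (g \<oplus> h)"
  using comm_groupE(3)[OF hom_comm_group[of "Dom A f" "Cod A f"], of f g h] Dom_Ob Cod_Ob
  by (auto simp: hom_group_simps Hom_iff)

lemma Add_commute:
  "f \<in> Ar A \<Longrightarrow> g \<in> Ar A \<Longrightarrow> Dom A g = Dom A f \<Longrightarrow> Cod A g = Cod A f \<Longrightarrow> f \<oplus> g = g \<oplus> f"
  using comm_groupE(4)[OF hom_comm_group[of "Dom A f" "Cod A f"], of f g] Dom_Ob Cod_Ob
  by (auto simp: hom_group_simps Hom_iff)

lemma Add_left_commute:
  "f \<in> Ar A \<Longrightarrow> g \<in> Ar A \<Longrightarrow> h \<in> Ar A \<Longrightarrow> Dom A g = Dom A f \<Longrightarrow> Cod A g = Cod A f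
    \<Longrightarrow> Dom A h = Dom A f \<Longrightarrow> Cod A h = Cod A f \<Longrightarrow> f \<oplus> (g \<oplus> h) = g \<oplus> (f \<oplus> h)"
  using Add_assoc[of f g h] Add_assoc[of g f h] Add_commute[of f g] by simp

lemma Zer_Add:
  assumes "f \<in> Ar A"
  shows "Dom A f = X \<Longrightarrow> Cod A f = Y \<Longrightarrow> Zer A X Y \<oplus> f = f"
    "Dom A f = X \<Longrightarrow> Cod A f = Y \<Longrightarrow> f \<oplus> Zer A X Y = f"
proof -
  interpret comm_group "hom_group A (Dom A f) (Cod A f)"
    by (rule hom_comm_group) (use assms Dom_Ob Cod_Ob in auto)
  show "Dom A f = X \<Longrightarrow> Cod A f = Y \<Longrightarrow> Zer A X Y \<oplus> f = f"
    "Dom A f = X \<Longrightarrow> Cod A f = Y \<Longrightarrow> f \<oplus> Zer A X Y = f"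
    using l_one[of f] r_one[of f] assms by (auto simp: hom_group_simps Hom_iff)
qed

lemma neg_Add:
  assumes "f \<in> Ar A"
  shows "f \<oplus> \<ominus> f = Zer A (Dom A f) (Cod A f)" "\<ominus> f \<oplus> f = Zer A (Dom A f) (Cod A f)"
proof -
  interpret comm_group "hom_group A (Dom A f) (Cod A f)"
    by (rule hom_comm_group) (use assms Dom_Ob Cod_Ob in auto)
  show "f \<oplus> \<ominus> f = Zer A (Dom A f) (Cod A f)" "\<ominus> f \<oplus> f = Zer A (Dom A f) (Cod A f)"
    using l_inv[of f] r_inv[of f] assms by (auto simp: hom_group_simps Hom_iff neg_def)
qed

lemma neg_Add_cancel:
  assumes "f \<in> Ar A" "g \<in> Ar A" "Dom A g = Dom A f" "Cod A g = Cod A f"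
  shows "f \<oplus> (\<ominus> f \<oplus> g) = g" "\<ominus> f \<oplus> (f \<oplus> g) = g"
  using assms by (simp_all add: Add_assoc[symmetric] neg_simps neg_Add Zer_Add)

lemma Add_left_cancel:
  assumes "f \<in> Ar A" "g \<in> Ar A" "h \<in> Ar A" "Dom A g = Dom A f" "Cod A g = Cod A f"
    "Dom A h = Dom A f" "Cod A h = Cod A f"
  shows "f \<oplus> g = f \<oplus> h \<longleftrightarrow> g = h"
  using neg_Add_cancel(2) assms by metis

lemma neg_eqI:
  assumes "f \<oplus> g = Zer A (Dom A f) (Cod A f)"
    "f \<in> Ar A" "g \<in> Ar A" "Dom A g = Dom A f" "Cod A g = Cod A f"
  shows "\<ominus> f = g"
  using assms neg_Add_cancel(2)[of f g] by (simp add: Zer_Add neg_simps)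

lemma neg_neg: "f \<in> Ar A \<Longrightarrow> \<ominus> (\<ominus> f) = f"
  by (rule neg_eqI) (simp_all add: neg_Add neg_simps)

lemma neg_Zer: "X \<in> Ob A \<Longrightarrow> Y \<in> Ob A \<Longrightarrow> \<ominus> Zer A X Y = Zer A X Y"
  by (rule neg_eqI) (simp_all add: Zer_simps Zer_Add)

lemma neg_distrib:
  "f \<in> Ar A \<Longrightarrow> g \<in> Ar A \<Longrightarrow> Dom A g = Dom A f \<Longrightarrow> Cod A g = Cod A f \<Longrightarrow> \<ominus> (f \<oplus> g) = \<ominus> f \<oplus> \<ominus> g"
  by (rule neg_eqI)
    (simp_all add: neg_simps Add_simps Add_assoc Add_left_commute[of g "\<ominus> f"] neg_Add neg_Add_cancel Zer_Add)

lemma Comp_Add: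
  assumes "f \<in> Ar A" "g \<in> Ar A" "Dom A g = Dom A f" "Cod A g = Cod A f" "h \<in> Ar A"
  shows "Dom A h = Cod A f \<Longrightarrow> h \<cdot> (f \<oplus> g) = h \<cdot> f \<oplus> h \<cdot> g"
    "Dom A f = Cod A h \<Longrightarrow> (f \<oplus> g) \<cdot> h = f \<cdot> h \<oplus> g \<cdot> h"
  using Comp_Add_left[of h "Dom A h" "Cod A h" f "Cod A f" g]
    Comp_Add_right[of f "Dom A f" "Cod A f" g h "Cod A h"] assms by (auto simp: Hom_iff)

text \<open>Zero is the only idempotent of a group. Distributivity then yields that composites with
  zero arrows are zero, which the locale does not postulate.\<close>

lemma idem_Zer:
  assumes "f \<in> Ar A" "f \<oplus> f = f" shows "f = Zer A (Dom A f) (Cod A f)"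
  using Add_left_cancel[of f f "Zer A (Dom A f) (Cod A f)"] assms
  by (simp add: Zer_simps Zer_Add Dom_Ob Cod_Ob)

lemma Comp_Zer:
  assumes "f \<in> Ar A" "X \<in> Ob A"
  shows "Y = Dom A f \<Longrightarrow> f \<cdot> Zer A X Y = Zer A X (Cod A f)"
    "Y = Cod A f \<Longrightarrow> Zer A Y X \<cdot> f = Zer A (Dom A f) X"
proof -
  assume Y: "Y = Dom A f"
  have "f \<cdot> Zer A X Y \<oplus> f \<cdot> Zer A X Y = f \<cdot> Zer A X Y"
    using assms Y by (subst Comp_Add(1)[symmetric]) (simp_all add: Zer_simps Zer_Add Dom_Ob)
  from idem_Zer[OF _ this] show "f \<cdot> Zer A X Y = Zer A X (Cod A f)"
    using assms Y by (simp add: Zer_simps cat_simps)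
next
  assume Y: "Y = Cod A f"
  have "Zer A Y X \<cdot> f \<oplus> Zer A Y X \<cdot> f = Zer A Y X \<cdot> f"
    using assms Y by (subst Comp_Add(2)[symmetric]) (simp_all add: Zer_simps Zer_Add Cod_Ob)
  from idem_Zer[OF _ this] show "Zer A Y X \<cdot> f = Zer A (Dom A f) X"
    using assms Y by (simp add: Zer_simps cat_simps)
qed

lemma Comp_neg:
  assumes "f \<in> Ar A" "g \<in> Ar A" "Dom A g = Cod A f"
  shows "g \<cdot> \<ominus> f = \<ominus> (g \<cdot> f)" "\<ominus> g \<cdot> f = \<ominus> (g \<cdot> f)"
proof -
  have "g \<cdot> f \<oplus> g \<cdot> \<ominus> f = Zer A (Dom A f) (Cod A g)"
    using Comp_Add(1)[of f "\<ominus> f" g] assms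
    by (simp add: neg_simps neg_Add Comp_Zer Dom_Ob Cod_Ob)
  thus "g \<cdot> \<ominus> f = \<ominus> (g \<cdot> f)"
    using neg_eqI[of "g \<cdot> f" "g \<cdot> \<ominus> f"] assms by (simp add: neg_simps cat_simps)
  have "g \<cdot> f \<oplus> \<ominus> g \<cdot> f = Zer A (Dom A f) (Cod A g)"
    using Comp_Add(2)[of g "\<ominus> g" f] assms
    by (simp add: neg_simps neg_Add Comp_Zer Dom_Ob Cod_Ob)
  thus "\<ominus> g \<cdot> f = \<ominus> (g \<cdot> f)"
    using neg_eqI[of "g \<cdot> f" "\<ominus> g \<cdot> f"] assms by (simp add: neg_simps cat_simps)
qed

lemmas ab_simps = cat_simps Zer_simps Add_simps neg_simps Add_assoc Zer_Add neg_Add neg_Add_cancel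
  neg_neg neg_Zer neg_distrib Comp_Add Comp_Zer Comp_neg

lemma diff_eq_iff:
  assumes "f \<in> Ar A" "g \<in> Ar A" "h \<in> Ar A" "Dom A g = Dom A f" "Cod A g = Cod A f"
    "Dom A h = Dom A f" "Cod A h = Cod A f"
  shows "f \<oplus> \<ominus> g = h \<longleftrightarrow> f = g \<oplus> h"
proof -
  have 1: "f \<oplus> \<ominus> g = \<ominus> g \<oplus> f" by (rule Add_commute) (use assms in \<open>simp_all add: neg_simps\<close>)
  have 2: "g \<oplus> (\<ominus> g \<oplus> f) = f" by (rule neg_Add_cancel) (use assms in simp_all)
  have "g \<oplus> (\<ominus> g \<oplus> f) = g \<oplus> h \<longleftrightarrow> \<ominus> g \<oplus> f = h"
    by (rule Add_left_cancel) (use assms in \<open>simp_all add: neg_simps Add_simps\<close>)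
  thus ?thesis unfolding 1 2 by simp
qed

lemma diff_Zer_iff:
  assumes "f \<in> Ar A" "g \<in> Ar A" "Dom A g = X" "Cod A g = Y"
    "Dom A f = X" "Cod A f = Y"
  shows "f \<oplus> \<ominus> g = Zer A X Y \<longleftrightarrow> f = g"
  using diff_eq_iff[of f g "Zer A X Y"] assms Dom_Ob Cod_Ob by (auto simp: Zer_simps Zer_Add)

lemma sum_Zer_iff:
  assumes "f \<in> Ar A" "g \<in> Ar A" "Dom A g = X" "Cod A g = Y"
    "Dom A f = X" "Cod A f = Y"
  shows "f \<oplus> g = Zer A X Y \<longleftrightarrow> f = \<ominus> g"
  using diff_Zer_iff[of f "\<ominus> g" X Y] assms by (simp add: neg_simps neg_neg)

subsection \<open>Monomorphisms, epimorphisms and images\<close>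

lemma mono_arrowI:
  assumes "f \<in> Ar A" "\<And>W g. g \<in> Hom A W (Dom A f) \<Longrightarrow> f \<cdot> g = Zer A W (Cod A f) \<Longrightarrow> g = Zer A W (Dom A f)"
  shows "mono_arrow A f"
  unfolding mono_arrow_def
proof (intro conjI allI ballI impI)
  fix W g h assume gh: "g \<in> Hom A W (Dom A f)" "h \<in> Hom A W (Dom A f)" "f \<cdot> g = f \<cdot> h"
  have "f \<cdot> (g \<oplus> \<ominus> h) = Zer A W (Cod A f)"
    using assms(1) gh by (simp add: Hom_iff ab_simps)
  hence "g \<oplus> \<ominus> h = Zer A W (Dom A f)"
    using gh by (intro assms(2)) (auto simp: Hom_iff ab_simps)
  thus "g = h" using gh by (simp add: diff_Zer_iff Hom_iff)
qed fact

lemma epi_arrowI: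
  assumes "f \<in> Ar A" "\<And>W g. g \<in> Hom A (Cod A f) W \<Longrightarrow> g \<cdot> f = Zer A (Dom A f) W \<Longrightarrow> g = Zer A (Cod A f) W"
  shows "epi_arrow A f"
  unfolding epi_arrow_def
proof (intro conjI allI ballI impI)
  fix W g h assume gh: "g \<in> Hom A (Cod A f) W" "h \<in> Hom A (Cod A f) W" "g \<cdot> f = h \<cdot> f"
  have "(g \<oplus> \<ominus> h) \<cdot> f = Zer A (Dom A f) W"
    using assms(1) gh by (auto simp: Hom_iff ab_simps)
  hence "g \<oplus> \<ominus> h = Zer A (Cod A f) W"
    using gh by (intro assms(2)) (auto simp: Hom_iff ab_simps)
  thus "g = h" using gh by (simp add: diff_Zer_iff Hom_iff)
qed fact

lemma mono_Zer:
  assumes "mono_arrow A f" "g \<in> Hom A W (Dom A f)" "f \<cdot> g = Zer A W (Cod A f)"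
  shows "g = Zer A W (Dom A f)"
proof -
  have "Zer A W (Dom A f) \<in> Hom A W (Dom A f)" using assms
    by (auto simp: mono_arrow_def Hom_iff ab_simps)
  moreover have "f \<cdot> Zer A W (Dom A f) = f \<cdot> g" using assms
    by (auto simp: mono_arrow_def Hom_iff ab_simps)
  ultimately show ?thesis using assms(1,2) by (simp add: mono_arrow_def)
qed

lemma kernel_mono: "is_kernel A f k \<Longrightarrow> mono_arrow A k"
  unfolding mono_arrow_def
proof (intro conjI allI ballI impI)
  fix W g h assume k: "is_kernel A f k" and gh: "g \<in> Hom A W (Dom A k)" "h \<in> Hom A W (Dom A k)"
    "k \<cdot> g = k \<cdot> h"
  note k' = k[unfolded is_kernel_def]
  have "k \<cdot> g \<in> Hom A W (Dom A f)" using gh k' by (auto simp: Hom_iff ab_simps)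
  moreover have "(f \<cdot> k) \<cdot> g = f \<cdot> (k \<cdot> g)" using gh k' by (intro Comp_assoc_simp) (auto simp: Hom_iff)
  hence "f \<cdot> (k \<cdot> g) = Zer A W (Cod A f)" using gh k' by (auto simp: Hom_iff ab_simps)
  ultimately have "\<exists>!u. u \<in> Hom A W (Dom A k) \<and> k \<cdot> u = k \<cdot> g" using k' by blast
  thus "g = h" using gh by metis
qed (auto simp: is_kernel_def)

lemma cokernel_epi: "is_cokernel A f c \<Longrightarrow> epi_arrow A c"
  unfolding epi_arrow_def
proof (intro conjI allI ballI impI)
  fix W g h assume k: "is_cokernel A f c" and gh: "g \<in> Hom A (Cod A c) W" "h \<in> Hom A (Cod A c) W"
    "g \<cdot> c = h \<cdot> c"
  note k' = k[unfolded is_cokernel_def]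
  have "g \<cdot> c \<in> Hom A (Cod A f) W" using gh k' by (auto simp: Hom_iff ab_simps)
  moreover have "(g \<cdot> c) \<cdot> f = Zer A (Dom A f) W" using gh k' by (auto simp: Hom_iff ab_simps)
  ultimately have "\<exists>!u. u \<in> Hom A (Cod A c) W \<and> u \<cdot> c = g \<cdot> c" using k' by blast
  thus "g = h" using gh by metis
qed (auto simp: is_cokernel_def)

lemma is_kernelD:
  assumes "is_kernel A f k"
  shows "f \<in> Ar A" "k \<in> Ar A" "Cod A k = Dom A f" "f \<cdot> k = Zer A (Dom A k) (Cod A f)"
  using assms by (auto simp: is_kernel_def)

lemma is_cokernelD:
  assumes "is_cokernel A f c"
  shows "f \<in> Ar A" "c \<in> Ar A" "Dom A c = Cod A f" "c \<cdot> f = Zer A (Dom A f) (Cod A c)"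
  using assms by (auto simp: is_cokernel_def)

lemma kernelE:
  assumes "is_kernel A f k" "h \<in> Hom A W (Dom A f)" "f \<cdot> h = Zer A W (Cod A f)"
  obtains u where "u \<in> Hom A W (Dom A k)" "k \<cdot> u = h"
  using assms unfolding is_kernel_def by blast

lemma cokernelE:
  assumes "is_cokernel A f c" "h \<in> Hom A (Cod A f) W" "h \<cdot> f = Zer A (Dom A f) W"
  obtains u where "u \<in> Hom A (Cod A c) W" "u \<cdot> c = h"
  using assms unfolding is_cokernel_def by blast

lemma lift_along_eq:
  assumes "mono_arrow A m" "h \<in> Hom A (Dom A g) (Dom A m)" "m \<cdot> h = g"
  shows "lift_along A m g = h"
  unfolding lift_along_def using assms by (intro the_equality) (auto simp: mono_arrow_def)

lemma descend_along_eq: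
  assumes "epi_arrow A e" "h \<in> Hom A (Cod A e) (Cod A g)" "h \<cdot> e = g"
  shows "descend_along A e g = h"
  unfolding descend_along_def using assms by (intro the_equality) (auto simp: epi_arrow_def)

lemma ker_arrow_kernel: "f \<in> Ar A \<Longrightarrow> is_kernel A f (ker_arrow A f)"
  unfolding ker_arrow_def using ex_kernel by (rule someI_ex)

lemma coker_arrow_cokernel: "f \<in> Ar A \<Longrightarrow> is_cokernel A f (coker_arrow A f)"
  unfolding coker_arrow_def using ex_cokernel by (rule someI_ex)

lemma mono_comp:
  assumes "mono_arrow A f" "mono_arrow A g" "Dom A g = Cod A f"
  shows "mono_arrow A (g \<cdot> f)"
proof (rule mono_arrowI)
  note a = assms[unfolded mono_arrow_def]
  show "g \<cdot> f \<in> Ar A" using a by (auto simp: ab_simps)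
  fix W h assume h: "h \<in> Hom A W (Dom A (g \<cdot> f))" "(g \<cdot> f) \<cdot> h = Zer A W (Cod A (g \<cdot> f))"
  hence "g \<cdot> (f \<cdot> h) = Zer A W (Cod A g)" "f \<cdot> h \<in> Hom A W (Dom A g)" using a
    by (auto simp: Hom_iff ab_simps)
  hence "f \<cdot> h = Zer A W (Cod A f)" using mono_Zer assms by metis
  thus "h = Zer A W (Dom A (g \<cdot> f))" using mono_Zer[OF assms(1)] h a by (simp add: ab_simps)
qed

text \<open>That the corestriction \<open>e\<close> of \<open>f\<close> to its image
  \<open>m\<close> is epi uses that monos are kernels. If \<open>g \<cdot> e\<close> vanishes,
  \<open>e\<close> factors through the kernel \<open>k\<close> of \<open>g\<close>, and the mono
  \<open>m \<cdot> k\<close> is the kernel of some \<open>h\<close>. This \<open>h\<close> kills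
  \<open>f\<close>, hence factors through the cokernel of \<open>f\<close> and kills
  \<open>m\<close>. So \<open>m\<close> factors through \<open>m \<cdot> k\<close>, which splits
  \<open>k\<close> and forces \<open>g\<close> to vanish.\<close>

lemma image_factorization:
  assumes f: "f \<in> Ar A"
  obtains e where "e \<in> Hom A (Dom A f) (Dom A (im_arrow A f))" "epi_arrow A e"
    "im_arrow A f \<cdot> e = f" "mono_arrow A (im_arrow A f)" "Cod A (im_arrow A f) = Cod A f"
    "im_arrow A f \<in> Ar A"
proof -
  define c m where "c = coker_arrow A f" and "m = im_arrow A f"
  have c: "is_cokernel A f c" unfolding c_def by (rule coker_arrow_cokernel[OF f])
  note c' = is_cokernelD[OF c]
  have m: "is_kernel A c m" unfolding m_def im_arrow_def c_def[symmetric]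
    by (rule ker_arrow_kernel) (use c' in auto)
  note m' = is_kernelD[OF m]
  have mm: "mono_arrow A m" by (rule kernel_mono[OF m])
  obtain e where e: "e \<in> Hom A (Dom A f) (Dom A m)" "m \<cdot> e = f"
    using kernelE[OF m, of f "Dom A f"] c' by (auto simp: Hom_iff)
  have "epi_arrow A e"
  proof (rule epi_arrowI)
    show "e \<in> Ar A" using e by (auto simp: Hom_iff)
    fix W g assume g: "g \<in> Hom A (Cod A e) W" "g \<cdot> e = Zer A (Dom A e) W"
    have "g \<in> Ar A" using g by (auto simp: Hom_iff)
    note k = ker_arrow_kernel[OF this]
    let ?k = "ker_arrow A g"
    note k' = is_kernelD[OF k]
    obtain e' where e': "e' \<in> Hom A (Dom A e) (Dom A ?k)" "?k \<cdot> e' = e"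
      using kernelE[OF k, of e "Dom A e"] g e by (auto simp: Hom_iff)
    have "mono_arrow A (m \<cdot> ?k)"
      by (rule mono_comp[OF kernel_mono[OF k] mm]) (use k' g e in \<open>auto simp: Hom_iff\<close>)
    then obtain h where h: "is_kernel A h (m \<cdot> ?k)" using mono_is_kernel by blast
    note h' = is_kernelD[OF h]
    have ty1: "m \<in> Ar A" "?k \<in> Ar A" "h \<in> Ar A" "Cod A ?k = Dom A m"
      using m'(2) k'(2,3) h'(1) g(1) e(1) by (simp_all add: Hom_iff)
    have "Cod A m = Dom A h" using h'(3) Comp_simps(3)[OF ty1(2,1)] ty1(4) by simp
    moreover have "e' \<in> Ar A" "e \<in> Ar A" "Cod A e' = Dom A ?k" "Dom A e' = Dom A f" "g \<in> Ar A"
      "Dom A g = Dom A m"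
      using g(1) e(1) e'(1) by (simp_all add: Hom_iff)
    moreover have "Cod A m = Cod A f" using m'(3) c'(3) by simp
    ultimately have ty: "m \<in> Ar A" "?k \<in> Ar A" "h \<in> Ar A" "Cod A ?k = Dom A m" "Dom A h = Cod A f"
      "e' \<in> Ar A" "e \<in> Ar A" "Cod A e' = Dom A ?k" "Cod A m = Cod A f" "Dom A e' = Dom A f" "g \<in> Ar A"
      "Dom A g = Dom A m" using ty1 by simp_all
    have "h \<cdot> f = (h \<cdot> (m \<cdot> ?k)) \<cdot> e'"
      unfolding e(2)[symmetric] e'(2)[symmetric] using ty by (simp add: cat_simps)
    also have "\<dots> = Zer A (Dom A f) (Cod A h)" using h' ty by (simp add: ab_simps)
    finally obtain h2 where h2: "h2 \<in> Hom A (Cod A c) (Cod A h)" "h2 \<cdot> c = h"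
      using cokernelE[OF c, of h "Cod A h"] ty by (auto simp: Hom_iff)
    have "h \<cdot> m = h2 \<cdot> (c \<cdot> m)" using h2 m' by (auto simp: ab_simps Hom_iff)
    also have "\<dots> = Zer A (Dom A m) (Cod A h)" using h2 m' by (auto simp: ab_simps Hom_iff)
    finally obtain s where s: "s \<in> Hom A (Dom A m) (Dom A (m \<cdot> ?k))" "(m \<cdot> ?k) \<cdot> s = m"
      using kernelE[OF h, of m "Dom A m"] ty by (auto simp: Hom_iff)
    have "m \<cdot> (?k \<cdot> s) = m \<cdot> Ident A (Dom A m)" using s ty by (simp add: Hom_iff ab_simps)
    hence ks: "?k \<cdot> s = Ident A (Dom A m)"
      using mm s ty unfolding mono_arrow_def by (simp add: Hom_iff ab_simps)
    have "g = g \<cdot> (?k \<cdot> s)" unfolding ks using ty by (simp add: ab_simps)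
    also have "\<dots> = (g \<cdot> ?k) \<cdot> s" using ty s by (simp add: ab_simps Hom_iff)
    also have "\<dots> = Zer A (Cod A e) W"
      unfolding k'(4) using s(1) ty(1,2,4,11,12) g(1) e(1) by (auto simp: ab_simps Hom_iff)
    finally show "g = Zer A (Cod A e) W" .
  qed
  thus ?thesis using e that mm m' c' unfolding m_def by (auto simp: Hom_iff)
qed

text \<open>A mono is the kernel of some \<open>g\<close>; being epi as well, it forces
  \<open>g\<close> to be zero, so the identity of its codomain factors through it.\<close>

lemma mono_epi_iso:
  assumes "mono_arrow A f" "epi_arrow A f"
  shows "iso_arrow A f"
proof -
  obtain g where g: "is_kernel A g f" using mono_is_kernel assms by blast
  note g' = is_kernelD[OF g]
  have fA: "f \<in> Ar A" using g' by blast
  have "g \<cdot> f = Zer A (Cod A f) (Cod A g) \<cdot> f" using g' by (auto simp: ab_simps)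
  hence gz: "g = Zer A (Cod A f) (Cod A g)"
    using assms(2) g' unfolding epi_arrow_def by (auto simp: Hom_iff ab_simps)
  have "g \<cdot> Ident A (Cod A f) = Zer A (Cod A f) (Cod A g)" using g' gz by (auto simp: ab_simps)
  then obtain u where u: "u \<in> Hom A (Cod A f) (Dom A f)" "f \<cdot> u = Ident A (Cod A f)"
    using kernelE[OF g, of "Ident A (Cod A f)" "Cod A f"] g' by (auto simp: Hom_iff ab_simps)
  have "f \<cdot> (u \<cdot> f) = (f \<cdot> u) \<cdot> f"
    by (rule Comp_assoc_simp[symmetric]) (use u fA in \<open>auto simp: Hom_iff\<close>)
  also have "\<dots> = f \<cdot> Ident A (Dom A f)" using u fA by (auto simp: Hom_iff ab_simps)
  finally have "u \<cdot> f = Ident A (Dom A f)" using assms(1) u fA unfolding mono_arrow_def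
    by (auto simp: Hom_iff ab_simps)
  thus ?thesis using u fA unfolding iso_arrow_def inverse_arrows_def by blast
qed

lemma zero_object_Zer:
  assumes "zero_object A Z" "f \<in> Ar A"
  shows "Dom A f = Z \<Longrightarrow> f = Zer A Z (Cod A f)" "Cod A f = Z \<Longrightarrow> f = Zer A (Dom A f) Z"
  using assms unfolding zero_object_def by (metis Hom_iff Dom_Ob Cod_Ob Zer_Hom)+

end

section \<open>Localization\<close>

locale localizing = category C
  for C :: "('o, 'm, 'z) category_scheme" (structure) +
  fixes W :: "'m set"
  assumes W_Ar: "W \<subseteq> Ar C"
begin

abbreviation L where "L \<equiv> localization C W"

lemma letter_Ob: "letter_ok C W l \<Longrightarrow> letter_src C l \<in> Ob C \<and> letter_tgt C l \<in> Ob C"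
  using W_Ar by (cases l) (auto simp: cat_simps)

lemma zigzag_Ob: "zigzag C W X p Y \<Longrightarrow> X \<in> Ob C \<and> Y \<in> Ob C"
  by (induction p arbitrary: X) (auto dest: letter_Ob)

lemma zigzag_append: "zigzag C W X (p @ q) Y \<longleftrightarrow> (\<exists>Z. zigzag C W X p Z \<and> zigzag C W Z q Y)"
proof (induction p arbitrary: X)
  case Nil
  thus ?case using zigzag_Ob by auto
qed auto

lemma zigzag_src_unique: "zigzag C W X p Y \<Longrightarrow> zigzag C W X p Y' \<Longrightarrow> Y = Y'"
  by (induction p arbitrary: X) auto

lemma loc_equiv_zigzag:
  "loc_equiv C W X Y p q \<Longrightarrow> zigzag C W X p Y \<and> zigzag C W X q Y"
  by (induction rule: loc_equiv.induct) auto

lemma loc_equiv_append_right: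
  "loc_equiv C W X Y p q \<Longrightarrow> zigzag C W Y r Z \<Longrightarrow> loc_equiv C W X Z (p @ r) (q @ r)"
proof (induction rule: loc_equiv.induct)
  case (step a b p q)
  have "loc_equiv C W X Z (p @ a @ (q @ r)) (p @ b @ (q @ r))"
    by (rule loc_equiv.step[OF step.hyps(1)]) (use step in \<open>auto simp: zigzag_append\<close>)
  thus ?case by simp
next
  case (refl p)
  thus ?case by (auto intro!: loc_equiv.refl simp: zigzag_append)
qed (auto intro: loc_equiv.sym loc_equiv.trans)

lemma loc_equiv_append_left:
  "loc_equiv C W Y Z p q \<Longrightarrow> zigzag C W X r Y \<Longrightarrow> loc_equiv C W X Z (r @ p) (r @ q)"
proof (induction rule: loc_equiv.induct)
  case (step a b p q)
  have "zigzag C W X (r @ p @ c @ q) Z" if "zigzag C W Y (p @ c @ q) Z" for c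
    using that step.prems zigzag_append by blast
  hence "loc_equiv C W X Z ((r @ p) @ a @ q) ((r @ p) @ b @ q)"
    by (intro loc_equiv.step[OF step.hyps(1)]) (use step.hyps in simp_all)
  thus ?case by simp
next
  case (refl p)
  thus ?case by (auto intro!: loc_equiv.refl simp: zigzag_append)
qed (auto intro: loc_equiv.sym loc_equiv.trans)

lemma loc_class_eq_iff:
  assumes "zigzag C W X p Y"
  shows "loc_class C W X p Y = loc_class C W X' q Y' \<longleftrightarrow> X' = X \<and> Y' = Y \<and> loc_equiv C W X Y p q"
proof -
  have "{r. loc_equiv C W X Y p r} = {r. loc_equiv C W X Y q r} \<longleftrightarrow> loc_equiv C W X Y p q"
  proof
    assume "{r. loc_equiv C W X Y p r} = {r. loc_equiv C W X Y q r}"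
    hence "loc_equiv C W X Y q p" using loc_equiv.refl[OF assms] by blast
    thus "loc_equiv C W X Y p q" by (rule loc_equiv.sym)
  qed (blast intro: loc_equiv.sym loc_equiv.trans)
  thus ?thesis unfolding loc_class_def by auto
qed

lemma loc_Hom: "\<alpha> \<in> Hom L X Y \<longleftrightarrow> (\<exists>p. zigzag C W X p Y \<and> \<alpha> = loc_class C W X p Y)"
  unfolding Hom_iff by (auto simp: localization_def loc_class_def)

lemma loc_Hom_class: "zigzag C W X p Y \<Longrightarrow> loc_class C W X p Y \<in> Hom L X Y"
  by (auto simp: loc_Hom)

lemma loc_Ob: "Ob L = Ob C"
  by (simp add: localization_def)

lemma loc_Ident: "Ident L X = loc_class C W X [] X"
  by (simp add: localization_def)

lemma loc_Comp:
  assumes "zigzag C W X p Y" "zigzag C W Y q Z"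
  shows "loc_class C W Y q Z \<cdot>\<^bsub>L\<^esub> loc_class C W X p Y = loc_class C W X (p @ q) Z"
proof -
  have "(\<exists>p'. loc_equiv C W X Y p p' \<and> (\<exists>q'. loc_equiv C W Y Z q q' \<and> loc_equiv C W X Z (p' @ q') r))
    \<longleftrightarrow> loc_equiv C W X Z (p @ q) r" for r
  proof
    assume "\<exists>p'. loc_equiv C W X Y p p' \<and> (\<exists>q'. loc_equiv C W Y Z q q' \<and> loc_equiv C W X Z (p' @ q') r)"
    then obtain p' q' where pq: "loc_equiv C W X Y p p'" "loc_equiv C W Y Z q q'"
      "loc_equiv C W X Z (p' @ q') r" by blast
    have "loc_equiv C W X Z (p @ q) (p' @ q)"
      by (rule loc_equiv_append_right[OF pq(1) assms(2)])
    moreover have "loc_equiv C W X Z (p' @ q) (p' @ q')"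
      using loc_equiv_append_left[OF pq(2)] loc_equiv_zigzag[OF pq(1)] by blast
    ultimately show "loc_equiv C W X Z (p @ q) r" using pq(3) loc_equiv.trans by metis
  next
    assume "loc_equiv C W X Z (p @ q) r"
    thus "\<exists>p'. loc_equiv C W X Y p p' \<and> (\<exists>q'. loc_equiv C W Y Z q q' \<and> loc_equiv C W X Z (p' @ q') r)"
      using loc_equiv.refl[OF assms(1)] loc_equiv.refl[OF assms(2)] by blast
  qed
  thus ?thesis by (simp add: localization_def loc_class_def)
qed

lemma category_loc: "category L"
proof
  show "f \<in> Ar L \<Longrightarrow> Dom L f \<in> Ob L" "f \<in> Ar L \<Longrightarrow> Cod L f \<in> Ob L" for f
    using zigzag_Ob by (auto simp: localization_def loc_class_def)
  show "X \<in> Ob L \<Longrightarrow> Ident L X \<in> Hom L X X" for X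
    unfolding loc_Ident by (intro loc_Hom_class) (simp add: loc_Ob)
  show "g \<cdot>\<^bsub>L\<^esub> f \<in> Hom L X Z" if fg: "f \<in> Hom L X Y" "g \<in> Hom L Y Z" for f g X Y Z
  proof -
    obtain p q where "zigzag C W X p Y" "f = loc_class C W X p Y"
      "zigzag C W Y q Z" "g = loc_class C W Y q Z" using fg unfolding loc_Hom by metis
    moreover from this have "zigzag C W X (p @ q) Z" using zigzag_append by blast
    ultimately show ?thesis by (simp add: loc_Comp loc_Hom_class)
  qed
  show "Ident L Y \<cdot>\<^bsub>L\<^esub> f = f" if "f \<in> Hom L X Y" for f X Y
  proof -
    obtain p where p: "zigzag C W X p Y" "f = loc_class C W X p Y" using \<open>f \<in> _\<close> by (auto simp: loc_Hom)
    have "zigzag C W Y [] Y" using zigzag_Ob p by auto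
    from loc_Comp[OF p(1) this] show ?thesis using p by (simp add: loc_Ident)
  qed
  show "f \<cdot>\<^bsub>L\<^esub> Ident L X = f" if "f \<in> Hom L X Y" for f X Y
  proof -
    obtain p where p: "zigzag C W X p Y" "f = loc_class C W X p Y" using \<open>f \<in> _\<close> by (auto simp: loc_Hom)
    have "zigzag C W X [] X" using zigzag_Ob p by auto
    from loc_Comp[OF this p(1)] show ?thesis using p by (simp add: loc_Ident)
  qed
  show "h \<cdot>\<^bsub>L\<^esub> (g \<cdot>\<^bsub>L\<^esub> f) = (h \<cdot>\<^bsub>L\<^esub> g) \<cdot>\<^bsub>L\<^esub> f"
    if fgh: "f \<in> Hom L X Y" "g \<in> Hom L Y Z" "h \<in> Hom L Z V" for f g h X Y Z V
  proof -
    obtain p q r where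
      p: "zigzag C W X p Y" "f = loc_class C W X p Y" and
      q: "zigzag C W Y q Z" "g = loc_class C W Y q Z" and
      r: "zigzag C W Z r V" "h = loc_class C W Z r V" using fgh unfolding loc_Hom by metis
    have "zigzag C W X (p @ q) Z" "zigzag C W Y (q @ r) V" using p q r by (auto simp: zigzag_append)
    thus ?thesis using p q r by (simp add: loc_Comp)
  qed
qed

sublocale L: category L by (rule category_loc)

abbreviation Q where "Q \<equiv> loc_functor C W"

lemma Q_Hom: "f \<in> Hom C X Y \<Longrightarrow> Q f \<in> Hom L X Y"
  unfolding loc_functor_def by (auto simp: Hom_iff[of f] cat_simps intro!: loc_Hom_class)

lemma Q_Ident: "X \<in> Ob C \<Longrightarrow> Q (Ident C X) = Ident L X"
proof -
  assume X: "X \<in> Ob C"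
  have z: "zigzag C W X [Fwd (Ident C X)] X" using X by (simp add: Ident_simps)
  have "loc_equiv C W X X ([] @ [Fwd (Ident C X)] @ []) ([] @ [] @ [])"
    by (rule loc_equiv.step) (use X z in \<open>auto intro: zigzag_rel.ident\<close>)
  thus ?thesis using X z by (simp add: loc_functor_def loc_Ident Ident_simps loc_class_eq_iff)
qed

lemma Q_Comp:
  assumes "f \<in> Hom C X Y" "g \<in> Hom C Y Z"
  shows "Q (g \<cdot> f) = Q g \<cdot>\<^bsub>L\<^esub> Q f"
proof -
  note a = assms[unfolded Hom_iff]
  have z: "zigzag C W X [Fwd f] Y" "zigzag C W Y [Fwd g] Z" "zigzag C W X [Fwd f, Fwd g] Z"
    "zigzag C W X [Fwd (g \<cdot> f)] Z"
    using a by (auto simp: cat_simps)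
  have "loc_equiv C W X Z ([] @ [Fwd f, Fwd g] @ []) ([] @ [Fwd (g \<cdot> f)] @ [])"
    by (rule loc_equiv.step) (use a z in \<open>auto intro: zigzag_rel.comp\<close>)
  hence "loc_class C W X ([Fwd f] @ [Fwd g]) Z = loc_class C W X [Fwd (g \<cdot> f)] Z"
    using z by (simp add: loc_class_eq_iff)
  thus ?thesis using a z(1,2) by (simp add: loc_functor_def cat_simps loc_Comp)
qed

definition Qinv where "Qinv w = loc_class C W (Cod C w) [Bwd w] (Dom C w)"

lemma Qinv_inverse:
  assumes "w \<in> W" "w \<in> Hom C X Y"
  shows "Qinv w \<in> Hom L Y X" "Qinv w \<cdot>\<^bsub>L\<^esub> Q w = Ident L X" "Q w \<cdot>\<^bsub>L\<^esub> Qinv w = Ident L Y"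
    "inverse_arrows L (Q w) (Qinv w)"
proof -
  note a = assms[unfolded Hom_iff]
  have z: "zigzag C W X [Fwd w] Y" "zigzag C W Y [Bwd w] X" "zigzag C W X [] X" "zigzag C W Y [] Y"
    using a by (auto simp: cat_simps)
  show h: "Qinv w \<in> Hom L Y X" using z a by (auto simp: Qinv_def intro!: loc_Hom_class)
  have "loc_equiv C W X X ([] @ [Fwd w, Bwd w] @ []) ([] @ [] @ [])"
    by (rule loc_equiv.step) (use a z in \<open>auto intro: zigzag_rel.inv_right\<close>)
  hence "loc_class C W X ([Fwd w] @ [Bwd w]) X = loc_class C W X [] X"
    using z a by (simp add: loc_class_eq_iff)
  thus 1: "Qinv w \<cdot>\<^bsub>L\<^esub> Q w = Ident L X"
    using a z(1,2) by (simp add: loc_functor_def Qinv_def loc_Comp loc_Ident)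
  have "loc_equiv C W Y Y ([] @ [Bwd w, Fwd w] @ []) ([] @ [] @ [])"
    by (rule loc_equiv.step) (use a z in \<open>auto intro: zigzag_rel.inv_left\<close>)
  hence "loc_class C W Y ([Bwd w] @ [Fwd w]) Y = loc_class C W Y [] Y"
    using z a by (simp add: loc_class_eq_iff)
  thus 2: "Q w \<cdot>\<^bsub>L\<^esub> Qinv w = Ident L Y"
    using a z(1,2) by (simp add: loc_functor_def Qinv_def loc_Comp loc_Ident)
  show "inverse_arrows L (Q w) (Qinv w)"
    by (rule L.inverse_arrowsI[OF Q_Hom[OF assms(2)] h 1 2])
qed

text \<open>Induction on a representing zigzag with its first letter split off, so the target stays
  fixed while the source moves. Properties proved in this way must be stated for all sources at
  once.\<close>

lemma loc_induct [consumes 1, case_names Ident Fwd Bwd]: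
  assumes "\<alpha> \<in> Hom L X Y"
    and "Y \<in> Ob C \<Longrightarrow> P Y (Ident L Y)"
    and "\<And>X Z f \<beta>. f \<in> Hom C X Z \<Longrightarrow> \<beta> \<in> Hom L Z Y \<Longrightarrow> P Z \<beta> \<Longrightarrow> P X (\<beta> \<cdot>\<^bsub>L\<^esub> Q f)"
    and "\<And>X Z w \<beta>. w \<in> W \<Longrightarrow> w \<in> Hom C Z X \<Longrightarrow> \<beta> \<in> Hom L Z Y \<Longrightarrow> P Z \<beta> \<Longrightarrow> P X (\<beta> \<cdot>\<^bsub>L\<^esub> Qinv w)"
  shows "P X \<alpha>"
proof -
  have "P X (loc_class C W X p Y)" if "zigzag C W X p Y" for p
    using that
  proof (induction p arbitrary: X)
    case Nil
    hence "Y \<in> Ob C" "X = Y" by auto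
    thus ?case using assms(2) unfolding loc_Ident by simp
  next
    case (Cons l p)
    define Z where "Z = letter_tgt C l"
    have z: "zigzag C W Z p Y" "zigzag C W X [l] Z"
      using Cons.prems letter_Ob by (auto simp: Z_def)
    have c: "loc_class C W X (l # p) Y = loc_class C W Z p Y \<cdot>\<^bsub>L\<^esub> loc_class C W X [l] Z"
      using loc_Comp[OF z(2,1)] by simp
    note P = Cons.IH[OF z(1)]
    note h = loc_Hom_class[OF z(1)]
    show ?case
    proof (cases l)
      case (Fwd f)
      hence "f \<in> Hom C X Z" "loc_class C W X [l] Z = Q f"
        using z(2) by (auto simp: Hom_iff loc_functor_def)
      thus ?thesis unfolding c using assms(3) P h by simp
    next
      case (Bwd w)
      hence "w \<in> W" "w \<in> Hom C Z X" "loc_class C W X [l] Z = Qinv w"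
        using z(2) W_Ar by (auto simp: Hom_iff Qinv_def)
      thus ?thesis unfolding c using assms(4) P h by simp
    qed
  qed
  thus ?thesis using assms(1) by (auto simp: loc_Hom)
qed

end

section \<open>Complexes and homology\<close>

locale projective_abelian_category = abelian_category A
  for A :: "('o, 'm, 'z) ab_category_scheme" (structure) +
  assumes enough: "enough_projectives A"
begin

section \<open>Projective objects as test objects\<close>

lemma projective_Ob: "projective A P \<Longrightarrow> P \<in> Ob A"
  by (simp add: projective_def)

lemma projective_lift:
  assumes "projective A P" "epi_arrow A e" "f \<in> Hom A P (Cod A e)"
  obtains g where "g \<in> Hom A P (Dom A e)" "e \<cdot> g = f"
  using assms unfolding projective_def by blast

lemma projective_cover:
  assumes "X \<in> Ob A"
  obtains P e where "projective A P" "e \<in> Hom A P X" "epi_arrow A e"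
  using assms enough unfolding enough_projectives_def by blast

lemma eq_if_epi:
  assumes "epi_arrow A e" "e \<in> Hom A P X" "f \<in> Hom A X Y" "g \<in> Hom A X Y" "f \<cdot> e = g \<cdot> e"
  shows "f = g"
  using assms unfolding epi_arrow_def by (auto simp: Hom_iff)

text \<open>Arrows out of projectives detect monos and epis: a test object for injectivity is
  covered by a projective, and for surjectivity a projective cover of the codomain itself is lifted
  through \<open>f\<close>.\<close>

lemma iso_arrow_if_projective:
  assumes f: "f \<in> Hom A X Y"
    and surj: "\<And>P y. projective A P \<Longrightarrow> y \<in> Hom A P Y \<Longrightarrow> \<exists>x \<in> Hom A P X. f \<cdot> x = y"
    and inj: "\<And>P x. projective A P \<Longrightarrow> x \<in> Hom A P X \<Longrightarrow> f \<cdot> x = Zer A P Y \<Longrightarrow> x = Zer A P X"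
  shows "iso_arrow A f"
proof (rule mono_epi_iso)
  have ty: "f \<in> Ar A" "Dom A f = X" "Cod A f = Y" "X \<in> Ob A" "Y \<in> Ob A"
    using f by (auto simp: Hom_iff cat_simps)
  show "mono_arrow A f"
  proof (rule mono_arrowI)
    fix W g assume g: "g \<in> Hom A W (Dom A f)" "f \<cdot> g = Zer A W (Cod A f)"
    have W: "W \<in> Ob A" using g(1) by (rule Hom_Ob)
    obtain P e where e: "projective A P" "e \<in> Hom A P W" "epi_arrow A e" using projective_cover[OF W] .
    have "f \<cdot> (g \<cdot> e) = (f \<cdot> g) \<cdot> e" using g(1) e(2) ty(1) by (simp add: Hom_iff cat_simps)
    also have "\<dots> = Zer A P Y" unfolding g(2) using e(2) W ty by (auto simp: Hom_iff ab_simps)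
    finally have "g \<cdot> e = Zer A P X"
      using inj[OF e(1), of "g \<cdot> e"] g(1) e(2) ty by (simp add: Hom_iff cat_simps)
    also have "\<dots> = Zer A W X \<cdot> e" using e(2) ty by (auto simp: Hom_iff ab_simps)
    finally show "g = Zer A W (Dom A f)"
      using eq_if_epi[OF e(3,2) g(1), of "Zer A W X"] ty W by (simp add: Zer_Hom)
  qed (rule ty)
  show "epi_arrow A f"
  proof (rule epi_arrowI)
    fix W g assume g: "g \<in> Hom A (Cod A f) W" "g \<cdot> f = Zer A (Dom A f) W"
    have W: "W \<in> Ob A" using g(1) by (rule Hom_Ob)
    obtain P e where e: "projective A P" "e \<in> Hom A P Y" "epi_arrow A e" using projective_cover[OF ty(5)] .
    obtain x where x: "x \<in> Hom A P X" "f \<cdot> x = e" using surj[OF e(1,2)] by blast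
    have "g \<cdot> e = (g \<cdot> f) \<cdot> x" unfolding x(2)[symmetric] using x(1) g(1) ty by (simp add: Hom_iff cat_simps)
    also have "\<dots> = Zer A P W" unfolding g(2) using x(1) W ty by (auto simp: Hom_iff ab_simps)
    also have "\<dots> = Zer A Y W \<cdot> e" using e(2) W by (auto simp: Hom_iff ab_simps)
    finally show "g = Zer A (Cod A f) W"
      using eq_if_epi[OF e(3,2), of g W "Zer A Y W"] g(1) ty W by (simp add: Zer_Hom)
  qed (rule ty)
qed

lemma iso_arrow_cancel:
  assumes "iso_arrow A f" "f \<in> Hom A X Y" "x \<in> Hom A P X" "x' \<in> Hom A P X" "f \<cdot> x = f \<cdot> x'"
  shows "x = x'"
proof -
  obtain g where g: "g \<in> Hom A Y X" "g \<cdot> f = Ident A X"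
    using assms(1,2) by (auto simp: iso_arrow_def inverse_arrows_def Hom_iff)
  have "(g \<cdot> f) \<cdot> x = (g \<cdot> f) \<cdot> x'" using assms(2-) g(1) by (simp add: Hom_iff cat_simps)
  thus ?thesis unfolding g(2) using assms(2-) by (auto simp: Hom_iff cat_simps)
qed

lemma iso_arrow_surj:
  assumes "iso_arrow A f" "f \<in> Hom A X Y" "y \<in> Hom A P Y"
  obtains x where "x \<in> Hom A P X" "f \<cdot> x = y"
proof -
  obtain g where g: "g \<in> Hom A Y X" "f \<cdot> g = Ident A Y"
    using assms(1,2) by (auto simp: iso_arrow_def inverse_arrows_def Hom_iff)
  have "f \<cdot> (g \<cdot> y) = (f \<cdot> g) \<cdot> y" using assms(2-) g(1) by (simp add: Hom_iff cat_simps)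
  also have "\<dots> = y" unfolding g(2) using assms(2-) by (auto simp: Hom_iff cat_simps)
  finally show ?thesis using that[of "g \<cdot> y"] assms(3) g(1) by (simp add: Hom_iff cat_simps)
qed

section \<open>Cycles and boundaries of a complex as sets of arrows\<close>

lemma cplx_simps:
  assumes "chain_complex A X"
  shows "fst X n \<in> Ob A" "snd X n \<in> Ar A" "Dom A (snd X n) = fst X n" "Cod A (snd X n) = fst X (n - 1)"
    "snd X (n - 1) \<cdot> snd X n = Zer A (fst X n) (fst X (n - 2))"
    "snd X n \<cdot> snd X (n + 1) = Zer A (fst X (n + 1)) (fst X (n - 1))"
proof -
  have *: "fst X n \<in> Ob A" "snd X n \<in> Ar A" "Dom A (snd X n) = fst X n" "Cod A (snd X n) = fst X (n - 1)"
    "snd X (n - 1) \<cdot> snd X n = Zer A (fst X n) (fst X (n - 2))" for n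
    using assms unfolding chain_complex_def Hom_iff by auto
  show "fst X n \<in> Ob A" "snd X n \<in> Ar A" "Dom A (snd X n) = fst X n" "Cod A (snd X n) = fst X (n - 1)"
    "snd X (n - 1) \<cdot> snd X n = Zer A (fst X n) (fst X (n - 2))" by (rule *)+
  show "snd X n \<cdot> snd X (n + 1) = Zer A (fst X (n + 1)) (fst X (n - 1))" using *(5)[of "n + 1"] by simp
qed

lemma cplx_Comp_simps:
  assumes "chain_complex A X" "x \<in> Ar A"
  shows "Cod A x = fst X n \<Longrightarrow> snd X (n - 1) \<cdot> (snd X n \<cdot> x) = Zer A (Dom A x) (fst X (n - 2))"
    "Cod A x = fst X (n + 1) \<Longrightarrow> snd X n \<cdot> (snd X (n + 1) \<cdot> x) = Zer A (Dom A x) (fst X (n - 1))"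
proof -
  have *: "Cod A x = fst X n \<Longrightarrow> snd X (n - 1) \<cdot> (snd X n \<cdot> x) = Zer A (Dom A x) (fst X (n - 2))" for n
  proof -
    assume c: "Cod A x = fst X n"
    have "snd X (n - 1) \<cdot> (snd X n \<cdot> x) = (snd X (n - 1) \<cdot> snd X n) \<cdot> x"
      by (rule Comp_assoc_simp[symmetric]) (use assms c in \<open>auto simp: cplx_simps\<close>)
    thus ?thesis using assms c by (simp add: cplx_simps Comp_Zer)
  qed
  show "Cod A x = fst X n \<Longrightarrow> snd X (n - 1) \<cdot> (snd X n \<cdot> x) = Zer A (Dom A x) (fst X (n - 2))" by (rule *)
  show "Cod A x = fst X (n + 1) \<Longrightarrow> snd X n \<cdot> (snd X (n + 1) \<cdot> x) = Zer A (Dom A x) (fst X (n - 1))"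
    using *[of "n + 1"] by simp
qed

lemma chmap_simps:
  assumes "chain_map A (X, f, Y)"
  shows "chain_complex A X" "chain_complex A Y" "f n \<in> Ar A" "Dom A (f n) = fst X n" "Cod A (f n) = fst Y n"
    "snd Y n \<cdot> f n = f (n - 1) \<cdot> snd X n"
  using assms by (auto simp: chain_map_def Hom_iff)

lemma chmap_Comp:
  assumes "chain_map A (X, f, Y)" "x \<in> Hom A W (fst X n)"
  shows "snd Y n \<cdot> (f n \<cdot> x) = f (n - 1) \<cdot> (snd X n \<cdot> x)"
proof -
  note c = chmap_simps[OF assms(1)]
  have "snd Y n \<cdot> (f n \<cdot> x) = (snd Y n \<cdot> f n) \<cdot> x"
    by (rule Comp_assoc_simp[symmetric]) (use assms c in \<open>auto simp: cplx_simps Hom_iff\<close>)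
  also have "\<dots> = (f (n - 1) \<cdot> snd X n) \<cdot> x" using c by simp
  also have "\<dots> = f (n - 1) \<cdot> (snd X n \<cdot> x)"
    by (rule Comp_assoc_simp) (use assms c in \<open>auto simp: cplx_simps Hom_iff\<close>)
  finally show ?thesis .
qed

text \<open>Arrows \<open>W \<rightarrow> X n\<close> play the role of elements. Since \<open>Hom(W, -)\<close> is exact for projective \<open>W\<close>,
  diagram chases on projective elements need no refinement of \<open>W\<close>.\<close>

definition cyc :: "('o, 'm) cplx \<Rightarrow> int \<Rightarrow> 'o \<Rightarrow> 'm set" where
  "cyc X n W = {x \<in> Hom A W (fst X n). snd X n \<cdot> x = Zer A W (fst X (n - 1))}"

definition bnd :: "('o, 'm) cplx \<Rightarrow> int \<Rightarrow> 'o \<Rightarrow> 'm set" where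
  "bnd X n W = (\<lambda>y. snd X (n + 1) \<cdot> y) ` Hom A W (fst X (n + 1))"

lemma cyc_Hom: "x \<in> cyc X n W \<Longrightarrow> x \<in> Hom A W (fst X n)"
  by (simp add: cyc_def)

lemma bndI: "y \<in> Hom A W (fst X (n + 1)) \<Longrightarrow> x = snd X (n + 1) \<cdot> y \<Longrightarrow> x \<in> bnd X n W"
  by (auto simp: bnd_def)

lemma bndE:
  assumes "x \<in> bnd X n W"
  obtains y where "y \<in> Hom A W (fst X (n + 1))" "x = snd X (n + 1) \<cdot> y"
  using assms by (auto simp: bnd_def)

context
  fixes X :: "('o, 'm) cplx" assumes X: "chain_complex A X"
begin

lemma d_Hom: "y \<in> Hom A W (fst X n) \<Longrightarrow> snd X n \<cdot> y \<in> Hom A W (fst X (n - 1))"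
  using X by (auto simp: Hom_iff cat_simps cplx_simps)

lemma bnd_cyc: "x \<in> bnd X n W \<Longrightarrow> x \<in> cyc X n W"
  using X by (auto simp: bnd_def cyc_def Hom_iff cplx_Comp_simps cat_simps cplx_simps)

lemma bnd_Hom: "x \<in> bnd X n W \<Longrightarrow> x \<in> Hom A W (fst X n)"
  using bnd_cyc cyc_Hom by blast

lemma cyc_Add: "x \<in> cyc X n W \<Longrightarrow> y \<in> cyc X n W \<Longrightarrow> x \<oplus> y \<in> cyc X n W"
  using X by (auto simp: cyc_def Hom_iff ab_simps cplx_simps)

lemma cyc_neg: "x \<in> cyc X n W \<Longrightarrow> \<ominus> x \<in> cyc X n W"
  using X by (auto simp: cyc_def Hom_iff ab_simps cplx_simps)

lemma bnd_Add:
  assumes "x \<in> bnd X n W" "y \<in> bnd X n W" shows "x \<oplus> y \<in> bnd X n W"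
proof -
  obtain u v where "u \<in> Hom A W (fst X (n + 1))" "x = snd X (n + 1) \<cdot> u"
    "v \<in> Hom A W (fst X (n + 1))" "y = snd X (n + 1) \<cdot> v" using assms bndE by metis
  thus ?thesis using X by (intro bndI[of "u \<oplus> v"]) (auto simp: Hom_iff ab_simps cplx_simps)
qed

lemma bnd_neg:
  assumes "x \<in> bnd X n W" shows "\<ominus> x \<in> bnd X n W"
proof -
  obtain u where "u \<in> Hom A W (fst X (n + 1))" "x = snd X (n + 1) \<cdot> u" using assms bndE by metis
  thus ?thesis using X by (intro bndI[of "\<ominus> u"]) (auto simp: Hom_iff ab_simps cplx_simps)
qed

lemma bnd_Zer: "W \<in> Ob A \<Longrightarrow> Zer A W (fst X n) \<in> bnd X n W"
  using X by (intro bndI[of "Zer A W (fst X (n + 1))"]) (auto simp: Hom_iff ab_simps cplx_simps)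

lemma cyc_Comp: "x \<in> cyc X n W \<Longrightarrow> u \<in> Hom A V W \<Longrightarrow> x \<cdot> u \<in> cyc X n V"
proof -
  assume a: "x \<in> cyc X n W" "u \<in> Hom A V W"
  have "snd X n \<cdot> (x \<cdot> u) = (snd X n \<cdot> x) \<cdot> u"
    by (rule Comp_assoc_simp[symmetric]) (use X a in \<open>auto simp: cyc_def Hom_iff cplx_simps\<close>)
  thus ?thesis using a X by (auto simp: cyc_def Hom_iff ab_simps cplx_simps)
qed

lemma bnd_Comp: "x \<in> bnd X n W \<Longrightarrow> u \<in> Hom A V W \<Longrightarrow> x \<cdot> u \<in> bnd X n V"
proof -
  assume a: "x \<in> bnd X n W" "u \<in> Hom A V W"
  then obtain y where "y \<in> Hom A W (fst X (n + 1))" "x = snd X (n + 1) \<cdot> y" using bndE by blast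
  thus ?thesis using a(2) X by (intro bndI[of "y \<cdot> u"]) (auto simp: Hom_iff cat_simps cplx_simps)
qed

end

lemma chmap_cyc: "chain_map A (X, f, Y) \<Longrightarrow> x \<in> cyc X n W \<Longrightarrow> f n \<cdot> x \<in> cyc Y n W"
  using chmap_simps[of X f Y] chmap_Comp[of X f Y x W n]
  by (auto simp: cyc_def Hom_iff ab_simps cplx_simps)

subsection \<open>Homology classes of projective elements\<close>

text \<open>The class in \<open>H\<^sub>n X\<close> of a cycle
  \<open>x : W \<rightarrow> X n\<close>. If \<open>x\<close> is not a cycle the lift is
  unspecified, so the rules about \<open>hcl\<close> speak of cycles only.\<close>

definition hcl :: "('o, 'm) cplx \<Rightarrow> int \<Rightarrow> 'm \<Rightarrow> 'm" where
  "hcl X n x = homology_proj A n X \<cdot> lift_along A (cycles_incl A n X) x"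

context
  fixes X :: "('o, 'm) cplx" and n :: int assumes X: "chain_complex A X"
begin

lemma cycles_kernel: "is_kernel A (snd X n) (cycles_incl A n X)"
  unfolding cycles_incl_def by (rule ker_arrow_kernel) (simp add: X cplx_simps)

lemma cycles_mono: "mono_arrow A (cycles_incl A n X)"
  by (rule kernel_mono[OF cycles_kernel])

lemma cycles_incl_Hom: "cycles_incl A n X \<in> Hom A (Dom A (cycles_incl A n X)) (fst X n)"
  using is_kernelD[OF cycles_kernel] by (simp add: Hom_iff X cplx_simps)

lemma cycles_incl_cyc: "cycles_incl A n X \<in> cyc X n (Dom A (cycles_incl A n X))"
  using cycles_incl_Hom is_kernelD[OF cycles_kernel] X by (simp add: cyc_def cplx_simps)

lemma lift_cycle:
  assumes "x \<in> cyc X n W"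
  shows "lift_along A (cycles_incl A n X) x \<in> Hom A W (Dom A (cycles_incl A n X))"
    "cycles_incl A n X \<cdot> lift_along A (cycles_incl A n X) x = x"
proof -
  obtain u where u: "u \<in> Hom A W (Dom A (cycles_incl A n X))" "cycles_incl A n X \<cdot> u = x"
    using kernelE[OF cycles_kernel, of x W] assms X by (auto simp: cyc_def cplx_simps)
  have "lift_along A (cycles_incl A n X) x = u"
    by (rule lift_along_eq[OF cycles_mono _ u(2)]) (use u(1) assms in \<open>auto simp: cyc_def Hom_iff\<close>)
  thus "lift_along A (cycles_incl A n X) x \<in> Hom A W (Dom A (cycles_incl A n X))"
    "cycles_incl A n X \<cdot> lift_along A (cycles_incl A n X) x = x" using u by auto
qed

text \<open>Here \<open>l\<close> is the inclusion of the boundaries into the cycles, and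
  \<open>e\<close> is the differential corestricted to the boundaries. As \<open>e\<close> is epi,
  questions about \<open>B\<^sub>n X\<close> become questions about the differential itself.\<close>

lemma homology_proj_cokernel:
  obtains l e where "is_cokernel A l (homology_proj A n X)"
    "l \<in> Hom A (Dom A l) (Dom A (cycles_incl A n X))"
    "mono_arrow A l" "epi_arrow A e" "e \<in> Hom A (fst X (n + 1)) (Dom A l)"
    "cycles_incl A n X \<cdot> (l \<cdot> e) = snd X (n + 1)"
proof -
  let ?b = "boundaries_incl A n X" and ?z = "cycles_incl A n X"
  have dA: "snd X (n + 1) \<in> Ar A" by (simp add: X cplx_simps)
  from image_factorization[OF this]
  obtain e where e: "e \<in> Hom A (fst X (n + 1)) (Dom A ?b)" "epi_arrow A e"
    "?b \<cdot> e = snd X (n + 1)" "mono_arrow A ?b" "Cod A ?b = fst X n" "?b \<in> Ar A"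
    unfolding boundaries_incl_def using X by (auto simp: cplx_simps)
  have "(snd X n \<cdot> ?b) \<cdot> e = snd X n \<cdot> snd X (n + 1)"
    using e(1,3,5,6) X by (simp add: Comp_assoc_simp cplx_simps Hom_iff)
  also have "\<dots> = Zer A (Dom A ?b) (fst X (n - 1)) \<cdot> e"
    using e(1) X by (auto simp: cplx_simps Hom_iff ab_simps)
  finally have "snd X n \<cdot> ?b = Zer A (Dom A ?b) (fst X (n - 1))"
    using eq_if_epi[OF e(2,1), of "snd X n \<cdot> ?b" "fst X (n - 1)" "Zer A (Dom A ?b) (fst X (n - 1))"] e(5,6) X
    by (auto simp: cplx_simps Hom_iff ab_simps)
  hence "?b \<in> cyc X n (Dom A ?b)" using e by (simp add: cyc_def Hom_iff)
  note l = lift_cycle[OF this]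
  let ?l = "lift_along A ?z ?b"
  have lA: "?l \<in> Ar A" "Dom A ?l = Dom A ?b" "Cod A ?l = Dom A ?z" using l(1) by (auto simp: Hom_iff)
  have zA: "?z \<in> Ar A" "Cod A ?z = fst X n" using cycles_incl_Hom by (auto simp: Hom_iff)
  have "mono_arrow A ?l"
  proof (rule mono_arrowI[OF lA(1)])
    fix W g assume g: "g \<in> Hom A W (Dom A ?l)" "?l \<cdot> g = Zer A W (Cod A ?l)"
    have "?b \<cdot> g = ?z \<cdot> (?l \<cdot> g)"
      using Comp_assoc_simp[of g ?l ?z] l(2) g(1) lA zA by (simp add: Hom_iff)
    also have "\<dots> = Zer A W (Cod A ?b)" unfolding g(2) using g(1) lA zA e(5)
      by (auto simp: Hom_iff ab_simps)
    finally show "g = Zer A W (Dom A ?l)" using mono_Zer[OF e(4), of g W] g(1) lA by simp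
  qed
  moreover have "?z \<cdot> (?l \<cdot> e) = snd X (n + 1)"
    using Comp_assoc_simp[of e ?l ?z] l(2) e(1,3) lA zA by (simp add: Hom_iff)
  moreover have "is_cokernel A ?l (homology_proj A n X)"
    unfolding homology_proj_def by (rule coker_arrow_cokernel[OF lA(1)])
  ultimately show ?thesis using that[of ?l e] e lA by (simp add: Hom_iff)
qed

lemma homology_proj_Hom:
  "homology_proj A n X \<in> Hom A (Dom A (cycles_incl A n X)) (homology A n X)"
proof -
  obtain l where l: "is_cokernel A l (homology_proj A n X)" "l \<in> Hom A (Dom A l) (Dom A (cycles_incl A n X))"
    using homology_proj_cokernel by metis
  show ?thesis using is_cokernelD[OF l(1)] l(2) by (simp add: Hom_iff homology_def)
qed

lemma homology_proj_epi: "epi_arrow A (homology_proj A n X)"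
  using homology_proj_cokernel cokernel_epi by metis

lemma homology_Ob: "homology A n X \<in> Ob A"
  using homology_proj_Hom Hom_Ob by blast

lemma hcl_Hom: "x \<in> cyc X n W \<Longrightarrow> hcl X n x \<in> Hom A W (homology A n X)"
  unfolding hcl_def using lift_cycle homology_proj_Hom Comp_Hom by blast

lemma lift_cycle_unique:
  "x \<in> cyc X n W \<Longrightarrow> u \<in> Hom A W (Dom A (cycles_incl A n X)) \<Longrightarrow> cycles_incl A n X \<cdot> u = x
    \<Longrightarrow> lift_along A (cycles_incl A n X) x = u"
  using lift_along_eq[OF cycles_mono, of u x] by (auto simp: cyc_def Hom_iff)

lemma hcl_cycles_incl: "hcl X n (cycles_incl A n X) = homology_proj A n X"
proof -
  let ?z = "cycles_incl A n X"
  have zA: "?z \<in> Ar A" using cycles_incl_Hom by (auto simp: Hom_iff)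
  have "lift_along A ?z ?z = Ident A (Dom A ?z)"
    by (rule lift_cycle_unique[OF cycles_incl_cyc]) (use zA in \<open>auto simp: Hom_iff cat_simps\<close>)
  thus ?thesis using homology_proj_Hom by (simp add: hcl_def Hom_iff cat_simps)
qed

lemma hcl_Comp:
  assumes "x \<in> cyc X n W" "u \<in> Hom A V W"
  shows "hcl X n (x \<cdot> u) = hcl X n x \<cdot> u"
proof -
  let ?z = "cycles_incl A n X"
  have zA: "?z \<in> Ar A" using cycles_incl_Hom by (auto simp: Hom_iff)
  note l = lift_cycle[OF assms(1)]
  have "?z \<cdot> (lift_along A ?z x \<cdot> u) = (?z \<cdot> lift_along A ?z x) \<cdot> u"
    by (rule Comp_assoc_simp[symmetric]) (use zA l(1) assms(2) in \<open>auto simp: Hom_iff\<close>)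
  hence "lift_along A ?z (x \<cdot> u) = lift_along A ?z x \<cdot> u"
    using lift_cycle_unique[OF cyc_Comp[OF X assms]] l assms(2) by (simp add: Comp_Hom)
  thus ?thesis using homology_proj_Hom l(1) assms(2) by (simp add: hcl_def Hom_iff cat_simps)
qed

lemma hcl_Add:
  assumes "x \<in> cyc X n W" "y \<in> cyc X n W"
  shows "hcl X n (x \<oplus> y) = hcl X n x \<oplus> hcl X n y"
proof -
  let ?z = "cycles_incl A n X"
  have zA: "?z \<in> Ar A" using cycles_incl_Hom by (auto simp: Hom_iff)
  note l = lift_cycle[OF assms(1)] and l' = lift_cycle[OF assms(2)]
  have "?z \<cdot> (lift_along A ?z x \<oplus> lift_along A ?z y) = x \<oplus> y"
    using zA l(1) l'(1) by (simp add: Comp_Add Hom_iff l(2) l'(2))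
  hence "lift_along A ?z (x \<oplus> y) = lift_along A ?z x \<oplus> lift_along A ?z y"
    using lift_cycle_unique[OF cyc_Add[OF X assms]] l(1) l'(1) by (simp add: Add_Hom)
  thus ?thesis using homology_proj_Hom l(1) l'(1) by (simp add: hcl_def Hom_iff Comp_Add)
qed

lemma hcl_bnd:
  assumes "x \<in> bnd X n W"
  shows "hcl X n x = Zer A W (homology A n X)"
proof -
  let ?z = "cycles_incl A n X" and ?h = "homology_proj A n X"
  have zA: "?z \<in> Ar A" using cycles_incl_Hom by (auto simp: Hom_iff)
  obtain y where y: "y \<in> Hom A W (fst X (n + 1))" "x = snd X (n + 1) \<cdot> y" using assms bndE by metis
  obtain l e where l: "is_cokernel A l ?h" "l \<in> Hom A (Dom A l) (Dom A ?z)"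
    "e \<in> Hom A (fst X (n + 1)) (Dom A l)" "?z \<cdot> (l \<cdot> e) = snd X (n + 1)"
    using homology_proj_cokernel by metis
  have h: "?h \<in> Ar A" "Dom A ?h = Dom A ?z" "Cod A ?h = homology A n X" "?h \<cdot> l = Zer A (Dom A l) (homology A n X)"
    using homology_proj_Hom is_cokernelD[OF l(1)] by (auto simp: Hom_iff)
  have lA: "l \<in> Ar A" "Cod A l = Dom A ?z" "e \<in> Ar A" "Dom A e = fst X (n + 1)" "Cod A e = Dom A l"
    "y \<in> Ar A" "Dom A y = W" "Cod A y = fst X (n + 1)"
    using l(2,3) y(1) by (auto simp: Hom_iff)
  have "?z \<cdot> (l \<cdot> (e \<cdot> y)) = (?z \<cdot> (l \<cdot> e)) \<cdot> y" using lA zA by (simp add: cat_simps)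
  hence "?z \<cdot> (l \<cdot> (e \<cdot> y)) = x" using l(4) y(2) by simp
  hence "lift_along A ?z x = l \<cdot> (e \<cdot> y)"
    using lA by (intro lift_cycle_unique[OF bnd_cyc[OF X assms]]) (auto simp: Hom_iff cat_simps)
  hence "hcl X n x = ?h \<cdot> (l \<cdot> (e \<cdot> y))" by (simp add: hcl_def)
  also have "\<dots> = (?h \<cdot> l) \<cdot> (e \<cdot> y)"
    by (rule Comp_assoc_simp[symmetric]) (use lA h in \<open>auto simp: cat_simps\<close>)
  also have "\<dots> = Zer A W (homology A n X)"
    unfolding h(4) using lA homology_Ob by (simp add: ab_simps)
  finally show ?thesis .
qed

text \<open>The inclusion of boundaries into cycles is a kernel, hence the kernel of its own
  cokernel, so a cycle with zero class lifts to \<open>B\<^sub>n X\<close>. Projectivity of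
  \<open>P\<close> serves to lift once more, through the epi from \<open>X (n + 1)\<close>.\<close>

lemma hcl_Zer_imp_bnd:
  assumes P: "projective A P" and "x \<in> cyc X n P" "hcl X n x = Zer A P (homology A n X)"
  shows "x \<in> bnd X n P"
proof -
  let ?z = "cycles_incl A n X" and ?h = "homology_proj A n X"
  have zA: "?z \<in> Ar A" using cycles_incl_Hom by (auto simp: Hom_iff)
  let ?x = "lift_along A ?z x"
  note x = lift_cycle[OF assms(2)]
  obtain l e where l: "is_cokernel A l ?h" "l \<in> Hom A (Dom A l) (Dom A ?z)" "mono_arrow A l" "epi_arrow A e"
    "e \<in> Hom A (fst X (n + 1)) (Dom A l)" "?z \<cdot> (l \<cdot> e) = snd X (n + 1)"
    using homology_proj_cokernel by metis
  have h: "?h \<in> Ar A" "Dom A ?h = Dom A ?z" "Cod A ?h = homology A n X" "?h \<cdot> ?x = Zer A P (homology A n X)"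
    using homology_proj_Hom assms(3) by (auto simp: Hom_iff hcl_def)
  obtain g where g: "is_kernel A g l" using mono_is_kernel l(3) by blast
  note g' = is_kernelD[OF g]
  have lC: "Dom A g = Dom A ?z" using g'(3) l(2) by (simp add: Hom_iff)
  obtain g2 where g2: "g2 \<in> Hom A (homology A n X) (Cod A g)" "g2 \<cdot> ?h = g"
    using cokernelE[OF l(1), of g "Cod A g"] g' lC l(2) h(3) by (auto simp: Hom_iff)
  have "g \<cdot> ?x = g2 \<cdot> (?h \<cdot> ?x)"
    unfolding g2(2)[symmetric] using h x(1) g2(1) by (simp add: Hom_iff Comp_assoc_simp)
  also have "\<dots> = Zer A P (Cod A g)" unfolding h(4) using g2(1) projective_Ob[OF P]
    by (simp add: Hom_iff ab_simps)
  finally obtain b where b: "b \<in> Hom A P (Dom A l)" "l \<cdot> b = ?x"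
    using kernelE[OF g, of ?x P] x(1) lC by auto
  obtain y where y: "y \<in> Hom A P (fst X (n + 1))" "e \<cdot> y = b"
    using projective_lift[OF P l(4), of b] b(1) l(5) by (auto simp: Hom_iff)
  have lA: "l \<in> Ar A" "Cod A l = Dom A ?z" "e \<in> Ar A" "Dom A e = fst X (n + 1)" "Cod A e = Dom A l"
    "y \<in> Ar A" "Dom A y = P" "Cod A y = fst X (n + 1)"
    using l(2,5) y(1) by (auto simp: Hom_iff)
  have "snd X (n + 1) \<cdot> y = ?z \<cdot> (l \<cdot> (e \<cdot> y))"
    unfolding l(6)[symmetric] using lA zA by (simp add: cat_simps)
  also have "\<dots> = x" using y(2) b(2) x(2) by simp
  finally show ?thesis using y(1) by (intro bndI) auto
qed

lemma hcl_surj: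
  assumes P: "projective A P" and "h \<in> Hom A P (homology A n X)"
  obtains x where "x \<in> cyc X n P" "hcl X n x = h"
proof -
  let ?z = "cycles_incl A n X" and ?h = "homology_proj A n X"
  obtain u where u: "u \<in> Hom A P (Dom A ?z)" "?h \<cdot> u = h"
    using projective_lift[OF P homology_proj_epi, of h] assms(2) homology_proj_Hom by (auto simp: Hom_iff)
  have "hcl X n (?z \<cdot> u) = h" using hcl_Comp[OF cycles_incl_cyc u(1)] hcl_cycles_incl u(2) by simp
  thus ?thesis using that cyc_Comp[OF X cycles_incl_cyc u(1)] by blast
qed

end

text \<open>The arrow from the cycles of \<open>X\<close> to the homology of \<open>Y\<close> kills
  boundaries because a chain map sends boundaries to boundaries; hence it descends. The second part
  is the form in which induced maps are computed afterwards.\<close>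

lemma homology_map:
  assumes f: "chain_map A (X, f, Y)"
  shows "homology_map A n (X, f, Y) \<in> Hom A (homology A n X) (homology A n Y)"
    "x \<in> cyc X n W \<Longrightarrow> homology_map A n (X, f, Y) \<cdot> hcl X n x = hcl Y n (f n \<cdot> x)"
proof -
  note c = chmap_simps[OF f]
  let ?z = "cycles_incl A n X" and ?h = "homology_proj A n X"
  let ?g = "hcl Y n (f n \<cdot> ?z)"
  have zc: "?z \<in> cyc X n (Dom A ?z)" by (rule cycles_incl_cyc[OF c(1)])
  have fz: "f n \<cdot> ?z \<in> cyc Y n (Dom A ?z)" by (rule chmap_cyc[OF f zc])
  have g: "?g \<in> Hom A (Dom A ?z) (homology A n Y)" by (rule hcl_Hom[OF c(2) fz])
  obtain l e where l: "is_cokernel A l ?h" "l \<in> Hom A (Dom A l) (Dom A ?z)" "epi_arrow A e"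
    "e \<in> Hom A (fst X (n + 1)) (Dom A l)" "?z \<cdot> (l \<cdot> e) = snd X (n + 1)"
    using homology_proj_cokernel[OF c(1)] by metis
  have le: "l \<cdot> e \<in> Hom A (fst X (n + 1)) (Dom A ?z)" using Comp_Hom[OF l(4,2)] .
  have ty: "?z \<in> Ar A" "Cod A ?z = fst X n" using zc by (auto simp: cyc_def Hom_iff)
  have "(?g \<cdot> l) \<cdot> e = ?g \<cdot> (l \<cdot> e)" using g l(2,4) by (simp add: Comp_assoc_simp Hom_iff)
  also have "\<dots> = hcl Y n ((f n \<cdot> ?z) \<cdot> (l \<cdot> e))" by (rule hcl_Comp[OF c(2) fz le, symmetric])
  also have "(f n \<cdot> ?z) \<cdot> (l \<cdot> e) = f n \<cdot> snd X (n + 1)"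
    unfolding l(5)[symmetric] by (rule Comp_assoc_simp) (use le c ty in \<open>auto simp: Hom_iff\<close>)
  also have "\<dots> = snd Y (n + 1) \<cdot> f (n + 1)" using c(6)[of "n + 1"] by simp
  also have "hcl Y n \<dots> = Zer A (fst X (n + 1)) (homology A n Y)"
    by (rule hcl_bnd[OF c(2)]) (use c(3-5) in \<open>auto intro!: bndI simp: Hom_iff\<close>)
  also have "\<dots> = Zer A (Dom A l) (homology A n Y) \<cdot> e"
    using l(4) homology_Ob[OF c(2)] by (auto simp: ab_simps Hom_iff)
  finally have "?g \<cdot> l = Zer A (Dom A l) (homology A n Y)"
    using eq_if_epi[OF l(3,4), of "?g \<cdot> l"] g l(2) homology_Ob[OF c(2)]
    by (auto simp: Hom_iff ab_simps)
  then obtain u where u: "u \<in> Hom A (homology A n X) (homology A n Y)" "u \<cdot> ?h = ?g"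
    using cokernelE[OF l(1), of ?g "homology A n Y"] g l(2) homology_proj_Hom[OF c(1), of n]
    by (auto simp: Hom_iff)
  have "homology_map A n (X, f, Y) = descend_along A ?h ?g"
    unfolding homology_map_def hcl_def by simp
  also have "\<dots> = u"
    using u g homology_proj_Hom[OF c(1), of n]
    by (intro descend_along_eq[OF homology_proj_epi[OF c(1)]]) (auto simp: Hom_iff)
  finally have hu: "homology_map A n (X, f, Y) = u" .
  show "homology_map A n (X, f, Y) \<in> Hom A (homology A n X) (homology A n Y)" using u hu by simp
  assume x: "x \<in> cyc X n W"
  let ?x = "lift_along A ?z x"
  note lx = lift_cycle[OF c(1) x]
  have "u \<cdot> hcl X n x = (u \<cdot> ?h) \<cdot> ?x"
    unfolding hcl_def using u(1) homology_proj_Hom[OF c(1), of n] lx(1)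
    by (simp add: Hom_iff Comp_assoc_simp)
  also have "\<dots> = hcl Y n ((f n \<cdot> ?z) \<cdot> ?x)" unfolding u(2) by (rule hcl_Comp[OF c(2) fz lx(1), symmetric])
  also have "(f n \<cdot> ?z) \<cdot> ?x = f n \<cdot> x"
    using Comp_assoc_simp[of ?x ?z "f n"] lx c ty by (simp add: Hom_iff)
  finally show "homology_map A n (X, f, Y) \<cdot> hcl X n x = hcl Y n (f n \<cdot> x)" using hu by simp
qed

text \<open>The inclusion of the cycles is the generic cycle: its class is the projection onto
  homology, which is epi.\<close>

lemma homology_ext:
  assumes X: "chain_complex A X" and "u \<in> Hom A (homology A n X) Z" "v \<in> Hom A (homology A n X) Z"
    and "\<And>W x. x \<in> cyc X n W \<Longrightarrow> u \<cdot> hcl X n x = v \<cdot> hcl X n x"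
  shows "u = v"
  using eq_if_epi[OF homology_proj_epi[OF X] homology_proj_Hom[OF X] assms(2,3)]
    assms(4)[OF cycles_incl_cyc[OF X]] by (simp add: hcl_cycles_incl[OF X])

lemma hcl_eq_imp_bnd:
  assumes X: "chain_complex A X" and P: "projective A P" and x: "x \<in> cyc X n P" and y: "y \<in> cyc X n P"
    and e: "hcl X n x = hcl X n y"
  obtains b where "b \<in> bnd X n P" "x = y \<oplus> b"
proof -
  note ny = cyc_neg[OF X y]
  have ty: "x \<in> Ar A" "Dom A x = P" "Cod A x = fst X n" "y \<in> Ar A" "Dom A y = P" "Cod A y = fst X n"
    using cyc_Hom[OF x] cyc_Hom[OF y] by (auto simp: Hom_iff)
  have yy: "y \<oplus> \<ominus> y \<in> bnd X n P" using ty bnd_Zer[OF X projective_Ob[OF P]] by (simp add: neg_Add)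
  have "hcl X n (x \<oplus> \<ominus> y) = hcl X n (y \<oplus> \<ominus> y)"
    unfolding hcl_Add[OF X x ny] hcl_Add[OF X y ny] e ..
  also have "\<dots> = Zer A P (homology A n X)" by (rule hcl_bnd[OF X yy])
  finally have "hcl X n (x \<oplus> \<ominus> y) = Zer A P (homology A n X)" .
  from this have b: "x \<oplus> \<ominus> y \<in> bnd X n P" by (rule hcl_Zer_imp_bnd[OF X P cyc_Add[OF X x ny]])
  have "x = y \<oplus> (x \<oplus> \<ominus> y)" using diff_eq_iff[of x y "x \<oplus> \<ominus> y"] ty by (simp add: Add_simps neg_simps)
  thus ?thesis using that b by blast
qed

text \<open>This removes homology objects from the notion: arrows out of projectives detect
  isomorphisms and lift along the projection from cycles to homology, so surjectivity and
  injectivity can be checked on cycles. The quasi-isomorphisms constructed below are recognised in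
  this form.\<close>

lemma quasi_iso_iff:
  "(X, f, Y) \<in> quasi_isos A \<longleftrightarrow> chain_map A (X, f, Y) \<and>
    (\<forall>P n. projective A P \<longrightarrow>
      (\<forall>y \<in> cyc Y n P. \<exists>x \<in> cyc X n P. \<exists>b \<in> bnd Y n P. y = f n \<cdot> x \<oplus> b) \<and>
      (\<forall>x \<in> cyc X n P. f n \<cdot> x \<in> bnd Y n P \<longrightarrow> x \<in> bnd X n P))"
proof (cases "chain_map A (X, f, Y)")
  case True
  note c = chmap_simps[OF True]
  note h = homology_map[OF True]
  have "iso_arrow A (homology_map A n (X, f, Y)) \<longleftrightarrow> (\<forall>P. projective A P \<longrightarrow>
      (\<forall>y \<in> cyc Y n P. \<exists>x \<in> cyc X n P. \<exists>b \<in> bnd Y n P. y = f n \<cdot> x \<oplus> b) \<and>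
      (\<forall>x \<in> cyc X n P. f n \<cdot> x \<in> bnd Y n P \<longrightarrow> x \<in> bnd X n P))" (is "?L = ?R") for n
  proof
    assume iso: ?L
    show ?R
    proof (intro allI impI conjI ballI)
      fix P y assume P: "projective A P" and y: "y \<in> cyc Y n P"
      obtain k where k: "k \<in> Hom A P (homology A n X)" "homology_map A n (X, f, Y) \<cdot> k = hcl Y n y"
        using iso_arrow_surj[OF iso h(1) hcl_Hom[OF c(2) y]] by metis
      obtain x where x: "x \<in> cyc X n P" "hcl X n x = k" using hcl_surj[OF c(1) P k(1)] by metis
      have "hcl Y n y = hcl Y n (f n \<cdot> x)" using h(2)[OF x(1)] x(2) k(2) by simp
      then obtain b where "b \<in> bnd Y n P" "y = f n \<cdot> x \<oplus> b"
        using hcl_eq_imp_bnd[OF c(2) P y chmap_cyc[OF True x(1)]] by metis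
      thus "\<exists>x \<in> cyc X n P. \<exists>b \<in> bnd Y n P. y = f n \<cdot> x \<oplus> b" using x(1) by blast
    next
      fix P x assume P: "projective A P" and x: "x \<in> cyc X n P" "f n \<cdot> x \<in> bnd Y n P"
      have "homology_map A n (X, f, Y) \<cdot> hcl X n x = Zer A P (homology A n Y)"
        using h(2)[OF x(1)] hcl_bnd[OF c(2) x(2)] by simp
      also have "\<dots> = homology_map A n (X, f, Y) \<cdot> Zer A P (homology A n X)"
        using h(1)[of n] projective_Ob[OF P] by (simp add: Hom_iff Comp_Zer)
      finally have "hcl X n x = Zer A P (homology A n X)"
        by (rule iso_arrow_cancel[OF iso h(1) hcl_Hom[OF c(1) x(1)] Zer_Hom[OF projective_Ob[OF P] homology_Ob[OF c(1)]]])
      thus "x \<in> bnd X n P" by (rule hcl_Zer_imp_bnd[OF c(1) P x(1)])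
    qed
  next
    assume R: ?R
    show ?L
    proof (rule iso_arrow_if_projective[OF h(1)])
      fix P y assume P: "projective A P" and y: "y \<in> Hom A P (homology A n Y)"
      obtain y' where y': "y' \<in> cyc Y n P" "hcl Y n y' = y" using hcl_surj[OF c(2) P y] by metis
      obtain x b where x: "x \<in> cyc X n P" "b \<in> bnd Y n P" "y' = f n \<cdot> x \<oplus> b" using R P y'(1) by blast
      have fx: "f n \<cdot> x \<in> cyc Y n P" by (rule chmap_cyc[OF True x(1)])
      have "y = hcl Y n (f n \<cdot> x) \<oplus> Zer A P (homology A n Y)"
        using hcl_Add[OF c(2) fx bnd_cyc[OF c(2) x(2)]] hcl_bnd[OF c(2) x(2)] x(3) y'(2) by simp
      also have "\<dots> = hcl Y n (f n \<cdot> x)" using hcl_Hom[OF c(2) fx] by (simp add: Hom_iff Zer_Add)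
      finally have "homology_map A n (X, f, Y) \<cdot> hcl X n x = y" using h(2)[OF x(1)] by simp
      thus "\<exists>x \<in> Hom A P (homology A n X). homology_map A n (X, f, Y) \<cdot> x = y"
        using hcl_Hom[OF c(1) x(1)] by blast
    next
      fix P k assume P: "projective A P" and k: "k \<in> Hom A P (homology A n X)"
        "homology_map A n (X, f, Y) \<cdot> k = Zer A P (homology A n Y)"
      obtain x where x: "x \<in> cyc X n P" "hcl X n x = k" using hcl_surj[OF c(1) P k(1)] by metis
      have "hcl Y n (f n \<cdot> x) = Zer A P (homology A n Y)" using h(2)[OF x(1)] x(2) k(2) by simp
      hence "f n \<cdot> x \<in> bnd Y n P" by (rule hcl_Zer_imp_bnd[OF c(2) P chmap_cyc[OF True x(1)]])
      hence "x \<in> bnd X n P" using R P x(1) by blast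
      thus "k = Zer A P (homology A n X)" using hcl_bnd[OF c(1)] x(2) by simp
    qed
  qed
  thus ?thesis using True unfolding quasi_isos_def by blast
qed (simp add: quasi_isos_def)

end

section \<open>Twisted sums of complexes\<close>

context projective_abelian_category
begin

section \<open>Chosen biproducts and their elements\<close>

definition bsum :: "'o \<Rightarrow> 'o \<Rightarrow> 'o \<times> 'm \<times> 'm \<times> 'm \<times> 'm" where
  "bsum X Y = (SOME t. case t of (S, i, j, p, q) \<Rightarrow> biproduct A X Y S i j p q)"

definition "bS X Y = fst (bsum X Y)"
definition "bi X Y = fst (snd (bsum X Y))"
definition "bj X Y = fst (snd (snd (bsum X Y)))"
definition "bp X Y = fst (snd (snd (snd (bsum X Y))))"
definition "bq X Y = snd (snd (snd (snd (bsum X Y))))"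

definition "pair X Y a b = bi X Y \<cdot> a \<oplus> bj X Y \<cdot> b"
definition "copair X Y u v = u \<cdot> bp X Y \<oplus> v \<cdot> bq X Y"

lemma biproduct_bsum:
  assumes "X \<in> Ob A" "Y \<in> Ob A"
  shows "biproduct A X Y (bS X Y) (bi X Y) (bj X Y) (bp X Y) (bq X Y)"
proof -
  have "\<exists>t. case t of (S, i, j, p, q) \<Rightarrow> biproduct A X Y S i j p q" using ex_biproduct[OF assms] by auto
  from someI_ex[OF this] show ?thesis
    unfolding bsum_def[symmetric] bS_def bi_def bj_def bp_def bq_def by (auto split: prod.splits)
qed

lemma bsum_simps:
  assumes "X \<in> Ob A" "Y \<in> Ob A"
  shows "bS X Y \<in> Ob A"
    "bi X Y \<in> Ar A" "Dom A (bi X Y) = X" "Cod A (bi X Y) = bS X Y"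
    "bj X Y \<in> Ar A" "Dom A (bj X Y) = Y" "Cod A (bj X Y) = bS X Y"
    "bp X Y \<in> Ar A" "Dom A (bp X Y) = bS X Y" "Cod A (bp X Y) = X"
    "bq X Y \<in> Ar A" "Dom A (bq X Y) = bS X Y" "Cod A (bq X Y) = Y"
    "bp X Y \<cdot> bi X Y = Ident A X" "bq X Y \<cdot> bj X Y = Ident A Y"
    "bq X Y \<cdot> bi X Y = Zer A X Y" "bp X Y \<cdot> bj X Y = Zer A Y X"
    "bi X Y \<cdot> bp X Y \<oplus> bj X Y \<cdot> bq X Y = Ident A (bS X Y)"
  using biproduct_bsum[OF assms] Dom_Ob[of "bp X Y"] unfolding biproduct_def Hom_iff by auto

lemma pair_Hom:
  assumes "a \<in> Hom A W X" "b \<in> Hom A W Y"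
  shows "pair X Y a b \<in> Hom A W (bS X Y)"
  using assms Hom_Ob[OF assms(1)] Hom_Ob[OF assms(2)]
  by (simp add: pair_def Hom_iff ab_simps bsum_simps)

lemma copair_Hom:
  assumes "u \<in> Hom A X Z" "v \<in> Hom A Y Z"
  shows "copair X Y u v \<in> Hom A (bS X Y) Z"
  using assms Hom_Ob[OF assms(1)] Hom_Ob[OF assms(2)]
  by (simp add: copair_def Hom_iff ab_simps bsum_simps)

lemma bsum_Comp_simps:
  assumes "X \<in> Ob A" "Y \<in> Ob A" "a \<in> Ar A"
  shows "Cod A a = X \<Longrightarrow> bp X Y \<cdot> (bi X Y \<cdot> a) = a" "Cod A a = Y \<Longrightarrow> bq X Y \<cdot> (bj X Y \<cdot> a) = a"
    "Cod A a = X \<Longrightarrow> bq X Y \<cdot> (bi X Y \<cdot> a) = Zer A (Dom A a) Y"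
    "Cod A a = Y \<Longrightarrow> bp X Y \<cdot> (bj X Y \<cdot> a) = Zer A (Dom A a) X"
  using assms bsum_simps[OF assms(1,2)]
  by (simp_all add: Comp_assoc_simp[symmetric] del: Comp_assoc_simp)
    (simp_all add: Comp_Ident_simps Comp_Zer)

lemma pair_proj:
  assumes "a \<in> Hom A W X" "b \<in> Hom A W Y"
  shows "bp X Y \<cdot> pair X Y a b = a" "bq X Y \<cdot> pair X Y a b = b"
  using assms Hom_Ob[OF assms(1)] Hom_Ob[OF assms(2)]
  by (simp_all add: pair_def Hom_iff ab_simps bsum_simps bsum_Comp_simps)

lemma pair_eta:
  assumes "X \<in> Ob A" "Y \<in> Ob A" "z \<in> Hom A W (bS X Y)"
  shows "pair X Y (bp X Y \<cdot> z) (bq X Y \<cdot> z) = z"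
proof -
  have "pair X Y (bp X Y \<cdot> z) (bq X Y \<cdot> z) = (bi X Y \<cdot> bp X Y \<oplus> bj X Y \<cdot> bq X Y) \<cdot> z"
    unfolding pair_def using bsum_simps(1-17)[OF assms(1,2)] assms(3)
    by (simp add: Hom_iff cat_simps Comp_Add)
  thus ?thesis using bsum_simps[OF assms(1,2)] assms(3) by (simp add: Hom_iff cat_simps)
qed

lemma pair_cases:
  assumes "X \<in> Ob A" "Y \<in> Ob A" "z \<in> Hom A W (bS X Y)"
  obtains a b where "a \<in> Hom A W X" "b \<in> Hom A W Y" "z = pair X Y a b"
proof
  show "bp X Y \<cdot> z \<in> Hom A W X" "bq X Y \<cdot> z \<in> Hom A W Y"
    using bsum_simps[OF assms(1,2)] assms(3) by (auto simp: Hom_iff cat_simps)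
qed (simp add: pair_eta[OF assms])

lemma pair_eq_iff:
  assumes "a \<in> Hom A W X" "b \<in> Hom A W Y" "a' \<in> Hom A W X" "b' \<in> Hom A W Y"
  shows "pair X Y a b = pair X Y a' b' \<longleftrightarrow> a = a' \<and> b = b'"
  using pair_proj[OF assms(1,2)] pair_proj[OF assms(3,4)] by metis

lemma pair_Add:
  assumes "a \<in> Hom A W X" "b \<in> Hom A W Y" "a' \<in> Hom A W X" "b' \<in> Hom A W Y"
  shows "pair X Y a b \<oplus> pair X Y a' b' = pair X Y (a \<oplus> a') (b \<oplus> b')"
  using assms Hom_Ob[OF assms(1)] Hom_Ob[OF assms(2)]
  by (simp add: pair_def Hom_iff ab_simps bsum_simps Add_left_commute[of "bj X Y \<cdot> b" "bi X Y \<cdot> a'"])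

lemma pair_Comp:
  assumes "a \<in> Hom A W X" "b \<in> Hom A W Y" "w \<in> Hom A V W"
  shows "pair X Y a b \<cdot> w = pair X Y (a \<cdot> w) (b \<cdot> w)"
  using assms Hom_Ob[OF assms(1)] Hom_Ob[OF assms(2)]
  by (simp add: pair_def Hom_iff ab_simps bsum_simps)

lemma pair_Zer: "X \<in> Ob A \<Longrightarrow> Y \<in> Ob A \<Longrightarrow> W \<in> Ob A
    \<Longrightarrow> pair X Y (Zer A W X) (Zer A W Y) = Zer A W (bS X Y)"
  by (simp add: pair_def ab_simps bsum_simps)

lemma copair_pair:
  assumes "u \<in> Hom A X Z" "v \<in> Hom A Y Z" "a \<in> Hom A W X" "b \<in> Hom A W Y"
  shows "copair X Y u v \<cdot> pair X Y a b = u \<cdot> a \<oplus> v \<cdot> b"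
proof -
  have s: "u \<in> Ar A" "Dom A u = X" "Cod A u = Z" "v \<in> Ar A" "Dom A v = Y" "Cod A v = Z" "X \<in> Ob A" "Y \<in> Ob A"
    using assms(1,2) by (auto simp: Hom_iff cat_simps)
  have p: "pair X Y a b \<in> Ar A" "Cod A (pair X Y a b) = bS X Y"
    using pair_Hom[OF assms(3,4)] by (auto simp: Hom_iff)
  show ?thesis using s p pair_proj[OF assms(3,4)]
    by (simp add: copair_def Comp_Add cat_simps bsum_simps)
qed

text \<open>The pair formed by the two projections is the identity of the sum, so this single test
  element already suffices.\<close>

lemma bsum_hom_ext:
  assumes "X \<in> Ob A" "Y \<in> Ob A" "f \<in> Hom A (bS X Y) Z" "g \<in> Hom A (bS X Y) Z"
    and "\<And>W a b. a \<in> Hom A W X \<Longrightarrow> b \<in> Hom A W Y \<Longrightarrow> f \<cdot> pair X Y a b = g \<cdot> pair X Y a b"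
  shows "f = g"
proof -
  note s = bsum_simps[OF assms(1,2)]
  have "pair X Y (bp X Y) (bq X Y) = Ident A (bS X Y)" using s by (simp add: pair_def)
  thus ?thesis using assms(5)[of "bp X Y" "bS X Y" "bq X Y"] assms(3,4) s
    by (simp add: Hom_iff cat_simps)
qed

lemma chain_mapI:
  assumes "chain_complex A X" "chain_complex A Y" "\<And>n. f n \<in> Hom A (fst X n) (fst Y n)"
    and "\<And>n. snd Y n \<cdot> f n = f (n - 1) \<cdot> snd X n"
  shows "chain_map A (X, f, Y)"
  using assms by (simp add: chain_map_def)

lemma chain_complexI:
  assumes "\<And>n. fst X n \<in> Ob A" "\<And>n. snd X n \<in> Hom A (fst X n) (fst X (n - 1))"
    and "\<And>n. snd X (n - 1) \<cdot> snd X n = Zer A (fst X n) (fst X (n - 2))"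
  shows "chain_complex A X"
  using assms by (simp add: chain_complex_def)

text \<open>The differential is the triangular matrix
  \<open>(a, b) \<mapsto> (d a, t a + d b)\<close>, so \<open>Y\<close> is a subcomplex with
  quotient \<open>X\<close>. Mapping cones, complexes with cells attached and the cylinder in
  \<open>Q_homotopic_eq\<close> are all of this kind. The summands are arranged as in
  \<open>cone_sequence\<close>, so that cones match it literally.\<close>

definition TW :: "('o, 'm) cplx \<Rightarrow> ('o, 'm) cplx \<Rightarrow> (int \<Rightarrow> 'm) \<Rightarrow> ('o, 'm) cplx" where
  "TW X Y t = ((\<lambda>n. bS (fst X n) (fst Y n)),
    (\<lambda>n. bi (fst X (n - 1)) (fst Y (n - 1)) \<cdot> snd X n \<cdot> bp (fst X n) (fst Y n)
      \<oplus> (bj (fst X (n - 1)) (fst Y (n - 1)) \<cdot> t n \<cdot> bp (fst X n) (fst Y n)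
      \<oplus> bj (fst X (n - 1)) (fst Y (n - 1)) \<cdot> snd Y n \<cdot> bq (fst X n) (fst Y n))))"

text \<open>The equation is the off-diagonal entry of \<open>d \<cdot> d = 0\<close>: the term
  \<open>t\<close>, of degree \<open>-1\<close>, anticommutes with the differentials.\<close>

definition twisting :: "('o, 'm) cplx \<Rightarrow> ('o, 'm) cplx \<Rightarrow> (int \<Rightarrow> 'm) \<Rightarrow> bool" where
  "twisting X Y t \<longleftrightarrow> chain_complex A X \<and> chain_complex A Y \<and>
    (\<forall>n. t n \<in> Hom A (fst X n) (fst Y (n - 1))
      \<and> snd Y (n - 1) \<cdot> t n \<oplus> t (n - 1) \<cdot> snd X n = Zer A (fst X n) (fst Y (n - 2)))"

abbreviation tp where "tp X Y n a b \<equiv> pair (fst X n) (fst Y n) a b"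

lemma fst_TW: "fst (TW X Y t) n = bS (fst X n) (fst Y n)"
  by (simp add: TW_def)

context
  fixes X Y :: "('o, 'm) cplx" and t :: "int \<Rightarrow> 'm"
  assumes tw: "twisting X Y t"
begin

lemma tw_cplx: "chain_complex A X" "chain_complex A Y"
  using tw by (auto simp: twisting_def)

lemma tw_t:
  "t n \<in> Ar A" "Dom A (t n) = fst X n" "Cod A (t n) = fst Y (n - 1)"
  "snd Y (n - 1) \<cdot> t n \<oplus> t (n - 1) \<cdot> snd X n = Zer A (fst X n) (fst Y (n - 2))"
  using tw by (auto simp: twisting_def Hom_iff)

lemmas tw_typing = tw_t(1-3) cplx_simps(1-4)[OF tw_cplx(1)] cplx_simps(1-4)[OF tw_cplx(2)]

lemma tw_snd_Hom: "snd (TW X Y t) n \<in> Hom A (fst (TW X Y t) n) (fst (TW X Y t) (n - 1))"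
  by (simp add: TW_def Hom_iff ab_simps bsum_simps tw_typing)

lemma tw_d:
  assumes "a \<in> Hom A W (fst X n)" "b \<in> Hom A W (fst Y n)"
  shows "snd (TW X Y t) n \<cdot> tp X Y n a b = tp X Y (n - 1) (snd X n \<cdot> a) (t n \<cdot> a \<oplus> snd Y n \<cdot> b)"
proof -
  have p: "tp X Y n a b \<in> Ar A" "Dom A (tp X Y n a b) = W" "Cod A (tp X Y n a b) = bS (fst X n) (fst Y n)"
    using pair_Hom[OF assms] by (auto simp: Hom_iff)
  have "snd (TW X Y t) n \<cdot> tp X Y n a b
    = bi (fst X (n - 1)) (fst Y (n - 1)) \<cdot> snd X n \<cdot> bp (fst X n) (fst Y n) \<cdot> tp X Y n a b
      \<oplus> (bj (fst X (n - 1)) (fst Y (n - 1)) \<cdot> t n \<cdot> bp (fst X n) (fst Y n) \<cdot> tp X Y n a b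
      \<oplus> bj (fst X (n - 1)) (fst Y (n - 1)) \<cdot> snd Y n \<cdot> bq (fst X n) (fst Y n) \<cdot> tp X Y n a b)"
    unfolding TW_def snd_conv using p
    by (simp add: Comp_Add cat_simps Add_simps bsum_simps tw_typing)
  thus ?thesis unfolding pair_proj[OF assms]
    using assms by (simp add: pair_def[of "fst X (n - 1)"] Hom_iff ab_simps bsum_simps tw_typing)
qed

lemma tw_t_elt:
  assumes "a \<in> Hom A W (fst X n)"
  shows "snd Y (n - 1) \<cdot> (t n \<cdot> a) \<oplus> t (n - 1) \<cdot> (snd X n \<cdot> a) = Zer A W (fst Y (n - 2))"
proof -
  have "(snd Y (n - 1) \<cdot> t n \<oplus> t (n - 1) \<cdot> snd X n) \<cdot> a
    = snd Y (n - 1) \<cdot> (t n \<cdot> a) \<oplus> t (n - 1) \<cdot> (snd X n \<cdot> a)"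
    using assms by (simp add: Hom_iff cat_simps Comp_Add tw_typing)
  thus ?thesis unfolding tw_t(4) using assms by (auto simp: Hom_iff Comp_Zer tw_typing)
qed

lemma tw_complex: "chain_complex A (TW X Y t)"
proof (rule chain_complexI)
  show "fst (TW X Y t) n \<in> Ob A" for n by (simp add: fst_TW bsum_simps tw_typing)
  show "snd (TW X Y t) n \<in> Hom A (fst (TW X Y t) n) (fst (TW X Y t) (n - 1))" for n by (rule tw_snd_Hom)
  show "snd (TW X Y t) (n - 1) \<cdot> snd (TW X Y t) n = Zer A (fst (TW X Y t) n) (fst (TW X Y t) (n - 2))" for n
  proof -
    note h = tw_snd_Hom[of n] tw_snd_Hom[of "n - 1"]
    have o: "fst (TW X Y t) m \<in> Ob A" for m by (simp add: fst_TW bsum_simps tw_typing)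
    show ?thesis
    proof (rule bsum_hom_ext[of "fst X n" "fst Y n"])
      show "fst X n \<in> Ob A" "fst Y n \<in> Ob A" by (simp_all add: tw_typing)
      show "snd (TW X Y t) (n - 1) \<cdot> snd (TW X Y t) n \<in> Hom A (bS (fst X n) (fst Y n)) (fst (TW X Y t) (n - 2))"
        using Comp_Hom[OF h] by (simp add: fst_TW)
      show "Zer A (fst (TW X Y t) n) (fst (TW X Y t) (n - 2)) \<in> Hom A (bS (fst X n) (fst Y n)) (fst (TW X Y t) (n - 2))"
        using Zer_Hom[OF o o] by (simp add: fst_TW)
      fix W a b assume ab: "a \<in> Hom A W (fst X n)" "b \<in> Hom A W (fst Y n)"
      have W: "W \<in> Ob A" using ab Hom_Ob by blast
      have p: "tp X Y n a b \<in> Hom A W (fst (TW X Y t) n)" using pair_Hom[OF ab] by (simp add: fst_TW)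
      have ab': "snd X n \<cdot> a \<in> Hom A W (fst X (n - 1))" "t n \<cdot> a \<oplus> snd Y n \<cdot> b \<in> Hom A W (fst Y (n - 1))"
        using ab by (auto simp: Hom_iff ab_simps tw_typing)
      have "(snd (TW X Y t) (n - 1) \<cdot> snd (TW X Y t) n) \<cdot> tp X Y n a b
        = snd (TW X Y t) (n - 1) \<cdot> (snd (TW X Y t) n \<cdot> tp X Y n a b)"
        using h p by (simp add: Hom_iff cat_simps)
      also have "\<dots> = tp X Y (n - 2) (snd X (n - 1) \<cdot> (snd X n \<cdot> a))
          (t (n - 1) \<cdot> (snd X n \<cdot> a) \<oplus> snd Y (n - 1) \<cdot> (t n \<cdot> a \<oplus> snd Y n \<cdot> b))"
        unfolding tw_d[OF ab] using tw_d[OF ab'] by simp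
      also have "snd X (n - 1) \<cdot> (snd X n \<cdot> a) = Zer A W (fst X (n - 2))"
        using ab by (simp add: Hom_iff cplx_Comp_simps[OF tw_cplx(1)])
      also have "t (n - 1) \<cdot> (snd X n \<cdot> a) \<oplus> snd Y (n - 1) \<cdot> (t n \<cdot> a \<oplus> snd Y n \<cdot> b)
        = snd Y (n - 1) \<cdot> (t n \<cdot> a) \<oplus> t (n - 1) \<cdot> (snd X n \<cdot> a)"
        using ab W by (simp add: Hom_iff ab_simps tw_typing cplx_Comp_simps[OF tw_cplx(2)]
          Add_commute[of "t (n - 1) \<cdot> (snd X n \<cdot> a)"])
      also have "\<dots> = Zer A W (fst Y (n - 2))" by (rule tw_t_elt[OF ab(1)])
      finally show "(snd (TW X Y t) (n - 1) \<cdot> snd (TW X Y t) n) \<cdot> tp X Y n a b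
        = Zer A (fst (TW X Y t) n) (fst (TW X Y t) (n - 2)) \<cdot> tp X Y n a b"
        using p o W by (simp add: pair_Zer tw_typing fst_TW Hom_iff Comp_Zer)
    qed
  qed
qed

lemma tw_cases:
  assumes "z \<in> Hom A W (fst (TW X Y t) n)"
  obtains a b where "a \<in> Hom A W (fst X n)" "b \<in> Hom A W (fst Y n)" "z = tp X Y n a b"
  using pair_cases[of "fst X n" "fst Y n" z W] assms by (auto simp: fst_TW tw_typing)

lemma tw_Hom:
  "a \<in> Hom A W (fst X n) \<Longrightarrow> b \<in> Hom A W (fst Y n) \<Longrightarrow> tp X Y n a b \<in> Hom A W (fst (TW X Y t) n)"
  using pair_Hom by (simp add: fst_TW)

lemma tw_cyc_iff:
  assumes "a \<in> Hom A W (fst X n)" "b \<in> Hom A W (fst Y n)"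
  shows "tp X Y n a b \<in> cyc (TW X Y t) n W \<longleftrightarrow>
    a \<in> cyc X n W \<and> t n \<cdot> a \<oplus> snd Y n \<cdot> b = Zer A W (fst Y (n - 1))"
proof -
  have W: "W \<in> Ob A" using assms Hom_Ob by blast
  have ab': "snd X n \<cdot> a \<in> Hom A W (fst X (n - 1))" "t n \<cdot> a \<oplus> snd Y n \<cdot> b \<in> Hom A W (fst Y (n - 1))"
    using assms by (auto simp: Hom_iff ab_simps tw_typing)
  have "tp X Y n a b \<in> cyc (TW X Y t) n W \<longleftrightarrow>
    tp X Y (n - 1) (snd X n \<cdot> a) (t n \<cdot> a \<oplus> snd Y n \<cdot> b)
      = tp X Y (n - 1) (Zer A W (fst X (n - 1))) (Zer A W (fst Y (n - 1)))"
    using tw_Hom[OF assms] W by (simp add: cyc_def tw_d[OF assms] pair_Zer fst_TW tw_typing)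
  also have "\<dots> \<longleftrightarrow> snd X n \<cdot> a = Zer A W (fst X (n - 1)) \<and> t n \<cdot> a \<oplus> snd Y n \<cdot> b = Zer A W (fst Y (n - 1))"
    by (rule pair_eq_iff) (use ab' W in \<open>auto intro!: Zer_Hom simp: tw_typing\<close>)
  finally show ?thesis using assms by (simp add: cyc_def)
qed

lemma tw_bnd_iff:
  assumes "a \<in> Hom A W (fst X n)" "b \<in> Hom A W (fst Y n)"
  shows "tp X Y n a b \<in> bnd (TW X Y t) n W \<longleftrightarrow>
    (\<exists>a' \<in> Hom A W (fst X (n + 1)). \<exists>b' \<in> Hom A W (fst Y (n + 1)).
      a = snd X (n + 1) \<cdot> a' \<and> b = t (n + 1) \<cdot> a' \<oplus> snd Y (n + 1) \<cdot> b')" (is "?L \<longleftrightarrow> ?R")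
proof
  assume ?L
  then obtain z where z: "z \<in> Hom A W (fst (TW X Y t) (n + 1))" "tp X Y n a b = snd (TW X Y t) (n + 1) \<cdot> z"
    using bndE by metis
  obtain a' b' where ab: "a' \<in> Hom A W (fst X (n + 1))" "b' \<in> Hom A W (fst Y (n + 1))"
    "z = tp X Y (n + 1) a' b'" using tw_cases[OF z(1)] by metis
  have "tp X Y n a b = tp X Y n (snd X (n + 1) \<cdot> a') (t (n + 1) \<cdot> a' \<oplus> snd Y (n + 1) \<cdot> b')"
    unfolding z(2) ab(3) using tw_d[OF ab(1,2)] by simp
  moreover have "snd X (n + 1) \<cdot> a' \<in> Hom A W (fst X n)" "t (n + 1) \<cdot> a' \<oplus> snd Y (n + 1) \<cdot> b' \<in> Hom A W (fst Y n)"
    using ab by (auto simp: Hom_iff ab_simps tw_typing)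
  ultimately show ?R using ab(1,2) pair_eq_iff[OF assms] by blast
next
  assume ?R
  then obtain a' b' where ab: "a' \<in> Hom A W (fst X (n + 1))" "b' \<in> Hom A W (fst Y (n + 1))"
    "a = snd X (n + 1) \<cdot> a'" "b = t (n + 1) \<cdot> a' \<oplus> snd Y (n + 1) \<cdot> b'" by blast
  show ?L by (rule bndI[OF tw_Hom[OF ab(1,2)]]) (use tw_d[OF ab(1,2)] ab(3,4) in simp)
qed

lemma tw_incl: "chain_map A (Y, \<lambda>n. bj (fst X n) (fst Y n), TW X Y t)"
proof (rule chain_mapI[OF tw_cplx(2) tw_complex])
  show "bj (fst X n) (fst Y n) \<in> Hom A (fst Y n) (fst (TW X Y t) n)" for n
    by (simp add: Hom_iff bsum_simps tw_typing fst_TW)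
  show "snd (TW X Y t) n \<cdot> bj (fst X n) (fst Y n) = bj (fst X (n - 1)) (fst Y (n - 1)) \<cdot> snd Y n" for n
  proof -
    have e: "bj (fst X m) (fst Y m) \<cdot> b = tp X Y m (Zer A W (fst X m)) b" if "b \<in> Hom A W (fst Y m)" for b W m
      using that Hom_Ob[OF that] by (simp add: pair_def Hom_iff ab_simps bsum_simps tw_typing)
    have i: "Ident A (fst Y n) \<in> Hom A (fst Y n) (fst Y n)" "Zer A (fst Y n) (fst X n) \<in> Hom A (fst Y n) (fst X n)"
      by (auto intro!: Ident_Hom Zer_Hom simp: tw_typing)
    have dn: "snd Y n \<in> Hom A (fst Y n) (fst Y (n - 1))" by (simp add: Hom_iff tw_typing)
    have "snd (TW X Y t) n \<cdot> bj (fst X n) (fst Y n)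
      = snd (TW X Y t) n \<cdot> tp X Y n (Zer A (fst Y n) (fst X n)) (Ident A (fst Y n))"
      using e[OF i(1)] by (simp add: cat_simps bsum_simps tw_typing)
    also have "\<dots> = tp X Y (n - 1) (Zer A (fst Y n) (fst X (n - 1))) (snd Y n)"
      unfolding tw_d[OF i(2,1)] by (simp add: ab_simps tw_typing)
    finally show ?thesis using e[OF dn] by simp
  qed
qed

lemma tw_incl_elt:
  assumes "b \<in> Hom A W (fst Y n)"
  shows "bj (fst X n) (fst Y n) \<cdot> b = tp X Y n (Zer A W (fst X n)) b"
  using assms Hom_Ob[OF assms] by (simp add: pair_def Hom_iff ab_simps bsum_simps tw_typing)

text \<open>Condition \<open>uv\<close> says that \<open>u\<close> is a null-homotopy of
  \<open>v\<close> composed with \<open>t\<close>. This is what it takes to extend \<open>v\<close>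
  from the subcomplex \<open>Y\<close> to the twisted sum.\<close>

lemma tw_out:
  assumes v: "chain_map A (Y, v, Z)" and u: "\<And>n. u n \<in> Hom A (fst X n) (fst Z n)"
    and uv: "\<And>n. snd Z n \<cdot> u n = u (n - 1) \<cdot> snd X n \<oplus> v (n - 1) \<cdot> t n"
  shows "chain_map A (TW X Y t, \<lambda>n. copair (fst X n) (fst Y n) (u n) (v n), Z)"
proof (rule chain_mapI[OF tw_complex])
  note c = chmap_simps[OF v]
  show Z: "chain_complex A Z" by (rule c)
  have vH: "v n \<in> Hom A (fst Y n) (fst Z n)" for n using c by (simp add: Hom_iff)
  show H: "copair (fst X n) (fst Y n) (u n) (v n) \<in> Hom A (fst (TW X Y t) n) (fst Z n)" for n
    using copair_Hom[OF u vH] by (simp add: fst_TW)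
  show "snd Z n \<cdot> copair (fst X n) (fst Y n) (u n) (v n)
      = copair (fst X (n - 1)) (fst Y (n - 1)) (u (n - 1)) (v (n - 1)) \<cdot> snd (TW X Y t) n" for n
  proof (rule bsum_hom_ext[of "fst X n" "fst Y n" _ "fst Z (n - 1)"])
    show "fst X n \<in> Ob A" "fst Y n \<in> Ob A" by (simp_all add: tw_typing)
    have dZ: "snd Z n \<in> Hom A (fst Z n) (fst Z (n - 1))" using cplx_simps[OF Z] by (simp add: Hom_iff)
    show "snd Z n \<cdot> copair (fst X n) (fst Y n) (u n) (v n) \<in> Hom A (bS (fst X n) (fst Y n)) (fst Z (n - 1))"
      using Comp_Hom[OF H dZ] by (simp add: fst_TW)
    show "copair (fst X (n - 1)) (fst Y (n - 1)) (u (n - 1)) (v (n - 1)) \<cdot> snd (TW X Y t) n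
        \<in> Hom A (bS (fst X n) (fst Y n)) (fst Z (n - 1))"
      using Comp_Hom[OF tw_snd_Hom H] by (simp add: fst_TW)
    fix W a b assume ab: "a \<in> Hom A W (fst X n)" "b \<in> Hom A W (fst Y n)"
    have ab': "snd X n \<cdot> a \<in> Hom A W (fst X (n - 1))" "t n \<cdot> a \<oplus> snd Y n \<cdot> b \<in> Hom A W (fst Y (n - 1))"
      using ab by (auto simp: Hom_iff ab_simps tw_typing)
    have uA: "u m \<in> Ar A" "Dom A (u m) = fst X m" "Cod A (u m) = fst Z m" for m using u[of m] by (auto simp: Hom_iff)
    have "(snd Z n \<cdot> copair (fst X n) (fst Y n) (u n) (v n)) \<cdot> tp X Y n a b
      = snd Z n \<cdot> (u n \<cdot> a \<oplus> v n \<cdot> b)"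
      unfolding copair_pair[OF u vH ab, symmetric]
      using dZ H[of n] tw_Hom[OF ab] by (simp add: Hom_iff cat_simps)
    also have "\<dots> = (snd Z n \<cdot> u n) \<cdot> a \<oplus> (snd Z n \<cdot> v n) \<cdot> b"
      using ab uA c(3-5) cplx_simps(1-4)[OF Z] by (simp add: Comp_Add cat_simps Hom_iff)
    also have "\<dots> = (u (n - 1) \<cdot> snd X n \<oplus> v (n - 1) \<cdot> t n) \<cdot> a \<oplus> (v (n - 1) \<cdot> snd Y n) \<cdot> b"
      unfolding uv c(6) ..
    also have "\<dots> = u (n - 1) \<cdot> (snd X n \<cdot> a) \<oplus> v (n - 1) \<cdot> (t n \<cdot> a \<oplus> snd Y n \<cdot> b)"
      using ab uA c(3-5) by (simp add: ab_simps Hom_iff tw_typing)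
    also have "\<dots> = copair (fst X (n - 1)) (fst Y (n - 1)) (u (n - 1)) (v (n - 1)) \<cdot> (snd (TW X Y t) n \<cdot> tp X Y n a b)"
      unfolding tw_d[OF ab] by (rule copair_pair[OF u vH ab', symmetric])
    also have "\<dots> = (copair (fst X (n - 1)) (fst Y (n - 1)) (u (n - 1)) (v (n - 1)) \<cdot> snd (TW X Y t) n) \<cdot> tp X Y n a b"
      using tw_snd_Hom[of n] H[of "n - 1"] tw_Hom[OF ab] by (simp add: Hom_iff cat_simps)
    finally show "(snd Z n \<cdot> copair (fst X n) (fst Y n) (u n) (v n)) \<cdot> tp X Y n a b
      = (copair (fst X (n - 1)) (fst Y (n - 1)) (u (n - 1)) (v (n - 1)) \<cdot> snd (TW X Y t) n) \<cdot> tp X Y n a b" .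
  qed
qed

lemma tw_proj: "chain_map A (TW X Y t, \<lambda>n. bp (fst X n) (fst Y n), X)"
proof (rule chain_mapI[OF tw_complex tw_cplx(1)])
  show "bp (fst X n) (fst Y n) \<in> Hom A (fst (TW X Y t) n) (fst X n)" for n
    by (simp add: Hom_iff bsum_simps tw_typing fst_TW)
  show "snd X n \<cdot> bp (fst X n) (fst Y n) = bp (fst X (n - 1)) (fst Y (n - 1)) \<cdot> snd (TW X Y t) n" for n
    by (simp add: TW_def ab_simps bsum_simps bsum_Comp_simps tw_typing)
qed

end

subsection \<open>Complexes with zero differential and attaching cells\<close>

definition zd :: "(int \<Rightarrow> 'o) \<Rightarrow> ('o, 'm) cplx" where
  "zd G = (G, \<lambda>n. Zer A (G n) (G (n - 1)))"

lemma zd_complex: "(\<And>n. G n \<in> Ob A) \<Longrightarrow> chain_complex A (zd G)"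
  by (rule chain_complexI) (simp_all add: zd_def Zer_Hom ab_simps)

lemma zd_fst: "fst (zd G) = G"
  by (simp add: zd_def)

lemma zd_snd: "snd (zd G) n = Zer A (G n) (G (n - 1))"
  by (simp add: zd_def)

lemma zd_cyc: "(\<And>n. G n \<in> Ob A) \<Longrightarrow> x \<in> cyc (zd G) n W \<longleftrightarrow> x \<in> Hom A W (G n)"
  by (auto simp: cyc_def zd_fst zd_snd Hom_iff Comp_Zer)

lemma zd_bnd: "(\<And>n. G n \<in> Ob A) \<Longrightarrow> W \<in> Ob A \<Longrightarrow> x \<in> bnd (zd G) n W \<longleftrightarrow> x = Zer A W (G n)"
  by (auto simp: bnd_def zd_fst zd_snd Hom_iff Comp_Zer image_iff Zer_simps intro!: exI[of _ "Zer A W (G (n + 1))"])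

lemma zd_chain_map:
  assumes "\<And>n. G n \<in> Ob A" "chain_complex A Y"
  shows "chain_map A (zd G, f, Y) \<longleftrightarrow> (\<forall>n. f n \<in> cyc Y n (G n))"
proof -
  have "f (n - 1) \<cdot> snd (zd G) n = Zer A (G n) (fst Y (n - 1))" if "\<forall>n. f n \<in> Hom A (G n) (fst Y n)" for n
    using that[rule_format, of "n - 1"] assms(1) by (simp add: zd_snd Hom_iff Comp_Zer)
  thus ?thesis using zd_complex[OF assms(1)] assms(2) by (auto simp: chain_map_def cyc_def zd_fst)
qed

text \<open>Cells \<open>G n\<close> of degree \<open>n\<close> are attached to \<open>Y\<close>
  along arrows \<open>t n\<close> into degree \<open>n - 1\<close>. With zero differential on the
  cells, being a twisting means just that these arrows are cycles.\<close>

abbreviation "att Y G t \<equiv> TW (zd G) Y t"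

lemma att_twisting:
  assumes "\<And>n. G n \<in> Ob A" "chain_complex A Y" "\<And>n. t n \<in> cyc Y (n - 1) (G n)"
  shows "twisting (zd G) Y t"
proof -
  have "t n \<in> Ar A \<and> Dom A (t n) = G n \<and> Cod A (t n) = fst Y (n - 1)" for n
    using cyc_Hom[OF assms(3)] by (simp add: Hom_iff)
  moreover have "snd Y (n - 1) \<cdot> t n = Zer A (G n) (fst Y (n - 2))" for n
    using assms(3)[of n] by (simp add: cyc_def)
  ultimately show ?thesis
    using assms(1,2) by (simp add: twisting_def zd_complex zd_fst zd_snd Hom_iff ab_simps cplx_simps)
qed

end

section \<open>The derived category as a localization\<close>

lemma ex1_mem_eq: "\<exists>!f. f \<in> S \<Longrightarrow> a \<in> S \<Longrightarrow> b \<in> S \<Longrightarrow> a = b"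
  by blast

lemma Ch_simps:
  "Ob (Ch A) = {X. chain_complex A X}" "Ar (Ch A) = {\<phi>. chain_map A \<phi>}"
  "Dom (Ch A) (X, f, Y) = X" "Cod (Ch A) (X, f, Y) = Y"
  "Ident (Ch A) X = (X, (\<lambda>n. Ident A (fst X n)), X)"
  "(Y', g, Z) \<cdot>\<^bsub>Ch A\<^esub> (X, f, Y) = (X, (\<lambda>n. g n \<cdot>\<^bsub>A\<^esub> f n), Z)"
  by (simp_all add: Ch_def)

lemma Ch_Hom: "\<phi> \<in> Hom (Ch A) X Y \<longleftrightarrow> (\<exists>f. \<phi> = (X, f, Y) \<and> chain_map A (X, f, Y))"
  by (cases \<phi>) (auto simp: Hom_iff Ch_simps)

lemma derived_simps:
  "Ob (derived A) = Ob (loc_derived A)" "Ar (derived A) = Ar (loc_derived A)"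
  "Dom (derived A) = Dom (loc_derived A)" "Cod (derived A) = Cod (loc_derived A)"
  "Ident (derived A) = Ident (loc_derived A)" "Comp (derived A) = Comp (loc_derived A)"
  "Susp (derived A) = shift_cplx A" "SuspAr (derived A) = shift_darrow A"
  "Tri (derived A) = derived_triangles A"
  by (simp_all add: derived_def category.defs tri_category.defs)

lemma derived_Hom: "Hom (derived A) X Y = Hom (loc_derived A) X Y"
  by (simp add: Hom_def derived_simps)

text \<open>\<open>derived\<close> extends the record of the localization by suspension and
  triangles, and purely categorical notions do not see the extension. The arguments run in
  \<open>loc_derived\<close> and are carried back by these equations.\<close>

lemma derived_notions:
  "zero_object (derived A) X \<longleftrightarrow> zero_object (loc_derived A) X"
  "zero_arrow (derived A) \<alpha> \<longleftrightarrow> zero_arrow (loc_derived A) \<alpha>"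
  "isomorphic (derived A) X Y \<longleftrightarrow> isomorphic (loc_derived A) X Y"
  "retract_of (derived A) X Y \<longleftrightarrow> retract_of (loc_derived A) X Y"
  "composite (derived A) X f k = composite (loc_derived A) X f k"
  by (simp_all add: zero_object_def zero_arrow_def isomorphic_def iso_arrow_def inverse_arrows_def
      retract_of_def derived_simps derived_Hom) (induction k, simp_all add: derived_simps)

context projective_abelian_category
begin

section \<open>Chain complexes as a category, and its localization at the quasi-isomorphisms\<close>

lemma chain_map_Ident: "chain_complex A X \<Longrightarrow> chain_map A (X, \<lambda>n. Ident A (fst X n), X)"
  by (rule chain_mapI) (auto simp: cplx_simps cat_simps intro!: Ident_Hom)

lemma chain_map_Comp:
  assumes "chain_map A (X, f, Y)" "chain_map A (Y, g, Z)"
  shows "chain_map A (X, \<lambda>n. g n \<cdot> f n, Z)"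
proof (rule chain_mapI)
  note f = chmap_simps[OF assms(1)] and g = chmap_simps[OF assms(2)]
  show "chain_complex A X" "chain_complex A Z" by (rule f g)+
  show "g n \<cdot> f n \<in> Hom A (fst X n) (fst Z n)" for n using f g by (simp add: Hom_iff cat_simps)
  have fH: "f n \<in> Hom A (fst X n) (fst Y n)" for n using f by (simp add: Hom_iff)
  show "snd Z n \<cdot> (g n \<cdot> f n) = (g (n - 1) \<cdot> f (n - 1)) \<cdot> snd X n" for n
    unfolding chmap_Comp[OF assms(2) fH] f(6)
    using f(3-5) g(3-5) cplx_simps(1-4)[OF f(1)] by (simp add: cat_simps)
qed

lemma chain_map_Zer:
  assumes "chain_complex A X" "chain_complex A Y"
  shows "chain_map A (X, \<lambda>n. Zer A (fst X n) (fst Y n), Y)"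
  by (rule chain_mapI) (use assms in \<open>auto simp: cplx_simps ab_simps intro!: Zer_Hom\<close>)

lemma category_Ch: "category (Ch A)"
proof
  show "f \<in> Ar (Ch A) \<Longrightarrow> Dom (Ch A) f \<in> Ob (Ch A)" "f \<in> Ar (Ch A) \<Longrightarrow> Cod (Ch A) f \<in> Ob (Ch A)" for f
    by (cases f; auto simp: Ch_simps chain_map_def)+
  show "X \<in> Ob (Ch A) \<Longrightarrow> Ident (Ch A) X \<in> Hom (Ch A) X X" for X
    by (auto simp: Ch_simps Ch_Hom chain_map_Ident)
  show "f \<in> Hom (Ch A) X Y \<Longrightarrow> g \<in> Hom (Ch A) Y Z \<Longrightarrow> g \<cdot>\<^bsub>Ch A\<^esub> f \<in> Hom (Ch A) X Z" for f g X Y Z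
    by (auto simp: Ch_Hom Ch_simps chain_map_Comp)
  show "f \<in> Hom (Ch A) X Y \<Longrightarrow> Ident (Ch A) Y \<cdot>\<^bsub>Ch A\<^esub> f = f" for f X Y
    by (auto simp: Ch_Hom Ch_simps chmap_simps cat_simps)
  show "f \<in> Hom (Ch A) X Y \<Longrightarrow> f \<cdot>\<^bsub>Ch A\<^esub> Ident (Ch A) X = f" for f X Y
    by (auto simp: Ch_Hom Ch_simps chmap_simps cat_simps)
  show "f \<in> Hom (Ch A) X Y \<Longrightarrow> g \<in> Hom (Ch A) Y Z \<Longrightarrow> h \<in> Hom (Ch A) Z W
    \<Longrightarrow> h \<cdot>\<^bsub>Ch A\<^esub> (g \<cdot>\<^bsub>Ch A\<^esub> f) = (h \<cdot>\<^bsub>Ch A\<^esub> g) \<cdot>\<^bsub>Ch A\<^esub> f" for f g h X Y Z W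
    by (auto simp: Ch_Hom Ch_simps chmap_simps cat_simps)
qed

sublocale D: localizing "Ch A" "quasi_isos A"
proof (rule localizing.intro[OF category_Ch])
  show "localizing_axioms (Ch A) (quasi_isos A)"
    by unfold_locales (auto simp: quasi_isos_def Ch_simps)
qed

abbreviation D_Comp (infixr "\<star>" 70) where "\<beta> \<star> \<alpha> \<equiv> \<beta> \<cdot>\<^bsub>D.L\<^esub> \<alpha>"

lemma Q_Hom: "chain_map A (X, f, Y) \<Longrightarrow> D.Q (X, f, Y) \<in> Hom D.L X Y"
  by (rule D.Q_Hom) (auto simp: Ch_Hom)

lemma Q_Comp:
  "chain_map A (X, f, Y) \<Longrightarrow> chain_map A (Y, g, Z)
    \<Longrightarrow> D.Q (Y, g, Z) \<star> D.Q (X, f, Y) = D.Q (X, \<lambda>n. g n \<cdot> f n, Z)"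
  using D.Q_Comp[of "(X, f, Y)" X Y "(Y, g, Z)" Z] by (simp add: Ch_Hom Ch_simps)

lemma Q_Ident: "chain_complex A X \<Longrightarrow> D.Q (X, \<lambda>n. Ident A (fst X n), X) = Ident D.L X"
  using D.Q_Ident[of X] by (simp add: Ch_simps)

lemma Q_cong:
  "(\<And>n. f n = g n) \<Longrightarrow> D.Q (X, f, Y) = D.Q (X, g, Y)"
  by (metis ext)

lemma L_Ob: "X \<in> Ob D.L \<longleftrightarrow> chain_complex A X"
  by (simp add: D.loc_Ob Ch_simps)

lemma L_Hom_cplx: "\<alpha> \<in> Hom D.L X Y \<Longrightarrow> chain_complex A X \<and> chain_complex A Y"
  using D.L.Hom_Ob[of \<alpha> X Y] by (simp add: L_Ob)

lemma quasi_iso_chmap: "(X, f, Y) \<in> quasi_isos A \<Longrightarrow> chain_map A (X, f, Y)"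
  by (simp add: quasi_isos_def)

lemma Qinv:
  assumes "(X, f, Y) \<in> quasi_isos A"
  shows "D.Qinv (X, f, Y) \<in> Hom D.L Y X" "D.Qinv (X, f, Y) \<star> D.Q (X, f, Y) = Ident D.L X"
    "D.Q (X, f, Y) \<star> D.Qinv (X, f, Y) = Ident D.L Y"
  using D.Qinv_inverse[OF assms, of X Y] quasi_iso_chmap[OF assms] by (auto simp: Ch_Hom)

lemma Qinv_Comp:
  assumes w: "(X, w, Y) \<in> quasi_isos A" and a: "\<alpha> \<in> Hom D.L V X" and b: "\<beta> = D.Q (X, w, Y) \<star> \<alpha>"
  shows "D.Qinv (X, w, Y) \<star> \<beta> = \<alpha>"
  using D.L.Comp_assoc[OF a Q_Hom[OF quasi_iso_chmap[OF w]] Qinv(1)[OF w]] Qinv(2)[OF w]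
    D.L.Ident_left[OF a] b by simp

lemma Comp_Qinv:
  assumes w: "(X, w, Y) \<in> quasi_isos A" and a: "\<alpha> \<in> Hom D.L Y V" and b: "\<beta> = \<alpha> \<star> D.Q (X, w, Y)"
  shows "\<beta> \<star> D.Qinv (X, w, Y) = \<alpha>"
  using D.L.Comp_assoc[OF Qinv(1)[OF w] Q_Hom[OF quasi_iso_chmap[OF w]] a] Qinv(3)[OF w]
    D.L.Ident_right[OF a] b by simp

lemma L_induct [consumes 1, case_names Ident Fwd Bwd]:
  assumes "\<alpha> \<in> Hom D.L X Y"
    and "chain_complex A Y \<Longrightarrow> P Y (Ident D.L Y)"
    and "\<And>X Z f \<beta>. chain_map A (X, f, Z) \<Longrightarrow> \<beta> \<in> Hom D.L Z Y \<Longrightarrow> P Z \<beta>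
      \<Longrightarrow> P X (\<beta> \<star> D.Q (X, f, Z))"
    and "\<And>X Z w \<beta>. (Z, w, X) \<in> quasi_isos A \<Longrightarrow> \<beta> \<in> Hom D.L Z Y \<Longrightarrow> P Z \<beta>
      \<Longrightarrow> P X (\<beta> \<star> D.Qinv (Z, w, X))"
  shows "P X \<alpha>"
  using assms(1)
  by (rule D.loc_induct) (use assms(2-) in \<open>auto simp: Ch_simps Ch_Hom\<close>)

subsection \<open>Zero arrows\<close>

text \<open>A fixed representative of the zero arrow, which turns vanishing into an equation;
  \<open>zero_arrow_iff\<close> shows that it agrees with factorization through a zero
  object.\<close>

definition zarr where "zarr X Y = D.Q (X, \<lambda>n. Zer A (fst X n) (fst Y n), Y)"

lemma zarr_Hom: "chain_complex A X \<Longrightarrow> chain_complex A Y \<Longrightarrow> zarr X Y \<in> Hom D.L X Y"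
  unfolding zarr_def by (intro Q_Hom chain_map_Zer)

lemma zarr_Q:
  assumes "chain_map A (X, f, Y)" "chain_complex A V"
  shows "zarr Y V \<star> D.Q (X, f, Y) = zarr X V" "D.Q (X, f, Y) \<star> zarr V X = zarr V Y"
  unfolding zarr_def using assms chmap_simps[OF assms(1)]
  by (subst Q_Comp; auto simp: chain_map_Zer Comp_Zer cplx_simps)+

text \<open>No addition of arrows is at hand in the localization, so absorption of zero is proved
  letter by letter: for chain maps it holds degreewise in the abelian category, and a formal inverse
  is moved to the other side of the equation.\<close>

lemma zarr_Comp:
  assumes "\<alpha> \<in> Hom D.L X Y" "chain_complex A V"
  shows "zarr Y V \<star> \<alpha> = zarr X V"
  using assms(1)
proof (induction rule: L_induct)
  case Ident
  thus ?case using D.L.Ident_right zarr_Hom assms(2) by blast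
next
  case (Fwd X Z f \<beta>)
  have "chain_complex A Y" using L_Hom_cplx[OF Fwd(2)] by simp
  from D.L.Comp_assoc[OF Q_Hom[OF Fwd(1)] Fwd(2) zarr_Hom[OF this assms(2)]]
  show ?case using Fwd(3) zarr_Q(1)[OF Fwd(1) assms(2)] by simp
next
  case (Bwd X Z w \<beta>)
  have Y: "chain_complex A Y" and Z: "chain_complex A X" using L_Hom_cplx[OF Bwd(2)]
    chmap_simps[OF quasi_iso_chmap[OF Bwd(1)]] by auto
  have "zarr Z V \<star> D.Qinv (Z, w, X) = zarr X V"
    by (rule Comp_Qinv[OF Bwd(1) zarr_Hom[OF Z assms(2)]])
      (simp add: zarr_Q[OF quasi_iso_chmap[OF Bwd(1)] assms(2)])
  with D.L.Comp_assoc[OF Qinv(1)[OF Bwd(1)] Bwd(2) zarr_Hom[OF Y assms(2)]]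
  show ?case using Bwd(3) by simp
qed

lemma Comp_zarr:
  assumes "\<alpha> \<in> Hom D.L X Y" "chain_complex A V"
  shows "\<alpha> \<star> zarr V X = zarr V Y"
  using assms(1)
proof (induction rule: L_induct)
  case Ident
  thus ?case using D.L.Ident_left zarr_Hom assms(2) by blast
next
  case (Fwd X Z f \<beta>)
  have "chain_complex A X" using chmap_simps[OF Fwd(1)] by simp
  from D.L.Comp_assoc[OF zarr_Hom[OF assms(2) this] Q_Hom[OF Fwd(1)] Fwd(2)]
  show ?case using Fwd(3) zarr_Q(2)[OF Fwd(1) assms(2)] by simp
next
  case (Bwd X Z w \<beta>)
  have Z: "chain_complex A X" "chain_complex A Z" using chmap_simps[OF quasi_iso_chmap[OF Bwd(1)]] by auto
  have "D.Qinv (Z, w, X) \<star> zarr V X = zarr V Z"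
    by (rule Qinv_Comp[OF Bwd(1) zarr_Hom[OF assms(2) Z(2)]])
      (simp add: zarr_Q[OF quasi_iso_chmap[OF Bwd(1)] assms(2)])
  with D.L.Comp_assoc[OF zarr_Hom[OF assms(2) Z(1)] Qinv(1)[OF Bwd(1)] Bwd(2)]
  show ?case using Bwd(3) by simp
qed

lemma zero_object_if_zarr:
  assumes X: "chain_complex A X" and "Ident D.L X = zarr X X"
  shows "zero_object D.L X"
proof -
  have "f = zarr X Y" if "f \<in> Hom D.L X Y" for f Y
    using D.L.Ident_right[OF that] Comp_zarr[OF that X] assms(2) by simp
  moreover have "f = zarr Y X" if "f \<in> Hom D.L Y X" for f Y
    using D.L.Ident_left[OF that] zarr_Comp[OF that X] assms(2) by simp
  ultimately have "\<exists>!f. f \<in> Hom D.L X Y" "\<exists>!f. f \<in> Hom D.L Y X" if "Y \<in> Ob D.L" for Y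
    using zarr_Hom[OF X, of Y] zarr_Hom[OF _ X, of Y] that unfolding L_Ob by blast+
  thus ?thesis using X by (simp add: zero_object_def L_Ob)
qed

definition "zo = (SOME Z. zero_object A Z)"

lemma zo: "zero_object A zo" "zo \<in> Ob A"
  using someI_ex[OF ex_zero_object] by (auto simp: zo_def zero_object_def)

abbreviation "Oc \<equiv> zd (\<lambda>_. zo)"

lemma Oc_complex: "chain_complex A Oc"
  by (rule zd_complex) (rule zo)

text \<open>The map to the zero complex \<open>Oc\<close> is a quasi-isomorphism, so in the derived
  category the identity of \<open>X\<close> factors through \<open>Oc\<close> and hence equals the
  zero arrow.\<close>

lemma acyclic_zero_object:
  assumes X: "chain_complex A X" and "\<And>P n. projective A P \<Longrightarrow> cyc X n P \<subseteq> bnd X n P"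
  shows "zero_object D.L X"
proof (rule zero_object_if_zarr[OF X])
  let ?w = "\<lambda>n. Zer A (fst X n) (fst Oc n)"
  have "(X, ?w, Oc) \<in> quasi_isos A"
    unfolding quasi_iso_iff
  proof (intro conjI allI impI ballI)
    show "chain_map A (X, ?w, Oc)" by (rule chain_map_Zer[OF X Oc_complex])
    fix P n assume P: "projective A P"
    fix y assume y: "y \<in> cyc Oc n P"
    have yz: "y = Zer A P zo" using zero_object_Zer(2)[OF zo(1), of y] cyc_Hom[OF y]
      by (simp add: zd_fst Hom_iff)
    show "\<exists>x \<in> cyc X n P. \<exists>b \<in> bnd Oc n P. y = ?w n \<cdot> x \<oplus> b"
      using bnd_cyc[OF X bnd_Zer[OF X projective_Ob[OF P]]] bnd_Zer[OF Oc_complex projective_Ob[OF P]]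
        cplx_simps(1)[OF X] projective_Ob[OF P] zo(2)
      by (intro bexI[of _ "Zer A P (fst X n)"] bexI[of _ "Zer A P zo"])
        (auto simp: zd_fst ab_simps yz)
  qed (use assms(2) in blast)
  from Qinv_Comp[OF this D.L.Ident_Hom[of X]] X
  have "D.Qinv (X, ?w, Oc) \<star> zarr X Oc = Ident D.L X"
    unfolding zarr_def by (simp add: L_Ob D.L.Ident_right[OF Q_Hom[OF chain_map_Zer[OF X Oc_complex]]])
  thus "Ident D.L X = zarr X X"
    using Comp_zarr[OF Qinv(1)[OF \<open>(X, ?w, Oc) \<in> quasi_isos A\<close>] X] by simp
qed

lemma zero_object_Oc: "zero_object D.L Oc"
proof (rule acyclic_zero_object[OF Oc_complex])
  fix P n assume P: "projective A P"
  show "cyc Oc n P \<subseteq> bnd Oc n P"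
    using zero_object_Zer(2)[OF zo(1)] zo(2) projective_Ob[OF P]
    by (auto simp: zd_cyc zd_bnd Hom_iff)
qed

lemma zero_object_zarr:
  assumes "zero_object D.L Z"
  shows "chain_complex A Z" "\<alpha> \<in> Hom D.L X Z \<Longrightarrow> \<alpha> = zarr X Z" "\<alpha> \<in> Hom D.L Z X \<Longrightarrow> \<alpha> = zarr Z X"
proof -
  show Z: "chain_complex A Z" using assms by (simp add: zero_object_def L_Ob)
  show "\<alpha> = zarr X Z" if a: "\<alpha> \<in> Hom D.L X Z"
  proof -
    have X: "chain_complex A X" using L_Hom_cplx[OF a] by simp
    hence "\<exists>!f. f \<in> Hom D.L X Z" using assms by (simp add: zero_object_def L_Ob)
    thus ?thesis by (rule ex1_mem_eq[OF _ a zarr_Hom[OF X Z]])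
  qed
  show "\<alpha> = zarr Z X" if a: "\<alpha> \<in> Hom D.L Z X"
  proof -
    have X: "chain_complex A X" using L_Hom_cplx[OF a] by simp
    hence "\<exists>!f. f \<in> Hom D.L Z X" using assms by (simp add: zero_object_def L_Ob)
    thus ?thesis by (rule ex1_mem_eq[OF _ a zarr_Hom[OF Z X]])
  qed
qed

lemma zero_arrow_iff:
  assumes a: "\<alpha> \<in> Hom D.L X Y"
  shows "zero_arrow D.L \<alpha> \<longleftrightarrow> \<alpha> = zarr X Y"
proof
  have XY: "Dom D.L \<alpha> = X" "Cod D.L \<alpha> = Y" "chain_complex A X" "chain_complex A Y"
    using a L_Hom_cplx[OF a] by (auto simp: Hom_iff)
  {
    assume "zero_arrow D.L \<alpha>"
    then obtain Z g h where Z: "zero_object D.L Z" "g \<in> Hom D.L X Z" "h \<in> Hom D.L Z Y" "\<alpha> = h \<star> g"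
      using XY by (auto simp: zero_arrow_def)
    have "g = zarr X Z" using zero_object_zarr Z by blast
    thus "\<alpha> = zarr X Y" using Comp_zarr[OF Z(3) XY(3)] Z(4) by simp
  }
  assume "\<alpha> = zarr X Y"
  hence "\<alpha> = zarr Oc Y \<star> zarr X Oc"
    using zarr_Comp[OF zarr_Hom[OF XY(3) Oc_complex] XY(4)] by simp
  thus "zero_arrow D.L \<alpha>"
    unfolding zero_arrow_def XY using zero_object_Oc zarr_Hom XY(3,4) Oc_complex by blast
qed

subsection \<open>Homology on the derived category\<close>

lemma homology_map_Ident:
  assumes X: "chain_complex A X"
  shows "homology_map A n (X, \<lambda>n. Ident A (fst X n), X) = Ident A (homology A n X)"
proof (rule homology_ext[OF X])
  note h = homology_map[OF chain_map_Ident[OF X]]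
  show "homology_map A n (X, \<lambda>n. Ident A (fst X n), X) \<in> Hom A (homology A n X) (homology A n X)" by (rule h)
  show "Ident A (homology A n X) \<in> Hom A (homology A n X) (homology A n X)"
    by (rule Ident_Hom[OF homology_Ob[OF X]])
  fix W x assume x: "x \<in> cyc X n W"
  show "homology_map A n (X, \<lambda>n. Ident A (fst X n), X) \<cdot> hcl X n x = Ident A (homology A n X) \<cdot> hcl X n x"
    using h(2)[OF x] cyc_Hom[OF x] hcl_Hom[OF X x] by (simp add: Hom_iff cat_simps)
qed

lemma homology_map_Comp:
  assumes f: "chain_map A (X, f, Y)" and g: "chain_map A (Y, g, Z)"
  shows "homology_map A n (X, \<lambda>n. g n \<cdot> f n, Z) = homology_map A n (Y, g, Z) \<cdot> homology_map A n (X, f, Y)"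
proof (rule homology_ext)
  note hf = homology_map[OF f] and hg = homology_map[OF g] and h = homology_map[OF chain_map_Comp[OF f g]]
  show X: "chain_complex A X" by (rule chmap_simps[OF f])
  show "homology_map A n (X, \<lambda>n. g n \<cdot> f n, Z) \<in> Hom A (homology A n X) (homology A n Z)" by (rule h)
  show "homology_map A n (Y, g, Z) \<cdot> homology_map A n (X, f, Y) \<in> Hom A (homology A n X) (homology A n Z)"
    by (rule Comp_Hom[OF hf(1) hg(1)])
  fix W x assume x: "x \<in> cyc X n W"
  have "(homology_map A n (Y, g, Z) \<cdot> homology_map A n (X, f, Y)) \<cdot> hcl X n x
    = homology_map A n (Y, g, Z) \<cdot> (homology_map A n (X, f, Y) \<cdot> hcl X n x)"
    using hf(1)[of n] hg(1)[of n] hcl_Hom[OF X x] by (simp add: Hom_iff Comp_assoc_simp)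
  also have "\<dots> = hcl Z n (g n \<cdot> (f n \<cdot> x))" unfolding hf(2)[OF x] by (rule hg(2)[OF chmap_cyc[OF f x]])
  also have "g n \<cdot> (f n \<cdot> x) = (g n \<cdot> f n) \<cdot> x"
    using chmap_simps(3-5)[OF f] chmap_simps(3-5)[OF g] cyc_Hom[OF x] by (simp add: Hom_iff Comp_assoc_simp)
  finally show "homology_map A n (X, \<lambda>n. g n \<cdot> f n, Z) \<cdot> hcl X n x
    = (homology_map A n (Y, g, Z) \<cdot> homology_map A n (X, f, Y)) \<cdot> hcl X n x" using h(2)[OF x] by simp
qed

text \<open>For the converse one projective element is enough: a projective cover of the homology of
  \<open>X\<close>, lifted to a cycle.\<close>

lemma homology_map_Zer_iff:
  assumes f: "chain_map A (X, f, Y)"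
  shows "homology_map A n (X, f, Y) = Zer A (homology A n X) (homology A n Y) \<longleftrightarrow>
    (\<forall>P. projective A P \<longrightarrow> (\<forall>x \<in> cyc X n P. f n \<cdot> x \<in> bnd Y n P))" (is "?h = ?z \<longleftrightarrow> ?R")
proof
  note h = homology_map[OF f] and c = chmap_simps[OF f]
  have o: "homology A n X \<in> Ob A" "homology A n Y \<in> Ob A" using c(1,2) homology_Ob by auto
  {
    assume z: "?h = ?z"
    show ?R
    proof (intro allI impI ballI)
      fix P x assume P: "projective A P" and x: "x \<in> cyc X n P"
      have "hcl Y n (f n \<cdot> x) = Zer A P (homology A n Y)"
        using h(2)[OF x] z hcl_Hom[OF c(1) x] o by (simp add: Hom_iff Comp_Zer)
      thus "f n \<cdot> x \<in> bnd Y n P" by (rule hcl_Zer_imp_bnd[OF c(2) P chmap_cyc[OF f x]])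
    qed
  }
  assume R: ?R
  obtain P e where e: "projective A P" "e \<in> Hom A P (homology A n X)" "epi_arrow A e" using projective_cover[OF o(1)] .
  obtain x where x: "x \<in> cyc X n P" "hcl X n x = e" using hcl_surj[OF c(1) e(1,2)] by metis
  have "f n \<cdot> x \<in> bnd Y n P" using R e(1) x(1) by blast
  hence "?h \<cdot> e = Zer A P (homology A n Y)" using h(2)[OF x(1)] x(2) hcl_bnd[OF c(2)] by simp
  also have "\<dots> = ?z \<cdot> e" using e(2) o by (auto simp: Hom_iff Comp_Zer)
  finally show "?h = ?z" using eq_if_epi[OF e(3,2) h(1)] Zer_Hom[OF o] by blast
qed

lemma letter_homology_Hom:
  assumes "letter_ok (Ch A) (quasi_isos A) l"
  shows "letter_homology A n l
    \<in> Hom A (homology A n (letter_src (Ch A) l)) (homology A n (letter_tgt (Ch A) l))"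
proof (cases l)
  case (Fwd \<phi>)
  obtain X f Y where "\<phi> = (X, f, Y)" by (cases \<phi>)
  thus ?thesis using assms Fwd homology_map(1) by (simp add: Ch_simps)
next
  case (Bwd \<phi>)
  obtain X f Y where p: "\<phi> = (X, f, Y)" by (cases \<phi>)
  hence "inverse_arrows A (homology_map A n (X, f, Y)) (inv_arrow A (homology_map A n (X, f, Y)))"
    and "chain_map A (X, f, Y)"
    using assms Bwd inv_arrow_inverse by (auto simp: quasi_isos_def)
  thus ?thesis using p Bwd homology_map(1)[of X f Y n] by (simp add: Ch_simps inverse_arrows_def Hom_iff)
qed

lemma zigzag_homology_Hom:
  "zigzag (Ch A) (quasi_isos A) X p Y \<Longrightarrow> zigzag_homology A n X p \<in> Hom A (homology A n X) (homology A n Y)"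
proof (induction p arbitrary: X)
  case Nil
  thus ?case by (auto simp: Ch_simps intro!: Ident_Hom homology_Ob)
next
  case (Cons l p)
  thus ?case using letter_homology_Hom[of l n] Comp_Hom by fastforce
qed

lemma zigzag_homology_append:
  "zigzag (Ch A) (quasi_isos A) X p Y \<Longrightarrow> zigzag (Ch A) (quasi_isos A) Y q Z
    \<Longrightarrow> zigzag_homology A n X (p @ q) = zigzag_homology A n Y q \<cdot> zigzag_homology A n X p"
proof (induction p arbitrary: X)
  case Nil
  thus ?case using zigzag_homology_Hom[of Y q Z n] by (auto simp: Hom_iff cat_simps)
next
  case (Cons l p)
  have l: "letter_ok (Ch A) (quasi_isos A) l" "letter_src (Ch A) l = X" and
    p: "zigzag (Ch A) (quasi_isos A) (letter_tgt (Ch A) l) p Y" using Cons.prems by auto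
  show ?case using Cons.IH[OF p Cons.prems(2)] letter_homology_Hom[OF l(1), of n]
    zigzag_homology_Hom[OF p, of n] zigzag_homology_Hom[OF Cons.prems(2), of n]
    by (simp add: Hom_iff Comp_assoc_simp)
qed

lemma zigzag_homology_rel:
  assumes "zigzag_rel (Ch A) (quasi_isos A) a b" "zigzag (Ch A) (quasi_isos A) X a Y"
    "zigzag (Ch A) (quasi_isos A) X b Y"
  shows "zigzag_homology A n X a = zigzag_homology A n X b"
  using assms(1)
proof cases
  case (ident Z)
  thus ?thesis using assms(2) by (auto simp: Ch_simps homology_map_Ident cat_simps homology_Ob)
next
  case (comp f g)
  obtain X' f' Y' where f: "f = (X', f', Y')" by (cases f)
  obtain g' Z' where g: "g = (Y', g', Z')" using comp f by (cases g) (auto simp: Ch_simps)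
  have c: "chain_map A (X', f', Y')" "chain_map A (Y', g', Z')" using comp f g by (auto simp: Ch_simps)
  have "X = X'" using assms(2) comp f by (auto simp: Ch_simps)
  thus ?thesis using comp f g c homology_map(1)[OF c(1), of n] homology_map(1)[OF c(2), of n]
      homology_Ob[of Z' n] chmap_simps(2)[OF c(2)]
    by (auto simp: Ch_simps homology_map_Comp[OF c] Hom_iff cat_simps)
next
  case (inv_right w)
  obtain X' f Y' where f: "w = (X', f, Y')" by (cases w)
  have c: "chain_map A (X', f, Y')" "inverse_arrows A (homology_map A n (X', f, Y')) (inv_arrow A (homology_map A n (X', f, Y')))"
    using inv_right f inv_arrow_inverse by (auto simp: quasi_isos_def)
  have "X = X'" using assms(2) inv_right f by (auto simp: Ch_simps)
  thus ?thesis using inv_right f c(2) homology_map(1)[OF c(1), of n] homology_Ob[OF chmap_simps(1)[OF c(1)], of n]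
    by (auto simp: Ch_simps inverse_arrows_def Hom_iff cat_simps)
next
  case (inv_left w)
  obtain X' f Y' where f: "w = (X', f, Y')" by (cases w)
  have c: "chain_map A (X', f, Y')" "inverse_arrows A (homology_map A n (X', f, Y')) (inv_arrow A (homology_map A n (X', f, Y')))"
    using inv_left f inv_arrow_inverse by (auto simp: quasi_isos_def)
  have "X = Y'" using assms(2) inv_left f by (auto simp: Ch_simps)
  thus ?thesis using inv_left f c(2) homology_map(1)[OF c(1), of n] homology_Ob[OF chmap_simps(2)[OF c(1)], of n]
    by (auto simp: Ch_simps inverse_arrows_def Hom_iff cat_simps)
qed

lemma zigzag_homology_equiv:
  "loc_equiv (Ch A) (quasi_isos A) X Y p q \<Longrightarrow> zigzag_homology A n X p = zigzag_homology A n X q"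
proof (induction rule: loc_equiv.induct)
  case (step a b p q)
  obtain U V where 1: "zigzag (Ch A) (quasi_isos A) X p U" "zigzag (Ch A) (quasi_isos A) U a V"
    "zigzag (Ch A) (quasi_isos A) V q Y" using step(2) by (auto simp: D.zigzag_append)
  obtain U' V' where 2: "zigzag (Ch A) (quasi_isos A) X p U'" "zigzag (Ch A) (quasi_isos A) U' b V'"
    "zigzag (Ch A) (quasi_isos A) V' q Y" using step(3) by (auto simp: D.zigzag_append)
  have U: "U' = U" by (rule D.zigzag_src_unique[OF 2(1) 1(1)])
  \<comment> \<open>\<open>a\<close> and \<open>b\<close> must be seen to end at the same object: it
    is the source of the first letter of \<open>q\<close>, or \<open>Y\<close> if \<open>q\<close>
    is empty.\<close>
  have V: "V' = V"
  proof (cases q)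
    case Nil
    thus ?thesis using 1(3) 2(3) by simp
  next
    case (Cons l q')
    thus ?thesis using 1(3) 2(3) by auto
  qed
  have "zigzag_homology A n X (p @ c @ q)
      = (zigzag_homology A n V q \<cdot> zigzag_homology A n U c) \<cdot> zigzag_homology A n X p"
    if "zigzag (Ch A) (quasi_isos A) U c V" for c
  proof -
    have "zigzag (Ch A) (quasi_isos A) U (c @ q) Y" using that 1(3) D.zigzag_append by blast
    thus ?thesis using zigzag_homology_append[OF that 1(3), of n]
      zigzag_homology_append[OF 1(1), of "c @ q" Y n] by simp
  qed
  thus ?case using zigzag_homology_rel[OF step(1) 1(2), of n] 1(2) 2(2) unfolding U V by simp
qed auto

text \<open>Invariance of \<open>zigzag_homology\<close> under the relations makes the definite
  description in \<open>derived_homology\<close> independent of the representative.\<close>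

lemma derived_homology_class:
  assumes "zigzag (Ch A) (quasi_isos A) X p Y"
  shows "derived_homology A n (loc_class (Ch A) (quasi_isos A) X p Y) = zigzag_homology A n X p"
proof -
  have "(THE h. \<exists>q \<in> {q. loc_equiv (Ch A) (quasi_isos A) X Y p q}. h = zigzag_homology A n X q)
    = zigzag_homology A n X p"
  proof (rule the_equality)
    show "\<exists>q \<in> {q. loc_equiv (Ch A) (quasi_isos A) X Y p q}. zigzag_homology A n X p = zigzag_homology A n X q"
      using loc_equiv.refl[OF assms] by blast
  next
    fix h assume "\<exists>q \<in> {q. loc_equiv (Ch A) (quasi_isos A) X Y p q}. h = zigzag_homology A n X q"
    then obtain q where "loc_equiv (Ch A) (quasi_isos A) X Y p q" "h = zigzag_homology A n X q" by blast
    thus "h = zigzag_homology A n X p" using zigzag_homology_equiv by metis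
  qed
  thus ?thesis by (simp add: derived_homology_def loc_class_def)
qed

lemma derived_homology_Hom:
  assumes "\<alpha> \<in> Hom D.L X Y"
  shows "derived_homology A n \<alpha> \<in> Hom A (homology A n X) (homology A n Y)"
proof -
  obtain p where p: "zigzag (Ch A) (quasi_isos A) X p Y" "\<alpha> = loc_class (Ch A) (quasi_isos A) X p Y"
    using assms unfolding D.loc_Hom by metis
  show ?thesis unfolding p(2) derived_homology_class[OF p(1)] by (rule zigzag_homology_Hom[OF p(1)])
qed

lemma derived_homology_Comp:
  assumes "\<alpha> \<in> Hom D.L X Y" "\<beta> \<in> Hom D.L Y Z"
  shows "derived_homology A n (\<beta> \<star> \<alpha>) = derived_homology A n \<beta> \<cdot> derived_homology A n \<alpha>"
proof -
  obtain p q where p: "zigzag (Ch A) (quasi_isos A) X p Y" "\<alpha> = loc_class (Ch A) (quasi_isos A) X p Y"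
    "zigzag (Ch A) (quasi_isos A) Y q Z" "\<beta> = loc_class (Ch A) (quasi_isos A) Y q Z"
    using assms unfolding D.loc_Hom by metis
  have "zigzag (Ch A) (quasi_isos A) X (p @ q) Z" using p D.zigzag_append by blast
  thus ?thesis using p by (simp add: D.loc_Comp derived_homology_class zigzag_homology_append)
qed

lemma derived_homology_Q:
  assumes "chain_map A (X, f, Y)"
  shows "derived_homology A n (D.Q (X, f, Y)) = homology_map A n (X, f, Y)"
proof -
  have "zigzag (Ch A) (quasi_isos A) X [Fwd (X, f, Y)] Y"
    using assms chmap_simps[OF assms] by (auto simp: Ch_simps)
  thus ?thesis using homology_map(1)[OF assms, of n]
    by (simp add: loc_functor_def derived_homology_class Ch_simps Hom_iff cat_simps)
qed

text \<open>Homology is defined on the localization, so a chain map that becomes zero there is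
  already zero in homology. This brings vanishing in the derived category back to the chain level
  without a look at the zigzags that witness it.\<close>

lemma Q_zarr_imp_bnd:
  assumes f: "chain_map A (X, f, Y)" and "D.Q (X, f, Y) = zarr X Y" and "projective A P" "x \<in> cyc X n P"
  shows "f n \<cdot> x \<in> bnd Y n P"
proof -
  note c = chmap_simps[OF f]
  have "homology_map A n (X, f, Y) = homology_map A n (X, \<lambda>n. Zer A (fst X n) (fst Y n), Y)"
    using derived_homology_Q[OF f, of n] derived_homology_Q[OF chain_map_Zer[OF c(1,2)], of n] assms(2)
    by (simp add: zarr_def)
  also have "\<dots> = Zer A (homology A n X) (homology A n Y)"
    unfolding homology_map_Zer_iff[OF chain_map_Zer[OF c(1,2)]]
  proof (intro allI impI ballI)
    fix P x assume "projective A P" "x \<in> cyc X n P"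
    thus "Zer A (fst X n) (fst Y n) \<cdot> x \<in> bnd Y n P"
      using bnd_Zer[OF c(2) projective_Ob] cplx_simps(1)[OF c(2)] by (auto simp: cyc_def Hom_iff Comp_Zer)
  qed
  finally show ?thesis using homology_map_Zer_iff[OF f] assms(3,4) by blast
qed

end

section \<open>Maps out of complexes of projectives with zero differential\<close>

context projective_abelian_category
begin

text \<open>Both sections become the inverse of \<open>w\<close>. Applied to the two ends of a
  cylinder, this identifies homotopic maps in the derived category.\<close>

lemma Q_sections_eq:
  assumes w: "(E, w, X) \<in> quasi_isos A" and i: "chain_map A (X, i, E)" "chain_map A (X, j, E)"
    and "\<And>n. w n \<cdot> i n = Ident A (fst X n)" "\<And>n. w n \<cdot> j n = Ident A (fst X n)"
  shows "D.Q (X, i, E) = D.Q (X, j, E)"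
proof -
  note wc = quasi_iso_chmap[OF w]
  have "D.Q (E, w, X) \<star> D.Q (X, i, E) = D.Q (E, w, X) \<star> D.Q (X, j, E)"
    unfolding Q_Comp[OF i(1) wc] Q_Comp[OF i(2) wc] assms(4,5) ..
  thus ?thesis
    using HOL.trans[OF Qinv_Comp[OF w Q_Hom[OF i(1)] HOL.refl, symmetric] Qinv_Comp[OF w Q_Hom[OF i(2)]]] by simp
qed

lemma zd_zd_chain_map:
  assumes "\<And>n. G n \<in> Ob A" "\<And>n. G' n \<in> Ob A" "\<And>n. f n \<in> Hom A (G n) (G' n)"
  shows "chain_map A (zd G, f, zd G')"
  using assms by (simp add: zd_chain_map zd_complex zd_cyc)

text \<open>\<open>E\<close> is the cylinder of \<open>zd G\<close>, after a change of basis in \<open>G \<oplus> G\<close> under which the two ends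
  become the first summand and the diagonal.\<close>

lemma Q_homotopic_eq:
  assumes G: "\<And>n. G n \<in> Ob A" and f: "chain_map A (zd G, f, Y)" "chain_map A (zd G, f', Y)"
    and s: "\<And>n. s n \<in> Hom A (G n) (fst Y (n + 1))" and eq: "\<And>n. f n = f' n \<oplus> snd Y (n + 1) \<cdot> s n"
  shows "D.Q (zd G, f, Y) = D.Q (zd G, f', Y)"
proof -
  define S where "S n = bS (G n) (G n)" for n
  define H where "H n = G (n - 1)" for n
  \<comment> \<open>The cells \<open>H n\<close> bound the second summand of
    \<open>G \<oplus> G\<close>, which in this basis is the difference of the two ends.\<close>
  define t where "t n = bj (G (n - 1)) (G (n - 1))" for n
  note b = bsum_simps[OF G G]
  have SO: "S n \<in> Ob A" for n unfolding S_def by (rule b)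
  have HO: "H n \<in> Ob A" for n unfolding H_def by (rule G)
  have Y: "chain_complex A Y" using chmap_simps[OF f(1)] by simp
  note c = cplx_simps(1-4)[OF Y]
  have sA: "s n \<in> Ar A" "Dom A (s n) = G n" "Cod A (s n) = fst Y (n + 1)" for n
    using s[of n] by (auto simp: Hom_iff)
  have f'A: "f' n \<in> Ar A" "Dom A (f' n) = G n" "Cod A (f' n) = fst Y n" for n
    using chmap_simps(3-5)[OF f(2), of n] by (auto simp: zd_fst)
  have tw: "twisting (zd H) (zd S) t"
    by (rule att_twisting) (auto simp: HO SO zd_complex zd_cyc Hom_iff t_def H_def S_def b G)
  define E where "E = TW (zd H) (zd S) t"
  have HS: "fst (zd H) n = H n" "fst (zd S) n = S n" for n by (simp_all add: zd_fst)
  have incl: "chain_map A (zd S, \<lambda>n. bj (H n) (S n), E)" using tw_incl[OF tw] by (simp add: E_def HS)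
  have i0: "chain_map A (zd G, \<lambda>n. bi (G n) (G n), zd S)"
    by (rule zd_zd_chain_map[OF G SO]) (auto simp: Hom_iff S_def b)
  have idG: "Ident A (G n) \<in> Hom A (G n) (G n)" for n by (rule Ident_Hom[OF G])
  have i1: "chain_map A (zd G, \<lambda>n. pair (G n) (G n) (Ident A (G n)) (Ident A (G n)), zd S)"
    by (rule zd_zd_chain_map[OF G SO]) (use pair_Hom[OF idG idG] in \<open>auto simp: S_def\<close>)
  have p: "chain_map A (zd S, \<lambda>n. bp (G n) (G n), zd G)"
    by (rule zd_zd_chain_map[OF SO G]) (auto simp: Hom_iff S_def b)
  let ?r = "\<lambda>n. copair (H n) (S n) (Zer A (H n) (G n)) (bp (G n) (G n))"
  have r: "chain_map A (E, ?r, zd G)"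
    unfolding E_def using tw_out[OF tw p, of "\<lambda>n. Zer A (H n) (G n)"]
    by (simp add: HS zd_fst zd_snd Zer_Hom HO G SO) (simp add: H_def S_def t_def ab_simps b G zd_fst)
  have ZH: "Zer A (H n) (G n) \<in> Hom A (H n) (G n)" for n by (rule Zer_Hom[OF HO G])
  have bpH: "bp (G n) (G n) \<in> Hom A (S n) (G n)" for n by (simp add: Hom_iff S_def b)
  \<comment> \<open>The second summand and the cells \<open>H\<close> cancel each other, so the
    projection to the first summand is a quasi-isomorphism.\<close>
  have q: "(E, ?r, zd G) \<in> quasi_isos A"
    unfolding quasi_iso_iff
  proof (intro conjI allI impI ballI)
    show "chain_map A (E, ?r, zd G)" by (rule r)
    fix P n assume P: "projective A P"
    note PO = projective_Ob[OF P]
    fix y assume "y \<in> cyc (zd G) n P"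
    hence y: "y \<in> Hom A P (G n)" by (simp add: zd_cyc G)
    have biy: "bi (G n) (G n) \<cdot> y \<in> Hom A P (S n)" using y by (auto simp: Hom_iff S_def b cat_simps)
    let ?x = "tp (zd H) (zd S) n (Zer A P (H n)) (bi (G n) (G n) \<cdot> y)"
    have ZP: "Zer A P (H n) \<in> Hom A P (H n)" by (rule Zer_Hom[OF PO HO])
    have "?x \<in> cyc E n P" unfolding E_def
      by (subst tw_cyc_iff[OF tw]) (use biy y PO in \<open>auto simp: HS zd_cyc HO ZP Hom_iff zd_snd ab_simps SO t_def H_def S_def b G zd_fst\<close>)
    moreover have "?r n \<cdot> ?x = y"
      unfolding HS copair_pair[OF ZH bpH ZP biy]
      using y by (auto simp: Hom_iff ab_simps HO G b bsum_Comp_simps PO)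
    ultimately show "\<exists>x \<in> cyc E n P. \<exists>b \<in> bnd (zd G) n P. y = ?r n \<cdot> x \<oplus> b"
      using y by (intro bexI[of _ ?x] bexI[of _ "Zer A P (G n)"])
        (auto simp: zd_bnd G PO Hom_iff ab_simps)
  next
    fix P n x assume P: "projective A P" and x: "x \<in> cyc E n P" "?r n \<cdot> x \<in> bnd (zd G) n P"
    note PO = projective_Ob[OF P]
    obtain k z where z: "k \<in> Hom A P (H n)" "z \<in> Hom A P (S n)" "x = tp (zd H) (zd S) n k z"
      using tw_cases[OF tw, of x P n] cyc_Hom[OF x(1)] by (auto simp: E_def HS)
    have kH: "k \<in> Hom A P (G (n - 1))" using z(1) by (simp add: H_def)
    have "z \<in> Hom A P (bS (G n) (G n))" using z(2) by (simp add: S_def)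
    then obtain u v where uv: "u \<in> Hom A P (G n)" "v \<in> Hom A P (G n)" "z = pair (G n) (G n) u v"
      using pair_cases[OF G G] by metis
    have "t n \<cdot> k \<oplus> snd (zd S) n \<cdot> z = Zer A P (S (n - 1))"
      using x(1) z tw_cyc_iff[OF tw, of k P n z] by (simp add: E_def HS)
    hence "t n \<cdot> k = Zer A P (S (n - 1))"
      using z(1,2) by (simp add: zd_snd Comp_Zer Hom_iff SO Zer_Add t_def H_def cat_simps b S_def)
    hence "bq (G (n - 1)) (G (n - 1)) \<cdot> (t n \<cdot> k) = Zer A P (G (n - 1))"
      by (simp add: Comp_Zer b S_def PO)
    hence k0: "k = Zer A P (H n)"
      using kH by (simp add: t_def bsum_Comp_simps G Hom_iff H_def)
    have "?r n \<cdot> x = Zer A (H n) (G n) \<cdot> k \<oplus> bp (G n) (G n) \<cdot> z"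
      unfolding z(3) HS by (rule copair_pair[OF ZH bpH z(1,2)])
    also have "\<dots> = u" unfolding uv(3) pair_proj(1)[OF uv(1,2)]
      using z(1) uv(1) by (auto simp: Hom_iff ab_simps G)
    finally have u0: "u = Zer A P (G n)" using x(2) by (simp add: zd_bnd G PO)
    have z': "z = t (n + 1) \<cdot> v"
      unfolding uv(3) u0 t_def using uv(2) by (simp add: pair_def ab_simps b G PO Hom_iff)
    have HSz: "k \<in> Hom A P (fst (zd H) n)" "z \<in> Hom A P (fst (zd S) n)" using z by (simp_all add: HS)
    show "x \<in> bnd E n P" unfolding z(3) E_def tw_bnd_iff[OF tw HSz]
    proof (intro bexI conjI)
      show "v \<in> Hom A P (fst (zd H) (n + 1))" using uv(2) by (simp add: HS H_def)
      show "Zer A P (S (n + 1)) \<in> Hom A P (fst (zd S) (n + 1))" by (simp add: HS Zer_Hom PO SO)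
      show "k = snd (zd H) (n + 1) \<cdot> v" using uv(2) by (auto simp: k0 zd_snd H_def Hom_iff Comp_Zer G)
      show "z = t (n + 1) \<cdot> v \<oplus> snd (zd S) (n + 1) \<cdot> Zer A P (S (n + 1))"
        using z(2) z' by (simp add: zd_snd ab_simps SO PO Hom_iff)
    qed
  qed
  \<comment> \<open>The two ends of the cylinder have coordinates \<open>(1, 0)\<close> and
    \<open>(1, 1)\<close> in \<open>G \<oplus> G\<close>; both are sections of the
    projection.\<close>
  define c0 where "c0 n = bj (H n) (S n) \<cdot> bi (G n) (G n)" for n
  define c1 where "c1 n = bj (H n) (S n) \<cdot> pair (G n) (G n) (Ident A (G n)) (Ident A (G n))" for n
  have c01: "chain_map A (zd G, c0, E)" "chain_map A (zd G, c1, E)"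
    unfolding c0_def c1_def by (rule chain_map_Comp[OF i0 incl]) (rule chain_map_Comp[OF i1 incl])
  note bHS = bsum_simps[OF HO SO]
  have pA: "pair (G n) (G n) (Ident A (G n)) (Ident A (G n)) \<in> Ar A"
    "Dom A (pair (G n) (G n) (Ident A (G n)) (Ident A (G n))) = G n"
    "Cod A (pair (G n) (G n) (Ident A (G n)) (Ident A (G n))) = bS (G n) (G n)" for n
    using pair_Hom[OF idG idG, of n] by (auto simp: Hom_iff)
  have cp: "copair (H n) (S n) u v \<cdot> (bj (H n) (S n) \<cdot> z) = v \<cdot> z"
    if "u \<in> Hom A (H n) V" "v \<in> Hom A (S n) V" "z \<in> Hom A P (S n)" for n u v z V P
    using that Hom_Ob[OF that(1)] Hom_Ob[OF that(3)]
    by (auto simp: copair_def Hom_iff ab_simps bHS bsum_Comp_simps HO SO)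
  have bgH: "bi (G n) (G n) \<in> Hom A (G n) (S n)" "pair (G n) (G n) (Ident A (G n)) (Ident A (G n)) \<in> Hom A (G n) (S n)" for n
    using pA by (auto simp: Hom_iff b S_def)
  have "D.Q (zd G, c0, E) = D.Q (zd G, c1, E)"
  proof (rule Q_sections_eq[OF q c01])
    show "?r n \<cdot> c0 n = Ident A (fst (zd G) n)" for n
      unfolding c0_def cp[OF ZH bpH bgH(1)] by (simp add: b zd_fst)
    show "?r n \<cdot> c1 n = Ident A (fst (zd G) n)" for n
      unfolding c1_def cp[OF ZH bpH bgH(2)] pair_proj(1)[OF idG idG] by (simp add: zd_fst)
  qed
  \<comment> \<open>On the second summand, the difference of the ends, the map has to be
    \<open>f - f'\<close>, which is the boundary of \<open>s\<close>. Taking \<open>s\<close> itself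
    on the cells \<open>H\<close> therefore extends it to the cylinder, and the two ends give back
    \<open>f'\<close> and \<open>f\<close>.\<close>
  let ?v = "\<lambda>n. copair (G n) (G n) (f' n) (snd Y (n + 1) \<cdot> s n)"
  have f'H: "f' n \<in> Hom A (G n) (fst Y n)" for n using f'A by (simp add: Hom_iff)
  have dsH: "snd Y (n + 1) \<cdot> s n \<in> Hom A (G n) (fst Y n)" for n using sA c by (simp add: Hom_iff cat_simps)
  have vH: "?v n \<in> Hom A (S n) (fst Y n)" for n unfolding S_def by (rule copair_Hom[OF f'H dsH])
  have f'c: "snd Y n \<cdot> f' n = Zer A (G n) (fst Y (n - 1))" for n
    using f(2) by (simp add: zd_chain_map[OF G Y] cyc_def)
  have v: "chain_map A (zd S, ?v, Y)"
    unfolding zd_chain_map[OF SO Y]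
  proof
    fix n
    have 1: "f' n \<in> cyc Y n (G n)" using f'H f'c by (simp add: cyc_def)
    have 2: "snd Y (n + 1) \<cdot> s n \<in> cyc Y n (G n)" by (rule bnd_cyc[OF Y bndI[OF s HOL.refl]])
    have 3: "bp (G n) (G n) \<in> Hom A (S n) (G n)" "bq (G n) (G n) \<in> Hom A (S n) (G n)"
      by (simp_all add: Hom_iff S_def b)
    show "?v n \<in> cyc Y n (S n)"
      unfolding copair_def by (rule cyc_Add[OF Y cyc_Comp[OF Y 1 3(1)] cyc_Comp[OF Y 2 3(2)]])
  qed
  let ?h = "\<lambda>n. copair (H n) (S n) (s (n - 1)) (?v n)"
  have s': "s (n - 1) \<in> Hom A (H n) (fst Y n)" for n using s[of "n - 1"] by (simp add: H_def)
  have h: "chain_map A (E, ?h, Y)"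
  proof -
    have "snd Y n \<cdot> s (n - 1) = s (n - 1 - 1) \<cdot> snd (zd H) n \<oplus> ?v (n - 1) \<cdot> t n" for n
    proof -
      have "?v (n - 1) \<cdot> t n = snd Y n \<cdot> s (n - 1)"
        using f'A sA c by (simp add: copair_def t_def ab_simps b G)
      thus ?thesis using s'[of "n - 1"] c sA[of "n - 1"] by (simp add: zd_snd Comp_Zer HO Hom_iff Zer_Add cat_simps H_def G)
    qed
    thus ?thesis unfolding E_def using tw_out[OF tw v, of "\<lambda>n. s (n - 1)"] s' by (simp add: HS)
  qed
  have "D.Q (zd G, f', Y) = D.Q (E, ?h, Y) \<star> D.Q (zd G, c0, E)"
    unfolding Q_Comp[OF c01(1) h]
  proof (rule Q_cong)
    show "f' n = ?h n \<cdot> c0 n" for n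
      unfolding c0_def cp[OF s' vH bgH(1)] using f'A sA c by (simp add: copair_def ab_simps b G)
  qed
  moreover have "D.Q (zd G, f, Y) = D.Q (E, ?h, Y) \<star> D.Q (zd G, c1, E)"
    unfolding Q_Comp[OF c01(2) h]
  proof (rule Q_cong)
    show "f n = ?h n \<cdot> c1 n" for n
      unfolding c1_def cp[OF s' vH bgH(2)] copair_pair[OF f'H dsH idG idG] eq
      using f'A sA c by (simp add: ab_simps G)
  qed
  ultimately show ?thesis using \<open>D.Q (zd G, c0, E) = D.Q (zd G, c1, E)\<close> by simp
qed

text \<open>The source has zero differential, so the lifts in the various degrees can be chosen
  independently: surjectivity of \<open>w\<close> in homology is applied to the single projective
  element \<open>p n\<close>. The boundaries that are left over make up the homotopy
  \<open>s\<close>.\<close>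

lemma lift_quasi_iso:
  assumes w: "(Z, w, X) \<in> quasi_isos A" and G: "\<And>n. projective A (G n)" and p: "chain_map A (zd G, p, X)"
  obtains p' s where "chain_map A (zd G, p', Z)" "\<And>n. s n \<in> Hom A (G n) (fst X (n + 1))"
    "\<And>n. w n \<cdot> p' n = p n \<oplus> snd X (n + 1) \<cdot> s n"
proof -
  note GO = projective_Ob[OF G]
  note wc = chmap_simps[OF quasi_iso_chmap[OF w]]
  have "\<exists>x s. x \<in> cyc Z n (G n) \<and> s \<in> Hom A (G n) (fst X (n + 1)) \<and> w n \<cdot> x = p n \<oplus> snd X (n + 1) \<cdot> s" for n
  proof -
    have "p n \<in> cyc X n (G n)" using p by (simp add: zd_chain_map[OF GO wc(2)])
    then obtain x b where x: "x \<in> cyc Z n (G n)" "b \<in> bnd X n (G n)" "p n = w n \<cdot> x \<oplus> b"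
      using w G unfolding quasi_iso_iff by blast
    obtain y where y: "y \<in> Hom A (G n) (fst X (n + 1))" "b = snd X (n + 1) \<cdot> y" using bndE[OF x(2)] .
    have ty: "w n \<cdot> x \<in> Ar A" "Dom A (w n \<cdot> x) = G n" "Cod A (w n \<cdot> x) = fst X n"
      "b \<in> Ar A" "Dom A b = G n" "Cod A b = fst X n"
      using cyc_Hom[OF x(1)] wc bnd_Hom[OF wc(2) x(2)] by (auto simp: Hom_iff cat_simps)
    have "p n \<oplus> snd X (n + 1) \<cdot> (\<ominus> y) = (w n \<cdot> x \<oplus> b) \<oplus> \<ominus> b"
      unfolding x(3) using y cplx_simps(1-4)[OF wc(2)] by (simp add: Hom_iff Comp_neg)
    also have "\<dots> = w n \<cdot> x" using ty Cod_Ob Dom_Ob by (simp add: Add_assoc neg_simps neg_Add Zer_Add)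
    finally show ?thesis using x(1) y(1) neg_Hom by metis
  qed
  then obtain p' s where ps: "\<And>n. p' n \<in> cyc Z n (G n)" "\<And>n. s n \<in> Hom A (G n) (fst X (n + 1))"
    "\<And>n. w n \<cdot> p' n = p n \<oplus> snd X (n + 1) \<cdot> s n" by metis
  moreover have "chain_map A (zd G, p', Z)" using ps(1) by (simp add: zd_chain_map[OF GO wc(1)])
  ultimately show ?thesis using that by blast
qed

text \<open>The claim is proved for all chain maps \<open>g\<close> at once, since the source of
  \<alpha> changes with each letter of its zigzag. A forward letter is composed with
  \<open>g\<close>; a backward one is crossed by lifting \<open>g\<close> through the
  quasi-isomorphism, up to homotopy.\<close>

lemma Q_full:
  assumes G: "\<And>n. projective A (G n)" and "\<alpha> \<in> Hom D.L X Y" "chain_map A (zd G, g, X)"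
  obtains g' where "chain_map A (zd G, g', Y)" "\<alpha> \<star> D.Q (zd G, g, X) = D.Q (zd G, g', Y)"
proof -
  note GO = projective_Ob[OF G]
  have "\<forall>g. chain_map A (zd G, g, X) \<longrightarrow>
    (\<exists>g'. chain_map A (zd G, g', Y) \<and> \<alpha> \<star> D.Q (zd G, g, X) = D.Q (zd G, g', Y))"
    using assms(2)
  proof (induction rule: L_induct)
    case Ident
    thus ?case using D.L.Ident_left[OF Q_Hom] by blast
  next
    case (Fwd X Z f \<beta>)
    show ?case
    proof (intro allI impI)
      fix g assume g: "chain_map A (zd G, g, X)"
      have "(\<beta> \<star> D.Q (X, f, Z)) \<star> D.Q (zd G, g, X)
        = \<beta> \<star> D.Q (zd G, \<lambda>n. f n \<cdot> g n, Z)"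
        using D.L.Comp_assoc[OF Q_Hom[OF g] Q_Hom[OF Fwd(1)] Fwd(2)] Q_Comp[OF g Fwd(1)] by simp
      thus "\<exists>g'. chain_map A (zd G, g', Y) \<and>
        (\<beta> \<star> D.Q (X, f, Z)) \<star> D.Q (zd G, g, X) = D.Q (zd G, g', Y)"
        using Fwd(3) chain_map_Comp[OF g Fwd(1)] by simp
    qed
  next
    case (Bwd X Z w \<beta>)
    note wc = quasi_iso_chmap[OF Bwd(1)]
    show ?case
    proof (intro allI impI)
      fix g assume g: "chain_map A (zd G, g, X)"
      obtain g1 s where g1: "chain_map A (zd G, g1, Z)" "\<And>n. s n \<in> Hom A (G n) (fst X (n + 1))"
        "\<And>n. w n \<cdot> g1 n = g n \<oplus> snd X (n + 1) \<cdot> s n"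
        using lift_quasi_iso[OF Bwd(1) G g] by metis
      have "D.Q (zd G, \<lambda>n. w n \<cdot> g1 n, X) = D.Q (zd G, g, X)"
        by (rule Q_homotopic_eq[OF GO chain_map_Comp[OF g1(1) wc] g g1(2,3)])
      hence "D.Qinv (Z, w, X) \<star> D.Q (zd G, g, X) = D.Q (zd G, g1, Z)"
        by (intro Qinv_Comp[OF Bwd(1) Q_Hom[OF g1(1)]]) (simp add: Q_Comp[OF g1(1) wc])
      hence "(\<beta> \<star> D.Qinv (Z, w, X)) \<star> D.Q (zd G, g, X) = \<beta> \<star> D.Q (zd G, g1, Z)"
        using D.L.Comp_assoc[OF Q_Hom[OF g] Qinv(1)[OF Bwd(1)] Bwd(2)] by simp
      thus "\<exists>g'. chain_map A (zd G, g', Y) \<and>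
        (\<beta> \<star> D.Qinv (Z, w, X)) \<star> D.Q (zd G, g, X) = D.Q (zd G, g', Y)"
        using Bwd(3) g1(1) by simp
    qed
  qed
  thus ?thesis using that assms(3) by blast
qed

lemma Q_null_homotopic:
  assumes G: "\<And>n. G n \<in> Ob A" and f: "chain_map A (zd G, f, Y)" and "\<And>n. f n \<in> bnd Y n (G n)"
  shows "D.Q (zd G, f, Y) = zarr (zd G) Y"
proof -
  have Y: "chain_complex A Y" using chmap_simps[OF f] by simp
  have "\<exists>s. s \<in> Hom A (G n) (fst Y (n + 1)) \<and> f n = snd Y (n + 1) \<cdot> s" for n
    using bndE[OF assms(3)] by metis
  then obtain s where s: "\<And>n. s n \<in> Hom A (G n) (fst Y (n + 1))" "\<And>n. f n = snd Y (n + 1) \<cdot> s n" by metis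
  show ?thesis unfolding zarr_def
    by (rule Q_homotopic_eq[OF G f chain_map_Zer[OF zd_complex[OF G] Y] s(1)])
      (use s cplx_simps(1-4)[OF Y] in \<open>simp add: zd_fst Zer_Add Hom_iff cat_simps\<close>)
qed

lemma zd_map_Q:
  assumes G: "\<And>n. projective A (G n)" and h: "h \<in> Hom D.L (zd G) Y"
  obtains g where "chain_map A (zd G, g, Y)" "h = D.Q (zd G, g, Y)"
proof -
  have i: "chain_map A (zd G, \<lambda>n. Ident A (G n), zd G)"
    using chain_map_Ident[OF zd_complex[OF projective_Ob[OF G]]] by (simp add: zd_fst)
  have "D.Q (zd G, \<lambda>n. Ident A (G n), zd G) = Ident D.L (zd G)"
    using Q_Ident[OF zd_complex[OF projective_Ob[OF G]]] by (simp add: zd_fst)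
  hence "h \<star> D.Q (zd G, \<lambda>n. Ident A (G n), zd G) = h" using D.L.Ident_right[OF h] by simp
  with Q_full[OF G h i] that show ?thesis by metis
qed

text \<open>With \<open>zd_map_Q\<close> this is the chain-level description of arrows from
  \<open>zd G\<close> to \<open>Y\<close>: families of cycles, with boundaries counting as
  zero.\<close>

lemma zd_map_zarr_iff:
  assumes G: "\<And>n. projective A (G n)" and g: "chain_map A (zd G, g, Y)"
  shows "D.Q (zd G, g, Y) = zarr (zd G) Y \<longleftrightarrow> (\<forall>n. g n \<in> bnd Y n (G n))"
proof
  note GO = projective_Ob[OF G]
  assume z: "D.Q (zd G, g, Y) = zarr (zd G) Y"
  show "\<forall>n. g n \<in> bnd Y n (G n)"
  proof
    fix n
    have "g n \<cdot> Ident A (G n) \<in> bnd Y n (G n)"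
      by (rule Q_zarr_imp_bnd[OF g z G]) (simp add: zd_cyc GO Ident_Hom)
    thus "g n \<in> bnd Y n (G n)" using chmap_simps(3-5)[OF g, of n] by (simp add: zd_fst Comp_Ident_simps)
  qed
qed (use Q_null_homotopic[OF projective_Ob[OF G] g] in blast)

section \<open>Factorization through a cone\<close>

text \<open>The mapping cone of \<open>p : zd G \<rightarrow> X\<close>: the object
  \<open>G (n - 1)\<close> sits in degree \<open>n\<close> and is attached along
  \<open>p (n - 1)\<close>. The sign in the suspension has no effect on a zero differential, so the
  cone is written directly as an attachment of cells.\<close>

abbreviation "cell X G p \<equiv> TW (zd (\<lambda>n. G (n - 1))) X (\<lambda>n. p (n - 1))"

abbreviation "cell_incl X G \<equiv> (\<lambda>n. bj (G (n - 1)) (fst X n))"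

abbreviation "cpair X G n a b \<equiv> pair (G (n - 1)) (fst X n) a b"

context
  fixes X :: "('o, 'm) cplx" and G :: "int \<Rightarrow> 'o" and p :: "int \<Rightarrow> 'm"
  assumes G: "\<And>n. G n \<in> Ob A" and p: "chain_map A (zd G, p, X)"
begin

lemma cell_cplx: "chain_complex A X"
  using chmap_simps[OF p] by simp

lemma cell_p_cyc: "p n \<in> cyc X n (G n)"
  using p by (simp add: zd_chain_map[OF G cell_cplx])

lemma cell_twisting: "twisting (zd (\<lambda>n. G (n - 1))) X (\<lambda>n. p (n - 1))"
  by (rule att_twisting[OF _ cell_cplx]) (auto simp: G cell_p_cyc)

lemma cell_complex: "chain_complex A (cell X G p)"
  by (rule tw_complex[OF cell_twisting])

lemma cell_incl: "chain_map A (X, cell_incl X G, cell X G p)"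
  using tw_incl[OF cell_twisting] by (simp add: zd_fst)

lemma cell_d:
  assumes "a \<in> Hom A W (G (n - 1))" "b \<in> Hom A W (fst X n)"
  shows "snd (cell X G p) n \<cdot> cpair X G n a b
    = cpair X G (n - 1) (Zer A W (G (n - 2))) (p (n - 1) \<cdot> a \<oplus> snd X n \<cdot> b)"
  using tw_d[OF cell_twisting, of a W n b] assms by (auto simp: zd_fst zd_snd Hom_iff Comp_Zer G)

lemma cell_Hom:
  assumes "a \<in> Hom A W (G (n - 1))" "b \<in> Hom A W (fst X n)"
  shows "cpair X G n a b \<in> Hom A W (fst (cell X G p) n)"
  using tw_Hom[OF cell_twisting, of a W n b] assms by (simp add: zd_fst)

lemma cell_cases:
  assumes "z \<in> Hom A W (fst (cell X G p) n)"
  obtains a b where "a \<in> Hom A W (G (n - 1))" "b \<in> Hom A W (fst X n)" "z = cpair X G n a b"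
  using tw_cases[OF cell_twisting assms] by (auto simp: zd_fst)

lemma cell_cyc_iff:
  assumes "a \<in> Hom A W (G (n - 1))" "b \<in> Hom A W (fst X n)"
  shows "cpair X G n a b \<in> cyc (cell X G p) n W \<longleftrightarrow> p (n - 1) \<cdot> a \<oplus> snd X n \<cdot> b = Zer A W (fst X (n - 1))"
  using tw_cyc_iff[OF cell_twisting, of a W n b] assms by (simp add: zd_fst zd_cyc G)

lemma cell_bnd_iff:
  assumes "a \<in> Hom A W (G (n - 1))" "b \<in> Hom A W (fst X n)"
  shows "cpair X G n a b \<in> bnd (cell X G p) n W \<longleftrightarrow> a = Zer A W (G (n - 1)) \<and>
    (\<exists>u \<in> Hom A W (G n). \<exists>y \<in> Hom A W (fst X (n + 1)). b = p n \<cdot> u \<oplus> snd X (n + 1) \<cdot> y)"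
proof -
  have "Zer A (G n) (G (n - 1)) \<cdot> u = Zer A W (G (n - 1))" if "u \<in> Hom A W (G n)" for u
    using that by (auto simp: Hom_iff Comp_Zer G)
  thus ?thesis using tw_bnd_iff[OF cell_twisting, of a W n b] assms by (auto simp: zd_fst zd_snd)
qed

lemma cell_incl_elt:
  "b \<in> Hom A W (fst X n) \<Longrightarrow> cell_incl X G n \<cdot> b = cpair X G n (Zer A W (G (n - 1))) b"
  using tw_incl_elt[OF cell_twisting, of b W n] by (simp add: zd_fst)

lemma cell_out:
  assumes "chain_map A (X, v, Z)" "\<And>n. u n \<in> Hom A (G (n - 1)) (fst Z n)"
    and "\<And>n. snd Z n \<cdot> u n = v (n - 1) \<cdot> p (n - 1)"
  shows "chain_map A (cell X G p, \<lambda>n. copair (G (n - 1)) (fst X n) (u n) (v n), Z)"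
proof -
  have "u (n - 1) \<cdot> snd (zd (\<lambda>n. G (n - 1))) n \<oplus> v (n - 1) \<cdot> p (n - 1) = snd Z n \<cdot> u n" for n
  proof -
    have "v (n - 1) \<cdot> p (n - 1) \<in> Hom A (G (n - 1)) (fst Z (n - 1))"
      using chmap_simps(3-5)[OF assms(1), of "n - 1"] cyc_Hom[OF cell_p_cyc, of "n - 1"]
      by (simp add: Hom_iff cat_simps)
    thus ?thesis using assms(2)[of "n - 1"] G by (simp add: zd_snd Hom_iff Comp_Zer Zer_Add assms(3))
  qed
  thus ?thesis using tw_out[OF cell_twisting assms(1), of u] assms(2) by (simp add: zd_fst)
qed

end

section \<open>Maps of cones induced by squares that commute up to homotopy\<close>

lemma copair_bj:
  assumes "u \<in> Hom A X Z" "v \<in> Hom A Y Z"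
  shows "copair X Y u v \<cdot> bj X Y = v"
  using assms Hom_Ob[OF assms(1)] Hom_Ob[OF assms(2)]
  by (auto simp: copair_def Hom_iff ab_simps bsum_simps)

context
  fixes X Z :: "('o, 'm) cplx" and G :: "int \<Rightarrow> 'o" and p p' f s :: "int \<Rightarrow> 'm"
  assumes G: "\<And>n. G n \<in> Ob A" and p: "chain_map A (zd G, p, X)" and p': "chain_map A (zd G, p', Z)"
    and f: "chain_map A (Z, f, X)" and s: "\<And>n. s n \<in> Hom A (G n) (fst X (n + 1))"
    and eq: "\<And>n. f n \<cdot> p' n = p n \<oplus> snd X (n + 1) \<cdot> s n"
begin

text \<open>The matrix has rows \<open>(1, 0)\<close> and \<open>(s, f)\<close>: the identity on
  cells and \<open>f\<close> on the base, while the homotopy \<open>s\<close> compensates for the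
  failure of \<open>f \<cdot> p'\<close> to equal \<open>p\<close>.\<close>

definition cell_map where
  "cell_map n = copair (G (n - 1)) (fst Z n)
    (cpair X G n (Ident A (G (n - 1))) (s (n - 1))) (cell_incl X G n \<cdot> f n)"

lemma cell_map_components:
  "cpair X G n (Ident A (G (n - 1))) (s (n - 1)) \<in> Hom A (G (n - 1)) (fst (cell X G p) n)"
  "cell_incl X G n \<cdot> f n \<in> Hom A (fst Z n) (fst (cell X G p) n)"
proof -
  have "s (n - 1) \<in> Hom A (G (n - 1)) (fst X n)" using s[of "n - 1"] by simp
  thus "cpair X G n (Ident A (G (n - 1))) (s (n - 1)) \<in> Hom A (G (n - 1)) (fst (cell X G p) n)"
    by (rule cell_Hom[OF G p Ident_Hom[OF G]])
  show "cell_incl X G n \<cdot> f n \<in> Hom A (fst Z n) (fst (cell X G p) n)"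
    using chmap_simps(3-5)[OF f] chmap_simps(3-5)[OF cell_incl[OF G p]] by (simp add: Hom_iff cat_simps)
qed

lemma cell_map_chain_map: "chain_map A (cell Z G p', cell_map, cell X G p)"
  unfolding cell_map_def
proof (rule cell_out[OF G p' chain_map_Comp[OF f cell_incl[OF G p]] cell_map_components(1)])
  fix n
  note X = cell_cplx[OF G p]
  have s': "s (n - 1) \<in> Hom A (G (n - 1)) (fst X n)" using s[of "n - 1"] by simp
  have p'H: "p' (n - 1) \<in> Hom A (G (n - 1)) (fst Z (n - 1))" by (rule cyc_Hom[OF cell_p_cyc[OF G p']])
  have pH: "p (n - 1) \<in> Hom A (G (n - 1)) (fst X (n - 1))" by (rule cyc_Hom[OF cell_p_cyc[OF G p]])
  have "snd (cell X G p) n \<cdot> cpair X G n (Ident A (G (n - 1))) (s (n - 1))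
    = cpair X G (n - 1) (Zer A (G (n - 1)) (G (n - 2))) (p (n - 1) \<oplus> snd X n \<cdot> s (n - 1))"
    unfolding cell_d[OF G p Ident_Hom[OF G] s'] using pH by (simp add: Hom_iff cat_simps)
  also have "p (n - 1) \<oplus> snd X n \<cdot> s (n - 1) = f (n - 1) \<cdot> p' (n - 1)" using eq[of "n - 1"] by simp
  also have "cpair X G (n - 1) (Zer A (G (n - 1)) (G (n - 2))) (f (n - 1) \<cdot> p' (n - 1))
    = cell_incl X G (n - 1) \<cdot> (f (n - 1) \<cdot> p' (n - 1))"
    using cell_incl_elt[OF G p, of "f (n - 1) \<cdot> p' (n - 1)" "G (n - 1)" "n - 1"]
      p'H chmap_simps(3-5)[OF f] by (simp add: Hom_iff cat_simps)
  also have "\<dots> = (cell_incl X G (n - 1) \<cdot> f (n - 1)) \<cdot> p' (n - 1)"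
    by (rule Comp_assoc_simp[symmetric])
      (use p'H chmap_simps(3-5)[OF f] chmap_simps(3-5)[OF cell_incl[OF G p], of "n - 1"] in \<open>auto simp: Hom_iff\<close>)
  finally show "snd (cell X G p) n \<cdot> cpair X G n (Ident A (G (n - 1))) (s (n - 1))
    = (cell_incl X G (n - 1) \<cdot> f (n - 1)) \<cdot> p' (n - 1)" .
qed

lemma cell_map_incl: "cell_map n \<cdot> cell_incl Z G n = cell_incl X G n \<cdot> f n"
  unfolding cell_map_def by (rule copair_bj[OF cell_map_components])

lemma cell_map_elt:
  assumes "a \<in> Hom A W (G (n - 1))" "z \<in> Hom A W (fst Z n)"
  shows "cell_map n \<cdot> cpair Z G n a z = cpair X G n a (s (n - 1) \<cdot> a \<oplus> f n \<cdot> z)"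
proof -
  have s': "s (n - 1) \<in> Hom A (G (n - 1)) (fst X n)" using s[of "n - 1"] by simp
  note fA = chmap_simps(3-5)[OF f] and iA = chmap_simps(3-5)[OF cell_incl[OF G p]]
  have ZH: "Zer A W (G (n - 1)) \<in> Hom A W (G (n - 1))" using Hom_Ob[OF assms(1)] by (simp add: Zer_Hom)
  have fz: "f n \<cdot> z \<in> Hom A W (fst X n)" using fA assms(2) by (simp add: Hom_iff cat_simps)
  have sa: "s (n - 1) \<cdot> a \<in> Hom A W (fst X n)" using s' assms(1) by (simp add: Hom_iff cat_simps)
  have "cell_map n \<cdot> cpair Z G n a z
    = cpair X G n (Ident A (G (n - 1))) (s (n - 1)) \<cdot> a \<oplus> (cell_incl X G n \<cdot> f n) \<cdot> z"
    unfolding cell_map_def by (rule copair_pair[OF cell_map_components assms])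
  also have "cpair X G n (Ident A (G (n - 1))) (s (n - 1)) \<cdot> a = cpair X G n a (s (n - 1) \<cdot> a)"
    using pair_Comp[OF Ident_Hom[OF G] s' assms(1)] assms(1) by (simp add: Hom_iff cat_simps)
  also have "(cell_incl X G n \<cdot> f n) \<cdot> z = cell_incl X G n \<cdot> (f n \<cdot> z)"
    by (rule Comp_assoc_simp) (use fA iA assms(2) in \<open>auto simp: Hom_iff\<close>)
  also have "\<dots> = cpair X G n (Zer A W (G (n - 1))) (f n \<cdot> z)" by (rule cell_incl_elt[OF G p fz])
  also have "cpair X G n a (s (n - 1) \<cdot> a) \<oplus> cpair X G n (Zer A W (G (n - 1))) (f n \<cdot> z)
    = cpair X G n a (s (n - 1) \<cdot> a \<oplus> f n \<cdot> z)"
    unfolding pair_Add[OF assms(1) sa ZH fz] using assms(1) by (simp add: Hom_iff Zer_Add)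
  finally show ?thesis .
qed

text \<open>The five lemma for the two cones, as a chase on projective elements: the cells agree on
  both sides, and \<open>f\<close> is a quasi-isomorphism on the bases.\<close>

lemma cell_map_quasi_iso:
  assumes q: "(Z, f, X) \<in> quasi_isos A"
  shows "(cell Z G p', cell_map, cell X G p) \<in> quasi_isos A"
  unfolding quasi_iso_iff
proof (intro conjI allI impI ballI)
  show "chain_map A (cell Z G p', cell_map, cell X G p)" by (rule cell_map_chain_map)
  note fc = chmap_simps[OF f]
  note X = fc(2) and Z = fc(1)
  note XA = cplx_simps(1-4)[OF X] and ZA = cplx_simps(1-4)[OF Z]
  have pA: "p n \<in> Ar A" "Dom A (p n) = G n" "Cod A (p n) = fst X n"
    "p' n \<in> Ar A" "Dom A (p' n) = G n" "Cod A (p' n) = fst Z n"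
    "s n \<in> Ar A" "Dom A (s n) = G n" "Cod A (s n) = fst X (n + 1)" for n
    using cyc_Hom[OF cell_p_cyc[OF G p]] cyc_Hom[OF cell_p_cyc[OF G p']] s by (auto simp: Hom_iff)
  have eqe: "f n \<cdot> (p' n \<cdot> a) = p n \<cdot> a \<oplus> snd X (n + 1) \<cdot> (s n \<cdot> a)" if "a \<in> Hom A W (G n)" for a W n
  proof -
    have "f n \<cdot> (p' n \<cdot> a) = (f n \<cdot> p' n) \<cdot> a"
      using that pA fc(3-5) by (simp add: Hom_iff Comp_assoc_simp)
    also have "\<dots> = p n \<cdot> a \<oplus> snd X (n + 1) \<cdot> (s n \<cdot> a)"
      unfolding eq using that pA XA by (simp add: Hom_iff cat_simps Comp_Add)
    finally show ?thesis .
  qed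
  fix P n assume P: "projective A P"
  note PO = projective_Ob[OF P]
  {
    fix y assume y: "y \<in> cyc (cell X G p) n P"
    obtain a x where ax: "a \<in> Hom A P (G (n - 1))" "x \<in> Hom A P (fst X n)" "y = cpair X G n a x"
      using cell_cases[OF G p cyc_Hom[OF y]] .
    have c: "p (n - 1) \<cdot> a \<oplus> snd X n \<cdot> x = Zer A P (fst X (n - 1))"
      using y cell_cyc_iff[OF G p ax(1,2)] ax(3) by simp
    have ty: "a \<in> Ar A" "Dom A a = P" "Cod A a = G (n - 1)" "x \<in> Ar A" "Dom A x = P" "Cod A x = fst X n"
      using ax by (auto simp: Hom_iff)
    have pa: "p (n - 1) \<cdot> a = \<ominus> (snd X n \<cdot> x)"
      using c by (subst (asm) sum_Zer_iff) (use ty pA XA in \<open>auto simp: cat_simps\<close>)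
    \<comment> \<open>As \<open>y\<close> is a cycle, \<open>p a\<close> bounds in \<open>X\<close>.
      Injectivity of \<open>f\<close> in homology then makes \<open>p' a\<close> bound in
      \<open>Z\<close>, so that \<open>a\<close> is the cell part of a cycle of the cone over
      \<open>Z\<close>.\<close>
    have "f (n - 1) \<cdot> (p' (n - 1) \<cdot> a) = snd X n \<cdot> (\<ominus> x \<oplus> s (n - 1) \<cdot> a)"
      using eqe[OF ax(1)] ty pA[of "n - 1"] XA by (simp add: pa ab_simps)
    hence "f (n - 1) \<cdot> (p' (n - 1) \<cdot> a) \<in> bnd X (n - 1) P"
      using ty pA[of "n - 1"] by (intro bndI) (auto simp: Hom_iff ab_simps)
    moreover have "p' (n - 1) \<cdot> a \<in> cyc Z (n - 1) P" by (rule cyc_Comp[OF Z cell_p_cyc[OF G p'] ax(1)])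
    ultimately have "p' (n - 1) \<cdot> a \<in> bnd Z (n - 1) P" using q P unfolding quasi_iso_iff by blast
    then obtain z0 where z0: "z0 \<in> Hom A P (fst Z n)" "p' (n - 1) \<cdot> a = snd Z n \<cdot> z0"
      by (rule bndE) simp
    define z1 where "z1 = \<ominus> z0"
    have z1: "z1 \<in> Hom A P (fst Z n)" "p' (n - 1) \<cdot> a \<oplus> snd Z n \<cdot> z1 = Zer A P (fst Z (n - 1))"
      using z0 ZA by (auto simp: z1_def Hom_iff ab_simps)
    \<comment> \<open>The cycle \<open>(a, z1)\<close> has image \<open>(a, g)\<close>. What is
      missing from \<open>y\<close> is \<open>(0, x - g)\<close>, where \<open>x - g\<close> is a
      cycle of \<open>X\<close>, which \<open>f\<close> reaches up to a boundary.\<close>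
    define g where "g = s (n - 1) \<cdot> a \<oplus> f n \<cdot> z1"
    have gH: "g \<in> Hom A P (fst X n)"
      using ty z1 pA[of "n - 1"] fc(3-5) by (simp add: g_def Hom_iff ab_simps)
    have F1: "cell_map n \<cdot> cpair Z G n a z1 = cpair X G n a g"
      unfolding g_def by (rule cell_map_elt[OF ax(1) z1(1)])
    have c1: "cpair Z G n a z1 \<in> cyc (cell Z G p') n P" using cell_cyc_iff[OF G p' ax(1) z1(1)] z1(2) by simp
    have "cpair X G n a g \<in> cyc (cell X G p) n P"
      using chmap_cyc[OF cell_map_chain_map c1] F1 by simp
    hence "p (n - 1) \<cdot> a \<oplus> snd X n \<cdot> g = Zer A P (fst X (n - 1))" using cell_cyc_iff[OF G p ax(1) gH] by simp
    hence "p (n - 1) \<cdot> a \<oplus> snd X n \<cdot> g = p (n - 1) \<cdot> a \<oplus> snd X n \<cdot> x" using c by simp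
    hence dg: "snd X n \<cdot> g = snd X n \<cdot> x"
      by (subst (asm) Add_left_cancel) (use ty pA XA gH in \<open>auto simp: Hom_iff cat_simps\<close>)
    have xg: "x \<oplus> \<ominus> g \<in> cyc X n P"
      using ax(2) gH XA dg by (auto simp: cyc_def Hom_iff ab_simps)
    obtain z2 b where z2: "z2 \<in> cyc Z n P" "b \<in> bnd X n P" "x \<oplus> \<ominus> g = f n \<cdot> z2 \<oplus> b"
      using q P xg unfolding quasi_iso_iff by blast
    have fz2: "f n \<cdot> z2 \<in> Hom A P (fst X n)" by (rule cyc_Hom[OF chmap_cyc[OF f z2(1)]])
    have bH: "b \<in> Hom A P (fst X n)" by (rule bnd_Hom[OF X z2(2)])
    have xeq: "x = g \<oplus> (f n \<cdot> z2 \<oplus> b)"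
      using z2(3) by (subst (asm) diff_eq_iff) (use ax(2) gH fz2 bH in \<open>auto simp: Hom_iff ab_simps\<close>)
    obtain y0 where y0: "y0 \<in> Hom A P (fst X (n + 1))" "b = snd X (n + 1) \<cdot> y0" using bndE[OF z2(2)] .
    have ZG: "Zer A P (G (n - 1)) \<in> Hom A P (G (n - 1))" "Zer A P (G n) \<in> Hom A P (G n)"
      using PO G by (auto intro: Zer_Hom)
    have z12: "z1 \<oplus> z2 \<in> Hom A P (fst Z n)" using z1(1) cyc_Hom[OF z2(1)] by (rule Add_Hom)
    have "cpair Z G n a (z1 \<oplus> z2) \<in> cyc (cell Z G p') n P"
      using cell_cyc_iff[OF G p' ax(1) z12] z1 z2(1) ZA ty pA[of "n - 1"]
      by (auto simp: cyc_def Hom_iff ab_simps)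
    moreover have "cpair X G n (Zer A P (G (n - 1))) b \<in> bnd (cell X G p) n P"
    proof -
      have "b = p n \<cdot> Zer A P (G n) \<oplus> snd X (n + 1) \<cdot> y0"
        using y0(2) bH pA[of n] by (simp add: Comp_Zer PO Hom_iff Zer_Add)
      thus ?thesis unfolding cell_bnd_iff[OF G p ZG(1) bH] using ZG(2) y0(1) by blast
    qed
    moreover have "y = cell_map n \<cdot> cpair Z G n a (z1 \<oplus> z2) \<oplus> cpair X G n (Zer A P (G (n - 1))) b"
    proof -
      have "s (n - 1) \<cdot> a \<oplus> f n \<cdot> (z1 \<oplus> z2) = g \<oplus> f n \<cdot> z2"
        using ty z1(1) cyc_Hom[OF z2(1)] pA[of "n - 1"] fc(3-5) by (simp add: g_def Hom_iff ab_simps)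
      hence "cell_map n \<cdot> cpair Z G n a (z1 \<oplus> z2) = cpair X G n a (g \<oplus> f n \<cdot> z2)"
        using cell_map_elt[OF ax(1) z12] by simp
      moreover have "cpair X G n a (g \<oplus> f n \<cdot> z2) \<oplus> cpair X G n (Zer A P (G (n - 1))) b
        = cpair X G n (a \<oplus> Zer A P (G (n - 1))) ((g \<oplus> f n \<cdot> z2) \<oplus> b)"
        by (rule pair_Add[OF ax(1) Add_Hom[OF gH fz2] ZG(1) bH])
      ultimately show ?thesis unfolding ax(3) xeq using ax(1) gH fz2 bH by (simp add: Hom_iff Zer_Add Add_assoc)
    qed
    ultimately show "\<exists>x \<in> cyc (cell Z G p') n P. \<exists>b \<in> bnd (cell X G p) n P. y = cell_map n \<cdot> x \<oplus> b"
      by blast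
  next
    fix z assume z: "z \<in> cyc (cell Z G p') n P" and b: "cell_map n \<cdot> z \<in> bnd (cell X G p) n P"
    obtain a z1 where az: "a \<in> Hom A P (G (n - 1))" "z1 \<in> Hom A P (fst Z n)" "z = cpair Z G n a z1"
      using cell_cases[OF G p' cyc_Hom[OF z]] .
    have saf: "s (n - 1) \<cdot> a \<oplus> f n \<cdot> z1 \<in> Hom A P (fst X n)"
      using az(1,2) pA[of "n - 1"] fc(3-5) by (simp add: Hom_iff ab_simps)
    from b cell_map_elt[OF az(1,2)] cell_bnd_iff[OF G p az(1) saf]
    obtain u y where uy: "a = Zer A P (G (n - 1))" "u \<in> Hom A P (G n)" "y \<in> Hom A P (fst X (n + 1))"
      "s (n - 1) \<cdot> a \<oplus> f n \<cdot> z1 = p n \<cdot> u \<oplus> snd X (n + 1) \<cdot> y" unfolding az(3) by auto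
    have "p' (n - 1) \<cdot> a \<oplus> snd Z n \<cdot> z1 = Zer A P (fst Z (n - 1))"
      using z cell_cyc_iff[OF G p' az(1,2)] az(3) by simp
    hence z1c: "z1 \<in> cyc Z n P" using az(2) pA[of "n - 1"] ZA
      by (simp add: uy(1) Comp_Zer PO cyc_def Hom_iff Zer_Add cat_simps)
    have p'u: "p' n \<cdot> u \<in> cyc Z n P" by (rule cyc_Comp[OF Z cell_p_cyc[OF G p'] uy(2)])
    have fz: "f n \<cdot> z1 = p n \<cdot> u \<oplus> snd X (n + 1) \<cdot> y"
      using uy(4) az(2) pA[of "n - 1"] fc(3-5) PO by (simp add: uy(1) Comp_Zer Hom_iff Zer_Add cat_simps)
    have ty: "u \<in> Ar A" "Dom A u = P" "Cod A u = G n" "y \<in> Ar A" "Dom A y = P" "Cod A y = fst X (n + 1)"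
      "z1 \<in> Ar A" "Dom A z1 = P" "Cod A z1 = fst Z n" using uy(2,3) az(2) by (auto simp: Hom_iff)
    have pu: "p n \<cdot> u = f n \<cdot> (p' n \<cdot> u) \<oplus> \<ominus> (snd X (n + 1) \<cdot> (s n \<cdot> u))"
      using eqe[OF uy(2)] ty pA[of n] XA[of "n + 1"] by (simp add: ab_simps XA(1) Dom_Ob Cod_Ob)
    \<comment> \<open>Up to the boundary of \<open>(u, 0)\<close> the given cycle is
      \<open>(0, z1 - p' u)\<close>. Its base part goes to a boundary of \<open>X\<close>, and
      \<open>f\<close> is injective in homology.\<close>
    have "f n \<cdot> (z1 \<oplus> \<ominus> (p' n \<cdot> u)) = snd X (n + 1) \<cdot> (y \<oplus> \<ominus> (s n \<cdot> u))"
    proof -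
      have "f n \<cdot> (z1 \<oplus> \<ominus> (p' n \<cdot> u)) = f n \<cdot> z1 \<oplus> \<ominus> (f n \<cdot> (p' n \<cdot> u))"
        using ty pA[of n] fc(3-5) by (simp add: ab_simps)
      also have "\<dots> = (f n \<cdot> (p' n \<cdot> u) \<oplus> \<ominus> (snd X (n + 1) \<cdot> (s n \<cdot> u)) \<oplus> snd X (n + 1) \<cdot> y)
          \<oplus> \<ominus> (f n \<cdot> (p' n \<cdot> u))"
        unfolding fz pu ..
      also have "\<dots> = snd X (n + 1) \<cdot> y \<oplus> \<ominus> (snd X (n + 1) \<cdot> (s n \<cdot> u))"
      proof (subst diff_eq_iff)
        show "f n \<cdot> (p' n \<cdot> u) \<oplus> \<ominus> (snd X (n + 1) \<cdot> (s n \<cdot> u)) \<oplus> snd X (n + 1) \<cdot> y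
          = f n \<cdot> (p' n \<cdot> u) \<oplus> (snd X (n + 1) \<cdot> y \<oplus> \<ominus> (snd X (n + 1) \<cdot> (s n \<cdot> u)))"
          using ty pA[of n] fc(3-5) XA[of "n + 1"]
          by (simp add: cat_simps Add_assoc neg_simps Add_simps Add_commute[of "\<ominus> (snd X (n + 1) \<cdot> (s n \<cdot> u))"])
      qed (use ty pA[of n] fc(3-5) XA[of "n + 1"] in \<open>simp_all add: cat_simps Add_simps neg_simps\<close>)
      also have "\<dots> = snd X (n + 1) \<cdot> (y \<oplus> \<ominus> (s n \<cdot> u))"
        using ty pA[of n] XA[of "n + 1"] by (simp add: ab_simps)
      finally show ?thesis .
    qed
    hence "f n \<cdot> (z1 \<oplus> \<ominus> (p' n \<cdot> u)) \<in> bnd X n P"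
      using ty pA[of n] by (intro bndI) (auto simp: Hom_iff ab_simps)
    moreover have "z1 \<oplus> \<ominus> (p' n \<cdot> u) \<in> cyc Z n P" by (rule cyc_Add[OF Z z1c cyc_neg[OF Z p'u]])
    ultimately have "z1 \<oplus> \<ominus> (p' n \<cdot> u) \<in> bnd Z n P" using q P unfolding quasi_iso_iff by blast
    then obtain y' where y': "y' \<in> Hom A P (fst Z (n + 1))" "z1 \<oplus> \<ominus> (p' n \<cdot> u) = snd Z (n + 1) \<cdot> y'"
      by (rule bndE)
    have "z1 = p' n \<cdot> u \<oplus> snd Z (n + 1) \<cdot> y'"
      using y'(2) by (subst (asm) diff_eq_iff) (use ty y'(1) pA[of n] ZA[of "n + 1"] in \<open>auto simp: Hom_iff cat_simps\<close>)
    thus "z \<in> bnd (cell Z G p') n P"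
      unfolding az(3) cell_bnd_iff[OF G p' az(1,2)] using uy(1,2) y'(1) by blast
  }
qed

end

text \<open>A weak cokernel property of the cone of a map out of a complex of projectives with zero
  differential. The cone is transported along the zigzag representing \<open>\<alpha>\<close>.\<close>

lemma factor_through_cell:
  assumes G: "\<And>n. projective A (G n)" and "\<alpha> \<in> Hom D.L X Y" "chain_map A (zd G, p, X)"
    and "\<alpha> \<star> D.Q (zd G, p, X) = zarr (zd G) Y"
  obtains \<beta> where "\<beta> \<in> Hom D.L (cell X G p) Y" "\<alpha> = \<beta> \<star> D.Q (X, cell_incl X G, cell X G p)"
proof -
  note GO = projective_Ob[OF G]
  have "\<forall>p. chain_map A (zd G, p, X) \<longrightarrow> \<alpha> \<star> D.Q (zd G, p, X) = zarr (zd G) Y \<longrightarrow>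
    (\<exists>\<beta> \<in> Hom D.L (cell X G p) Y. \<alpha> = \<beta> \<star> D.Q (X, cell_incl X G, cell X G p))"
    using assms(2)
  proof (induction rule: L_induct)
    case Ident
    show ?case
    proof (intro allI impI)
      fix p assume p: "chain_map A (zd G, p, Y)"
        and z: "Ident D.L Y \<star> D.Q (zd G, p, Y) = zarr (zd G) Y"
      have "D.Q (zd G, p, Y) = zarr (zd G) Y" using z D.L.Ident_left[OF Q_Hom[OF p]] by simp
      hence "p n \<in> bnd Y n (G n)" for n using zd_map_zarr_iff[OF G p] by simp
      hence "\<exists>s. s \<in> Hom A (G n) (fst Y (n + 1)) \<and> p n = snd Y (n + 1) \<cdot> s" for n using bndE by metis
      then obtain s where s: "\<And>n. s n \<in> Hom A (G n) (fst Y (n + 1))" "\<And>n. p n = snd Y (n + 1) \<cdot> s n"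
        by metis
      \<comment> \<open>As \<open>p\<close> is null-homotopic via \<open>s\<close>, the inclusion of
        \<open>Y\<close> into the cone has this retraction, which serves as the second factor of the
        identity.\<close>
      let ?r = "\<lambda>n. copair (G (n - 1)) (fst Y n) (s (n - 1)) (Ident A (fst Y n))"
      have s': "s (n - 1) \<in> Hom A (G (n - 1)) (fst Y n)" for n using s(1)[of "n - 1"] by simp
      have r: "chain_map A (cell Y G p, ?r, Y)"
      proof (rule cell_out[OF GO p chain_map_Ident[OF Ident] s'])
        show "snd Y n \<cdot> s (n - 1) = Ident A (fst Y (n - 1)) \<cdot> p (n - 1)" for n
          using s(2)[of "n - 1"] cyc_Hom[OF cell_p_cyc[OF GO p], of "n - 1"] by (simp add: Hom_iff cat_simps)
      qed
      have "?r n \<cdot> cell_incl Y G n = Ident A (fst Y n)" for n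
        by (rule copair_bj[OF s' Ident_Hom[OF cplx_simps(1)[OF Ident]]])
      hence "D.Q (cell Y G p, ?r, Y) \<star> D.Q (Y, cell_incl Y G, cell Y G p) = Ident D.L Y"
        unfolding Q_Comp[OF cell_incl[OF GO p] r] Q_Ident[OF Ident, symmetric] by simp
      thus "\<exists>\<beta> \<in> Hom D.L (cell Y G p) Y. Ident D.L Y = \<beta> \<star> D.Q (Y, cell_incl Y G, cell Y G p)"
        by (intro bexI[OF _ Q_Hom[OF r]]) (rule HOL.sym)
    qed
  next
    case (Fwd X Z f \<beta>)
    show ?case
    proof (intro allI impI)
      fix p assume p: "chain_map A (zd G, p, X)"
        and z: "(\<beta> \<star> D.Q (X, f, Z)) \<star> D.Q (zd G, p, X) = zarr (zd G) Y"
      let ?p = "\<lambda>n. f n \<cdot> p n"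
      note fp = chain_map_Comp[OF p Fwd(1)]
      have "\<beta> \<star> D.Q (zd G, ?p, Z) = zarr (zd G) Y"
        using D.L.Comp_assoc[OF Q_Hom[OF p] Q_Hom[OF Fwd(1)] Fwd(2)] Q_Comp[OF p Fwd(1)] z by simp
      then obtain \<gamma> where g: "\<gamma> \<in> Hom D.L (cell Z G ?p) Y"
        "\<beta> = \<gamma> \<star> D.Q (Z, cell_incl Z G, cell Z G ?p)" using Fwd(3) fp by blast
      \<comment> \<open>The square with \<open>f\<close> commutes strictly, so the map of cones is
        formed with the zero homotopy.\<close>
      let ?s = "\<lambda>n. Zer A (G n) (fst Z (n + 1))"
      note c = chmap_simps[OF Fwd(1)]
      have s: "?s n \<in> Hom A (G n) (fst Z (n + 1))" for n by (rule Zer_Hom[OF GO cplx_simps(1)[OF c(2)]])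
      have eq: "f n \<cdot> p n = ?p n \<oplus> snd Z (n + 1) \<cdot> ?s n" for n
        using chmap_simps(3-5)[OF fp, of n] cplx_simps(1-4)[OF c(2), of "n + 1"]
        by (simp add: Comp_Zer GO zd_fst Zer_Add)
      note F = cell_map_chain_map[OF GO fp p Fwd(1) s eq]
      have "cell_map Z X G f ?s n \<cdot> cell_incl X G n = cell_incl Z G n \<cdot> f n" for n
        by (rule cell_map_incl[OF GO fp p Fwd(1) s eq])
      hence e: "D.Q (cell X G p, cell_map Z X G f ?s, cell Z G ?p) \<star> D.Q (X, cell_incl X G, cell X G p)
        = D.Q (Z, cell_incl Z G, cell Z G ?p) \<star> D.Q (X, f, Z)"
        unfolding Q_Comp[OF cell_incl[OF GO p] F] Q_Comp[OF Fwd(1) cell_incl[OF GO fp]] by simp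
      have "\<beta> \<star> D.Q (X, f, Z) = (\<gamma> \<star> D.Q (cell X G p, cell_map Z X G f ?s, cell Z G ?p))
        \<star> D.Q (X, cell_incl X G, cell X G p)"
        unfolding g(2) D.L.Comp_assoc[OF Q_Hom[OF cell_incl[OF GO p]] Q_Hom[OF F] g(1), symmetric] e
        by (rule D.L.Comp_assoc[OF Q_Hom[OF Fwd(1)] Q_Hom[OF cell_incl[OF GO fp]] g(1), symmetric])
      thus "\<exists>\<gamma> \<in> Hom D.L (cell X G p) Y. \<beta> \<star> D.Q (X, f, Z) = \<gamma> \<star> D.Q (X, cell_incl X G, cell X G p)"
        using D.L.Comp_Hom[OF Q_Hom[OF F] g(1)] by blast
    qed
  next
    case (Bwd X Z w \<beta>)
    note wc = quasi_iso_chmap[OF Bwd(1)]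
    show ?case
    proof (intro allI impI)
      fix p assume p: "chain_map A (zd G, p, X)"
        and z: "(\<beta> \<star> D.Qinv (Z, w, X)) \<star> D.Q (zd G, p, X) = zarr (zd G) Y"
      obtain p1 s where p1: "chain_map A (zd G, p1, Z)" and s: "\<And>n. s n \<in> Hom A (G n) (fst X (n + 1))"
        and eq: "\<And>n. w n \<cdot> p1 n = p n \<oplus> snd X (n + 1) \<cdot> s n"
        using lift_quasi_iso[OF Bwd(1) G p] by metis
      have "D.Q (zd G, \<lambda>n. w n \<cdot> p1 n, X) = D.Q (zd G, p, X)"
        by (rule Q_homotopic_eq[OF GO chain_map_Comp[OF p1 wc] p s eq])
      hence "D.Qinv (Z, w, X) \<star> D.Q (zd G, p, X) = D.Q (zd G, p1, Z)"
        by (intro Qinv_Comp[OF Bwd(1) Q_Hom[OF p1]]) (simp add: Q_Comp[OF p1 wc])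
      hence "\<beta> \<star> D.Q (zd G, p1, Z) = zarr (zd G) Y"
        using D.L.Comp_assoc[OF Q_Hom[OF p] Qinv(1)[OF Bwd(1)] Bwd(2)] z by simp
      then obtain \<gamma> where g: "\<gamma> \<in> Hom D.L (cell Z G p1) Y"
        "\<beta> = \<gamma> \<star> D.Q (Z, cell_incl Z G, cell Z G p1)" using Bwd(3) p1 by blast
      \<comment> \<open>This map runs from the cone over \<open>Z\<close> to the cone over
        \<open>X\<close>, against the direction in which the factorization is wanted; as a
        quasi-isomorphism it can be inverted.\<close>
      let ?F = "cell_map X Z G w s"
      note F = cell_map_quasi_iso[OF GO p p1 wc s eq Bwd(1)]
      note Fc = quasi_iso_chmap[OF F]
      have "?F n \<cdot> cell_incl Z G n = cell_incl X G n \<cdot> w n" for n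
        by (rule cell_map_incl[OF GO p p1 wc s eq])
      hence e: "D.Q (cell Z G p1, ?F, cell X G p) \<star> D.Q (Z, cell_incl Z G, cell Z G p1)
        = D.Q (X, cell_incl X G, cell X G p) \<star> D.Q (Z, w, X)"
        unfolding Q_Comp[OF cell_incl[OF GO p1] Fc] Q_Comp[OF wc cell_incl[OF GO p]] by simp
      have xi: "D.Q (X, cell_incl X G, cell X G p) \<in> Hom D.L X (cell X G p)"
        by (rule Q_Hom[OF cell_incl[OF GO p]])
      have zi: "D.Q (Z, cell_incl Z G, cell Z G p1) \<in> Hom D.L Z (cell Z G p1)"
        by (rule Q_Hom[OF cell_incl[OF GO p1]])
      have gF: "\<gamma> \<star> D.Qinv (cell Z G p1, ?F, cell X G p) \<in> Hom D.L (cell X G p) Y"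
        by (rule D.L.Comp_Hom[OF Qinv(1)[OF F] g(1)])
      have "D.Qinv (cell Z G p1, ?F, cell X G p) \<star>
          (D.Q (X, cell_incl X G, cell X G p) \<star> D.Q (Z, w, X))
        = D.Q (Z, cell_incl Z G, cell Z G p1)"
        by (rule Qinv_Comp[OF F zi e[symmetric]])
      hence "\<beta> = (\<gamma> \<star> D.Qinv (cell Z G p1, ?F, cell X G p)) \<star>
          (D.Q (X, cell_incl X G, cell X G p) \<star> D.Q (Z, w, X))"
        unfolding g(2)
        using D.L.Comp_assoc[OF D.L.Comp_Hom[OF Q_Hom[OF wc] xi] Qinv(1)[OF F] g(1)] by simp
      also have "\<dots> = ((\<gamma> \<star> D.Qinv (cell Z G p1, ?F, cell X G p)) \<star>
          D.Q (X, cell_incl X G, cell X G p)) \<star> D.Q (Z, w, X)"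
        by (rule D.L.Comp_assoc[OF Q_Hom[OF wc] xi gF])
      finally have "\<beta> \<star> D.Qinv (Z, w, X) =
          (\<gamma> \<star> D.Qinv (cell Z G p1, ?F, cell X G p)) \<star> D.Q (X, cell_incl X G, cell X G p)"
        by (rule Comp_Qinv[OF Bwd(1) D.L.Comp_Hom[OF xi gF]])
      thus "\<exists>\<gamma> \<in> Hom D.L (cell X G p) Y. \<beta> \<star> D.Qinv (Z, w, X) = \<gamma> \<star> D.Q (X, cell_incl X G, cell X G p)"
        using gF by blast
    qed
  qed
  thus ?thesis using that assms(3,4) by blast
qed

section \<open>Resolutions of the homology of a complex\<close>

text \<open>\<open>S 0, S 1, \<dots>\<close> is a projective resolution of the graded object \<open>H\<^sub>* X\<close> by maps of degree \<open>-1\<close>,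
  with augmentation lifted to cycles. Exactness is expressed on projective elements.\<close>

definition homology_resolution ::
  "('o, 'm) cplx \<Rightarrow> (nat \<Rightarrow> int \<Rightarrow> 'o) \<Rightarrow> (int \<Rightarrow> 'm) \<Rightarrow> (nat \<Rightarrow> int \<Rightarrow> 'm) \<Rightarrow> bool" where
  "homology_resolution X S \<rho> r \<longleftrightarrow>
    (\<forall>s n. projective A (S s n)) \<and> chain_map A (zd (S 0), \<rho>, X) \<and>
    (\<forall>s n. r s n \<in> Hom A (S (Suc s) n) (S s (n - 1))) \<and>
    (\<forall>W n. projective A W \<longrightarrow>
      (\<forall>x \<in> cyc X n W. \<exists>u \<in> Hom A W (S 0 n). \<exists>b \<in> bnd X n W. x = \<rho> n \<cdot> u \<oplus> b) \<and>
      (\<forall>u \<in> Hom A W (S 0 n). \<rho> n \<cdot> u \<in> bnd X n W \<longleftrightarrow>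
        (\<exists>v \<in> Hom A W (S (Suc 0) (n + 1)). u = r 0 (n + 1) \<cdot> v)) \<and>
      (\<forall>s. \<forall>u \<in> Hom A W (S (Suc s) n). r s n \<cdot> u = Zer A W (S s (n - 1)) \<longleftrightarrow>
        (\<exists>v \<in> Hom A W (S (Suc (Suc s)) (n + 1)). u = r (Suc s) (n + 1) \<cdot> v)))"

context
  fixes X S \<rho> r assumes res: "homology_resolution X S \<rho> r"
begin

lemma res_projective: "projective A (S s n)" and res_Ob: "S s n \<in> Ob A"
  using res projective_Ob unfolding homology_resolution_def by auto

lemma res_chain_map: "chain_map A (zd (S 0), \<rho>, X)"
  using res unfolding homology_resolution_def by simp

lemma res_cplx: "chain_complex A X"
  using chmap_simps[OF res_chain_map] by simp

lemma res_aug_cyc: "\<rho> n \<in> cyc X n (S 0 n)"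
  using res_chain_map by (simp add: zd_chain_map[OF res_Ob res_cplx])

lemma res_Hom: "r s n \<in> Hom A (S (Suc s) n) (S s (n - 1))"
  using res unfolding homology_resolution_def by simp

lemma res_Hom': "r s (n + 1) \<in> Hom A (S (Suc s) (n + 1)) (S s n)"
  using res_Hom[of s "n + 1"] by simp

lemma res_surj:
  assumes "projective A W" "x \<in> cyc X n W"
  obtains u b where "u \<in> Hom A W (S 0 n)" "b \<in> bnd X n W" "x = \<rho> n \<cdot> u \<oplus> b"
  using res assms unfolding homology_resolution_def by metis

lemma res_exact_0:
  assumes "projective A W" "u \<in> Hom A W (S 0 n)"
  shows "\<rho> n \<cdot> u \<in> bnd X n W \<longleftrightarrow> (\<exists>v \<in> Hom A W (S (Suc 0) (n + 1)). u = r 0 (n + 1) \<cdot> v)"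
  using res assms unfolding homology_resolution_def by simp

lemma res_exact:
  assumes "projective A W" "u \<in> Hom A W (S (Suc s) n)"
  shows "r s n \<cdot> u = Zer A W (S s (n - 1)) \<longleftrightarrow>
    (\<exists>v \<in> Hom A W (S (Suc (Suc s)) (n + 1)). u = r (Suc s) (n + 1) \<cdot> v)"
  using res assms unfolding homology_resolution_def by simp

text \<open>Exactness is given on projective elements; here it is applied to the generic one, the
  identity of \<open>S (Suc 0) (n + 1)\<close>.\<close>

lemma res_aug_comp_bnd: "\<rho> n \<cdot> r 0 (n + 1) \<in> bnd X n (S (Suc 0) (n + 1))"
  using res_exact_0[OF res_projective res_Hom'[of 0 n]]
    bexI[OF _ Ident_Hom[OF res_Ob[of "Suc 0" "n + 1"]]] res_Hom'[of 0 n]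
  by (auto simp: Hom_iff Comp_Ident_simps)

text \<open>The next syzygy is realized by the cone of the augmentation.\<close>

lemma homology_resolution_cell:
  obtains \<rho>' where "homology_resolution (cell X (S 0) \<rho>) (\<lambda>s. S (Suc s)) \<rho>' (\<lambda>s. r (Suc s))"
proof -
  note G = res_Ob[of 0] and X = res_cplx and p = res_chain_map
  note XA = cplx_simps(1-4)[OF X]
  have rA: "r s n \<in> Ar A" "Dom A (r s n) = S (Suc s) n" "Cod A (r s n) = S s (n - 1)" for s n
    using res_Hom[of s n] by (auto simp: Hom_iff)
  have \<rho>A: "\<rho> n \<in> Ar A" "Dom A (\<rho> n) = S 0 n" "Cod A (\<rho> n) = fst X n" for n
    using cyc_Hom[OF res_aug_cyc[of n]] by (auto simp: Hom_iff)
  \<comment> \<open>The arrow \<open>r 0 n\<close> has to be completed to a cycle of the cone. Its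
    image under the augmentation bounds, and the negative of a bounding arrow is the missing
    component.\<close>
  have "\<exists>c. c \<in> Hom A (S (Suc 0) n) (fst X n)
    \<and> \<rho> (n - 1) \<cdot> r 0 n \<oplus> snd X n \<cdot> c = Zer A (S (Suc 0) n) (fst X (n - 1))" for n
  proof -
    obtain y where y: "y \<in> Hom A (S (Suc 0) n) (fst X n)" "\<rho> (n - 1) \<cdot> r 0 n = snd X n \<cdot> y"
      using bndE[OF res_aug_comp_bnd[of "n - 1"]] by auto
    show ?thesis using y XA by (intro exI[of _ "\<ominus> y"]) (auto simp: Hom_iff ab_simps)
  qed
  then obtain c where c: "\<And>n. c n \<in> Hom A (S (Suc 0) n) (fst X n)"
    "\<And>n. \<rho> (n - 1) \<cdot> r 0 n \<oplus> snd X n \<cdot> c n = Zer A (S (Suc 0) n) (fst X (n - 1))" by metis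
  have cA: "c n \<in> Ar A" "Dom A (c n) = S (Suc 0) n" "Cod A (c n) = fst X n" for n
    using c(1)[of n] by (auto simp: Hom_iff)
  let ?C = "cell X (S 0) \<rho>"
  define \<rho>' where "\<rho>' n = cpair X (S 0) n (r 0 n) (c n)" for n
  have \<rho>'cyc: "\<rho>' n \<in> cyc ?C n (S (Suc 0) n)" for n
    unfolding \<rho>'_def cell_cyc_iff[OF G p res_Hom c(1)] by (rule c(2))
  have \<rho>'elt: "\<rho>' n \<cdot> u = cpair X (S 0) n (r 0 n \<cdot> u) (c n \<cdot> u)" if "u \<in> Hom A W (S (Suc 0) n)" for u W n
    unfolding \<rho>'_def by (rule pair_Comp[OF res_Hom c(1) that])
  have ce: "\<rho> (n - 1) \<cdot> (r 0 n \<cdot> u) \<oplus> snd X n \<cdot> (c n \<cdot> u) = Zer A W (fst X (n - 1))"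
    if u: "u \<in> Hom A W (S (Suc 0) n)" for u W n
  proof -
    have "(\<rho> (n - 1) \<cdot> r 0 n \<oplus> snd X n \<cdot> c n) \<cdot> u = \<rho> (n - 1) \<cdot> (r 0 n \<cdot> u) \<oplus> snd X n \<cdot> (c n \<cdot> u)"
      using u rA[of 0 n] \<rho>A[of "n - 1"] cA[of n] XA by (simp add: Hom_iff cat_simps Comp_Add)
    thus ?thesis unfolding c(2) using u XA res_Ob by (auto simp: Hom_iff Comp_Zer)
  qed
  \<comment> \<open>The augmentation is onto in homology, so every cycle of \<open>X\<close> becomes
    a boundary in the cone. The homology of the cone is therefore carried by the cell parts.\<close>
  have bndC: "cpair X (S 0) n (Zer A W (S 0 (n - 1))) x \<in> bnd ?C n W"
    if W: "projective A W" and x: "x \<in> cyc X n W" for x n W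
  proof -
    obtain u b where u: "u \<in> Hom A W (S 0 n)" "b \<in> bnd X n W" "x = \<rho> n \<cdot> u \<oplus> b" using res_surj[OF W x] .
    show ?thesis
      unfolding cell_bnd_iff[OF G p Zer_Hom[OF projective_Ob[OF W] G] cyc_Hom[OF x]]
      using u bndE[OF u(2)] by metis
  qed
  have "homology_resolution ?C (\<lambda>s. S (Suc s)) \<rho>' (\<lambda>s. r (Suc s))"
    unfolding homology_resolution_def
  proof (intro conjI allI impI ballI)
    show "projective A (S (Suc s) n)" for s n by (rule res_projective)
    show "chain_map A (zd (S (Suc 0)), \<rho>', ?C)"
      using \<rho>'cyc by (simp add: zd_chain_map[OF res_Ob cell_complex[OF G p]])
    show "r (Suc s) n \<in> Hom A (S (Suc (Suc s)) n) (S (Suc s) (n - 1))" for s n by (rule res_Hom)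
    fix W n assume W: "projective A W"
    note WO = projective_Ob[OF W]
    {
      fix s u assume "u \<in> Hom A W (S (Suc (Suc s)) n)"
      from res_exact[OF W this]
      show "r (Suc s) n \<cdot> u = Zer A W (S (Suc s) (n - 1)) \<longleftrightarrow>
        (\<exists>v \<in> Hom A W (S (Suc (Suc (Suc s))) (n + 1)). u = r (Suc (Suc s)) (n + 1) \<cdot> v)" .
    next
      fix u assume u: "u \<in> Hom A W (S (Suc 0) n)"
      have ru: "r 0 n \<cdot> u \<in> Hom A W (S 0 (n - 1))" and cu: "c n \<cdot> u \<in> Hom A W (fst X n)"
        using u rA cA by (auto simp: Hom_iff cat_simps)
      have "\<rho>' n \<cdot> u \<in> bnd ?C n W \<longleftrightarrow> r 0 n \<cdot> u = Zer A W (S 0 (n - 1))"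
      proof
        assume "\<rho>' n \<cdot> u \<in> bnd ?C n W"
        thus "r 0 n \<cdot> u = Zer A W (S 0 (n - 1))"
          unfolding \<rho>'elt[OF u] cell_bnd_iff[OF G p ru cu] by blast
      next
        assume z: "r 0 n \<cdot> u = Zer A W (S 0 (n - 1))"
        have "snd X n \<cdot> (c n \<cdot> u) = Zer A W (fst X (n - 1))"
          using ce[OF u] u \<rho>A[of "n - 1"] cA[of n] XA WO
          by (simp add: z Comp_Zer Hom_iff cat_simps Zer_Add)
        hence "c n \<cdot> u \<in> cyc X n W" using cu by (simp add: cyc_def)
        thus "\<rho>' n \<cdot> u \<in> bnd ?C n W" unfolding \<rho>'elt[OF u] z by (rule bndC[OF W])
      qed
      thus "\<rho>' n \<cdot> u \<in> bnd ?C n W \<longleftrightarrow> (\<exists>v \<in> Hom A W (S (Suc (Suc 0)) (n + 1)). u = r (Suc 0) (n + 1) \<cdot> v)"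
        using res_exact[OF W u] by simp
    next
      fix z assume z: "z \<in> cyc ?C n W"
      obtain a x where ax: "a \<in> Hom A W (S 0 (n - 1))" "x \<in> Hom A W (fst X n)" "z = cpair X (S 0) n a x"
        using cell_cases[OF G p cyc_Hom[OF z]] .
      have e: "\<rho> (n - 1) \<cdot> a \<oplus> snd X n \<cdot> x = Zer A W (fst X (n - 1))"
        using z cell_cyc_iff[OF G p ax(1,2)] ax(3) by simp
      have ty: "a \<in> Ar A" "Dom A a = W" "Cod A a = S 0 (n - 1)" "x \<in> Ar A" "Dom A x = W" "Cod A x = fst X n"
        using ax by (auto simp: Hom_iff)
      have "\<rho> (n - 1) \<cdot> a = \<ominus> (snd X n \<cdot> x)"
        using e by (subst (asm) sum_Zer_iff) (use ty \<rho>A XA in \<open>auto simp: cat_simps\<close>)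
      also have "\<dots> = snd X n \<cdot> (\<ominus> x)" using ty XA by (simp add: Comp_neg)
      finally have "\<rho> (n - 1) \<cdot> a \<in> bnd X (n - 1) W"
        using ty by (intro bndI[of "\<ominus> x"]) (auto simp: Hom_iff neg_simps)
      \<comment> \<open>The cell part of a cycle is a syzygy and so comes from some \<open>v\<close>
        into \<open>S (Suc 0) n\<close>. Subtracting the image of \<open>v\<close> leaves a cycle of
        \<open>X\<close>, to which \<open>bndC\<close> applies.\<close>
      with res_exact_0[OF W ax(1)] obtain v where v: "v \<in> Hom A W (S (Suc 0) n)" "a = r 0 n \<cdot> v" by auto
      have cv: "c n \<cdot> v \<in> Hom A W (fst X n)" using v cA by (auto simp: Hom_iff cat_simps)
      have "\<rho> (n - 1) \<cdot> a \<oplus> snd X n \<cdot> x = \<rho> (n - 1) \<cdot> a \<oplus> snd X n \<cdot> (c n \<cdot> v)"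
        using e ce[OF v(1)] v(2) by simp
      hence "snd X n \<cdot> x = snd X n \<cdot> (c n \<cdot> v)"
        by (subst (asm) Add_left_cancel) (use ty \<rho>A XA cv in \<open>auto simp: Hom_iff cat_simps\<close>)
      hence x1: "x \<oplus> \<ominus> (c n \<cdot> v) \<in> cyc X n W"
        using ax(2) cv XA by (auto simp: cyc_def Hom_iff ab_simps)
      let ?b = "cpair X (S 0) n (Zer A W (S 0 (n - 1))) (x \<oplus> \<ominus> (c n \<cdot> v))"
      have "\<rho>' n \<cdot> v \<oplus> ?b = cpair X (S 0) n (r 0 n \<cdot> v \<oplus> Zer A W (S 0 (n - 1))) (c n \<cdot> v \<oplus> (x \<oplus> \<ominus> (c n \<cdot> v)))"
        unfolding \<rho>'elt[OF v(1)]
        by (rule pair_Add) (use ax(1) v(2) cv cyc_Hom[OF x1] Zer_Hom[OF WO G] in auto)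
      also have "c n \<cdot> v \<oplus> (x \<oplus> \<ominus> (c n \<cdot> v)) = x"
        using ty cv XA(1) by (simp add: Hom_iff Add_left_commute[of "c n \<cdot> v" x] neg_simps neg_Add Zer_Add)
      finally have "z = \<rho>' n \<cdot> v \<oplus> ?b" using ax(3) v(2) ty by (simp add: Zer_Add)
      thus "\<exists>u \<in> Hom A W (S (Suc 0) n). \<exists>b \<in> bnd ?C n W. z = \<rho>' n \<cdot> u \<oplus> b"
        using v(1) bndC[OF W x1] by blast
    }
  qed
  thus ?thesis using that by blast
qed

lemma res_zero_acyclic:
  assumes "\<And>n. zero_object A (S 0 n)"
  shows "zero_object D.L X"
proof (rule acyclic_zero_object[OF res_cplx], rule subsetI)
  fix W n x assume W: "projective A W" and x: "x \<in> cyc X n W"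
  note WO = projective_Ob[OF W]
  obtain u b where u: "u \<in> Hom A W (S 0 n)" "b \<in> bnd X n W" "x = \<rho> n \<cdot> u \<oplus> b" using res_surj[OF W x] .
  have "u = Zer A W (S 0 n)" using zero_object_Zer(2)[OF assms, of u n] u(1) by (simp add: Hom_iff)
  hence "x = b" using u(3) cyc_Hom[OF res_aug_cyc[of n]] bnd_Hom[OF res_cplx u(2)] WO
    by (simp add: Hom_iff Comp_Zer Zer_Add)
  thus "x \<in> bnd X n W" using u(2) by simp
qed

end

subsection \<open>Composites of ghosts\<close>

definition ghost where
  "ghost \<alpha> \<longleftrightarrow> \<alpha> \<in> Ar D.L \<and>
    (\<forall>n. derived_homology A n \<alpha> = Zer A (homology A n (Dom D.L \<alpha>)) (homology A n (Cod D.L \<alpha>)))"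

lemma ghost_Comp:
  assumes g: "ghost \<gamma>" "\<gamma> \<in> Hom D.L Y Z" and a: "\<alpha> \<in> Hom D.L X Y"
  shows "derived_homology A n (\<gamma> \<star> \<alpha>) = Zer A (homology A n X) (homology A n Z)"
  using g derived_homology_Hom[OF a, of n] homology_Ob L_Hom_cplx[OF g(2)]
  by (auto simp: ghost_def derived_homology_Comp[OF a g(2)] Hom_iff Comp_Zer)

text \<open>The identity of \<open>G n\<close> is a cycle of \<open>zd G\<close> whose image is
  \<open>g n\<close>. A ghost turns it into a boundary, and a family of boundaries is
  null-homotopic.\<close>

lemma ghost_from_zd:
  assumes G: "\<And>n. projective A (G n)" and a: "\<alpha> \<in> Hom D.L (zd G) Y"
    and z: "\<And>n. derived_homology A n \<alpha> = Zer A (homology A n (zd G)) (homology A n Y)"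
  shows "\<alpha> = zarr (zd G) Y"
proof -
  obtain g where g: "chain_map A (zd G, g, Y)" "\<alpha> = D.Q (zd G, g, Y)" using zd_map_Q[OF G a] .
  have "g n \<in> bnd Y n (G n)" for n
  proof -
    have "homology_map A n (zd G, g, Y) = Zer A (homology A n (zd G)) (homology A n Y)"
      using z[of n] g derived_homology_Q[OF g(1)] by simp
    moreover have "Ident A (G n) \<in> cyc (zd G) n (G n)" by (simp add: zd_cyc projective_Ob[OF G] Ident_Hom)
    ultimately have "g n \<cdot> Ident A (G n) \<in> bnd Y n (G n)" using homology_map_Zer_iff[OF g(1)] G by blast
    thus ?thesis using chmap_simps(3-5)[OF g(1), of n] by (simp add: zd_fst Comp_Ident_simps)
  qed
  thus ?thesis unfolding g(2) by (simp add: zd_map_zarr_iff[OF G g(1)])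
qed

text \<open>The additional arrow \<alpha> makes the induction possible: once
  \<open>f 0 \<star> \<alpha>\<close> has been factored through the cone, the resolved complex is
  the cone, while the remaining ghosts still start at \<open>Y 1\<close>. Each step uses up one
  ghost and one term of the resolution; for \<open>k = 0\<close> all terms vanish and
  \<open>X\<close> is acyclic.\<close>

lemma composite_ghosts_zero:
  assumes "homology_resolution X S \<rho> r" "\<And>s n. s \<ge> k \<Longrightarrow> zero_object A (S s n)"
    and "\<alpha> \<in> Hom D.L X (Y 0)" "\<And>i. i < k \<Longrightarrow> f i \<in> Hom D.L (Y i) (Y (Suc i)) \<and> ghost (f i)"
  shows "composite D.L (Y 0) f k \<star> \<alpha> = zarr X (Y k)"
  using assms
proof (induction k arbitrary: X S \<rho> r \<alpha> Y f)
  case 0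
  have Z: "zero_object D.L X" by (rule res_zero_acyclic[OF 0(1)]) (use 0(2) in simp)
  have "\<alpha> = zarr X (Y 0)" by (rule zero_object_zarr(3)[OF Z 0(3)])
  thus ?case using D.L.Ident_left[OF 0(3)] by simp
next
  case (Suc k)
  note res = Suc.prems(1)
  note a = Suc.prems(3)
  have f: "f i \<in> Hom D.L (Y i) (Y (Suc i))" "ghost (f i)" if "i < Suc k" for i
    using Suc.prems(4) that by auto
  note p = res_chain_map[OF res]
  have fa: "f 0 \<star> \<alpha> \<in> Hom D.L X (Y (Suc 0))" by (rule D.L.Comp_Hom[OF a f(1)]) simp
  have fap: "(f 0 \<star> \<alpha>) \<star> D.Q (zd (S 0), \<rho>, X) = f 0 \<star> (\<alpha> \<star> D.Q (zd (S 0), \<rho>, X))"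
    by (rule D.L.Comp_assoc[OF Q_Hom[OF p] a f(1), symmetric]) simp
  have "(f 0 \<star> \<alpha>) \<star> D.Q (zd (S 0), \<rho>, X) = zarr (zd (S 0)) (Y (Suc 0))"
    by (rule ghost_from_zd[OF res_projective[OF res] D.L.Comp_Hom[OF Q_Hom[OF p] fa]])
      (unfold fap, rule ghost_Comp[OF f(2,1) D.L.Comp_Hom[OF Q_Hom[OF p] a]], simp_all)
  then obtain \<beta> where b: "\<beta> \<in> Hom D.L (cell X (S 0) \<rho>) (Y (Suc 0))"
    "f 0 \<star> \<alpha> = \<beta> \<star> D.Q (X, cell_incl X (S 0), cell X (S 0) \<rho>)"
    by (rule factor_through_cell[OF res_projective[OF res] fa p])
  obtain \<rho>' where res': "homology_resolution (cell X (S 0) \<rho>) (\<lambda>s. S (Suc s)) \<rho>' (\<lambda>s. r (Suc s))"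
    using homology_resolution_cell[OF res] .
  let ?g = "composite D.L (Y (Suc 0)) (\<lambda>i. f (Suc i)) k"
  have IH: "?g \<star> \<beta> = zarr (cell X (S 0) \<rho>) (Y (Suc k))"
    using Suc.IH[OF res', of \<beta> "\<lambda>i. Y (Suc i)" "\<lambda>i. f (Suc i)"] Suc.prems(2) b(1) f by simp
  have Y1: "Y (Suc 0) \<in> Ob D.L" and Y0: "Y 0 \<in> Ob D.L" using D.L.Hom_Ob[OF f(1)[of 0]] by auto
  have g: "?g \<in> Hom D.L (Y (Suc 0)) (Y (Suc k))"
    by (rule D.L.composite_Hom[where Y = "\<lambda>i. Y (Suc i)"]) (use Y1 f in auto)
  note incl = cell_incl[OF res_Ob[OF res] p]
  have Yk: "chain_complex A (Y (Suc k))" using L_Hom_cplx[OF g] by simp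
  have "composite D.L (Y 0) f (Suc k) \<star> \<alpha> = (?g \<star> f 0) \<star> \<alpha>"
    by (subst D.L.composite_Suc_shift[OF Y0]) (use f in auto)
  also have "\<dots> = ?g \<star> (f 0 \<star> \<alpha>)"
    by (rule D.L.Comp_assoc[OF a f(1) g, symmetric]) simp
  also have "\<dots> = (?g \<star> \<beta>) \<star> D.Q (X, cell_incl X (S 0), cell X (S 0) \<rho>)"
    unfolding b(2) by (rule D.L.Comp_assoc[OF Q_Hom[OF incl] b(1) g])
  also have "\<dots> = zarr X (Y (Suc k))"
    unfolding IH by (rule zarr_Comp[OF Q_Hom[OF incl] Yk])
  finally show ?case .
qed

subsection \<open>Existence of resolutions\<close>

text \<open>Lets the zero terms beyond the end of a resolution count as projective, so that
  \<open>homology_resolution\<close> can ask for projectivity at every index.\<close>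

lemma zero_object_projective:
  assumes "zero_object A Z" shows "projective A Z"
  unfolding projective_def
proof (intro conjI allI impI ballI)
  show ZO: "Z \<in> Ob A" using assms by (simp add: zero_object_def)
  fix e f assume e: "epi_arrow A e" and f: "f \<in> Hom A Z (Cod A e)"
  have eA: "e \<in> Ar A" using e by (simp add: epi_arrow_def)
  have "e \<cdot> Zer A Z (Dom A e) = f"
    using zero_object_Zer(1)[OF assms, of f] f eA ZO by (simp add: Hom_iff Comp_Zer)
  thus "\<exists>g \<in> Hom A Z (Dom A e). e \<cdot> g = f" using Zer_Hom[OF ZO] eA Dom_Ob by blast
qed

text \<open>Exactness makes the image of \<open>f\<close> the kernel of \<open>g\<close>; a
  projective \<open>W\<close> then lifts from the image to the domain of \<open>f\<close>.\<close>

lemma exact_pair_elements: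
  assumes "exact_pair A f g" and W: "projective A W" and u: "u \<in> Hom A W (Dom A g)"
  shows "g \<cdot> u = Zer A W (Cod A g) \<longleftrightarrow> (\<exists>v \<in> Hom A W (Dom A f). u = f \<cdot> v)"
proof -
  have f: "f \<in> Ar A" and k: "is_kernel A g (im_arrow A f)" using assms(1) by (auto simp: exact_pair_def)
  note k' = is_kernelD[OF k]
  obtain e where e: "e \<in> Hom A (Dom A f) (Dom A (im_arrow A f))" "epi_arrow A e" "im_arrow A f \<cdot> e = f"
    using image_factorization[OF f] by metis
  have fe: "f \<cdot> v = im_arrow A f \<cdot> (e \<cdot> v)" if "v \<in> Hom A W (Dom A f)" for v
  proof -
    have "(im_arrow A f \<cdot> e) \<cdot> v = im_arrow A f \<cdot> (e \<cdot> v)"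
      by (rule Comp_assoc_simp) (use that e(1) k'(2) in \<open>auto simp: Hom_iff\<close>)
    thus ?thesis unfolding e(3) .
  qed
  show ?thesis
  proof
    assume "g \<cdot> u = Zer A W (Cod A g)"
    then obtain w where w: "w \<in> Hom A W (Dom A (im_arrow A f))" "im_arrow A f \<cdot> w = u"
      using kernelE[OF k u] by metis
    then obtain v where v: "v \<in> Hom A W (Dom A f)" "e \<cdot> v = w"
      using projective_lift[OF W e(2), of w] e(1) by (auto simp: Hom_iff)
    have fv: "f \<cdot> v = im_arrow A f \<cdot> (e \<cdot> v)" by (rule fe[OF v(1)])
    thus "\<exists>v \<in> Hom A W (Dom A f). u = f \<cdot> v" using v w by (intro bexI[OF _ v(1)]) simp
  next
    assume "\<exists>v \<in> Hom A W (Dom A f). u = f \<cdot> v"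
    then obtain v where v: "v \<in> Hom A W (Dom A f)" "u = f \<cdot> v" by blast
    have fv: "f \<cdot> v = im_arrow A f \<cdot> (e \<cdot> v)" by (rule fe[OF v(1)])
    have "g \<cdot> u = g \<cdot> (im_arrow A f \<cdot> (e \<cdot> v))" unfolding v(2) fv ..
    also have "\<dots> = (g \<cdot> im_arrow A f) \<cdot> (e \<cdot> v)"
      by (rule Comp_assoc_simp[symmetric]) (use v(1) e(1) k' in \<open>auto simp: Hom_iff cat_simps\<close>)
    also have "\<dots> = Zer A W (Cod A g)"
      unfolding k'(4) using v(1) e(1) k'(1) by (auto simp: Hom_iff cat_simps Comp_Zer)
    finally show "g \<cdot> u = Zer A W (Cod A g)" .
  qed
qed

lemma projdim_resolution:
  assumes "projdim A M < enat k"
  obtains P r where "\<And>s. projective A (P s)" "\<And>s. s \<ge> k \<Longrightarrow> zero_object A (P s)"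
    "r 0 \<in> Hom A (P 0) M" "\<And>s. r (Suc s) \<in> Hom A (P (Suc s)) (P s)"
    "epi_arrow A (r 0)" "\<And>s. exact_pair A (r (Suc s)) (r s)"
proof -
  obtain m P r where m: "projective_resolution A M m P r" "m < k"
    using assms unfolding projdim_def INF_less_iff by auto
  have "projective A (P s)" for s
    using m(1) zero_object_projective unfolding projective_resolution_def by (cases "s \<le> m") auto
  thus ?thesis using that[of P r] m unfolding projective_resolution_def by auto
qed

lemma homology_resolution_exists:
  assumes X: "chain_complex A X" and "\<And>n. projdim A (homology A n X) < enat k"
  obtains S \<rho> r where "homology_resolution X S \<rho> r" "\<And>s n. s \<ge> k \<Longrightarrow> zero_object A (S s n)"
proof -
  have "\<exists>P r. (\<forall>s. projective A (P s)) \<and> (\<forall>s \<ge> k. zero_object A (P s)) \<and>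
    r 0 \<in> Hom A (P 0) (homology A n X) \<and> (\<forall>s. r (Suc s) \<in> Hom A (P (Suc s)) (P s)) \<and>
    epi_arrow A (r 0) \<and> (\<forall>s. exact_pair A (r (Suc s)) (r s))" for n
    using projdim_resolution[OF assms(2)[of n]] by metis
  then obtain P q where PP: "\<And>n s. projective A (P n s)" and PZ: "\<And>n s. s \<ge> k \<Longrightarrow> zero_object A (P n s)"
    and q0: "\<And>n. q n 0 \<in> Hom A (P n 0) (homology A n X)"
    and qS: "\<And>n s. q n (Suc s) \<in> Hom A (P n (Suc s)) (P n s)"
    and qe: "\<And>n. epi_arrow A (q n 0)" and qx: "\<And>n s. exact_pair A (q n (Suc s)) (q n s)"
    by metis
  \<comment> \<open>The \<open>s\<close>-th term of the resolution of the homology in degree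
    \<open>i\<close> is put in degree \<open>i + s\<close>, so that all maps of the resolutions get
    degree \<open>-1\<close>.\<close>
  define S where "S s n = P (n - int s) s" for s n
  define r where "r s n = q (n - 1 - int s) (Suc s)" for s n
  \<comment> \<open>As \<open>S 0 n\<close> is projective, the augmentation into homology lifts to a
    cycle.\<close>
  have "\<exists>x. x \<in> cyc X n (S 0 n) \<and> hcl X n x = q n 0" for n
    using hcl_surj[OF X PP q0] unfolding S_def by (metis diff_zero of_nat_0)
  then obtain \<rho> where \<rho>: "\<And>n. \<rho> n \<in> cyc X n (S 0 n)" "\<And>n. hcl X n (\<rho> n) = q n 0" by metis
  have SP: "projective A (S s n)" for s n unfolding S_def by (rule PP)
  have Sr: "r s n \<in> Hom A (S (Suc s) n) (S s (n - 1))" for s n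
    using qS[of "n - 1 - int s" s] by (simp add: S_def r_def diff_diff_eq add.commute)
  have "homology_resolution X S \<rho> r"
    unfolding homology_resolution_def
  proof (intro conjI allI impI ballI)
    show "projective A (S s n)" for s n by (rule SP)
    show "chain_map A (zd (S 0), \<rho>, X)"
      using \<rho>(1) by (simp add: zd_chain_map[OF projective_Ob[OF SP] X])
    show "r s n \<in> Hom A (S (Suc s) n) (S s (n - 1))" for s n by (rule Sr)
    fix W n assume W: "projective A W"
    {
      fix s u assume u: "u \<in> Hom A W (S (Suc s) n)"
      have "Dom A (q (n - 1 - int s) (Suc s)) = S (Suc s) n" "Cod A (q (n - 1 - int s) (Suc s)) = S s (n - 1)"
        "Dom A (q (n - 1 - int s) (Suc (Suc s))) = S (Suc (Suc s)) (n + 1)"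
        "r (Suc s) (n + 1) = q (n - 1 - int s) (Suc (Suc s))"
        using qS[of "n - 1 - int s"] by (auto simp: Hom_iff S_def r_def algebra_simps)
      thus "r s n \<cdot> u = Zer A W (S s (n - 1)) \<longleftrightarrow>
        (\<exists>v \<in> Hom A W (S (Suc (Suc s)) (n + 1)). u = r (Suc s) (n + 1) \<cdot> v)"
        using exact_pair_elements[OF qx W, of u "n - 1 - int s" "Suc s"] u by (simp add: r_def[of s n])
    next
      fix u assume u: "u \<in> Hom A W (S 0 n)"
      have ru: "\<rho> n \<cdot> u \<in> cyc X n W" by (rule cyc_Comp[OF X \<rho>(1) u])
      have "\<rho> n \<cdot> u \<in> bnd X n W \<longleftrightarrow> hcl X n (\<rho> n \<cdot> u) = Zer A W (homology A n X)"
        using hcl_bnd[OF X] hcl_Zer_imp_bnd[OF X W ru] by blast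
      also have "hcl X n (\<rho> n \<cdot> u) = q n 0 \<cdot> u" unfolding hcl_Comp[OF X \<rho>(1) u] \<rho>(2) ..
      finally have "\<rho> n \<cdot> u \<in> bnd X n W \<longleftrightarrow> q n 0 \<cdot> u = Zer A W (homology A n X)" .
      moreover have "Dom A (q n 0) = S 0 n" "Cod A (q n 0) = homology A n X"
        "Dom A (q n (Suc 0)) = S (Suc 0) (n + 1)" "r 0 (n + 1) = q n (Suc 0)"
        using q0[of n] qS[of n 0] by (auto simp: Hom_iff S_def r_def)
      ultimately show "\<rho> n \<cdot> u \<in> bnd X n W \<longleftrightarrow>
        (\<exists>v \<in> Hom A W (S (Suc 0) (n + 1)). u = r 0 (n + 1) \<cdot> v)"
        using exact_pair_elements[OF qx W, of u n 0] u by simp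
    next
      fix x assume x: "x \<in> cyc X n W"
      obtain u where u: "u \<in> Hom A W (S 0 n)" "q n 0 \<cdot> u = hcl X n x"
        using projective_lift[OF W qe, of "hcl X n x" n] hcl_Hom[OF X x] q0[of n] by (auto simp: Hom_iff S_def)
      have "hcl X n x = hcl X n (\<rho> n \<cdot> u)" unfolding hcl_Comp[OF X \<rho>(1) u(1)] \<rho>(2) u(2) ..
      then obtain b where "b \<in> bnd X n W" "x = \<rho> n \<cdot> u \<oplus> b"
        using hcl_eq_imp_bnd[OF X W x cyc_Comp[OF X \<rho>(1) u(1)]] by metis
      thus "\<exists>u \<in> Hom A W (S 0 n). \<exists>b \<in> bnd X n W. x = \<rho> n \<cdot> u \<oplus> b" using u(1) by blast
    }
  qed
  moreover have "s \<ge> k \<Longrightarrow> zero_object A (S s n)" for s n unfolding S_def by (rule PZ)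
  ultimately show ?thesis using that by blast
qed

section \<open>Suspension and triangles\<close>

lemma shift_fst: "fst (shift_cplx A n X) m = fst X (m - n)"
  by (simp add: shift_cplx_def)

lemma shift_snd: "snd (shift_cplx A n X) m = (if even n then snd X (m - n) else \<ominus> snd X (m - n))"
  by (simp add: shift_cplx_def)

lemma shift_complex:
  assumes X: "chain_complex A X" shows "chain_complex A (shift_cplx A n X)"
proof (rule chain_complexI)
  note XA = cplx_simps(1-4)[OF X]
  show "fst (shift_cplx A n X) m \<in> Ob A" for m by (simp add: shift_fst XA)
  show "snd (shift_cplx A n X) m \<in> Hom A (fst (shift_cplx A n X) m) (fst (shift_cplx A n X) (m - 1))" for m
    using XA[of "m - n"] by (simp add: shift_fst shift_snd Hom_iff neg_simps algebra_simps)
  show "snd (shift_cplx A n X) (m - 1) \<cdot> snd (shift_cplx A n X) m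
    = Zer A (fst (shift_cplx A n X) m) (fst (shift_cplx A n X) (m - 2))" for m
  proof -
    have e: "m - 1 - n = m - n - 1" "m - 2 - n = m - n - 2" by simp_all
    show ?thesis unfolding shift_fst shift_snd e
      using cplx_simps(1-5)[OF X, of "m - n"] XA[of "m - n - 1"] XA(1)[of "m - n - 2"]
      by (simp add: Comp_neg neg_neg neg_Zer neg_simps)
  qed
qed

lemma shift_snd_elt:
  assumes "chain_complex A X" "x \<in> Hom A W (fst X (m - n))"
  shows "snd (shift_cplx A n X) m \<cdot> x = (if even n then snd X (m - n) \<cdot> x else \<ominus> (snd X (m - n) \<cdot> x))"
  using assms(2) cplx_simps(1-4)[OF assms(1), of "m - n"] by (simp add: shift_snd Hom_iff Comp_neg)

lemma neg_eq_Zer_iff: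
  "f \<in> Ar A \<Longrightarrow> Dom A f = X \<Longrightarrow> Cod A f = Y \<Longrightarrow> \<ominus> f = Zer A X Y \<longleftrightarrow> f = Zer A X Y"
  using neg_neg[of f] neg_Zer[of X Y] Dom_Ob[of f] Cod_Ob[of f] by auto

text \<open>A sign in the differential changes neither its kernel nor its image. This lemma and its
  counterpart for boundaries make suspension preserve quasi-isomorphisms.\<close>

lemma cyc_shift:
  assumes X: "chain_complex A X"
  shows "cyc (shift_cplx A n X) m W = cyc X (m - n) W"
proof -
  have e: "m - 1 - n = m - n - 1" by simp
  have "snd (shift_cplx A n X) m \<cdot> x = Zer A W (fst X (m - n - 1))
      \<longleftrightarrow> snd X (m - n) \<cdot> x = Zer A W (fst X (m - n - 1))" if "x \<in> Hom A W (fst X (m - n))" for x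
    unfolding shift_snd_elt[OF X that] using that cplx_simps(1-4)[OF X, of "m - n"]
    by (simp add: neg_eq_Zer_iff Hom_iff cat_simps)
  thus ?thesis unfolding cyc_def shift_fst e by blast
qed

lemma bnd_shift:
  assumes X: "chain_complex A X"
  shows "bnd (shift_cplx A n X) m W = bnd X (m - n) W"
proof -
  have e: "m + 1 - n = m - n + 1" by simp
  have d: "snd (shift_cplx A n X) (m + 1) \<cdot> y = (if even n then snd X (m - n + 1) \<cdot> y else \<ominus> (snd X (m - n + 1) \<cdot> y))"
    if "y \<in> Hom A W (fst X (m - n + 1))" for y
    using shift_snd_elt[OF X, of y W "m + 1" n] that unfolding e by simp
  show ?thesis
  proof (intro Set.set_eqI iffI)
    fix x assume "x \<in> bnd (shift_cplx A n X) m W"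
    then obtain y where y: "y \<in> Hom A W (fst X (m - n + 1))" "x = snd (shift_cplx A n X) (m + 1) \<cdot> y"
      by (rule bndE) (simp add: shift_fst e)
    show "x \<in> bnd X (m - n) W"
      using bndI[OF y(1) HOL.refl] bnd_neg[OF X bndI[OF y(1) HOL.refl]] unfolding y(2) d[OF y(1)] by simp
  next
    fix x assume x: "x \<in> bnd X (m - n) W"
    obtain y where y: "y \<in> Hom A W (fst X (m - n + 1))" "(if even n then x else \<ominus> x) = snd X (m - n + 1) \<cdot> y"
      using bndE[OF x] bndE[OF bnd_neg[OF X x]] by (metis (full_types))
    have "x = snd (shift_cplx A n X) (m + 1) \<cdot> y"
      unfolding d[OF y(1)] y(2)[symmetric] using bnd_Hom[OF X x] by (simp add: neg_neg Hom_iff)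
    thus "x \<in> bnd (shift_cplx A n X) m W" using y(1) by (intro bndI[of y]) (simp_all add: shift_fst e)
  qed
qed

lemma shift_chain_map:
  assumes f: "chain_map A (X, f, Y)"
  shows "chain_map A (shift_cplx A n X, \<lambda>m. f (m - n), shift_cplx A n Y)"
proof (rule chain_mapI)
  note c = chmap_simps[OF f]
  show "chain_complex A (shift_cplx A n X)" "chain_complex A (shift_cplx A n Y)" using c shift_complex by auto
  show "f (m - n) \<in> Hom A (fst (shift_cplx A n X) m) (fst (shift_cplx A n Y) m)" for m
    using c(3-5) by (simp add: shift_fst Hom_iff)
  show "snd (shift_cplx A n Y) m \<cdot> f (m - n) = f (m - 1 - n) \<cdot> snd (shift_cplx A n X) m" for m
  proof -
    have e: "m - 1 - n = m - n - 1" by simp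
    show ?thesis unfolding shift_snd e
      using c(3-6) cplx_simps(1-4)[OF c(1)] cplx_simps(1-4)[OF c(2)] by (simp add: Comp_neg)
  qed
qed

lemma shift_quasi_iso:
  assumes f: "(X, f, Y) \<in> quasi_isos A"
  shows "(shift_cplx A n X, \<lambda>m. f (m - n), shift_cplx A n Y) \<in> quasi_isos A"
  using f shift_chain_map[of X f Y n] chmap_simps(1,2)[OF quasi_iso_chmap[OF f]]
  unfolding quasi_iso_iff by (simp add: cyc_shift bnd_shift)

section \<open>Suspension of zigzags and of arrows of the derived category\<close>

abbreviation "sh n \<equiv> map_letter (shift_chmap A n)"

lemma shift_zigzag:
  "zigzag (Ch A) (quasi_isos A) X p Y
    \<Longrightarrow> zigzag (Ch A) (quasi_isos A) (shift_cplx A n X) (map (sh n) p) (shift_cplx A n Y)"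
proof (induction p arbitrary: X)
  case Nil
  thus ?case by (auto simp: Ch_simps shift_complex)
next
  case (Cons l p)
  have "letter_ok (Ch A) (quasi_isos A) (sh n l) \<and>
    letter_src (Ch A) (sh n l) = shift_cplx A n (letter_src (Ch A) l) \<and>
    letter_tgt (Ch A) (sh n l) = shift_cplx A n (letter_tgt (Ch A) l)"
    using Cons.prems
    by (cases l; cases "(case l of Fwd \<phi> \<Rightarrow> \<phi> | Bwd \<phi> \<Rightarrow> \<phi>)")
      (auto simp: Ch_simps shift_chmap_def shift_chain_map shift_quasi_iso)
  thus ?case using Cons by auto
qed

lemma shift_zigzag_rel:
  assumes "zigzag_rel (Ch A) (quasi_isos A) a b"
  shows "zigzag_rel (Ch A) (quasi_isos A) (map (sh n) a) (map (sh n) b)"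
  using assms
proof cases
  case (ident X)
  have "shift_chmap A n (Ident (Ch A) X) = Ident (Ch A) (shift_cplx A n X)"
    by (simp add: Ch_simps shift_chmap_def shift_fst)
  thus ?thesis using ident zigzag_rel.ident[of "shift_cplx A n X" "Ch A"] by (simp add: Ch_simps shift_complex)
next
  case (comp f g)
  obtain X f' Y where f: "f = (X, f', Y)" by (cases f)
  obtain g' Z where g: "g = (Y, g', Z)" using comp f by (cases g) (auto simp: Ch_simps)
  show ?thesis
    using comp zigzag_rel.comp[of "shift_chmap A n f" "Ch A" "shift_chmap A n g" "quasi_isos A"]
    by (simp add: f g Ch_simps shift_chmap_def shift_chain_map)
next
  case (inv_right w)
  obtain X f Y where w: "w = (X, f, Y)" by (cases w)
  show ?thesis using inv_right zigzag_rel.inv_right[of "shift_chmap A n w" "quasi_isos A" "Ch A"]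
    by (simp add: w shift_chmap_def shift_quasi_iso)
next
  case (inv_left w)
  obtain X f Y where w: "w = (X, f, Y)" by (cases w)
  show ?thesis using inv_left zigzag_rel.inv_left[of "shift_chmap A n w" "quasi_isos A" "Ch A"]
    by (simp add: w shift_chmap_def shift_quasi_iso)
qed

lemma shift_loc_equiv:
  "loc_equiv (Ch A) (quasi_isos A) X Y p q
    \<Longrightarrow> loc_equiv (Ch A) (quasi_isos A) (shift_cplx A n X) (shift_cplx A n Y) (map (sh n) p) (map (sh n) q)"
proof (induction rule: loc_equiv.induct)
  case (step a b p q)
  show ?case
    using loc_equiv.step[OF shift_zigzag_rel[OF step(1), of n], of _ "map (sh n) p" "map (sh n) q"]
      shift_zigzag[OF step(2), of n] shift_zigzag[OF step(3), of n] by simp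
qed (auto intro: loc_equiv.refl loc_equiv.sym loc_equiv.trans shift_zigzag)

text \<open>\<open>shift_darrow\<close> suspends all zigzags of a class and saturates the result; by
  \<open>shift_loc_equiv\<close> a single representative gives the same class.\<close>

lemma shift_darrow_class:
  assumes "zigzag (Ch A) (quasi_isos A) X p Y"
  shows "shift_darrow A n (loc_class (Ch A) (quasi_isos A) X p Y)
    = loc_class (Ch A) (quasi_isos A) (shift_cplx A n X) (map (sh n) p) (shift_cplx A n Y)"
proof -
  let ?E = "loc_equiv (Ch A) (quasi_isos A) (shift_cplx A n X) (shift_cplx A n Y)"
  have "(\<exists>p'. loc_equiv (Ch A) (quasi_isos A) X Y p p' \<and> ?E (map (sh n) p') q) \<longleftrightarrow> ?E (map (sh n) p) q" for q
  proof
    assume "\<exists>p'. loc_equiv (Ch A) (quasi_isos A) X Y p p' \<and> ?E (map (sh n) p') q"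
    then obtain p' where "loc_equiv (Ch A) (quasi_isos A) X Y p p'" "?E (map (sh n) p') q" by blast
    thus "?E (map (sh n) p) q" by (rule loc_equiv.trans[OF shift_loc_equiv])
  qed (use loc_equiv.refl[OF assms] in blast)
  thus ?thesis by (simp add: shift_darrow_def loc_class_def)
qed

lemma shift_darrow_Q:
  assumes "chain_map A (X, f, Y)"
  shows "shift_darrow A n (D.Q (X, f, Y)) = D.Q (shift_cplx A n X, \<lambda>m. f (m - n), shift_cplx A n Y)"
proof -
  have "zigzag (Ch A) (quasi_isos A) X [Fwd (X, f, Y)] Y"
    using assms chmap_simps[OF assms] by (simp add: Ch_simps)
  thus ?thesis by (simp add: loc_functor_def shift_darrow_class Ch_simps shift_chmap_def)
qed

lemma shift_darrow_Ident:
  assumes "chain_complex A X"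
  shows "shift_darrow A n (Ident D.L X) = Ident D.L (shift_cplx A n X)"
  using shift_darrow_class[of X "[]" X n] assms by (simp add: D.loc_Ident Ch_simps)

lemma shift_darrow_Hom:
  assumes "\<alpha> \<in> Hom D.L X Y"
  shows "shift_darrow A n \<alpha> \<in> Hom D.L (shift_cplx A n X) (shift_cplx A n Y)"
proof -
  obtain p where p: "zigzag (Ch A) (quasi_isos A) X p Y" "\<alpha> = loc_class (Ch A) (quasi_isos A) X p Y"
    using assms unfolding D.loc_Hom by metis
  show ?thesis unfolding p(2) shift_darrow_class[OF p(1)] by (rule D.loc_Hom_class[OF shift_zigzag[OF p(1)]])
qed

lemma shift_darrow_Comp:
  assumes "\<alpha> \<in> Hom D.L X Y" "\<beta> \<in> Hom D.L Y Z"
  shows "shift_darrow A n (\<beta> \<star> \<alpha>) = shift_darrow A n \<beta> \<star> shift_darrow A n \<alpha>"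
proof -
  obtain p q where p: "zigzag (Ch A) (quasi_isos A) X p Y" "\<alpha> = loc_class (Ch A) (quasi_isos A) X p Y"
    and q: "zigzag (Ch A) (quasi_isos A) Y q Z" "\<beta> = loc_class (Ch A) (quasi_isos A) Y q Z"
    using assms unfolding D.loc_Hom by metis
  have "zigzag (Ch A) (quasi_isos A) X (p @ q) Z" using p q D.zigzag_append by blast
  thus ?thesis unfolding p(2) q(2)
    by (simp add: D.loc_Comp[OF p(1) q(1)] shift_darrow_class[OF p(1)] shift_darrow_class[OF q(1)]
        shift_darrow_class D.loc_Comp[OF shift_zigzag[OF p(1)] shift_zigzag[OF q(1)]])
qed

lemma shift_isomorphic:
  assumes "isomorphic D.L X Y"
  shows "isomorphic D.L (shift_cplx A n X) (shift_cplx A n Y)"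
proof -
  obtain f g where fg: "f \<in> Hom D.L X Y" "g \<in> Hom D.L Y X" "g \<star> f = Ident D.L X" "f \<star> g = Ident D.L Y"
    using D.L.isomorphicE[OF assms] by metis
  note XY = L_Hom_cplx[OF fg(1)]
  show ?thesis
    by (rule D.L.isomorphicI[OF shift_darrow_Hom[OF fg(1)] shift_darrow_Hom[OF fg(2)]])
      (use XY in \<open>simp_all add: shift_darrow_Comp[OF fg(1,2), symmetric]
        shift_darrow_Comp[OF fg(2,1), symmetric] fg(3,4) shift_darrow_Ident\<close>)
qed

lemma shift_zd: "(\<And>n. G n \<in> Ob A) \<Longrightarrow> shift_cplx A n (zd G) = zd (\<lambda>m. G (m - n))"
  by (auto simp: shift_cplx_def zd_def neg_Zer algebra_simps intro!: ext)

subsection \<open>Mapping cones\<close>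

text \<open>The negative differential of the suspension turns commutation of \<open>f\<close> with
  the differentials into the anticommutation required of a twisting.\<close>

lemma cone_twisting:
  assumes f: "chain_map A (U, f, V)"
  shows "twisting (shift_cplx A 1 U) V (\<lambda>n. f (n - 1))"
proof -
  note c = chmap_simps[OF f]
  note UA = cplx_simps(1-4)[OF c(1)] and VA = cplx_simps(1-4)[OF c(2)]
  have "snd V (n - 1) \<cdot> f (n - 1) \<oplus> f (n - 1 - 1) \<cdot> snd (shift_cplx A 1 U) n
    = Zer A (fst (shift_cplx A 1 U) n) (fst V (n - 2))" for n
    unfolding c(6) shift_snd shift_fst
    using c(3-5) UA[of "n - 1"] UA[of "n - 2"] by (simp add: Comp_neg neg_Add cat_simps)
  thus ?thesis using c shift_complex[OF c(1)] by (simp add: twisting_def Hom_iff shift_fst)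
qed

abbreviation "cone U f V \<equiv> TW (shift_cplx A 1 U) V (\<lambda>n. f (n - 1))"

lemma cone_sequence_cone:
  assumes f: "chain_map A (U, f, V)"
  shows "cone_sequence A (U, f, V) (V, \<lambda>n. bj (fst U (n - 1)) (fst V n), cone U f V)
    (cone U f V, \<lambda>n. bp (fst U (n - 1)) (fst V n), shift_cplx A 1 U)"
proof -
  note c = chmap_simps[OF f]
  note tw = cone_twisting[OF f]
  have 1: "chain_map A (V, \<lambda>n. bj (fst U (n - 1)) (fst V n), cone U f V)"
    using tw_incl[OF tw] by (simp add: shift_fst)
  have 2: "chain_map A (cone U f V, \<lambda>n. bp (fst U (n - 1)) (fst V n), shift_cplx A 1 U)"
    using tw_proj[OF tw] by (simp add: shift_fst)
  have 3: "biproduct A (fst U (n - 1)) (fst V n) (fst (cone U f V) n) (bi (fst U (n - 1)) (fst V n))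
    (bj (fst U (n - 1)) (fst V n)) (bp (fst U (n - 1)) (fst V n)) (bq (fst U (n - 1)) (fst V n))" for n
    using biproduct_bsum[OF cplx_simps(1)[OF c(1)] cplx_simps(1)[OF c(2)], of "n - 1" n]
    by (simp add: fst_TW shift_fst)
  have 4: "snd (cone U f V) n
    = bi (fst U (n - 1 - 1)) (fst V (n - 1)) \<cdot> snd (shift_cplx A 1 U) n \<cdot> bp (fst U (n - 1)) (fst V n)
      \<oplus> (bj (fst U (n - 1 - 1)) (fst V (n - 1)) \<cdot> f (n - 1) \<cdot> bp (fst U (n - 1)) (fst V n)
      \<oplus> bj (fst U (n - 1 - 1)) (fst V (n - 1)) \<cdot> snd V n \<cdot> bq (fst U (n - 1)) (fst V n))" for n
    by (simp add: TW_def shift_fst)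
  show ?thesis unfolding cone_sequence_def
    by (rule exI[of _ U], rule exI[of _ f], rule exI[of _ V], rule exI[of _ "cone U f V"],
        rule exI[of _ "\<lambda>n. bi (fst U (n - 1)) (fst V n)"],
        rule exI[of _ "\<lambda>n. bj (fst U (n - 1)) (fst V n)"],
        rule exI[of _ "\<lambda>n. bp (fst U (n - 1)) (fst V n)"],
        rule exI[of _ "\<lambda>n. bq (fst U (n - 1)) (fst V n)"])
      (intro conjI allI HOL.refl f 1 2 3 4)
qed

text \<open>Distinguished triangles are closed under isomorphism, so the cone may be replaced by a
  complex \<open>P\<close> to which it maps by a quasi-isomorphism: the comparison is the identity
  on \<open>U\<close> and \<open>V\<close> and the formal inverse of \<sigma> on
  \<open>P\<close>.\<close>

lemma cone_triangle:
  assumes f: "chain_map A (U, f, V)" and q: "(cone U f V, \<sigma>, P) \<in> quasi_isos A"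
  obtains v w where "v \<in> Hom D.L V P" "w \<in> Hom D.L P (shift_cplx A 1 U)"
    "(D.Q (U, f, V), v, w) \<in> derived_triangles A"
proof -
  note c = chmap_simps[OF f]
  let ?C = "cone U f V" and ?j = "\<lambda>n. bj (fst U (n - 1)) (fst V n)" and ?p = "\<lambda>n. bp (fst U (n - 1)) (fst V n)"
  have j: "chain_map A (V, ?j, ?C)" and p: "chain_map A (?C, ?p, shift_cplx A 1 U)"
    using tw_incl[OF cone_twisting[OF f]] tw_proj[OF cone_twisting[OF f]] by (simp_all add: shift_fst)
  let ?v = "D.Q (?C, \<sigma>, P) \<star> D.Q (V, ?j, ?C)"
  let ?c = "D.Qinv (?C, \<sigma>, P)"
  let ?w = "D.Q (?C, ?p, shift_cplx A 1 U) \<star> ?c"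
  note cH = Qinv(1)[OF q]
  have v: "?v \<in> Hom D.L V P" by (rule D.L.Comp_Hom[OF Q_Hom[OF j] Q_Hom[OF quasi_iso_chmap[OF q]]])
  have w: "?w \<in> Hom D.L P (shift_cplx A 1 U)" by (rule D.L.Comp_Hom[OF cH Q_Hom[OF p]])
  have "(?C, \<sigma>, P) \<in> Hom (Ch A) ?C P" using quasi_iso_chmap[OF q] by (simp add: Ch_Hom)
  from D.L.inverse_arrows_sym[OF D.Qinv_inverse(4)[OF q this]]
  have iso: "iso_arrow D.L ?c" unfolding iso_arrow_def by (rule exI)
  have idiso: "iso_arrow D.L (Ident D.L Z)" "Ident D.L Z \<in> Hom D.L Z Z" if "chain_complex A Z" for Z
  proof -
    show h: "Ident D.L Z \<in> Hom D.L Z Z" using that by (simp add: D.L.Ident_Hom L_Ob)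
    show "iso_arrow D.L (Ident D.L Z)"
      unfolding iso_arrow_def using D.L.inverse_arrowsI[OF h h] D.L.Ident_left[OF h] by blast
  qed
  have 1: "Ident D.L V \<star> D.Q (U, f, V) = D.Q (U, f, V) \<star> Ident D.L U"
    using D.L.Ident_left[OF Q_Hom[OF f]] D.L.Ident_right[OF Q_Hom[OF f]] by simp
  have 2: "?c \<star> ?v = D.Q (V, ?j, ?C) \<star> Ident D.L V"
    using Qinv_Comp[OF q Q_Hom[OF j] HOL.refl] D.L.Ident_right[OF Q_Hom[OF j]] by simp
  have 3: "shift_darrow A 1 (Ident D.L U) \<star> ?w = D.Q (?C, ?p, shift_cplx A 1 U) \<star> ?c"
    unfolding shift_darrow_Ident[OF c(1)] by (rule D.L.Ident_left[OF w])
  have "(D.Q (U, f, V), ?v, ?w) \<in> derived_triangles A"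
    unfolding derived_triangles_def Let_def loc_derived_def
    by (rule CollectI, rule exI[of _ "D.Q (U, f, V)"], rule exI[of _ ?v], rule exI[of _ ?w],
        rule conjI[OF HOL.refl], rule exI[of _ U], rule exI[of _ V], rule exI[of _ P],
        rule exI[of _ "(U, f, V)"], rule exI[of _ "(V, ?j, ?C)"], rule exI[of _ "(?C, ?p, shift_cplx A 1 U)"],
        rule exI[of _ "Ident D.L U"], rule exI[of _ "Ident D.L V"], rule exI[of _ ?c], unfold Ch_simps)
      (intro conjI v w Q_Hom[OF f] cone_sequence_cone[OF f] idiso[OF c(1)] idiso[OF c(2)] iso cH 1 2 3)
  thus ?thesis using that v w by blast
qed

text \<open>This takes the place of the rotation of triangles.\<close>

lemma att_cone_quasi_iso:
  assumes G: "\<And>n. G n \<in> Ob A" and Y: "chain_complex A Y" and t: "\<And>n. t n \<in> cyc Y (n - 1) (G n)"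
  shows "(cone Y (\<lambda>n. bj (G n) (fst Y n)) (att Y G t),
    \<lambda>n. copair (fst Y (n - 1)) (bS (G n) (fst Y n)) (Zer A (fst Y (n - 1)) (G n)) (bp (G n) (fst Y n)),
    zd G) \<in> quasi_isos A"
proof -
  note YA = cplx_simps(1-4)[OF Y]
  have tA: "t n \<in> Ar A" "Dom A (t n) = G n" "Cod A (t n) = fst Y (n - 1)" for n
    using cyc_Hom[OF t[of n]] by (auto simp: Hom_iff)
  have tw: "twisting (zd G) Y t" by (rule att_twisting[OF G Y t])
  let ?T = "att Y G t" and ?i = "\<lambda>n. bj (G n) (fst Y n)" and ?p = "\<lambda>n. bp (G n) (fst Y n)"
  have i: "chain_map A (Y, ?i, ?T)" and p: "chain_map A (?T, ?p, zd G)"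
    using tw_incl[OF tw] tw_proj[OF tw] by (simp_all add: zd_fst)
  note tc = cone_twisting[OF i]
  have fT: "fst ?T n = bS (G n) (fst Y n)" for n by (simp add: fst_TW zd_fst)
  let ?\<sigma> = "\<lambda>n. copair (fst Y (n - 1)) (bS (G n) (fst Y n)) (Zer A (fst Y (n - 1)) (G n)) (?p n)"
  note bs = bsum_simps[OF G YA(1)]
  have u: "Zer A (fst Y (n - 1)) (G n) \<in> Hom A (fst Y (n - 1)) (G n)" for n by (rule Zer_Hom[OF YA(1) G])
  have pH: "?p n \<in> Hom A (bS (G n) (fst Y n)) (G n)" for n by (simp add: Hom_iff bs)
  have sA: "snd (shift_cplx A 1 Y) n \<in> Hom A (fst Y (n - 1)) (fst Y (n - 2))" for n
    using cplx_simps(2-4)[OF shift_complex[OF Y, of 1], of n] by (simp add: Hom_iff shift_fst)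
  have c\<sigma>: "chain_map A (cone Y ?i ?T, ?\<sigma>, zd G)"
  proof -
    have "snd (zd G) n \<cdot> Zer A (fst Y (n - 1)) (G n)
      = Zer A (fst Y (n - 2)) (G (n - 1)) \<cdot> snd (shift_cplx A 1 Y) n \<oplus> ?p (n - 1) \<cdot> ?i (n - 1)" for n
      using sA[of n] by (simp add: zd_snd Comp_Zer G YA(1) Zer_simps Hom_iff bs Zer_Add)
    thus ?thesis using tw_out[OF tc p, of "\<lambda>n. Zer A (fst Y (n - 1)) (G n)"] u
      by (simp add: shift_fst zd_fst fT)
  qed
  show ?thesis unfolding quasi_iso_iff
  proof (intro conjI allI impI ballI)
    show "chain_map A (cone Y ?i ?T, ?\<sigma>, zd G)" by (rule c\<sigma>)
    fix P n assume P: "projective A P"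
    note PO = projective_Ob[OF P]
    have ZG: "Zer A P (G n) \<in> Hom A P (G n)" for n by (rule Zer_Hom[OF PO G])
    have ZY: "Zer A P (fst Y n) \<in> Hom A P (fst Y n)" for n by (rule Zer_Hom[OF PO YA(1)])
    have dT: "snd ?T n \<cdot> pair (G n) (fst Y n) a y
        = pair (G (n - 1)) (fst Y (n - 1)) (Zer A P (G (n - 1))) (t n \<cdot> a \<oplus> snd Y n \<cdot> y)"
      if "a \<in> Hom A P (G n)" "y \<in> Hom A P (fst Y n)" for a y n
      using tw_d[OF tw, of a P n y] that by (auto simp: zd_fst zd_snd Hom_iff Comp_Zer G)
    have ie: "bj (G n) (fst Y n) \<cdot> y = pair (G n) (fst Y n) (Zer A P (G n)) y"
      if "y \<in> Hom A P (fst Y n)" for y n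
      using tw_incl_elt[OF tw, of y P n] that by (simp add: zd_fst)
    have sumT: "pair (G m) (fst Y m) (Zer A P (G m)) y \<oplus> pair (G m) (fst Y m) (Zer A P (G m)) y'
        = pair (G m) (fst Y m) (Zer A P (G m)) (y \<oplus> y')"
      if "y \<in> Hom A P (fst Y m)" "y' \<in> Hom A P (fst Y m)" for y y' m
      using pair_Add[OF ZG that(1) ZG that(2)] by (simp add: Zer_Add Zer_simps PO G)
    {
      fix y assume "y \<in> cyc (zd G) n P"
      hence y: "y \<in> Hom A P (G n)" by (simp add: zd_cyc G)
      have ty: "t n \<cdot> y \<in> cyc Y (n - 1) P" by (rule cyc_Comp[OF Y t y])
      have nty: "\<ominus> (t n \<cdot> y) \<in> Hom A P (fst Y (n - 1))" by (rule cyc_Hom[OF cyc_neg[OF Y ty]])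
      have tyA: "t n \<cdot> y \<in> Ar A" "Dom A (t n \<cdot> y) = P" "Cod A (t n \<cdot> y) = fst Y (n - 1)"
        using cyc_Hom[OF ty] by (auto simp: Hom_iff)
      \<comment> \<open>A cell element \<open>y\<close> lifts to the cycle
        \<open>(- t y, (y, 0))\<close>: its first entry cancels the boundary \<open>t y\<close> of
        \<open>(y, 0)\<close> in the attached complex.\<close>
      let ?z = "pair (G n) (fst Y n) y (Zer A P (fst Y n))"
      let ?x = "pair (fst Y (n - 1)) (bS (G n) (fst Y n)) (\<ominus> (t n \<cdot> y)) ?z"
      have z: "?z \<in> Hom A P (fst ?T n)" unfolding fT by (rule pair_Hom[OF y ZY])
      have "bj (G (n - 1)) (fst Y (n - 1)) \<cdot> (\<ominus> (t n \<cdot> y)) \<oplus> snd ?T n \<cdot> ?z = Zer A P (fst ?T (n - 1))"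
      proof -
        have "snd ?T n \<cdot> ?z = pair (G (n - 1)) (fst Y (n - 1)) (Zer A P (G (n - 1))) (t n \<cdot> y)"
          unfolding dT[OF y ZY] using tyA YA[of n] YA(1)[of "n - 1"] by (simp add: Comp_Zer PO Zer_Add)
        thus ?thesis unfolding ie[OF nty]
          using sumT[OF nty cyc_Hom[OF ty]] tyA by (simp add: neg_Add pair_Zer PO G YA(1) fT)
      qed
      hence "?x \<in> cyc (cone Y ?i ?T) n P"
        using tw_cyc_iff[OF tc, of "\<ominus> (t n \<cdot> y)" P n ?z] nty z cyc_neg[OF Y ty]
        by (simp add: shift_fst fT cyc_shift[OF Y])
      moreover have "?\<sigma> n \<cdot> ?x = y"
        unfolding copair_pair[OF u pH nty z[unfolded fT]] pair_proj(1)[OF y ZY]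
        using nty y by (auto simp: Hom_iff Comp_Zer G Zer_Add)
      ultimately show "\<exists>x \<in> cyc (cone Y ?i ?T) n P. \<exists>b \<in> bnd (zd G) n P. y = ?\<sigma> n \<cdot> x \<oplus> b"
        using y by (intro bexI[of _ ?x] bexI[of _ "Zer A P (G n)"]) (auto simp: zd_bnd G PO Hom_iff Zer_Add)
    next
      fix x assume x: "x \<in> cyc (cone Y ?i ?T) n P" and xb: "?\<sigma> n \<cdot> x \<in> bnd (zd G) n P"
      obtain \<tau> z where \<tau>: "\<tau> \<in> Hom A P (fst Y (n - 1))" "z \<in> Hom A P (bS (G n) (fst Y n))"
        "x = pair (fst Y (n - 1)) (bS (G n) (fst Y n)) \<tau> z"
        using tw_cases[OF tc cyc_Hom[OF x]] by (auto simp: shift_fst fT)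
      obtain a y where ay: "a \<in> Hom A P (G n)" "y \<in> Hom A P (fst Y n)" "z = pair (G n) (fst Y n) a y"
        using pair_cases[OF G YA(1) \<tau>(2)] .
      have "?\<sigma> n \<cdot> x = Zer A (fst Y (n - 1)) (G n) \<cdot> \<tau> \<oplus> ?p n \<cdot> z"
        unfolding \<tau>(3) by (rule copair_pair[OF u pH \<tau>(1,2)])
      also have "?p n \<cdot> z = a" unfolding ay(3) by (rule pair_proj(1)[OF ay(1,2)])
      also have "Zer A (fst Y (n - 1)) (G n) \<cdot> \<tau> \<oplus> a = a"
        using \<tau>(1) ay(1) by (auto simp: Hom_iff Comp_Zer G Zer_Add)
      finally have "?\<sigma> n \<cdot> x = a" .
      hence a0: "a = Zer A P (G n)" using xb by (simp add: zd_bnd G PO)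
      have dy: "snd Y n \<cdot> y \<in> Hom A P (fst Y (n - 1))" by (rule d_Hom[OF Y ay(2)])
      have "bj (G (n - 1)) (fst Y (n - 1)) \<cdot> \<tau> \<oplus> snd ?T n \<cdot> z = Zer A P (bS (G (n - 1)) (fst Y (n - 1)))"
        using tw_cyc_iff[OF tc, of \<tau> P n z] x \<tau> by (simp add: shift_fst fT)
      moreover have "snd ?T n \<cdot> z = pair (G (n - 1)) (fst Y (n - 1)) (Zer A P (G (n - 1))) (snd Y n \<cdot> y)"
        unfolding ay(3) dT[OF ay(1,2)] unfolding a0
        using tA[of n] dy by (simp add: Comp_Zer PO Zer_Add Hom_iff)
      ultimately have "pair (G (n - 1)) (fst Y (n - 1)) (Zer A P (G (n - 1))) (\<tau> \<oplus> snd Y n \<cdot> y)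
        = pair (G (n - 1)) (fst Y (n - 1)) (Zer A P (G (n - 1))) (Zer A P (fst Y (n - 1)))"
        unfolding ie[OF \<tau>(1)] using sumT[OF \<tau>(1) dy] by (simp add: pair_Zer PO G YA(1))
      hence "\<tau> \<oplus> snd Y n \<cdot> y = Zer A P (fst Y (n - 1))"
        by (subst (asm) pair_eq_iff[OF ZG Add_Hom[OF \<tau>(1) dy] ZG ZY]) simp
      \<comment> \<open>Since the differential of the suspension is \<open>- d\<close>, this
        exhibits the whole element as the boundary of \<open>(y, 0)\<close>, with \<open>y\<close>
        taken in the suspended copy of \<open>Y\<close>.\<close>
      hence \<tau>e: "\<tau> = \<ominus> (snd Y n \<cdot> y)"
        by (subst (asm) sum_Zer_iff) (use \<tau>(1) dy in \<open>auto simp: Hom_iff\<close>)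
      have zy: "z = bj (G n) (fst Y n) \<cdot> y" unfolding ie[OF ay(2)] ay(3) a0 ..
      have e1: "snd (shift_cplx A 1 Y) (n + 1) \<cdot> y = \<ominus> (snd Y n \<cdot> y)"
        using shift_snd_elt[OF Y, of y P "n + 1" 1] ay(2) by simp
      have ZT: "Zer A P (fst ?T (n + 1)) \<in> Hom A P (fst ?T (n + 1))"
        by (rule Zer_Hom[OF PO]) (simp add: fT bs)
      have iff: "x \<in> bnd (cone Y ?i ?T) n P \<longleftrightarrow>
        (\<exists>a' \<in> Hom A P (fst Y n). \<exists>b' \<in> Hom A P (fst ?T (n + 1)).
          \<tau> = snd (shift_cplx A 1 Y) (n + 1) \<cdot> a' \<and> z = bj (G n) (fst Y n) \<cdot> a' \<oplus> snd ?T (n + 1) \<cdot> b')"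
        using tw_bnd_iff[OF tc, of \<tau> P n z] \<tau> by (simp add: shift_fst fT)
      have "z = bj (G n) (fst Y n) \<cdot> y \<oplus> snd ?T (n + 1) \<cdot> Zer A P (fst ?T (n + 1))"
        using \<tau>(2) cplx_simps(1-4)[OF tw_complex[OF tw], of "n + 1"]
        by (simp add: zy[symmetric] Comp_Zer PO fT Hom_iff Zer_Add)
      with e1 \<tau>e show "x \<in> bnd (cone Y ?i ?T) n P"
        unfolding iff by (intro bexI[OF _ ay(2)] bexI[OF _ ZT] conjI) simp_all
    }
  qed
qed

section \<open>Building a complex from a resolution of its homology\<close>

text \<open>\<open>T\<close> is built from \<open>S 0, \<dots>, S j\<close> and \<open>\<phi> : T \<rightarrow> X\<close> is surjective in homology; the kernel is
  resolved by \<open>S (j + 1), S (j + 2), \<dots>\<close> via \<open>\<psi>\<close>.\<close>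

definition tower where
  "tower X S r j T \<phi> \<psi> \<longleftrightarrow> chain_map A (T, \<phi>, X) \<and>
    (\<forall>n. \<psi> n \<in> cyc T (n - 1) (S (Suc j) n)) \<and>
    (\<forall>W n. projective A W \<longrightarrow>
      (\<forall>x \<in> cyc X n W. \<exists>t \<in> cyc T n W. \<exists>b \<in> bnd X n W. x = \<phi> n \<cdot> t \<oplus> b) \<and>
      (\<forall>t \<in> cyc T (n - 1) W. \<phi> (n - 1) \<cdot> t \<in> bnd X (n - 1) W \<longrightarrow>
        (\<exists>u \<in> Hom A W (S (Suc j) n). \<exists>b \<in> bnd T (n - 1) W. t = \<psi> n \<cdot> u \<oplus> b)) \<and>
      (\<forall>u \<in> Hom A W (S (Suc j) n). \<phi> (n - 1) \<cdot> (\<psi> n \<cdot> u) \<in> bnd X (n - 1) W) \<and>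
      (\<forall>u \<in> Hom A W (S (Suc j) n). \<psi> n \<cdot> u \<in> bnd T (n - 1) W \<longleftrightarrow>
        (\<exists>v \<in> Hom A W (S (Suc (Suc j)) (n + 1)). u = r (Suc j) (n + 1) \<cdot> v)))"

context
  fixes X :: "('o, 'm) cplx" and S :: "nat \<Rightarrow> int \<Rightarrow> 'o" and \<rho> :: "int \<Rightarrow> 'm" and r :: "nat \<Rightarrow> int \<Rightarrow> 'm"
  assumes res: "homology_resolution X S \<rho> r"
begin

text \<open>On \<open>zd (S 0)\<close> every arrow is a cycle and only zero is a boundary, so the
  kernel of the augmentation in homology is the first syzygy, covered by \<open>r 0\<close>.\<close>

lemma tower_start: "tower X S r 0 (zd (S 0)) \<rho> (r 0)"
  unfolding tower_def
proof (intro conjI allI impI ballI)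
  note SO = res_Ob[OF res]
  show "chain_map A (zd (S 0), \<rho>, X)" by (rule res_chain_map[OF res])
  show "r 0 n \<in> cyc (zd (S 0)) (n - 1) (S (Suc 0) n)" for n by (simp add: zd_cyc SO res_Hom[OF res])
  fix W n assume W: "projective A W"
  note WO = projective_Ob[OF W]
  {
    fix x assume "x \<in> cyc X n W"
    thus "\<exists>t \<in> cyc (zd (S 0)) n W. \<exists>b \<in> bnd X n W. x = \<rho> n \<cdot> t \<oplus> b"
      using res_surj[OF res W] by (metis zd_cyc SO)
  next
    fix t assume "t \<in> cyc (zd (S 0)) (n - 1) W" and b: "\<rho> (n - 1) \<cdot> t \<in> bnd X (n - 1) W"
    hence t: "t \<in> Hom A W (S 0 (n - 1))" by (simp add: zd_cyc SO)
    obtain v where v: "v \<in> Hom A W (S (Suc 0) n)" "t = r 0 n \<cdot> v"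
      using res_exact_0[OF res W t] b by auto
    show "\<exists>u \<in> Hom A W (S (Suc 0) n). \<exists>b \<in> bnd (zd (S 0)) (n - 1) W. t = r 0 n \<cdot> u \<oplus> b"
      using v t by (intro bexI[OF _ v(1)] bexI[of _ "Zer A W (S 0 (n - 1))"])
        (simp_all add: zd_bnd SO WO Hom_iff Zer_Add)
  next
    fix u assume u: "u \<in> Hom A W (S (Suc 0) n)"
    have ru: "r 0 n \<cdot> u \<in> Hom A W (S 0 (n - 1))" by (rule Comp_Hom[OF u res_Hom[OF res]])
    show "\<rho> (n - 1) \<cdot> (r 0 n \<cdot> u) \<in> bnd X (n - 1) W"
      using res_exact_0[OF res W ru] u by auto
    show "r 0 n \<cdot> u \<in> bnd (zd (S 0)) (n - 1) W \<longleftrightarrow>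
      (\<exists>v \<in> Hom A W (S (Suc (Suc 0)) (n + 1)). u = r (Suc 0) (n + 1) \<cdot> v)"
      unfolding res_exact[OF res W u, symmetric] by (simp add: zd_bnd SO WO)
  }
qed

context
  fixes j T \<phi> \<psi> assumes tow: "tower X S r j T \<phi> \<psi>"
begin

lemma tower_map: "chain_map A (T, \<phi>, X)"
  using tow unfolding tower_def by simp

lemma tower_cplx: "chain_complex A T"
  by (rule chmap_simps(1)[OF tower_map])

lemma tower_cyc: "\<psi> n \<in> cyc T (n - 1) (S (Suc j) n)"
  using tow unfolding tower_def by simp

lemma tower_surj:
  assumes "projective A W" "x \<in> cyc X n W"
  obtains t b where "t \<in> cyc T n W" "b \<in> bnd X n W" "x = \<phi> n \<cdot> t \<oplus> b"
  using tow assms unfolding tower_def by metis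

lemma tower_ker:
  assumes "projective A W" "t \<in> cyc T n W" "\<phi> n \<cdot> t \<in> bnd X n W"
  obtains u b where "u \<in> Hom A W (S (Suc j) (n + 1))" "b \<in> bnd T n W" "t = \<psi> (n + 1) \<cdot> u \<oplus> b"
proof -
  have "\<forall>t \<in> cyc T (n + 1 - 1) W. \<phi> (n + 1 - 1) \<cdot> t \<in> bnd X (n + 1 - 1) W \<longrightarrow>
        (\<exists>u \<in> Hom A W (S (Suc j) (n + 1)). \<exists>b \<in> bnd T (n + 1 - 1) W. t = \<psi> (n + 1) \<cdot> u \<oplus> b)"
    using tow assms(1) unfolding tower_def by blast
  thus ?thesis using assms(2,3) that by auto
qed

lemma tower_comp:
  "projective A W \<Longrightarrow> u \<in> Hom A W (S (Suc j) n) \<Longrightarrow> \<phi> (n - 1) \<cdot> (\<psi> n \<cdot> u) \<in> bnd X (n - 1) W"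
  using tow unfolding tower_def by simp

lemma tower_exact:
  "projective A W \<Longrightarrow> u \<in> Hom A W (S (Suc j) n) \<Longrightarrow> \<psi> n \<cdot> u \<in> bnd T (n - 1) W \<longleftrightarrow>
    (\<exists>v \<in> Hom A W (S (Suc (Suc j)) (n + 1)). u = r (Suc j) (n + 1) \<cdot> v)"
  using tow unfolding tower_def by simp

text \<open>Surjectivity in homology holds at every stage. The kernel is covered by
  \<open>S (Suc j)\<close> and hence vanishes together with it.\<close>

lemma tower_final:
  assumes "\<And>n. zero_object A (S (Suc j) n)"
  shows "(T, \<phi>, X) \<in> quasi_isos A"
  unfolding quasi_iso_iff
proof (intro conjI allI impI ballI)
  show "chain_map A (T, \<phi>, X)" by (rule tower_map)
  fix W n assume W: "projective A W"
  {
    fix x assume "x \<in> cyc X n W"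
    thus "\<exists>t \<in> cyc T n W. \<exists>b \<in> bnd X n W. x = \<phi> n \<cdot> t \<oplus> b" using tower_surj[OF W] by metis
  next
    fix t assume t: "t \<in> cyc T n W" "\<phi> n \<cdot> t \<in> bnd X n W"
    obtain u b where u: "u \<in> Hom A W (S (Suc j) (n + 1))" "b \<in> bnd T n W" "t = \<psi> (n + 1) \<cdot> u \<oplus> b"
      using tower_ker[OF W t] .
    have "u = Zer A W (S (Suc j) (n + 1))"
      using zero_object_Zer(2)[OF assms, of u "n + 1"] u(1) by (simp add: Hom_iff)
    hence "t = b" using u(3) cyc_Hom[OF tower_cyc[of "n + 1"]] bnd_Hom[OF tower_cplx u(2)] projective_Ob[OF W]
      by (simp add: Hom_iff Comp_Zer Zer_Add)
    thus "t \<in> bnd T n W" using u(2) by simp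
  }
qed

text \<open>Attaching \<open>S (Suc j)\<close> along \<psi> kills the kernel of \<phi> in homology
  but creates new cycles, whose cell parts \<open>a\<close> are those for which
  \<open>\<psi> a\<close> is a boundary. By exactness these come from
  \<open>S (Suc (Suc j))\<close>, so the next term of the resolution covers the new kernel.\<close>

lemma tower_step:
  obtains \<phi>' \<psi>' where "tower X S r (Suc j) (att T (S (Suc j)) \<psi>) \<phi>' \<psi>'"
proof -
  define G where "G = S (Suc j)"
  note X = res_cplx[OF res] and T = tower_cplx
  note XA = cplx_simps(1-4)[OF X] and TA = cplx_simps(1-4)[OF T]
  have GP: "projective A (G n)" for n unfolding G_def by (rule res_projective[OF res])
  note GO = projective_Ob[OF GP]
  have \<psi>c: "\<psi> n \<in> cyc T (n - 1) (G n)" for n unfolding G_def by (rule tower_cyc)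
  have \<psi>A: "\<psi> n \<in> Ar A" "Dom A (\<psi> n) = G n" "Cod A (\<psi> n) = fst T (n - 1)" for n
    using cyc_Hom[OF \<psi>c[of n]] by (auto simp: Hom_iff)
  note \<phi>A = chmap_simps(3-5)[OF tower_map]
  have \<phi>H: "\<phi> n \<in> Hom A (fst T n) (fst X n)" for n using \<phi>A by (simp add: Hom_iff)
  have tw: "twisting (zd G) T \<psi>" by (rule att_twisting[OF GO T \<psi>c])
  let ?T = "att T G \<psi>"
  have T': "chain_complex A ?T" by (rule tw_complex[OF tw])
  \<comment> \<open>\<phi> maps the attaching cycles to boundaries; a null-homotopy \<open>s\<close>
    of the composite extends \<phi> over the cells.\<close>
  have "\<exists>s. s \<in> Hom A (G n) (fst X n) \<and> \<phi> (n - 1) \<cdot> \<psi> n = snd X n \<cdot> s" for n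
  proof -
    have "\<phi> (n - 1) \<cdot> (\<psi> n \<cdot> Ident A (G n)) \<in> bnd X (n - 1) (G n)"
      by (rule tower_comp[OF GP]) (simp add: G_def Ident_Hom res_Ob[OF res])
    hence "\<phi> (n - 1) \<cdot> \<psi> n \<in> bnd X (n - 1) (G n)" using \<psi>A[of n] by (simp add: Comp_Ident_simps)
    thus ?thesis by (rule bndE) auto
  qed
  then obtain s where s: "\<And>n. s n \<in> Hom A (G n) (fst X n)" "\<And>n. \<phi> (n - 1) \<cdot> \<psi> n = snd X n \<cdot> s n" by metis
  have sA: "s n \<in> Ar A" "Dom A (s n) = G n" "Cod A (s n) = fst X n" for n using s(1)[of n] by (auto simp: Hom_iff)
  define \<phi>' where "\<phi>' n = copair (G n) (fst T n) (s n) (\<phi> n)" for n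
  have \<phi>'c: "chain_map A (?T, \<phi>', X)"
  proof -
    have "snd X n \<cdot> s n = s (n - 1) \<cdot> snd (zd G) n \<oplus> \<phi> (n - 1) \<cdot> \<psi> n" for n
      unfolding s(2) using sA[of "n - 1"] sA[of n] XA[of n] by (simp add: zd_snd Comp_Zer GO Zer_Add cat_simps)
    thus ?thesis unfolding \<phi>'_def using tw_out[OF tw tower_map, of s] s(1) by (simp add: zd_fst)
  qed
  have \<phi>'e: "\<phi>' n \<cdot> pair (G n) (fst T n) a t = s n \<cdot> a \<oplus> \<phi> n \<cdot> t"
    if "a \<in> Hom A W (G n)" "t \<in> Hom A W (fst T n)" for a t W n
    unfolding \<phi>'_def by (rule copair_pair[OF s(1) \<phi>H that])
  have cyc': "pair (G n) (fst T n) a t \<in> cyc ?T n W \<longleftrightarrow> \<psi> n \<cdot> a \<oplus> snd T n \<cdot> t = Zer A W (fst T (n - 1))"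
    if "a \<in> Hom A W (G n)" "t \<in> Hom A W (fst T n)" for a t W n
    using tw_cyc_iff[OF tw, of a W n t] that by (simp add: zd_fst zd_cyc GO)
  have bnd': "pair (G n) (fst T n) a t \<in> bnd ?T n W \<longleftrightarrow> a = Zer A W (G n) \<and>
      (\<exists>u \<in> Hom A W (G (n + 1)). \<exists>b \<in> bnd T n W. t = \<psi> (n + 1) \<cdot> u \<oplus> b)"
    if "a \<in> Hom A W (G n)" "t \<in> Hom A W (fst T n)" for a t W n
  proof -
    have "Zer A (G (n + 1)) (G n) \<cdot> u = Zer A W (G n)" if "u \<in> Hom A W (G (n + 1))" for u
      using that by (auto simp: Hom_iff Comp_Zer GO)
    thus ?thesis using tw_bnd_iff[OF tw, of a W n t] that by (auto simp: zd_fst zd_snd bnd_def)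
  qed
  define G2 where "G2 = S (Suc (Suc j))"
  define q where "q = r (Suc j)"
  have G2P: "projective A (G2 n)" for n unfolding G2_def by (rule res_projective[OF res])
  note G2O = projective_Ob[OF G2P]
  have qH: "q n \<in> Hom A (G2 n) (G (n - 1))" for n unfolding q_def G_def G2_def by (rule res_Hom[OF res])
  have qA: "q n \<in> Ar A" "Dom A (q n) = G2 n" "Cod A (q n) = G (n - 1)" for n
    using qH[of n] by (auto simp: Hom_iff)
  text \<open>The first choice \<open>c\<close> makes \<open>(q, c)\<close> a cycle of the new complex; correcting it by a cycle of \<open>T\<close>
    makes its image in \<open>X\<close> a boundary.\<close>
  have "\<exists>e. e \<in> Hom A (G2 n) (fst T (n - 1)) \<and>
      \<psi> (n - 1) \<cdot> q n \<oplus> snd T (n - 1) \<cdot> e = Zer A (G2 n) (fst T (n - 2)) \<and>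
      s (n - 1) \<cdot> q n \<oplus> \<phi> (n - 1) \<cdot> e \<in> bnd X (n - 1) (G2 n)" for n
  proof -
    have "\<psi> (n - 1) \<cdot> q n \<in> bnd T (n - 1 - 1) (G2 n)"
      using tower_exact[OF G2P, of "q n" n "n - 1"] qH[of n] bexI[OF _ Ident_Hom[OF G2O]] qA[of n]
      by (auto simp: G_def G2_def q_def Comp_Ident_simps)
    then obtain y where y: "y \<in> Hom A (G2 n) (fst T (n - 1))" "\<psi> (n - 1) \<cdot> q n = snd T (n - 1) \<cdot> y"
      by (rule bndE) simp
    define c where "c = \<ominus> y"
    have c: "c \<in> Hom A (G2 n) (fst T (n - 1))" unfolding c_def by (rule neg_Hom[OF y(1)])
    have ce: "\<psi> (n - 1) \<cdot> q n \<oplus> snd T (n - 1) \<cdot> c = Zer A (G2 n) (fst T (n - 2))"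
      unfolding c_def y(2) using y(1) TA[of "n - 1"] by (simp add: Hom_iff Comp_neg neg_Add cat_simps)
    have "pair (G (n - 1)) (fst T (n - 1)) (q n) c \<in> cyc ?T (n - 1) (G2 n)"
      unfolding cyc'[OF qH c] using ce by simp
    from chmap_cyc[OF \<phi>'c this] have "s (n - 1) \<cdot> q n \<oplus> \<phi> (n - 1) \<cdot> c \<in> cyc X (n - 1) (G2 n)"
      unfolding \<phi>'e[OF qH c] .
    then obtain t b where t: "t \<in> cyc T (n - 1) (G2 n)" "b \<in> bnd X (n - 1) (G2 n)"
      "s (n - 1) \<cdot> q n \<oplus> \<phi> (n - 1) \<cdot> c = \<phi> (n - 1) \<cdot> t \<oplus> b" using tower_surj[OF G2P] by metis
    note tH = cyc_Hom[OF t(1)]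
    have ty: "c \<in> Ar A" "Dom A c = G2 n" "Cod A c = fst T (n - 1)" "t \<in> Ar A" "Dom A t = G2 n" "Cod A t = fst T (n - 1)"
      using c tH by (auto simp: Hom_iff)
    have 1: "\<psi> (n - 1) \<cdot> q n \<oplus> snd T (n - 1) \<cdot> (c \<oplus> \<ominus> t) = Zer A (G2 n) (fst T (n - 2))"
      using ty TA[of "n - 1"] TA(1)[of "n - 2"] t(1) ce G2O by (simp add: ab_simps cyc_def)
    have "s (n - 1) \<cdot> q n \<oplus> \<phi> (n - 1) \<cdot> (c \<oplus> \<ominus> t) = (s (n - 1) \<cdot> q n \<oplus> \<phi> (n - 1) \<cdot> c) \<oplus> \<ominus> (\<phi> (n - 1) \<cdot> t)"
      using ty \<phi>A[of "n - 1"] sA[of "n - 1"] qA[of n] by (simp add: ab_simps)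
    also have "\<dots> = b"
      unfolding t(3) by (subst diff_eq_iff)
        (use ty \<phi>A[of "n - 1"] bnd_Hom[OF X t(2)] in \<open>auto simp: Hom_iff cat_simps Add_simps\<close>)
    finally show ?thesis using 1 t(2) Add_Hom[OF c neg_Hom[OF tH]] by auto
  qed
  then obtain e where e: "\<And>n. e n \<in> Hom A (G2 n) (fst T (n - 1))"
    "\<And>n. \<psi> (n - 1) \<cdot> q n \<oplus> snd T (n - 1) \<cdot> e n = Zer A (G2 n) (fst T (n - 2))"
    "\<And>n. s (n - 1) \<cdot> q n \<oplus> \<phi> (n - 1) \<cdot> e n \<in> bnd X (n - 1) (G2 n)" by metis
  have eA: "e n \<in> Ar A" "Dom A (e n) = G2 n" "Cod A (e n) = fst T (n - 1)" for n
    using e(1)[of n] by (auto simp: Hom_iff)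
  define \<psi>' where "\<psi>' n = pair (G (n - 1)) (fst T (n - 1)) (q n) (e n)" for n
  have \<psi>'c: "\<psi>' n \<in> cyc ?T (n - 1) (G2 n)" for n
    unfolding \<psi>'_def cyc'[OF qH e(1)] using e(2) by simp
  have \<psi>'e: "\<psi>' n \<cdot> u = pair (G (n - 1)) (fst T (n - 1)) (q n \<cdot> u) (e n \<cdot> u)"
    if "u \<in> Hom A W (G2 n)" for u W n
    unfolding \<psi>'_def by (rule pair_Comp[OF qH e(1) that])
  have \<phi>\<psi>: "\<phi>' (n - 1) \<cdot> (\<psi>' n \<cdot> u) \<in> bnd X (n - 1) W" if u: "u \<in> Hom A W (G2 n)" for u W n
  proof -
    have "\<phi>' (n - 1) \<cdot> (\<psi>' n \<cdot> u) = (\<phi>' (n - 1) \<cdot> \<psi>' n) \<cdot> u"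
      by (rule Comp_assoc_simp[symmetric])
        (use u chmap_simps(3-5)[OF \<phi>'c] cyc_Hom[OF \<psi>'c[of n]] in \<open>auto simp: Hom_iff\<close>)
    also have "\<phi>' (n - 1) \<cdot> \<psi>' n = s (n - 1) \<cdot> q n \<oplus> \<phi> (n - 1) \<cdot> e n"
      unfolding \<psi>'_def by (rule \<phi>'e[OF qH e(1)])
    finally show ?thesis using bnd_Comp[OF X e(3) u] by simp
  qed
  \<comment> \<open>This is the purpose of the attachment: cycles of \<open>T\<close> that \<phi>
    maps to boundaries become boundaries themselves.\<close>
  have bnd0: "pair (G n) (fst T n) (Zer A W (G n)) t \<in> bnd ?T n W"
    if W: "projective A W" and t: "t \<in> cyc T n W" "\<phi> n \<cdot> t \<in> bnd X n W" for W n t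
    unfolding bnd'[OF Zer_Hom[OF projective_Ob[OF W] GO] cyc_Hom[OF t(1)]]
    using tower_ker[OF W t] unfolding G_def by metis
  have \<phi>'0: "\<phi>' n \<cdot> pair (G n) (fst T n) (Zer A W (G n)) t = \<phi> n \<cdot> t"
    if "t \<in> Hom A W (fst T n)" for W t n
    using \<phi>'e[OF Zer_Hom[OF Hom_Ob(1)[OF that] GO] that] that \<phi>A[of n] sA[of n] Hom_Ob(1)[OF that]
    by (simp add: Comp_Zer Hom_iff Zer_Add cat_simps)
  have "tower X S r (Suc j) ?T \<phi>' \<psi>'"
    unfolding tower_def G2_def[symmetric]
  proof (intro conjI allI impI ballI)
    show "chain_map A (?T, \<phi>', X)" by (rule \<phi>'c)
    show "\<psi>' n \<in> cyc ?T (n - 1) (G2 n)" for n by (rule \<psi>'c)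
    fix W n assume W: "projective A W"
    note WO = projective_Ob[OF W]
    {
      fix x assume x: "x \<in> cyc X n W"
      obtain t b where t: "t \<in> cyc T n W" "b \<in> bnd X n W" "x = \<phi> n \<cdot> t \<oplus> b" using tower_surj[OF W x] .
      have ZG: "Zer A W (G n) \<in> Hom A W (G n)" by (rule Zer_Hom[OF WO GO])
      have "pair (G n) (fst T n) (Zer A W (G n)) t \<in> cyc ?T n W"
        unfolding cyc'[OF ZG cyc_Hom[OF t(1)]]
        using t(1) \<psi>A[of n] WO TA(1)[of "n - 1"] by (simp add: cyc_def Comp_Zer Zer_Add Zer_simps)
      thus "\<exists>t \<in> cyc ?T n W. \<exists>b \<in> bnd X n W. x = \<phi>' n \<cdot> t \<oplus> b"
        using t \<phi>'0[OF cyc_Hom[OF t(1)]] by metis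
    next
      fix u assume u: "u \<in> Hom A W (G2 n)"
      show "\<phi>' (n - 1) \<cdot> (\<psi>' n \<cdot> u) \<in> bnd X (n - 1) W" by (rule \<phi>\<psi>[OF u])
      have qu: "q n \<cdot> u \<in> Hom A W (G (n - 1))" and eu: "e n \<cdot> u \<in> Hom A W (fst T (n - 1))"
        using u qA[of n] eA[of n] by (auto simp: Hom_iff cat_simps)
      have "\<psi>' n \<cdot> u \<in> bnd ?T (n - 1) W \<longleftrightarrow> q n \<cdot> u = Zer A W (G (n - 1))"
      proof
        assume "\<psi>' n \<cdot> u \<in> bnd ?T (n - 1) W"
        thus "q n \<cdot> u = Zer A W (G (n - 1))" unfolding \<psi>'e[OF u] bnd'[OF qu eu] by blast
      next
        assume z: "q n \<cdot> u = Zer A W (G (n - 1))"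
        have "\<psi>' n \<cdot> u \<in> cyc ?T (n - 1) W" by (rule cyc_Comp[OF T' \<psi>'c u])
        hence "\<psi> (n - 1) \<cdot> (q n \<cdot> u) \<oplus> snd T (n - 1) \<cdot> (e n \<cdot> u) = Zer A W (fst T (n - 1 - 1))"
          unfolding \<psi>'e[OF u] cyc'[OF qu eu] .
        hence "e n \<cdot> u \<in> cyc T (n - 1) W"
          unfolding z using eu \<psi>A[of "n - 1"] TA[of "n - 1"] WO
          by (simp add: cyc_def Comp_Zer Hom_iff Zer_Add cat_simps)
        moreover have "\<phi> (n - 1) \<cdot> (e n \<cdot> u) \<in> bnd X (n - 1) W"
          using \<phi>\<psi>[OF u] unfolding \<psi>'e[OF u] z \<phi>'0[OF eu] .
        ultimately show "\<psi>' n \<cdot> u \<in> bnd ?T (n - 1) W"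
          unfolding \<psi>'e[OF u] z by (rule bnd0[OF W])
      qed
      thus "\<psi>' n \<cdot> u \<in> bnd ?T (n - 1) W \<longleftrightarrow>
        (\<exists>v \<in> Hom A W (S (Suc (Suc (Suc j))) (n + 1)). u = r (Suc (Suc j)) (n + 1) \<cdot> v)"
        using res_exact[OF res W, of u "Suc j" n] u by (simp add: q_def G_def G2_def)
    next
      fix z assume z: "z \<in> cyc ?T (n - 1) W" and zb: "\<phi>' (n - 1) \<cdot> z \<in> bnd X (n - 1) W"
      obtain a t where at: "a \<in> Hom A W (G (n - 1))" "t \<in> Hom A W (fst T (n - 1))"
        "z = pair (G (n - 1)) (fst T (n - 1)) a t"
        using tw_cases[OF tw cyc_Hom[OF z]] by (auto simp: zd_fst)
      have ty: "a \<in> Ar A" "Dom A a = W" "Cod A a = G (n - 1)" "t \<in> Ar A" "Dom A t = W" "Cod A t = fst T (n - 1)"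
        using at by (auto simp: Hom_iff)
      have c: "\<psi> (n - 1) \<cdot> a \<oplus> snd T (n - 1) \<cdot> t = Zer A W (fst T (n - 1 - 1))"
        using z unfolding at(3) cyc'[OF at(1,2)] .
      have "\<psi> (n - 1) \<cdot> a = \<ominus> (snd T (n - 1) \<cdot> t)"
        using c by (subst (asm) sum_Zer_iff) (use ty \<psi>A[of "n - 1"] TA[of "n - 1"] in \<open>auto simp: cat_simps\<close>)
      also have "\<dots> = snd T (n - 1) \<cdot> (\<ominus> t)" using ty TA[of "n - 1"] by (simp add: Comp_neg)
      finally have "\<psi> (n - 1) \<cdot> a \<in> bnd T (n - 1 - 1) W"
        using ty by (intro bndI[of "\<ominus> t"]) (auto simp: Hom_iff neg_simps)
      \<comment> \<open>The elements \<open>z\<close> and \<open>\<psi>' v\<close> have the same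
        cell part. Their difference is \<open>(0, t - e v)\<close>, where \<open>t - e v\<close> is
        a cycle of \<open>T\<close> that \<phi> maps to a boundary, so \<open>bnd0\<close>
        applies.\<close>
      with tower_exact[OF W at(1)[unfolded G_def]] obtain v where
        v: "v \<in> Hom A W (G2 n)" "a = q n \<cdot> v" by (auto simp: G2_def q_def)
      have v'c: "\<psi>' n \<cdot> v \<in> cyc ?T (n - 1) W" by (rule cyc_Comp[OF T' \<psi>'c v(1)])
      have ev: "e n \<cdot> v \<in> Hom A W (fst T (n - 1))" using v(1) eA[of n] by (simp add: Hom_iff cat_simps)
      have evA: "e n \<cdot> v \<in> Ar A" "Dom A (e n \<cdot> v) = W" "Cod A (e n \<cdot> v) = fst T (n - 1)"
        using ev by (auto simp: Hom_iff)
      have "\<psi> (n - 1) \<cdot> a \<oplus> snd T (n - 1) \<cdot> (e n \<cdot> v) = Zer A W (fst T (n - 1 - 1))"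
        using v'c unfolding \<psi>'e[OF v(1)] v(2)[symmetric] cyc'[OF at(1) ev] .
      hence "\<psi> (n - 1) \<cdot> a \<oplus> snd T (n - 1) \<cdot> t = \<psi> (n - 1) \<cdot> a \<oplus> snd T (n - 1) \<cdot> (e n \<cdot> v)" using c by simp
      hence dd: "snd T (n - 1) \<cdot> t = snd T (n - 1) \<cdot> (e n \<cdot> v)"
        by (subst (asm) Add_left_cancel) (use ty evA \<psi>A[of "n - 1"] TA[of "n - 1"] in \<open>auto simp: cat_simps\<close>)
      let ?t = "t \<oplus> \<ominus> (e n \<cdot> v)"
      have tc: "?t \<in> cyc T (n - 1) W"
        using ty evA TA[of "n - 1"] TA(1)[of "n - 2"] dd by (simp add: cyc_def Hom_iff Add_simps neg_simps Comp_Add Comp_neg neg_Add cat_simps del: Comp_assoc_simp)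
      have \<phi>v: "s (n - 1) \<cdot> a \<oplus> \<phi> (n - 1) \<cdot> (e n \<cdot> v) \<in> bnd X (n - 1) W"
        using \<phi>\<psi>[OF v(1)] unfolding \<psi>'e[OF v(1)] v(2)[symmetric] \<phi>'e[OF at(1) ev] .
      have \<phi>z: "s (n - 1) \<cdot> a \<oplus> \<phi> (n - 1) \<cdot> t \<in> bnd X (n - 1) W"
        using zb unfolding at(3) \<phi>'e[OF at(1,2)] .
      have "(s (n - 1) \<cdot> a \<oplus> \<phi> (n - 1) \<cdot> t) \<oplus> \<ominus> (s (n - 1) \<cdot> a \<oplus> \<phi> (n - 1) \<cdot> (e n \<cdot> v)) = \<phi> (n - 1) \<cdot> ?t"
      proof (subst diff_eq_iff)
        have "\<phi> (n - 1) \<cdot> (e n \<cdot> v) \<oplus> \<phi> (n - 1) \<cdot> ?t = \<phi> (n - 1) \<cdot> ((e n \<cdot> v) \<oplus> ?t)"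
          using ty evA \<phi>A[of "n - 1"] by (simp add: Comp_Add Add_simps neg_simps)
        also have "(e n \<cdot> v) \<oplus> ?t = t"
          using diff_eq_iff[of t "e n \<cdot> v" ?t] ty evA by (simp add: Add_simps neg_simps)
        finally show "s (n - 1) \<cdot> a \<oplus> \<phi> (n - 1) \<cdot> t = (s (n - 1) \<cdot> a \<oplus> \<phi> (n - 1) \<cdot> (e n \<cdot> v)) \<oplus> \<phi> (n - 1) \<cdot> ?t"
          using ty evA \<phi>A[of "n - 1"] sA[of "n - 1"] cyc_Hom[OF tc]
          by (simp add: Add_assoc Comp_simps Hom_iff del: Comp_assoc_simp)
      qed (use ty evA \<phi>A[of "n - 1"] sA[of "n - 1"] cyc_Hom[OF tc] in \<open>simp_all add: Comp_simps Add_simps Hom_iff\<close>)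
      hence "\<phi> (n - 1) \<cdot> ?t \<in> bnd X (n - 1) W" using bnd_Add[OF X \<phi>z bnd_neg[OF X \<phi>v]] by simp
      from bnd0[OF W tc this]
      have b: "pair (G (n - 1)) (fst T (n - 1)) (Zer A W (G (n - 1))) ?t \<in> bnd ?T (n - 1) W" .
      have "\<psi>' n \<cdot> v \<oplus> pair (G (n - 1)) (fst T (n - 1)) (Zer A W (G (n - 1))) ?t
        = pair (G (n - 1)) (fst T (n - 1)) (a \<oplus> Zer A W (G (n - 1))) (e n \<cdot> v \<oplus> ?t)"
        unfolding \<psi>'e[OF v(1)] v(2)[symmetric]
        by (rule pair_Add[OF at(1) ev Zer_Hom[OF WO GO] cyc_Hom[OF tc]])
      also have "e n \<cdot> v \<oplus> ?t = t"
        using diff_eq_iff[of t "e n \<cdot> v" ?t] ty evA by (simp add: Add_simps neg_simps)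
      finally have "z = \<psi>' n \<cdot> v \<oplus> pair (G (n - 1)) (fst T (n - 1)) (Zer A W (G (n - 1))) ?t"
        unfolding at(3) using ty by (simp add: Zer_Add)
      thus "\<exists>u \<in> Hom A W (G2 n). \<exists>b \<in> bnd ?T (n - 1) W. z = \<psi>' n \<cdot> u \<oplus> b" using v(1) b by blast
    }
  qed
  thus ?thesis using that unfolding G_def by blast
qed

end

end

section \<open>Ghost length\<close>

lemma L_isomorphic_refl: "chain_complex A X \<Longrightarrow> isomorphic D.L X X"
  using D.L.Ident_Hom[of X] D.L.Ident_left[of "Ident D.L X" X X]
  by (intro D.L.isomorphicI) (simp_all add: L_Ob)

lemma L_retract_refl:
  assumes "chain_complex A X" shows "retract_of D.L X X"
proof -
  have i: "Ident D.L X \<in> Hom D.L X X" using D.L.Ident_Hom assms by (simp add: L_Ob)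
  show ?thesis unfolding retract_of_def L_Ob using assms i D.L.Ident_left[OF i] by blast
qed

lemma quasi_iso_isomorphic:
  assumes "(X, f, Y) \<in> quasi_isos A" shows "isomorphic D.L Y X"
  by (rule D.L.isomorphicI[OF Qinv(1)[OF assms] Q_Hom[OF quasi_iso_chmap[OF assms]] Qinv(3,2)[OF assms]])

lemma ghost_projectives_iff:
  "X \<in> ghost_projectives A \<longleftrightarrow> (\<exists>G. (\<forall>n. projective A (G n)) \<and> isomorphic D.L X (zd G))"
proof
  assume "X \<in> ghost_projectives A"
  then obtain P where P: "\<And>n. projective A (fst P n)" "\<And>n. snd P n = Zer A (fst P n) (fst P (n - 1))"
    "isomorphic D.L X P"
    unfolding ghost_projectives_def derived_notions loc_derived_def by blast
  have "P = zd (fst P)" unfolding zd_def by (rule prod_eqI) (auto simp: P(2) intro!: ext)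
  thus "\<exists>G. (\<forall>n. projective A (G n)) \<and> isomorphic D.L X (zd G)" using P(1,3) by metis
next
  assume "\<exists>G. (\<forall>n. projective A (G n)) \<and> isomorphic D.L X (zd G)"
  then obtain G where G: "\<And>n. projective A (G n)" "isomorphic D.L X (zd G)" by blast
  have "X \<in> Ob D.L" using D.L.isomorphicE[OF G(2)] D.L.Hom_Ob(1) by metis
  thus "X \<in> ghost_projectives A"
    unfolding ghost_projectives_def derived_notions derived_simps loc_derived_def
    using G zd_complex[OF projective_Ob[OF G(1)]]
    by (intro CollectI conjI exI[of _ "zd G"]) (simp_all add: zd_fst zd_snd)
qed

lemma zd_ghost_projective:
  assumes "\<And>n. projective A (G n)" shows "zd G \<in> ghost_projectives A"
  unfolding ghost_projectives_iff
  using assms L_isomorphic_refl[OF zd_complex[OF projective_Ob[OF assms]]] by (intro exI[of _ G]) simp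

lemma ghost_projectives_iso:
  assumes "isomorphic D.L X Y" "Y \<in> ghost_projectives A"
  shows "X \<in> ghost_projectives A"
proof -
  obtain G where G: "\<And>n. projective A (G n)" "isomorphic D.L Y (zd G)"
    using assms(2) unfolding ghost_projectives_iff by blast
  show ?thesis unfolding ghost_projectives_iff
    using G(1) D.L.isomorphic_trans[OF assms(1) G(2)] by (intro exI[of _ G]) simp
qed

abbreviation "lc \<equiv> length_class (derived A) (ghost_projectives A)"

lemma lc_SucI:
  assumes "U \<in> lc (Suc n)" "P \<in> ghost_projectives A" "u \<in> Hom D.L U V" "v \<in> Hom D.L V P"
    "w \<in> Hom D.L P (shift_cplx A 1 U)" "(u, v, w) \<in> derived_triangles A" "retract_of D.L X V"
  shows "X \<in> lc (Suc (Suc n))"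
  unfolding length_class.simps derived_simps derived_Hom derived_notions loc_derived_def
  using assms by blast

text \<open>Level one is closed under isomorphism by its definition; at higher levels an isomorphism
  is a special retraction and is composed with the given one.\<close>

lemma lc_iso:
  assumes i: "isomorphic D.L X Y" and Y: "Y \<in> lc (Suc n)"
  shows "X \<in> lc (Suc n)"
proof (cases n)
  case 0
  thus ?thesis using ghost_projectives_iso[OF i] Y by simp
next
  case (Suc m)
  obtain f g where fg: "f \<in> Hom D.L X Y" "g \<in> Hom D.L Y X" "g \<star> f = Ident D.L X"
    using D.L.isomorphicE[OF i] by metis
  obtain U V P u v w where V: "U \<in> lc (Suc m)" "P \<in> ghost_projectives A" "u \<in> Hom D.L U V" "v \<in> Hom D.L V P"
    "w \<in> Hom D.L P (shift_cplx A 1 U)" "(u, v, w) \<in> derived_triangles A" "retract_of D.L Y V"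
    using Y unfolding Suc length_class.simps derived_simps derived_Hom derived_notions loc_derived_def
    by blast
  obtain h k where hk: "h \<in> Hom D.L Y V" "k \<in> Hom D.L V Y" "k \<star> h = Ident D.L Y"
    using V(7) unfolding retract_of_def by blast
  have hf: "h \<star> f \<in> Hom D.L X V" and gk: "g \<star> k \<in> Hom D.L V X"
    using D.L.Comp_Hom fg(1,2) hk(1,2) by blast+
  have "(g \<star> k) \<star> (h \<star> f) = g \<star> (k \<star> (h \<star> f))"
    by (rule D.L.Comp_assoc[OF hf hk(2) fg(2), symmetric])
  also have "k \<star> (h \<star> f) = f"
    unfolding D.L.Comp_assoc[OF fg(1) hk(1,2)] hk(3) by (rule D.L.Ident_left[OF fg(1)])
  finally have "(g \<star> k) \<star> (h \<star> f) = Ident D.L X" using fg(3) by simp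
  hence "retract_of D.L X V"
    unfolding retract_of_def using hf gk D.L.Hom_Ob[OF hf] by blast
  thus ?thesis unfolding Suc by (rule lc_SucI[OF V(1-6)])
qed

text \<open>Each attachment gives a triangle from \<open>T\<close> over the new stage to
  \<open>zd (S (Suc j))\<close>, by \<open>att_cone_quasi_iso\<close>. Stage \<open>j\<close> is
  built from the \<open>j + 1\<close> terms \<open>S 0, \<dots>, S j\<close>, hence the index
  \<open>Suc j\<close>.\<close>

lemma tower_length:
  assumes res: "homology_resolution X S \<rho> r"
  shows "\<exists>T \<phi> \<psi>. tower X S r j T \<phi> \<psi> \<and> T \<in> lc (Suc j)"
proof (induction j)
  case 0
  have "zd (S 0) \<in> lc (Suc 0)" by (simp add: zd_ghost_projective[OF res_projective[OF res]])
  thus ?case using tower_start[OF res] by blast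
next
  case (Suc j)
  then obtain T \<phi> \<psi> where T: "tower X S r j T \<phi> \<psi>" "T \<in> lc (Suc j)" by blast
  let ?G = "S (Suc j)"
  obtain \<phi>' \<psi>' where t': "tower X S r (Suc j) (att T ?G \<psi>) \<phi>' \<psi>'" using tower_step[OF res T(1)] .
  note c = tower_cplx[OF res T(1)] and GO = res_Ob[OF res, of "Suc j"]
  note tw = att_twisting[OF GO c tower_cyc[OF res T(1)]]
  have i: "chain_map A (T, \<lambda>n. bj (?G n) (fst T n), att T ?G \<psi>)" using tw_incl[OF tw] by (simp add: zd_fst)
  obtain v w where vw: "v \<in> Hom D.L (att T ?G \<psi>) (zd ?G)" "w \<in> Hom D.L (zd ?G) (shift_cplx A 1 T)"
    "(D.Q (T, \<lambda>n. bj (?G n) (fst T n), att T ?G \<psi>), v, w) \<in> derived_triangles A"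
    using cone_triangle[OF i att_cone_quasi_iso[OF GO c tower_cyc[OF res T(1)]]] .
  have "att T ?G \<psi> \<in> lc (Suc (Suc j))"
    by (rule lc_SucI[OF T(2) zd_ghost_projective[OF res_projective[OF res]] Q_Hom[OF i] vw
          L_retract_refl[OF tw_complex[OF tw]]])
  thus ?case using t' by blast
qed

section \<open>The relative resolution\<close>

text \<open>Arrows out of \<open>zd G\<close> are represented by chain maps, and vanishing means
  being a boundary in each degree, so exactness in the derived category reduces to the degreewise
  condition \<open>ex\<close>. Stating \<open>ex\<close> with boundaries of \<open>Z\<close> covers
  both uses: \<open>Z\<close> a suspension of \<open>X\<close>, and \<open>Z\<close> a suspended
  term of the resolution.\<close>

lemma hom_exact_zd:
  assumes G: "\<And>n. projective A (G n)" and G1: "\<And>n. G1 n \<in> Ob A" and G2: "\<And>n. G2 n \<in> Ob A"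
    and f: "chain_map A (zd G1, f, zd G2)" and g: "chain_map A (zd G2, g, Z)"
    and ex: "\<And>W n u. projective A W \<Longrightarrow> u \<in> Hom A W (G2 n) \<Longrightarrow>
      g n \<cdot> u \<in> bnd Z n W \<longleftrightarrow> (\<exists>v \<in> Hom A W (G1 n). u = f n \<cdot> v)"
  shows "hom_exact D.L (zd G) (D.Q (zd G1, f, zd G2)) (D.Q (zd G2, g, Z))"
proof -
  note GO = projective_Ob[OF G]
  have Dm: "Dom D.L (D.Q (zd G2, g, Z)) = zd G2" "Dom D.L (D.Q (zd G1, f, zd G2)) = zd G1"
    using Q_Hom[OF g] Q_Hom[OF f] by (auto simp: Hom_iff)
  show ?thesis unfolding hom_exact_def Dm
  proof
    fix h assume h: "h \<in> Hom D.L (zd G) (zd G2)"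
    obtain u where u: "chain_map A (zd G, u, zd G2)" "h = D.Q (zd G, u, zd G2)" using zd_map_Q[OF G h] .
    have uH: "u n \<in> Hom A (G n) (G2 n)" for n using chmap_simps(3-5)[OF u(1), of n] by (simp add: zd_fst Hom_iff)
    note gu = chain_map_Comp[OF u(1) g]
    have gh: "D.Q (zd G2, g, Z) \<star> h = D.Q (zd G, \<lambda>n. g n \<cdot> u n, Z)" unfolding u(2) by (rule Q_Comp[OF u(1) g])
    have "zero_arrow D.L (D.Q (zd G2, g, Z) \<star> h) \<longleftrightarrow> (\<forall>n. g n \<cdot> u n \<in> bnd Z n (G n))"
      unfolding gh zero_arrow_iff[OF Q_Hom[OF gu]] by (rule zd_map_zarr_iff[OF G gu])
    also have "\<dots> \<longleftrightarrow> (\<forall>n. \<exists>v \<in> Hom A (G n) (G1 n). u n = f n \<cdot> v)" using ex[OF G uH] by simp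
    also have "\<dots> \<longleftrightarrow> (\<exists>h' \<in> Hom D.L (zd G) (zd G1). D.Q (zd G1, f, zd G2) \<star> h' = h)"
    proof
      assume "\<forall>n. \<exists>v \<in> Hom A (G n) (G1 n). u n = f n \<cdot> v"
      then obtain v where v: "\<And>n. v n \<in> Hom A (G n) (G1 n)" "\<And>n. u n = f n \<cdot> v n" by metis
      have vc: "chain_map A (zd G, v, zd G1)" by (rule zd_zd_chain_map[OF GO G1 v(1)])
      have "D.Q (zd G1, f, zd G2) \<star> D.Q (zd G, v, zd G1) = h"
        unfolding Q_Comp[OF vc f] u(2) by (rule Q_cong) (simp add: v(2))
      thus "\<exists>h' \<in> Hom D.L (zd G) (zd G1). D.Q (zd G1, f, zd G2) \<star> h' = h" using Q_Hom[OF vc] by blast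
    next
      assume "\<exists>h' \<in> Hom D.L (zd G) (zd G1). D.Q (zd G1, f, zd G2) \<star> h' = h"
      then obtain h' where h': "h' \<in> Hom D.L (zd G) (zd G1)" "D.Q (zd G1, f, zd G2) \<star> h' = h" by blast
      obtain v where v: "chain_map A (zd G, v, zd G1)" "h' = D.Q (zd G, v, zd G1)" using zd_map_Q[OF G h'(1)] .
      have vH: "v n \<in> Hom A (G n) (G1 n)" for n using chmap_simps(3-5)[OF v(1), of n] by (simp add: zd_fst Hom_iff)
      note fv = chain_map_Comp[OF v(1) f] note gfv = chain_map_Comp[OF fv g]
      have fvH: "f n \<cdot> v n \<in> Hom A (G n) (G2 n)" for n
        using chmap_simps(3-5)[OF fv, of n] by (simp add: zd_fst Hom_iff)
      have hfv: "h = D.Q (zd G, \<lambda>n. f n \<cdot> v n, zd G2)" using h'(2) Q_Comp[OF v(1) f] v(2) by simp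
      have "\<forall>n. g n \<cdot> (f n \<cdot> v n) \<in> bnd Z n (G n)" using ex[OF G fvH] vH by blast
      hence "D.Q (zd G, \<lambda>n. g n \<cdot> (f n \<cdot> v n), Z) = zarr (zd G) Z" using zd_map_zarr_iff[OF G gfv] by simp
      hence "D.Q (zd G, \<lambda>n. g n \<cdot> u n, Z) = zarr (zd G) Z" using gh hfv Q_Comp[OF fv g] by simp
      hence "\<forall>n. g n \<cdot> u n \<in> bnd Z n (G n)" using zd_map_zarr_iff[OF G gu] by simp
      thus "\<forall>n. \<exists>v \<in> Hom A (G n) (G1 n). u n = f n \<cdot> v" using ex[OF G uH] by simp
    qed
    finally show "zero_arrow D.L (D.Q (zd G2, g, Z) \<star> h) \<longleftrightarrow>
      (\<exists>h' \<in> Hom D.L (zd G) (zd G1). D.Q (zd G1, f, zd G2) \<star> h' = h)" .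
  qed
qed

text \<open>Reduces an arbitrary test object among the ghost projectives to a complex of projectives
  with zero differential.\<close>

lemma hom_exact_iso:
  assumes i: "isomorphic D.L Q P" and f: "f \<in> Hom D.L U V" and g: "g \<in> Hom D.L V W"
    and ex: "hom_exact D.L P f g"
  shows "hom_exact D.L Q f g"
proof -
  obtain a b where ab: "a \<in> Hom D.L Q P" "b \<in> Hom D.L P Q" "b \<star> a = Ident D.L Q"
    "a \<star> b = Ident D.L P" using D.L.isomorphicE[OF i] by metis
  have Dm: "Dom D.L g = V" "Dom D.L f = U" using f g by (auto simp: Hom_iff)
  have cplx: "chain_complex A Q" "chain_complex A P" "chain_complex A W"
    using L_Hom_cplx[OF ab(1)] L_Hom_cplx[OF g] by auto
  have cancel: "(h \<star> b) \<star> a = h" if "h \<in> Hom D.L Q Y" for h Y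
    using D.L.Comp_assoc[OF ab(1,2) that] D.L.Ident_right[OF that] ab(3) by simp
  show ?thesis unfolding hom_exact_def Dm
  proof
    fix h assume h: "h \<in> Hom D.L Q V"
    have hb: "h \<star> b \<in> Hom D.L P V" by (rule D.L.Comp_Hom[OF ab(2) h])
    have gh: "g \<star> h \<in> Hom D.L Q W" by (rule D.L.Comp_Hom[OF h g])
    have e: "g \<star> (h \<star> b) = (g \<star> h) \<star> b" by (rule D.L.Comp_assoc[OF ab(2) h g])
    have "zero_arrow D.L (g \<star> h) \<longleftrightarrow> g \<star> h = zarr Q W" by (rule zero_arrow_iff[OF gh])
    also have "\<dots> \<longleftrightarrow> (g \<star> h) \<star> b = zarr P W"
      using cancel[OF gh] zarr_Comp[OF ab(1) cplx(3)] zarr_Comp[OF ab(2) cplx(3)] by metis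
    also have "\<dots> \<longleftrightarrow> zero_arrow D.L (g \<star> (h \<star> b))"
      unfolding e by (rule zero_arrow_iff[OF D.L.Comp_Hom[OF ab(2) gh], symmetric])
    also have "\<dots> \<longleftrightarrow> (\<exists>h' \<in> Hom D.L P U. f \<star> h' = h \<star> b)"
      using ex hb unfolding hom_exact_def Dm by blast
    also have "\<dots> \<longleftrightarrow> (\<exists>h' \<in> Hom D.L Q U. f \<star> h' = h)"
    proof
      assume "\<exists>h' \<in> Hom D.L P U. f \<star> h' = h \<star> b"
      then obtain h' where h': "h' \<in> Hom D.L P U" "f \<star> h' = h \<star> b" by blast
      have "f \<star> (h' \<star> a) = h" using D.L.Comp_assoc[OF ab(1) h'(1) f] h'(2) cancel[OF h] by simp
      thus "\<exists>h' \<in> Hom D.L Q U. f \<star> h' = h" using D.L.Comp_Hom[OF ab(1) h'(1)] by blast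
    next
      assume "\<exists>h' \<in> Hom D.L Q U. f \<star> h' = h"
      then obtain h' where h': "h' \<in> Hom D.L Q U" "f \<star> h' = h" by blast
      have "f \<star> (h' \<star> b) = h \<star> b" using D.L.Comp_assoc[OF ab(2) h'(1) f] h'(2) by simp
      thus "\<exists>h' \<in> Hom D.L P U. f \<star> h' = h \<star> b" using D.L.Comp_Hom[OF ab(2) h'(1)] by blast
    qed
    finally show "zero_arrow D.L (g \<star> h) \<longleftrightarrow> (\<exists>h' \<in> Hom D.L Q U. f \<star> h' = h)" .
  qed
qed

text \<open>Surjectivity of the augmentation in homology is applied in each degree to the projective
  \<open>G n\<close>; the leftover boundaries form a homotopy, which the derived category does not
  see.\<close>

lemma homology_resolution_lift:
  assumes res: "homology_resolution X S \<rho> r" and Q: "Q \<in> ghost_projectives A" and h: "h \<in> Hom D.L Q X"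
  shows "\<exists>h' \<in> Hom D.L Q (zd (S 0)). D.Q (zd (S 0), \<rho>, X) \<star> h' = h"
proof -
  note p = res_chain_map[OF res]
  obtain G where G: "\<And>n. projective A (G n)" "isomorphic D.L Q (zd G)" using Q unfolding ghost_projectives_iff by blast
  obtain a b where ab: "a \<in> Hom D.L Q (zd G)" "b \<in> Hom D.L (zd G) Q" "b \<star> a = Ident D.L Q"
    using D.L.isomorphicE[OF G(2)] by metis
  obtain g where g: "chain_map A (zd G, g, X)" "h \<star> b = D.Q (zd G, g, X)"
    using zd_map_Q[OF G(1) D.L.Comp_Hom[OF ab(2) h]] .
  note GO = projective_Ob[OF G(1)]
  have "\<exists>u s. u \<in> Hom A (G n) (S 0 n) \<and> s \<in> Hom A (G n) (fst X (n + 1)) \<and> g n = \<rho> n \<cdot> u \<oplus> snd X (n + 1) \<cdot> s" for n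
  proof -
    have "g n \<in> cyc X n (G n)" using g(1) by (simp add: zd_chain_map[OF GO res_cplx[OF res]])
    from res_surj[OF res G(1) this] obtain u c where u: "u \<in> Hom A (G n) (S 0 n)" "c \<in> bnd X n (G n)"
      "g n = \<rho> n \<cdot> u \<oplus> c" .
    thus ?thesis using bndE[OF u(2)] by metis
  qed
  then obtain u s where u: "\<And>n. u n \<in> Hom A (G n) (S 0 n)" "\<And>n. s n \<in> Hom A (G n) (fst X (n + 1))"
    "\<And>n. g n = \<rho> n \<cdot> u n \<oplus> snd X (n + 1) \<cdot> s n" by metis
  have uc: "chain_map A (zd G, u, zd (S 0))" by (rule zd_zd_chain_map[OF GO res_Ob[OF res] u(1)])
  have "D.Q (zd G, g, X) = D.Q (zd G, \<lambda>n. \<rho> n \<cdot> u n, X)"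
    by (rule Q_homotopic_eq[OF GO g(1) chain_map_Comp[OF uc p] u(2,3)])
  hence e: "D.Q (zd (S 0), \<rho>, X) \<star> D.Q (zd G, u, zd (S 0)) = h \<star> b" using Q_Comp[OF uc p] g(2) by simp
  have "D.Q (zd (S 0), \<rho>, X) \<star> (D.Q (zd G, u, zd (S 0)) \<star> a) = (h \<star> b) \<star> a"
    unfolding e[symmetric] by (rule D.L.Comp_assoc[OF ab(1) Q_Hom[OF uc] Q_Hom[OF p]])
  also have "\<dots> = h" using D.L.Comp_assoc[OF ab(1,2) h] ab(3) D.L.Ident_right[OF h] by simp
  finally show ?thesis using D.L.Comp_Hom[OF ab(1) Q_Hom[OF uc]] by blast
qed

lemma ghost_projectives_shift:
  assumes "Q \<in> ghost_projectives A" shows "shift_cplx A n Q \<in> ghost_projectives A"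
proof -
  obtain G where G: "\<And>m. projective A (G m)" "isomorphic D.L Q (zd G)" using assms unfolding ghost_projectives_iff by blast
  have "isomorphic D.L (shift_cplx A n Q) (zd (\<lambda>m. G (m - n)))"
    using shift_isomorphic[OF G(2), of n] by (simp add: shift_zd projective_Ob[OF G(1)])
  thus ?thesis unfolding ghost_projectives_iff using G(1) by (intro exI[of _ "\<lambda>m. G (m - n)"]) blast
qed

text \<open>By the choice of degrees in \<open>homology_resolution\<close>, \<open>r s\<close> is a
  chain map from \<open>zd (S (Suc s))\<close> to the suspension of \<open>zd (S s)\<close>, as
  \<open>rel_resolution\<close> demands. Exactness is tested after one suspension, so in degree
  \<open>n\<close> it is the exactness of the resolution at the arrows into degree
  \<open>n - 1\<close>.\<close>

lemma homology_resolution_rel_resolution: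
  assumes res: "homology_resolution X S \<rho> r" and z: "\<And>s n. s > m \<Longrightarrow> zero_object A (S s n)"
  shows "rel_resolution (derived A) (ghost_projectives A) X m (\<lambda>s. zd (S s))
    (\<lambda>s. case s of 0 \<Rightarrow> D.Q (zd (S 0), \<rho>, X)
      | Suc s \<Rightarrow> D.Q (zd (S (Suc s)), r s, zd (\<lambda>n. S s (n - 1))))" (is "rel_resolution _ _ _ _ _ ?R")
proof -
  note SP = res_projective[OF res] and SO = res_Ob[OF res] and p = res_chain_map[OF res] and X = res_cplx[OF res]
  have sh: "shift_cplx A 1 (zd (S s)) = zd (\<lambda>n. S s (n - 1))" for s by (rule shift_zd[OF SO])
  have sh2: "shift_cplx A 1 (zd (\<lambda>n. S s (n - 1))) = zd (\<lambda>n. S s (n - 2))" for s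
    using shift_zd[of "\<lambda>n. S s (n - 1)" 1] SO by simp
  have rc: "chain_map A (zd (S (Suc s)), r s, zd (\<lambda>n. S s (n - 1)))" for s
    by (rule zd_zd_chain_map[OF SO SO res_Hom[OF res]])
  have zero: "zero_object D.L (zd (S s))" if "s > m" for s
  proof (rule acyclic_zero_object[OF zd_complex[OF SO]], rule subsetI)
    fix P n x assume P: "projective A P" and "x \<in> cyc (zd (S s)) n P"
    hence "x = Zer A P (S s n)"
      using zero_object_Zer(2)[OF z[OF that], of x n] by (simp add: zd_cyc SO Hom_iff)
    thus "x \<in> bnd (zd (S s)) n P" by (simp add: zd_bnd SO projective_Ob[OF P])
  qed
  have exact: "hom_exact D.L Q (?R (Suc s)) (shift_darrow A 1 (?R s))" if Q: "Q \<in> ghost_projectives A" for Q s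
  proof -
    obtain G where G: "\<And>n. projective A (G n)" "isomorphic D.L Q (zd G)" using Q unfolding ghost_projectives_iff by blast
    show ?thesis
    proof (cases s)
      case 0
      have g: "chain_map A (zd (\<lambda>n. S 0 (n - 1)), \<lambda>n. \<rho> (n - 1), shift_cplx A 1 X)"
        using shift_chain_map[OF p, of 1] by (simp add: sh)
      have e: "shift_darrow A 1 (?R s) = D.Q (zd (\<lambda>n. S 0 (n - 1)), \<lambda>n. \<rho> (n - 1), shift_cplx A 1 X)"
        using shift_darrow_Q[OF p, of 1] by (simp add: 0 sh)
      show ?thesis unfolding e unfolding 0 nat.case
      proof (rule hom_exact_iso[OF G(2) Q_Hom[OF rc] Q_Hom[OF g] hom_exact_zd[OF G(1) SO SO rc g]])
        fix W n u assume W: "projective A W" and u: "u \<in> Hom A W (S 0 (n - 1))"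
        show "\<rho> (n - 1) \<cdot> u \<in> bnd (shift_cplx A 1 X) n W \<longleftrightarrow> (\<exists>v \<in> Hom A W (S (Suc 0) n). u = r 0 n \<cdot> v)"
          using res_exact_0[OF res W u] by (simp add: bnd_shift[OF X])
      qed
    next
      case (Suc s')
      have g: "chain_map A (zd (\<lambda>n. S (Suc s') (n - 1)), \<lambda>n. r s' (n - 1), zd (\<lambda>n. S s' (n - 2)))"
        using shift_chain_map[OF rc[of s'], of 1] by (simp add: sh sh2)
      have e: "shift_darrow A 1 (?R s) = D.Q (zd (\<lambda>n. S (Suc s') (n - 1)), \<lambda>n. r s' (n - 1), zd (\<lambda>n. S s' (n - 2)))"
        using shift_darrow_Q[OF rc[of s'], of 1] by (simp add: Suc sh sh2)
      show ?thesis unfolding e unfolding Suc nat.case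
      proof (rule hom_exact_iso[OF G(2) Q_Hom[OF rc] Q_Hom[OF g] hom_exact_zd[OF G(1) SO SO rc g]])
        fix W n u assume W: "projective A W" and u: "u \<in> Hom A W (S (Suc s') (n - 1))"
        show "r s' (n - 1) \<cdot> u \<in> bnd (zd (\<lambda>n. S s' (n - 2))) n W \<longleftrightarrow>
            (\<exists>v \<in> Hom A W (S (Suc (Suc s')) n). u = r (Suc s') n \<cdot> v)"
          using res_exact[OF res W u] by (simp add: zd_bnd SO projective_Ob[OF W])
      qed
    qed
  qed
  show ?thesis
    unfolding rel_resolution_def derived_simps derived_notions derived_Hom loc_derived_def
  proof (intro conjI allI impI ballI)
    show "zd (S s) \<in> ghost_projectives A" for s by (rule zd_ghost_projective[OF SP])
    show "zero_object D.L (zd (S s))" if "s > m" for s by (rule zero[OF that])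
    show "?R 0 \<in> Hom D.L (zd (S 0)) X" using Q_Hom[OF p] by simp
    show "?R (Suc s) \<in> Hom D.L (zd (S (Suc s))) (shift_cplx A 1 (zd (S s)))" for s
      using Q_Hom[OF rc] by (simp add: sh)
    fix Q n assume Q: "Q \<in> ghost_projectives A"
    note Q' = ghost_projectives_shift[OF Q, of n]
    show "\<exists>h' \<in> Hom D.L (shift_cplx A n Q) (zd (S 0)). ?R 0 \<star> h' = h"
      if "h \<in> Hom D.L (shift_cplx A n Q) X" for h
      using homology_resolution_lift[OF res Q' that] by simp
    show "hom_exact (derived A) (shift_cplx A n Q) (?R (Suc s)) (shift_darrow A 1 (?R s))" for s
      using exact[OF Q', of s]
      unfolding hom_exact_def derived_simps derived_notions derived_Hom loc_derived_def .
  qed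
qed

section \<open>The three conclusions for a complex with resolved homology\<close>

lemma ghosts_iff: "\<alpha> \<in> ghosts A \<longleftrightarrow> ghost \<alpha>"
  by (simp add: ghosts_def ghost_def derived_simps loc_derived_def)

lemma ghost_length:
  assumes X: "chain_complex A X" and k: "k \<ge> 1" and "\<And>n. projdim A (homology A n X) < enat k"
  shows "rel_projdim (derived A) (ghost_projectives A) X < enat k" "X \<in> lc k"
    "Y 0 = X \<Longrightarrow> (\<And>i. i < k \<Longrightarrow> f i \<in> Hom (derived A) (Y i) (Y (Suc i)) \<and> f i \<in> ghosts A)
      \<Longrightarrow> zero_arrow (derived A) (composite (derived A) X f k)"
proof -
  obtain S \<rho> r where res: "homology_resolution X S \<rho> r" and z: "\<And>s n. s \<ge> k \<Longrightarrow> zero_object A (S s n)"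
    using homology_resolution_exists[OF X assms(3)] by metis
  \<comment> \<open>A resolution that vanishes from index \<open>k = m + 1\<close> on has length at
    most \<open>m\<close>, and the tower is complete at stage \<open>m\<close>, which is built from
    \<open>k\<close> terms.\<close>
  obtain m where m: "k = Suc m" using k by (cases k) auto
  show "rel_projdim (derived A) (ghost_projectives A) X < enat k"
    unfolding rel_projdim_def INF_less_iff
    using homology_resolution_rel_resolution[OF res, of m] z by (intro bexI[of _ m]) (auto simp: m)
  obtain T \<phi> \<psi> where T: "tower X S r m T \<phi> \<psi>" "T \<in> lc (Suc m)" using tower_length[OF res] by metis
  have "(T, \<phi>, X) \<in> quasi_isos A" by (rule tower_final[OF res T(1)]) (use z m in simp)
  from lc_iso[OF quasi_iso_isomorphic[OF this] T(2)] show "X \<in> lc k" by (simp add: m)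
  assume Y: "Y 0 = X" and f: "\<And>i. i < k \<Longrightarrow> f i \<in> Hom (derived A) (Y i) (Y (Suc i)) \<and> f i \<in> ghosts A"
  have f': "f i \<in> Hom D.L (Y i) (Y (Suc i)) \<and> ghost (f i)" if "i < k" for i
    using f[OF that] by (simp add: derived_Hom ghosts_iff loc_derived_def)
  \<comment> \<open>The induction over ghosts starts from an arrow into \<open>Y 0\<close>; here it
    is the identity of \<open>X\<close>.\<close>
  have i: "Ident D.L X \<in> Hom D.L X (Y 0)" using D.L.Ident_Hom[of X] X Y by (simp add: L_Ob)
  have "composite D.L (Y 0) f k \<star> Ident D.L X = zarr X (Y k)"
    by (rule composite_ghosts_zero[OF res z i f'])
  moreover have c: "composite D.L X f k \<in> Hom D.L X (Y k)"
    by (rule D.L.composite_Hom[where Y = Y]) (use X Y f' in \<open>simp_all add: L_Ob\<close>)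
  ultimately have "composite D.L X f k = zarr X (Y k)" using D.L.Ident_right[OF c] Y by simp
  thus "zero_arrow (derived A) (composite (derived A) X f k)"
    unfolding derived_notions loc_derived_def zero_arrow_iff[OF c] .
qed

end

theorem theorem1p3:
  fixes A :: "('o, 'm) ab_category" and X :: "('o, 'm) cplx" and k :: nat
  assumes "abelian_category A"
    and "enough_projectives A"
    and "uncountable (UNIV :: 'i set)"
    and "AB5 TYPE('i) A"
    and "k \<ge> 1"
    and "chain_complex A X"
    and "\<And>n. projdim A (boundaries A n X) < enat k"
    and "\<And>n. projdim A (homology A n X) < enat k"
  shows "rel_projdim (derived A) (ghost_projectives A) X < enat k \<and>
    X \<in> length_class (derived A) (ghost_projectives A) k \<and>
    (\<forall>Y f. Y 0 = X \<and> (\<forall>i < k. f i \<in> Hom (derived A) (Y i) (Y (Suc i)) \<and> f i \<in> ghosts A) \<longrightarrow>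
      zero_arrow (derived A) (composite (derived A) X f k))"
proof -
  interpret projective_abelian_category A
    using assms(1,2) by (simp add: projective_abelian_category_def projective_abelian_category_axioms_def)
  show ?thesis using ghost_length[OF assms(6,5,8)] by blast
qed

end
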